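(* Let $a\in\mathbb C^*$ and let $\lambda\in\Lambda^+(n,r)$ have $m$ parts (i.e. $m$ nonzero entries). Suppose that the $\mathrm U_{\mathbb C}(\widehat{\mathfrak{gl}}_n)$-module $L(\lambda)_a$ is isomorphic to $L(\mathbf Q)$ for some $\mathbf Q\in\mathcal Q(n)_r$. Then $\mathbf Q=(Q_1(u),\ldots,Q_m(u),1,\ldots,1)$, where $$\frac{Q_i(uq^{i-1})}{Q_{i+1}(uq^{i+1})}=\prod_{\lambda_{i+1}+1\le s\le\lambda_i}(1-aq^{2s-1-i}u)\qquad\text{for all }1\le i\le m-1,$$ and $Q_m(u)=\prod_{1\le s\le\lambda_m}(1-aq^{2(s-m)}u)$.
   Context: Throughout $q\in\mathbb C^*$ is not a root of unity, all algebras are over $\mathbb C$, $n\ge2$, $r\ge1$, $[s]_q=\frac{q^s-q^{-s}}{q-q^{-1}}$, $[x,y]_b=xy-byx$, $[x,y]=xy-yx$. $\Lambda^+(n,r)$ is the set of weakly decreasing $\lambda\in\mathbb N^n$ with $\sum\lambda_i=r$. **Double Ringel–Hall algebra.** Let $(c_{i,j})$ be the Cartan matrix of affine type $A$ with index set $I=\mathbb Z/n\mathbb Z=\{1,\dots,n\}$. $\mathfrak D(n)$ is generated by $E_i,F_i,K_i^{\pm1}$ ($i\in I$), $\mathsf z_s^+,\mathsf z_s^-$ ($s\ge1$), with relations: the $K_i$ commute and $K_iK_i^{-1}=1$; $K_iE_j=q^{\delta_{i,j}-\delta_{i,j+1}}E_jK_i$, $K_iF_j=q^{-\delta_{i,j}+\delta_{i,j+1}}F_jK_i$;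 $E_iF_j-F_jE_i=\delta_{i,j}\frac{\tilde K_i-\tilde K_i^{-1}}{q-q^{-1}}$ with $\tilde K_i=K_iK_{i+1}^{-1}$ (indices mod $n$); the quantum Serre relations $\sum_{b+c=1-c_{i,j}}(-1)^b\left[{1-c_{i,j}\atop b}\right]_qE_i^bE_jE_i^c=0$ for $i\ne j$ and the same for the $F$'s; all $\mathsf z_s^\pm$ are central. It is a Hopf algebra with $\Delta(E_i)=E_i\otimes\tilde K_i+1\otimes E_i$, $\Delta(F_i)=F_i\otimes1+\tilde K_i^{-1}\otimes F_i$, $\Delta(K_i)=K_i\otimes K_i$, $\Delta(\mathsf z_s^\pm)=\mathsf z_s^\pm\otimes1+1\otimes\mathsf z_s^\pm$. $U(n)$ (quantum $\mathfrak{gl}_n$) is the subalgebra generated by $E_i,F_i$ ($1\le i<n$), $K_j^{\pm1}$ ($1\le j\le n$). **Tensor spaces and Schur algebras.** $\Omega$ has basis $\omega_s$ ($s\in\mathbb Z$), with $\mathfrak D(n)$-action $E_i\omega_s=\delta_{i+1,\bar s}\,\omega_{s-1}$, $F_i\omega_s=\delta_{i,\bar s}\,\omega_{s+1}$, $K_i^{\pm1}\omega_s=q^{\pm\delta_{i,\bar s}}\omega_s$, $\mathsf z_t^+\omega_s=\omega_{s-tn}$, $\mathsf z_t^-\omega_s=\omega_{s+tn}$ ($\bar s$ is $s$ mod $n$). $\Omega_n$ is the span of $\omega_1,\dots,\omega_n$, a $U(n)$-module. Let $\zeta_{\triangle,r}:\mathfrak D(n)\to\mathrm{End}(\Omega^{\otimes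 r})$ and $\zeta_r:U(n)\to\mathrm{End}(\Omega_n^{\otimes r})$ be the resulting homomorphisms; their images are the affine $q$-Schur algebra $\mathcal S_\triangle(n,r)$ and the $q$-Schur algebra $\mathcal S(n,r)$. Simple $\mathcal S(n,r)$-modules are the $L(\lambda)$, $\lambda\in\Lambda^+(n,r)$, where $L(\lambda)$ has highest weight $\lambda$ as a $U(n)$-module via $\zeta_r$ (there is a nonzero vector $w_0$ generating it with $E_iw_0=0$ for $1\le i<n$ and $K_jw_0=q^{\lambda_j}w_0$). **Hecke algebras.** $\mathcal H_\triangle(r)$ is generated by $T_1,\dots,T_{r-1}$, $X_1^{\pm1},\dots,X_r^{\pm1}$ with relations $(T_i+1)(T_i-q^2)=0$, braid relations for the $T_i$, $X_iX_j=X_jX_i$, $X_iX_i^{-1}=1$, $T_iX_iT_i=q^2X_{i+1}$, $X_jT_i=T_iX_j$ ($j\ne i,i+1$). $\mathcal H(r)$ is the subalgebra generated by the $T_i$. $\Omega^{\otimes r}$ is a right $\mathcal H_\triangle(r)$-module: $X_t^{-1}$ replaces $\omega_{i_t}$ by $\omega_{i_t+n}$ in $\omega_{\mathbf i}=\omega_{i_1}\otimes\cdots\otimes\omega_{i_r}$, and for $\mathbf i\in[1,n]^r$, $\omega_{\mathbf i}T_k=q^2\omega_{\mathbf i}$ if $i_k=i_{k+1}$, $q\omega_{\mathbf is_k}$ if $i_k<i_{k+1}$, $q\omega_{\mathbf is_k}+(q^2-1)\omega_{\mathbf i}$ if $i_{k+1}<i_k$ ($\mathbf is_k$ swaps entries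 $k,k+1$). One has $\mathcal S_\triangle(n,r)=\mathrm{End}_{\mathcal H_\triangle(r)}(\Omega^{\otimes r})$, $\mathcal S(n,r)=\mathrm{End}_{\mathcal H(r)}(\Omega_n^{\otimes r})$, and multiplication gives $\Omega^{\otimes r}\cong\Omega_n^{\otimes r}\otimes_{\mathcal H(r)}\mathcal H_\triangle(r)$. **Evaluation maps.** For $a\in\mathbb C^*$, $\mathsf{ev}_a:\mathcal H_\triangle(r)\to\mathcal H(r)$ is the algebra homomorphism with $T_i\mapsto T_i$, $X_j\mapsto aq^{-2(j-1)}T_{j-1}\cdots T_2T_1T_1T_2\cdots T_{j-1}$. Let $\varepsilon_a:\Omega^{\otimes r}\to\Omega_n^{\otimes r}$, $xh\mapsto x\cdot\mathsf{ev}_a(h)$ ($x\in\Omega_n^{\otimes r}$, $h\in\mathcal H_\triangle(r)$), and let $\widetilde{\mathsf{ev}}_a:\mathcal S_\triangle(n,r)\to\mathcal S(n,r)$ be the algebra homomorphism $(\widetilde{\mathsf{ev}}_a(\varphi))(x)=\varepsilon_a(\varphi(x))$. **Quantum loop algebra.** $\mathrm U_{\mathbb C}(\widehat{\mathfrak{gl}}_n)$ is generated by $\mathtt x^\pm_{i,s}$ ($1\le i<n$, $s\in\mathbb Z$), $\mathtt k_i^{\pm1}$, $\mathtt g_{i,t}$ ($1\le i\le n$, $t\in\mathbb Z\setminus\{0\}$) with relations: the $\mathtt k_i$ are invertible and commute; $\mathtt k_i\mathtt x^\pm_{j,s}=q^{\pm(\delta_{i,j}-\delta_{i,j+1})}\mathtt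 x^\pm_{j,s}\mathtt k_i$; $[\mathtt k_i,\mathtt g_{j,s}]=0$; $[\mathtt g_{i,s},\mathtt x^\pm_{j,t}]$ equals $0$ if $i\ne j,j+1$, $\pm q^{-is}\frac{[s]_q}{s}\mathtt x^\pm_{i,s+t}$ if $i=j$, $\mp q^{(1-i)s}\frac{[s]_q}{s}\mathtt x^\pm_{i-1,s+t}$ if $i=j+1$; $[\mathtt g_{i,s},\mathtt g_{j,t}]=0$; $[\mathtt x^+_{i,s},\mathtt x^-_{j,t}]=\delta_{i,j}\frac{\phi^+_{i,s+t}-\phi^-_{i,s+t}}{q-q^{-1}}$; $\mathtt x^\pm_{i,s}\mathtt x^\pm_{j,t}=\mathtt x^\pm_{j,t}\mathtt x^\pm_{i,s}$ for $|i-j|>1$, and $[\mathtt x^\pm_{i,s+1},\mathtt x^\pm_{j,t}]_{q^{\pm c_{ij}}}=-[\mathtt x^\pm_{j,t+1},\mathtt x^\pm_{i,s}]_{q^{\pm c_{ij}}}$; $[\mathtt x^\pm_{i,s},[\mathtt x^\pm_{j,t},\mathtt x^\pm_{i,p}]_q]_q=-[\mathtt x^\pm_{i,p},[\mathtt x^\pm_{j,t},\mathtt x^\pm_{i,s}]_q]_q$ for $|i-j|=1$. Here $\sum_{s\ge0}\phi^\pm_{i,\pm s}u^{\pm s}=\tilde{\mathtt k}_i^{\pm1}\exp(\pm(q-q^{-1})\sum_{m\ge1}\mathtt h_{i,\pm m}u^{\pm m})$, $\tilde{\mathtt k}_i=\mathtt k_i/\mathtt k_{i+1}$ ($\mathtt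 k_{n+1}=\mathtt k_1$), $\mathtt h_{i,m}=q^{(i-1)m}\mathtt g_{i,m}-q^{(i+1)m}\mathtt g_{i+1,m}$ ($1\le i<n$). There is a (known) isomorphism $f:\mathfrak D(n)\to\mathrm U_{\mathbb C}(\widehat{\mathfrak{gl}}_n)$ with $K_i^{\pm1}\mapsto\mathtt k_i^{\pm1}$, $E_j\mapsto\mathtt x^+_{j,0}$, $F_j\mapsto\mathtt x^-_{j,0}$ ($j<n$), $E_n\mapsto q\mathcal X_1\tilde{\mathtt k}_n$, $F_n\mapsto q^{-1}\tilde{\mathtt k}_n^{-1}\mathcal Y_1$, $\mathsf z_s^\pm\mapsto\mp sq^{\pm s}\theta_{\pm s}$, where $\mathcal X_1=[\mathtt x^-_{n-1,0},[\mathtt x^-_{n-2,0},\cdots,[\mathtt x^-_{2,0},\mathtt x^-_{1,1}]_{q^{-1}}\cdots]_{q^{-1}}]_{q^{-1}}$, $\mathcal Y_1=[\cdots[[\mathtt x^+_{1,-1},\mathtt x^+_{2,0}]_q,\mathtt x^+_{3,0}]_q,\cdots,\mathtt x^+_{n-1,0}]_q$, $\theta_{\pm s}=\mp\frac1{[s]_q}(\mathtt g_{1,\pm s}+\cdots+\mathtt g_{n,\pm s})$. $\mathfrak D(n)$ is identified with $\mathrm U_{\mathbb C}(\widehat{\mathfrak{gl}}_n)$ via $f$. $L(\lambda)_a$ denotes $L(\lambda)$ regarded as a $\mathrm U_{\mathbb C}(\widehat{\mathfrak{gl}}_n)$-module via $\widetilde{\mathsf{ev}}_a\circ\zeta_{\triangle,r}\circ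 f^{-1}$. **Drinfeld polynomials.** Let $\mathscr Q_i^\pm(u)=\exp\bigl(-\sum_{t\ge1}\frac1{[t]_q}\mathtt g_{i,\pm t}(qu)^{\pm t}\bigr)=\sum_{s\ge0}\mathscr Q_{i,\pm s}u^{\pm s}$ ($1\le i\le n$). $\mathcal Q(n)$ is the set of $n$-tuples $\mathbf Q=(Q_1(u),\dots,Q_n(u))$ of polynomials with constant term $1$ such that $Q_i(q^{i-1}u)/Q_{i+1}(q^{i+1}u)$ is a polynomial for $1\le i\le n-1$; $\mathcal Q(n)_r$ is the subset with $\sum_i\deg Q_i=r$. For a polynomial $g(u)=\prod_k(1-b_ku)$ put $g^+(u)=g(u)$, $g^-(u)=\prod_k(1-b_k^{-1}u^{-1})$, and define $Q_{i,s}\in\mathbb C$ by $Q_i^\pm(u)=\sum_{s\ge0}Q_{i,\pm s}u^{\pm s}$. $L(\mathbf Q)$ is the unique simple quotient of $\mathrm U_{\mathbb C}(\widehat{\mathfrak{gl}}_n)/I(\mathbf Q)$, where $I(\mathbf Q)$ is the left ideal generated by $\mathtt x^+_{j,s}$, $\mathscr Q_{i,s}-Q_{i,s}$, $\mathtt k_i-q^{\deg Q_i}$ ($1\le j<n$, $1\le i\le n$, $s\in\mathbb Z$). *)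

theory Defs
  imports
    Complex_Main
    "HOL-Library.Poly_Mapping"
    "HOL-Library.FuncSet"
    "HOL-Computational_Algebra.Polynomial"
    "HOL-Computational_Algebra.Formal_Power_Series"
    "HOL-Computational_Algebra.Fraction_Field"
    "HOL-Algebra.QuotRing"
    "HOL-Algebra.Module"
    "HOL-Algebra.Generated_Rings"
begin

section \<open>Free algebras, presented algebras and modules\<close>

datatype 'a word = Word (letters: "'a list")

instantiation word :: (type) monoid_add
begin
definition "0 = Word []"
definition "v + w = Word (letters v @ letters w)"
instance by standard (simp_all add: zero_word_def plus_word_def)
end

text \<open>The free associative complex algebra on \<open>'g\<close> is the monoid algebra of words.  The same type
  also serves as the tensor algebra of the vector space with basis \<open>'g\<close>.\<close>

type_synonym 'g fa = "'g word \<Rightarrow>\<^sub>0 complex"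

definition cst :: "complex \<Rightarrow> 'g fa" where
  "cst c = Poly_Mapping.single 0 c"

definition mon :: "'g list \<Rightarrow> 'g fa" where
  "mon gs = Poly_Mapping.single (Word gs) 1"

abbreviation gen :: "'g \<Rightarrow> 'g fa" where
  "gen g \<equiv> mon [g]"

definition free_alg :: "'g set \<Rightarrow> 'g fa ring" where
  "free_alg G = \<lparr>carrier = {x. \<forall>w\<in>Poly_Mapping.keys x. set (letters w) \<subseteq> G},
     mult = (*), one = 1, zero = 0, add = (+)\<rparr>"

definition rel_ideal :: "'g set \<Rightarrow> ('g fa \<Rightarrow> 'g fa \<Rightarrow> bool) \<Rightarrow> 'g fa set" where
  "rel_ideal G R = Idl\<^bsub>free_alg G\<^esub> {x - y | x y. R x y}"

definition presented :: "'g set \<Rightarrow> ('g fa \<Rightarrow> 'g fa \<Rightarrow> bool) \<Rightarrow> 'g fa set ring" where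
  "presented G R = free_alg G Quot rel_ideal G R"

definition cls :: "'g set \<Rightarrow> ('g fa \<Rightarrow> 'g fa \<Rightarrow> bool) \<Rightarrow> 'g fa \<Rightarrow> 'g fa set" where
  "cls G R x = rel_ideal G R +>\<^bsub>free_alg G\<^esub> x"

text \<open>Evaluation of elements of a free algebra: as operators given by a left action
  of the generators, by a right action of the generators, and by substitution.\<close>

definition left_eval :: "('g \<Rightarrow> 'b fa \<Rightarrow> 'b fa) \<Rightarrow> 'g fa \<Rightarrow> 'b fa \<Rightarrow> 'b fa" where
  "left_eval \<rho> x v = (\<Sum>w\<in>Poly_Mapping.keys x. cst (Poly_Mapping.lookup x w) * foldr \<rho> (letters w) v)"

definition right_eval :: "('g \<Rightarrow> 'b fa \<Rightarrow> 'b fa) \<Rightarrow> 'b fa \<Rightarrow> 'g fa \<Rightarrow> 'b fa" where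
  "right_eval \<rho> v x = (\<Sum>w\<in>Poly_Mapping.keys x. cst (Poly_Mapping.lookup x w) * fold \<rho> (letters w) v)"

definition subst_eval :: "('g \<Rightarrow> 'b fa) \<Rightarrow> 'g fa \<Rightarrow> 'b fa" where
  "subst_eval \<sigma> x = (\<Sum>w\<in>Poly_Mapping.keys x. cst (Poly_Mapping.lookup x w) * prod_list (map \<sigma> (letters w)))"

definition lin_ext :: "('a list \<Rightarrow> 'b fa) \<Rightarrow> 'a fa \<Rightarrow> 'b fa" where
  "lin_ext b v = (\<Sum>w\<in>Poly_Mapping.keys v. cst (Poly_Mapping.lookup v w) * b (letters w))"

text \<open>Left modules over a not necessarily commutative ring, on the library's \<open>module\<close> records
  (whose fields \<open>mult\<close> and \<open>one\<close> play no role); the library's locale \<open>module\<close> asks for a commutative ring.\<close>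

locale left_module = R?: ring R + M?: abelian_group M
  for R :: "('a, 'c) ring_scheme" (structure) and M :: "('a, 'b, 'd) module_scheme" (structure) +
  assumes smult_closed:
      "\<lbrakk>a \<in> carrier R; x \<in> carrier M\<rbrakk> \<Longrightarrow> a \<odot>\<^bsub>M\<^esub> x \<in> carrier M"
    and smult_l_distr:
      "\<lbrakk>a \<in> carrier R; b \<in> carrier R; x \<in> carrier M\<rbrakk> \<Longrightarrow>
        (a \<oplus>\<^bsub>R\<^esub> b) \<odot>\<^bsub>M\<^esub> x = a \<odot>\<^bsub>M\<^esub> x \<oplus>\<^bsub>M\<^esub> b \<odot>\<^bsub>M\<^esub> x"
    and smult_r_distr:
      "\<lbrakk>a \<in> carrier R; x \<in> carrier M; y \<in> carrier M\<rbrakk> \<Longrightarrow>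
        a \<odot>\<^bsub>M\<^esub> (x \<oplus>\<^bsub>M\<^esub> y) = a \<odot>\<^bsub>M\<^esub> x \<oplus>\<^bsub>M\<^esub> a \<odot>\<^bsub>M\<^esub> y"
    and smult_assoc1:
      "\<lbrakk>a \<in> carrier R; b \<in> carrier R; x \<in> carrier M\<rbrakk> \<Longrightarrow>
        (a \<otimes>\<^bsub>R\<^esub> b) \<odot>\<^bsub>M\<^esub> x = a \<odot>\<^bsub>M\<^esub> (b \<odot>\<^bsub>M\<^esub> x)"
    and smult_one:
      "x \<in> carrier M \<Longrightarrow> \<one>\<^bsub>R\<^esub> \<odot>\<^bsub>M\<^esub> x = x"

definition simple_module :: "'a ring \<Rightarrow> ('a, 'b) module \<Rightarrow> bool" where
  "simple_module R M \<longleftrightarrow> left_module R M \<and> carrier M \<noteq> {\<zero>\<^bsub>M\<^esub>} \<and>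
     (\<forall>N. submodule N R M \<longrightarrow> N = {\<zero>\<^bsub>M\<^esub>} \<or> N = carrier M)"

definition gen_submodule :: "'a ring \<Rightarrow> ('a, 'b) module \<Rightarrow> 'b set \<Rightarrow> 'b set" where
  "gen_submodule R M S = \<Inter>{N. submodule N R M \<and> S \<subseteq> N}"

definition module_hom :: "'a ring \<Rightarrow> ('a, 'b) module \<Rightarrow> ('a, 'c) module \<Rightarrow> ('b \<Rightarrow> 'c) set" where
  "module_hom R M N = {\<phi> \<in> carrier M \<rightarrow> carrier N.
     (\<forall>x\<in>carrier M. \<forall>y\<in>carrier M. \<phi> (x \<oplus>\<^bsub>M\<^esub> y) = \<phi> x \<oplus>\<^bsub>N\<^esub> \<phi> y) \<and>
     (\<forall>a\<in>carrier R. \<forall>x\<in>carrier M. \<phi> (a \<odot>\<^bsub>M\<^esub> x) = a \<odot>\<^bsub>N\<^esub> \<phi> x)}"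

definition module_isomorphic :: "'a ring \<Rightarrow> ('a, 'b) module \<Rightarrow> ('a, 'c) module \<Rightarrow> bool" where
  "module_isomorphic R M N \<longleftrightarrow> (\<exists>\<phi>\<in>module_hom R M N. bij_betw \<phi> (carrier M) (carrier N))"

definition regular_module :: "'a ring \<Rightarrow> ('a, 'a) module" where
  "regular_module R = \<lparr>carrier = carrier R, mult = mult R, one = one R, zero = zero R, add = add R,
     smult = mult R\<rparr>"

definition quotient_module :: "('a, 'b) module \<Rightarrow> 'b set \<Rightarrow> ('a, 'b set) module" where
  "quotient_module M N = \<lparr>carrier = a_rcosets\<^bsub>M\<^esub> N, mult = undefined, one = undefined, zero = N,
     add = set_add M, smult = (\<lambda>r C. \<Union>x\<in>C. N +>\<^bsub>M\<^esub> (r \<odot>\<^bsub>M\<^esub> x))\<rparr>"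

definition pullback_module :: "('a \<Rightarrow> 'c) \<Rightarrow> ('c, 'b) module \<Rightarrow> ('a, 'b) module" where
  "pullback_module \<phi> M = \<lparr>carrier = carrier M, mult = mult M, one = one M, zero = zero M, add = add M,
     smult = (\<lambda>r x. \<phi> r \<odot>\<^bsub>M\<^esub> x)\<rparr>"

section \<open>Quantum integers and indices modulo n\<close>

definition qint :: "complex \<Rightarrow> int \<Rightarrow> complex" where
  "qint q s = (q powi s - q powi (- s)) / (q - inverse q)"

definition qfact :: "complex \<Rightarrow> nat \<Rightarrow> complex" where
  "qfact q s = (\<Prod>k=1..s. qint q (int k))"

definition qbinom :: "complex \<Rightarrow> nat \<Rightarrow> nat \<Rightarrow> complex" where
  "qbinom q s b = qfact q s / (qfact q b * qfact q (s - b))"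

text \<open>The index set \<open>\<int>/n\<int>\<close> is represented by \<open>{1..n}\<close>: \<open>nx n i\<close> is \<open>i + 1\<close> and
  \<open>rs n s\<close> is the representative of \<open>s\<close>.\<close>

definition nx :: "nat \<Rightarrow> nat \<Rightarrow> nat" where
  "nx n i = (if i = n then 1 else i + 1)"

definition rs :: "nat \<Rightarrow> int \<Rightarrow> int" where
  "rs n s = (s - 1) mod int n + 1"

text \<open>Cartan matrix of affine type A; for \<open>n = 2\<close> the off-diagonal entries are \<open>-2\<close>.\<close>

definition cartan :: "nat \<Rightarrow> nat \<Rightarrow> nat \<Rightarrow> int" where
  "cartan n i j = 2 * of_bool (i = j) - of_bool (i = nx n j) - of_bool (j = nx n i)"

datatype sign = Pos | Neg

fun sg :: "sign \<Rightarrow> int" where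
  "sg Pos = 1" | "sg Neg = -1"

section \<open>The double Ringel--Hall algebra\<close>

datatype dgen = dEg nat | dFg nat | dKg nat | dKig nat | dZg sign nat

abbreviation "dE i \<equiv> gen (dEg i)"
abbreviation "dF i \<equiv> gen (dFg i)"
abbreviation "dK i \<equiv> gen (dKg i)"
abbreviation "dKi i \<equiv> gen (dKig i)"
abbreviation "dZ e s \<equiv> gen (dZg e s)"

definition D_gens :: "nat \<Rightarrow> dgen set" where
  "D_gens n = (\<Union>i\<in>{1..n}. {dEg i, dFg i, dKg i, dKig i}) \<union> {dZg e s | e s. 1 \<le> s}"

definition serre :: "nat \<Rightarrow> complex \<Rightarrow> (nat \<Rightarrow> dgen fa) \<Rightarrow> nat \<Rightarrow> nat \<Rightarrow> dgen fa" where
  "serre n q x i j = (let N = nat (1 - cartan n i j) in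
     \<Sum>b=0..N. cst ((-1) ^ b * qbinom q N b) * x i ^ b * x j * x i ^ (N - b))"

inductive D_rel :: "nat \<Rightarrow> complex \<Rightarrow> dgen fa \<Rightarrow> dgen fa \<Rightarrow> bool" for n :: nat and q :: complex where
  "\<lbrakk>i \<in> {1..n}; j \<in> {1..n}\<rbrakk> \<Longrightarrow> D_rel n q (dK i * dK j) (dK j * dK i)"
| "i \<in> {1..n} \<Longrightarrow> D_rel n q (dK i * dKi i) 1"
| "i \<in> {1..n} \<Longrightarrow> D_rel n q (dKi i * dK i) 1"
| "\<lbrakk>i \<in> {1..n}; j \<in> {1..n}\<rbrakk> \<Longrightarrow>
     D_rel n q (dK i * dE j) (cst (q powi (of_bool (i = j) - of_bool (i = nx n j))) * dE j * dK i)"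
| "\<lbrakk>i \<in> {1..n}; j \<in> {1..n}\<rbrakk> \<Longrightarrow>
     D_rel n q (dK i * dF j) (cst (q powi (- of_bool (i = j) + of_bool (i = nx n j))) * dF j * dK i)"
| "\<lbrakk>i \<in> {1..n}; j \<in> {1..n}\<rbrakk> \<Longrightarrow>
     D_rel n q (dE i * dF j - dF j * dE i)
       (if i = j then cst (inverse (q - inverse q)) * (dK i * dKi (nx n i) - dK (nx n i) * dKi i) else 0)"
| "\<lbrakk>i \<in> {1..n}; j \<in> {1..n}; i \<noteq> j\<rbrakk> \<Longrightarrow> D_rel n q (serre n q (\<lambda>i. dE i) i j) 0"
| "\<lbrakk>i \<in> {1..n}; j \<in> {1..n}; i \<noteq> j\<rbrakk> \<Longrightarrow> D_rel n q (serre n q (\<lambda>i. dF i) i j) 0"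
| "\<lbrakk>1 \<le> s; g \<in> D_gens n\<rbrakk> \<Longrightarrow> D_rel n q (dZ e s * gen g) (gen g * dZ e s)"

definition Dn :: "nat \<Rightarrow> complex \<Rightarrow> dgen fa set ring" where
  "Dn n q = presented (D_gens n) (D_rel n q)"

definition D_cls :: "nat \<Rightarrow> complex \<Rightarrow> dgen fa \<Rightarrow> dgen fa set" where
  "D_cls n q = cls (D_gens n) (D_rel n q)"

text \<open>The subalgebra \<open>U(n)\<close> of \<open>Dn n q\<close>; the scalars are added because
  \<open>generate_ring\<close> produces subrings only.\<close>

definition U_gl :: "nat \<Rightarrow> complex \<Rightarrow> dgen fa set set" where
  "U_gl n q = generate_ring (Dn n q) (D_cls n q `
     (range cst \<union> (\<Union>i\<in>{1..<n}. {dE i, dF i}) \<union> (\<Union>j\<in>{1..n}. {dK j, dKi j})))"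

section \<open>Tensor spaces and Schur algebras\<close>

text \<open>The basis vector \<open>\<omega>\<^bsub>i1\<^esub> \<otimes> \<dots> \<otimes> \<omega>\<^bsub>ir\<^esub>\<close> is \<open>mon [i1, \<dots>, ir]\<close>, and
  the tensor product of vectors is their product in the tensor algebra \<open>int fa\<close>.\<close>

definition Omega :: "nat \<Rightarrow> int fa set" where
  "Omega r = {v. \<forall>w\<in>Poly_Mapping.keys v. length (letters w) = r}"

definition Omega_fin :: "nat \<Rightarrow> nat \<Rightarrow> int fa set" where
  "Omega_fin n r = {v \<in> Omega r. \<forall>w\<in>Poly_Mapping.keys v. set (letters w) \<subseteq> {1..int n}}"

fun omega_act :: "nat \<Rightarrow> complex \<Rightarrow> dgen \<Rightarrow> int \<Rightarrow> int fa" where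
  "omega_act n q (dEg i) s = (if int (nx n i) = rs n s then mon [s - 1] else 0)"
| "omega_act n q (dFg i) s = (if int i = rs n s then mon [s + 1] else 0)"
| "omega_act n q (dKg i) s = cst (q powi of_bool (int i = rs n s)) * mon [s]"
| "omega_act n q (dKig i) s = cst (q powi (- of_bool (int i = rs n s))) * mon [s]"
| "omega_act n q (dZg e t) s = mon [s - sg e * int t * int n]"

text \<open>The comultiplication of a generator as a list of pairs \<open>(u, v)\<close> of words, standing for
  the sum of the \<open>u \<otimes> v\<close>.\<close>

fun comult :: "nat \<Rightarrow> dgen \<Rightarrow> (dgen list \<times> dgen list) list" where
  "comult n (dEg i) = [([dEg i], [dKg i, dKig (nx n i)]), ([], [dEg i])]"
| "comult n (dFg i) = [([dFg i], []), ([dKig i, dKg (nx n i)], [dFg i])]"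
| "comult n (dKg i) = [([dKg i], [dKg i])]"
| "comult n (dKig i) = [([dKig i], [dKig i])]"
| "comult n (dZg e s) = [([dZg e s], []), ([], [dZg e s])]"

text \<open>The action of a generator on the \<open>r\<close>-th tensor power, by splitting off the first tensor
  factor and applying the comultiplication.  The value for \<open>r = 0\<close> is irrelevant.\<close>

fun tens_act :: "nat \<Rightarrow> complex \<Rightarrow> nat \<Rightarrow> dgen \<Rightarrow> int fa \<Rightarrow> int fa" where
  "tens_act n q 0 g = (\<lambda>v. 0)"
| "tens_act n q (Suc 0) g = lin_ext (\<lambda>is. omega_act n q g (hd is))"
| "tens_act n q (Suc (Suc r)) g = lin_ext (\<lambda>is. \<Sum>(u, v)\<leftarrow>comult n g.
     foldr (\<lambda>h. lin_ext (\<lambda>js. omega_act n q h (hd js))) u (mon [hd is]) *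
     foldr (\<lambda>h. tens_act n q (Suc r) h) v (mon (tl is)))"

definition linear_on :: "int fa set \<Rightarrow> int fa set \<Rightarrow> (int fa \<Rightarrow> int fa) \<Rightarrow> bool" where
  "linear_on V W \<phi> \<longleftrightarrow> \<phi> \<in> V \<rightarrow> W \<and> (\<forall>x\<in>V. \<forall>y\<in>V. \<phi> (x + y) = \<phi> x + \<phi> y) \<and>
     (\<forall>c. \<forall>x\<in>V. \<phi> (cst c * x) = cst c * \<phi> x)"

text \<open>Linear maps on a subspace are represented by functions that are \<open>undefined\<close> outside of it.\<close>

definition End_alg :: "int fa set \<Rightarrow> (int fa \<Rightarrow> int fa) ring" where
  "End_alg V = \<lparr>carrier = {\<phi> \<in> extensional V. linear_on V V \<phi>},
     mult = (\<lambda>\<phi> \<psi>. compose V \<phi> \<psi>), one = (\<lambda>x\<in>V. x), zero = (\<lambda>x\<in>V. 0),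
     add = (\<lambda>\<phi> \<psi>. \<lambda>x\<in>V. \<phi> x + \<psi> x)\<rparr>"

text \<open>\<open>the_elem\<close> picks the common value on all representatives of a residue class.\<close>

definition zeta_aff :: "nat \<Rightarrow> complex \<Rightarrow> nat \<Rightarrow> dgen fa set \<Rightarrow> int fa \<Rightarrow> int fa" where
  "zeta_aff n q r C = the_elem ((\<lambda>x. restrict (left_eval (tens_act n q r) x) (Omega r)) ` C)"

definition zeta_fin :: "nat \<Rightarrow> complex \<Rightarrow> nat \<Rightarrow> dgen fa set \<Rightarrow> int fa \<Rightarrow> int fa" where
  "zeta_fin n q r C = restrict (zeta_aff n q r C) (Omega_fin n r)"

definition affine_schur :: "nat \<Rightarrow> complex \<Rightarrow> nat \<Rightarrow> (int fa \<Rightarrow> int fa) ring" where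
  "affine_schur n q r = (End_alg (Omega r))\<lparr>carrier := zeta_aff n q r ` carrier (Dn n q)\<rparr>"

definition schur :: "nat \<Rightarrow> complex \<Rightarrow> nat \<Rightarrow> (int fa \<Rightarrow> int fa) ring" where
  "schur n q r = (End_alg (Omega_fin n r))\<lparr>carrier := zeta_fin n q r ` U_gl n q\<rparr>"

definition dominant :: "nat \<Rightarrow> nat \<Rightarrow> (nat \<Rightarrow> nat) set" where
  "dominant n r = {lam. (\<forall>i\<in>{1..<n}. lam (i + 1) \<le> lam i) \<and> (\<Sum>i=1..n. lam i) = r}"

text \<open>\<open>M\<close> is a simple module over the q-Schur algebra with highest weight \<open>lam\<close>; this determines
  \<open>M\<close> up to isomorphism.\<close>

definition is_L_weight :: "nat \<Rightarrow> complex \<Rightarrow> nat \<Rightarrow> (nat \<Rightarrow> nat) \<Rightarrow> (int fa \<Rightarrow> int fa, 'w) module \<Rightarrow> bool" where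
  "is_L_weight n q r lam M \<longleftrightarrow> simple_module (schur n q r) M \<and>
     (\<exists>w\<in>carrier M. w \<noteq> \<zero>\<^bsub>M\<^esub> \<and> gen_submodule (schur n q r) M {w} = carrier M \<and>
       (\<forall>i\<in>{1..<n}. zeta_fin n q r (D_cls n q (dE i)) \<odot>\<^bsub>M\<^esub> w = \<zero>\<^bsub>M\<^esub>) \<and>
       (\<forall>j\<in>{1..n}. zeta_fin n q r (D_cls n q (dK j)) \<odot>\<^bsub>M\<^esub> w =
          (\<lambda>x\<in>Omega_fin n r. cst (q ^ lam j) * x) \<odot>\<^bsub>M\<^esub> w))"

section \<open>The affine Hecke algebra and evaluation maps\<close>

datatype hgen = hTg nat | hXg nat | hXig nat

abbreviation "hT i \<equiv> gen (hTg i)"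
abbreviation "hX i \<equiv> gen (hXg i)"
abbreviation "hXi i \<equiv> gen (hXig i)"

definition H_gens :: "nat \<Rightarrow> hgen set" where
  "H_gens r = hTg ` {1..<r} \<union> hXg ` {1..r} \<union> hXig ` {1..r}"

inductive H_rel :: "nat \<Rightarrow> complex \<Rightarrow> hgen fa \<Rightarrow> hgen fa \<Rightarrow> bool" for r :: nat and q :: complex where
  "i \<in> {1..<r} \<Longrightarrow> H_rel r q ((hT i + 1) * (hT i - cst (q\<^sup>2))) 0"
| "\<lbrakk>i \<in> {1..<r}; i + 1 \<in> {1..<r}\<rbrakk> \<Longrightarrow> H_rel r q (hT i * hT (i + 1) * hT i) (hT (i + 1) * hT i * hT (i + 1))"
| "\<lbrakk>i \<in> {1..<r}; j \<in> {1..<r}; \<bar>int i - int j\<bar> > 1\<rbrakk> \<Longrightarrow> H_rel r q (hT i * hT j) (hT j * hT i)"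
| "\<lbrakk>i \<in> {1..r}; j \<in> {1..r}\<rbrakk> \<Longrightarrow> H_rel r q (hX i * hX j) (hX j * hX i)"
| "i \<in> {1..r} \<Longrightarrow> H_rel r q (hX i * hXi i) 1"
| "i \<in> {1..r} \<Longrightarrow> H_rel r q (hXi i * hX i) 1"
| "i \<in> {1..<r} \<Longrightarrow> H_rel r q (hT i * hX i * hT i) (cst (q\<^sup>2) * hX (i + 1))"
| "\<lbrakk>i \<in> {1..<r}; j \<in> {1..r}; j \<noteq> i; j \<noteq> i + 1\<rbrakk> \<Longrightarrow> H_rel r q (hX j * hT i) (hT i * hX j)"

definition Hr :: "nat \<Rightarrow> complex \<Rightarrow> hgen fa set ring" where
  "Hr r q = presented (H_gens r) (H_rel r q)"

definition H_cls :: "nat \<Rightarrow> complex \<Rightarrow> hgen fa \<Rightarrow> hgen fa set" where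
  "H_cls r q = cls (H_gens r) (H_rel r q)"

text \<open>Action of \<open>T\<^sub>k\<close> on a basis vector with arbitrary integer entries.  Put
  \<open>x = a + c n\<close> and \<open>y = b + d n\<close> with \<open>a, b \<in> {1..n}\<close> for the entries in positions \<open>k\<close>, \<open>k + 1\<close>,
  and let \<open>f\<close> be the monomial of exponents \<open>-c\<close> and \<open>-d\<close> in \<open>X\<^sub>k\<close> and the next variable \<open>X'\<close>, and
  \<open>f'\<close> the one with the exponents exchanged.  The relations of the affine Hecke algebra give
  \<open>f T\<^sub>k = T\<^sub>k f' + (q\<^sup>2 - 1) (f - f') / (1 - X\<^sub>k / X')\<close>.
  The first summand below is \<open>\<omega> T\<^sub>k f'\<close> for the basis vector \<open>\<omega>\<close> with entries
  \<open>a\<close>, \<open>b\<close> in these positions, the two sums expand the Laurent polynomial \<open>(f - f') / (1 - X\<^sub>k / X')\<close>.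
  For entries in \<open>{1..n}\<close> (that is, \<open>c = d = 0\<close>) only the usual finite rule remains.\<close>

definition T_act :: "nat \<Rightarrow> complex \<Rightarrow> nat \<Rightarrow> int list \<Rightarrow> int fa" where
  "T_act n q k is = (let
     x = is ! (k - 1); y = is ! k;
     a = rs n x; b = rs n y; c = (x - a) div int n; d = (y - b) div int n;
     put = (\<lambda>u v. mon (is[k - 1 := u, k := v]))
   in (if a = b then cst (q\<^sup>2) * put (a + d * int n) (b + c * int n)
       else if a < b then cst q * put (b + d * int n) (a + c * int n)
       else cst q * put (b + d * int n) (a + c * int n) +
            cst (q\<^sup>2 - 1) * put (a + d * int n) (b + c * int n))
    + cst (q\<^sup>2 - 1) * (\<Sum>j<nat (c - d). put (a + (c - int j) * int n) (b + (d + int j) * int n))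
    - cst (q\<^sup>2 - 1) * (\<Sum>j<nat (d - c). put (a + (d - int j) * int n) (b + (c + int j) * int n)))"

fun hecke_act :: "nat \<Rightarrow> complex \<Rightarrow> hgen \<Rightarrow> int fa \<Rightarrow> int fa" where
  "hecke_act n q (hTg k) = lin_ext (T_act n q k)"
| "hecke_act n q (hXg t) = lin_ext (\<lambda>is. mon (is[t - 1 := is ! (t - 1) - int n]))"
| "hecke_act n q (hXig t) = lin_ext (\<lambda>is. mon (is[t - 1 := is ! (t - 1) + int n]))"

definition hecke_right :: "nat \<Rightarrow> complex \<Rightarrow> int fa \<Rightarrow> hgen fa set \<Rightarrow> int fa" where
  "hecke_right n q v C = the_elem (right_eval (hecke_act n q) v ` C)"

text \<open>The finite Hecke algebra is the subalgebra generated by the \<open>T\<^sub>i\<close>; \<open>ev\<close> takes its values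
  there.  The images of the \<open>X\<^sub>j\<^sup>-\<^sup>1\<close> use the inverse of \<open>T\<^sub>i\<close>.\<close>

definition hT_inv :: "complex \<Rightarrow> nat \<Rightarrow> hgen fa" where
  "hT_inv q i = cst (inverse (q\<^sup>2)) * (hT i - cst (q\<^sup>2 - 1))"

fun ev_gen :: "complex \<Rightarrow> complex \<Rightarrow> hgen \<Rightarrow> hgen fa" where
  "ev_gen q a (hTg i) = hT i"
| "ev_gen q a (hXg j) = cst (a * q powi (- 2 * (int j - 1))) *
     prod_list (map (\<lambda>i. hT i) (rev [1..<j] @ [1..<j]))"
| "ev_gen q a (hXig j) = cst (inverse a * q powi (2 * (int j - 1))) *
     prod_list (map (hT_inv q) (rev [1..<j] @ [1..<j]))"

definition ev :: "nat \<Rightarrow> complex \<Rightarrow> complex \<Rightarrow> hgen fa set \<Rightarrow> hgen fa set" where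
  "ev r q a C = the_elem ((\<lambda>x. H_cls r q (subst_eval (ev_gen q a) x)) ` C)"

definition eps :: "nat \<Rightarrow> complex \<Rightarrow> nat \<Rightarrow> complex \<Rightarrow> int fa \<Rightarrow> int fa" where
  "eps n q r a = (THE \<epsilon>. \<epsilon> \<in> extensional (Omega r) \<and> linear_on (Omega r) (Omega_fin n r) \<epsilon> \<and>
     (\<forall>x\<in>Omega_fin n r. \<forall>h\<in>carrier (Hr r q).
        \<epsilon> (hecke_right n q x h) = hecke_right n q x (ev r q a h)))"

definition ev_schur :: "nat \<Rightarrow> complex \<Rightarrow> nat \<Rightarrow> complex \<Rightarrow> (int fa \<Rightarrow> int fa) \<Rightarrow> int fa \<Rightarrow> int fa" where
  "ev_schur n q r a \<phi> = (\<lambda>x\<in>Omega_fin n r. eps n q r a (\<phi> x))"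

section \<open>The quantum loop algebra\<close>

datatype ugen = uXg sign nat int | uKg nat | uKig nat | uGg nat int

abbreviation "uX e i s \<equiv> gen (uXg e i s)"
abbreviation "uK i \<equiv> gen (uKg i)"
abbreviation "uKi i \<equiv> gen (uKig i)"
abbreviation "uG i t \<equiv> gen (uGg i t)"

definition U_gens :: "nat \<Rightarrow> ugen set" where
  "U_gens n = {uXg e i s | e i s. i \<in> {1..<n}} \<union> uKg ` {1..n} \<union> uKig ` {1..n} \<union>
     {uGg i t | i t. i \<in> {1..n} \<and> t \<noteq> 0}"

text \<open>Exponential of a formal power series with zero constant coefficient over a free algebra.\<close>

definition fexp :: "'g fa fps \<Rightarrow> 'g fa fps" where
  "fexp F = Abs_fps (\<lambda>s. \<Sum>k\<le>s. cst (inverse (fact k)) * fps_nth (F ^ k) s)"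

fun uKt :: "nat \<Rightarrow> sign \<Rightarrow> nat \<Rightarrow> ugen fa" where
  "uKt n Pos i = uK i * uKi (nx n i)"
| "uKt n Neg i = uK (nx n i) * uKi i"

definition uH :: "complex \<Rightarrow> nat \<Rightarrow> int \<Rightarrow> ugen fa" where
  "uH q i m = cst (q powi ((int i - 1) * m)) * uG i m - cst (q powi ((int i + 1) * m)) * uG (i + 1) m"

text \<open>The series \<open>\<phi>\<^sup>+\<close> and \<open>\<phi>\<^sup>-\<close> (and likewise \<open>Qcal\<close> below) are power series in
  \<open>u\<close> and in the inverse of \<open>u\<close>, respectively.  Coefficients of the other sign are 0.\<close>

definition phi_series :: "nat \<Rightarrow> complex \<Rightarrow> sign \<Rightarrow> nat \<Rightarrow> ugen fa fps" where
  "phi_series n q e i = fps_const (uKt n e i) * fexp (Abs_fps (\<lambda>m. if m = 0 then 0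
     else cst (of_int (sg e) * (q - inverse q)) * uH q i (sg e * int m)))"

definition phi :: "nat \<Rightarrow> complex \<Rightarrow> sign \<Rightarrow> nat \<Rightarrow> int \<Rightarrow> ugen fa" where
  "phi n q e i s = (if sg e * s \<ge> 0 then fps_nth (phi_series n q e i) (nat (sg e * s)) else 0)"

definition qbr :: "complex \<Rightarrow> ugen fa \<Rightarrow> ugen fa \<Rightarrow> ugen fa" where
  "qbr b x y = x * y - cst b * y * x"

inductive U_rel :: "nat \<Rightarrow> complex \<Rightarrow> ugen fa \<Rightarrow> ugen fa \<Rightarrow> bool" for n :: nat and q :: complex where
  "\<lbrakk>i \<in> {1..n}; j \<in> {1..n}\<rbrakk> \<Longrightarrow> U_rel n q (uK i * uK j) (uK j * uK i)"
| "i \<in> {1..n} \<Longrightarrow> U_rel n q (uK i * uKi i) 1"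
| "i \<in> {1..n} \<Longrightarrow> U_rel n q (uKi i * uK i) 1"
| "\<lbrakk>i \<in> {1..n}; j \<in> {1..<n}\<rbrakk> \<Longrightarrow> U_rel n q (uK i * uX e j s)
     (cst (q powi (sg e * (of_bool (i = j) - of_bool (i = j + 1)))) * uX e j s * uK i)"
| "\<lbrakk>i \<in> {1..n}; j \<in> {1..n}; s \<noteq> 0\<rbrakk> \<Longrightarrow> U_rel n q (uK i * uG j s) (uG j s * uK i)"
| "\<lbrakk>i \<in> {1..n}; j \<in> {1..<n}; s \<noteq> 0; i \<noteq> j; i \<noteq> j + 1\<rbrakk> \<Longrightarrow>
     U_rel n q (uG i s * uX e j t - uX e j t * uG i s) 0"
| "\<lbrakk>i \<in> {1..<n}; s \<noteq> 0\<rbrakk> \<Longrightarrow> U_rel n q (uG i s * uX e i t - uX e i t * uG i s)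
     (cst (of_int (sg e) * q powi (- (int i * s)) * qint q s / of_int s) * uX e i (s + t))"
| "\<lbrakk>i \<in> {1..n}; i - 1 \<in> {1..<n}; s \<noteq> 0\<rbrakk> \<Longrightarrow>
     U_rel n q (uG i s * uX e (i - 1) t - uX e (i - 1) t * uG i s)
       (cst (- of_int (sg e) * q powi ((1 - int i) * s) * qint q s / of_int s) * uX e (i - 1) (s + t))"
| "\<lbrakk>i \<in> {1..n}; j \<in> {1..n}; s \<noteq> 0; t \<noteq> 0\<rbrakk> \<Longrightarrow> U_rel n q (uG i s * uG j t) (uG j t * uG i s)"
| "\<lbrakk>i \<in> {1..<n}; j \<in> {1..<n}\<rbrakk> \<Longrightarrow>
     U_rel n q (uX Pos i s * uX Neg j t - uX Neg j t * uX Pos i s)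
       (if i = j then cst (inverse (q - inverse q)) * (phi n q Pos i (s + t) - phi n q Neg i (s + t)) else 0)"
| "\<lbrakk>i \<in> {1..<n}; j \<in> {1..<n}; \<bar>int i - int j\<bar> > 1\<rbrakk> \<Longrightarrow>
     U_rel n q (uX e i s * uX e j t) (uX e j t * uX e i s)"
| "\<lbrakk>i \<in> {1..<n}; j \<in> {1..<n}\<rbrakk> \<Longrightarrow>
     U_rel n q (qbr (q powi (sg e * cartan n i j)) (uX e i (s + 1)) (uX e j t))
       (- qbr (q powi (sg e * cartan n i j)) (uX e j (t + 1)) (uX e i s))"
| "\<lbrakk>i \<in> {1..<n}; j \<in> {1..<n}; \<bar>int i - int j\<bar> = 1\<rbrakk> \<Longrightarrow>
     U_rel n q (qbr q (uX e i s) (qbr q (uX e j t) (uX e i p)))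
       (- qbr q (uX e i p) (qbr q (uX e j t) (uX e i s)))"

definition Uhat :: "nat \<Rightarrow> complex \<Rightarrow> ugen fa set ring" where
  "Uhat n q = presented (U_gens n) (U_rel n q)"

definition U_cls :: "nat \<Rightarrow> complex \<Rightarrow> ugen fa \<Rightarrow> ugen fa set" where
  "U_cls n q = cls (U_gens n) (U_rel n q)"

text \<open>The element \<open>\<X>\<^sub>1\<close> is \<open>calX q (n - 2)\<close> and \<open>\<Y>\<^sub>1\<close> is \<open>calY q (n - 2)\<close>.\<close>

primrec calX :: "complex \<Rightarrow> nat \<Rightarrow> ugen fa" where
  "calX q 0 = uX Neg 1 1"
| "calX q (Suc k) = qbr (inverse q) (uX Neg (k + 2) 0) (calX q k)"

primrec calY :: "complex \<Rightarrow> nat \<Rightarrow> ugen fa" where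
  "calY q 0 = uX Pos 1 (-1)"
| "calY q (Suc k) = qbr q (calY q k) (uX Pos (k + 2) 0)"

definition theta :: "nat \<Rightarrow> complex \<Rightarrow> sign \<Rightarrow> nat \<Rightarrow> ugen fa" where
  "theta n q e s = cst (- of_int (sg e) / qint q (int s)) * (\<Sum>i=1..n. uG i (sg e * int s))"

text \<open>\<open>f\<close> is the (unique) algebra isomorphism from the double Ringel--Hall algebra onto the
  quantum loop algebra with the prescribed values on generators.\<close>

definition is_drinfeld_iso :: "nat \<Rightarrow> complex \<Rightarrow> (dgen fa set \<Rightarrow> ugen fa set) \<Rightarrow> bool" where
  "is_drinfeld_iso n q f \<longleftrightarrow> f \<in> ring_iso (Dn n q) (Uhat n q) \<and>
     (\<forall>c. f (D_cls n q (cst c)) = U_cls n q (cst c)) \<and>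
     (\<forall>i\<in>{1..n}. f (D_cls n q (dK i)) = U_cls n q (uK i) \<and> f (D_cls n q (dKi i)) = U_cls n q (uKi i)) \<and>
     (\<forall>j\<in>{1..<n}. f (D_cls n q (dE j)) = U_cls n q (uX Pos j 0) \<and>
                  f (D_cls n q (dF j)) = U_cls n q (uX Neg j 0)) \<and>
     f (D_cls n q (dE n)) = U_cls n q (cst q * calX q (n - 2) * uKt n Pos n) \<and>
     f (D_cls n q (dF n)) = U_cls n q (cst (inverse q) * uKt n Neg n * calY q (n - 2)) \<and>
     (\<forall>e s. 1 \<le> s \<longrightarrow> f (D_cls n q (dZ e s)) =
        U_cls n q (cst (- of_int (sg e) * of_nat s * q powi (sg e * int s)) * theta n q e s))"

definition eval_module :: "nat \<Rightarrow> complex \<Rightarrow> nat \<Rightarrow> complex \<Rightarrow> (dgen fa set \<Rightarrow> ugen fa set) \<Rightarrow>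
    (int fa \<Rightarrow> int fa, 'w) module \<Rightarrow> (ugen fa set, 'w) module" where
  "eval_module n q r a f M =
     pullback_module (\<lambda>u. ev_schur n q r a (zeta_aff n q r (inv_into (carrier (Dn n q)) f u))) M"

section \<open>Drinfeld polynomials\<close>

definition Qcal :: "complex \<Rightarrow> sign \<Rightarrow> nat \<Rightarrow> ugen fa fps" where
  "Qcal q e i = fexp (Abs_fps (\<lambda>t. if t = 0 then 0
     else - (cst (q powi (sg e * int t) / qint q (int t)) * uG i (sg e * int t))))"

text \<open>Tuples of polynomials are functions on indices of which only the values on \<open>{1..n}\<close> matter.
  \<open>dilate c p\<close> is \<open>p(c u)\<close>.\<close>

definition dilate :: "complex \<Rightarrow> complex poly \<Rightarrow> complex poly" where
  "dilate c p = pcompose p [:0, c:]"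

definition Q_ratio :: "complex \<Rightarrow> (nat \<Rightarrow> complex poly) \<Rightarrow> nat \<Rightarrow> complex poly fract" where
  "Q_ratio q Q i = Fraction_Field.Fract (dilate (q ^ (i - 1)) (Q i)) 1 /
                   Fraction_Field.Fract (dilate (q ^ (i + 1)) (Q (i + 1))) 1"

definition Q_set :: "nat \<Rightarrow> complex \<Rightarrow> nat \<Rightarrow> (nat \<Rightarrow> complex poly) set" where
  "Q_set n q r = {Q. (\<forall>i\<in>{1..n}. Polynomial.coeff (Q i) 0 = 1) \<and>
     (\<forall>i\<in>{1..<n}. \<exists>p. Q_ratio q Q i = Fraction_Field.Fract p 1) \<and> (\<Sum>i=1..n. Polynomial.degree (Q i)) = r}"

text \<open>If \<open>g(u) = \<Prod>\<^sub>k (1 - b\<^sub>k u)\<close>, then the roots of \<open>g\<close> are the inverses of the \<open>b\<^sub>k\<close>.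
  The second polynomial is \<open>g\<^sup>-\<close> as a polynomial in the inverse of \<open>u\<close>.\<close>

fun pm_poly :: "sign \<Rightarrow> complex poly \<Rightarrow> complex poly" where
  "pm_poly Pos g = g"
| "pm_poly Neg g = (\<Prod>x\<in>#proots g. [:1, - x:])"

definition I_Q :: "nat \<Rightarrow> complex \<Rightarrow> (nat \<Rightarrow> complex poly) \<Rightarrow> ugen fa set set" where
  "I_Q n q Q = gen_submodule (Uhat n q) (regular_module (Uhat n q)) (U_cls n q `
     ({uX Pos j s | j s. j \<in> {1..<n}} \<union>
      {fps_nth (Qcal q e i) s - cst (Polynomial.coeff (pm_poly e (Q i)) s) | e i s. i \<in> {1..n}} \<union>
      {uK i - cst (q ^ Polynomial.degree (Q i)) | i. i \<in> {1..n}}))"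

text \<open>\<open>M\<close> is a simple quotient of the quotient of the regular module by \<open>I_Q n q Q\<close>; there is only
  one such module up to isomorphism.\<close>

definition is_L_Q :: "nat \<Rightarrow> complex \<Rightarrow> (nat \<Rightarrow> complex poly) \<Rightarrow> (ugen fa set, 'm) module \<Rightarrow> bool" where
  "is_L_Q n q Q M \<longleftrightarrow> simple_module (Uhat n q) M \<and>
     (\<exists>\<pi>\<in>module_hom (Uhat n q) (quotient_module (regular_module (Uhat n q)) (I_Q n q Q)) M.
        \<pi> ` carrier (quotient_module (regular_module (Uhat n q)) (I_Q n q Q)) = carrier M)"

end

theory Submission
  imports Defs "HOL-Computational_Algebra.Polynomial_FPS"
begin

text \<open>The module carries a highest weight vector \<open>v\<close> of the quantum loop algebra, and the tuple \<open>Q\<close> is read off from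
  the eigenvalues of the commuting elements \<open>g\<^sub>i\<^sub>,\<^sub>t\<close> on \<open>v\<close>.  Three facts determine these eigenvalues.

  Weights: in a simple module over the Schur algebra the weights of two highest weight vectors bound each other in
  the dominance order (\<open>weights_below\<close>), so the degree of the \<open>i\<close>-th polynomial is \<open>lam i\<close>.

  The affine raising operator: evaluation turns \<open>E\<^sub>n\<close> into \<open>a q\<^sup>-\<^sup>1\<close> times a root vector in the lowering operators times
  \<open>K\<^sub>1 K\<^sub>n\<close> (\<open>eps_En\<close>).  Both sides commute with the Hecke algebra, so they are compared on weakly increasing
  words only, where the evaluation map is given by Jucys--Murphy operators in closed form (\<open>J_formula\<close>).  In the loop
  algebra \<open>E\<^sub>n\<close> is the same nested commutator, with the innermost lowering operator of degree 0 replaced by the one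
  of degree 1.  Raising operators strip the commutators off one by one and leave
  \<open>x\<^sub>i\<^sub>,\<^sub>1 v = a q\<^bsup>2 lam i - 1 - i\<^esup> x\<^sub>i\<^sub>,\<^sub>0 v\<close> for the lowering operators (\<open>F1_value\<close>).  Commuting this relation
  with all raising operators of index \<open>i\<close> gives a recursion of order one for the eigenvalues of \<open>\<phi>\<^sup>+\<close>; its solution compares
  the logarithms of neighbouring members of the tuple (\<open>hlog_step\<close>).

  The centre: these comparisons leave one power series undetermined, which the central elements \<open>z\<^sub>t\<close> supply.  Evaluation
  turns \<open>z\<^sub>t\<close> into the power sum of the \<open>t\<close>-th powers of the Jucys--Murphy operators.  Power sums commute with the Hecke
  algebra and hence come from the quantum group of \<open>gl\<^sub>n\<close> (\<open>schur_weyl\<close>), because the tensors that are symmetric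
  in the blocks of an increasing word are generated by this word (\<open>generation\<close>).  Modulo lowered tensors the increasing
  word of content \<open>lam\<close> is an eigenvector of the Jucys--Murphy operators with eigenvalues \<open>a q\<^bsup>2c\<^esup>\<close>, where \<open>c\<close> runs through
  the contents of the boxes of the Young diagram (\<open>Murphy\<close>).  So \<open>z\<^sub>t\<close> acts on \<open>v\<close> by the power sum of these numbers
  (\<open>center_value\<close>), and the product of the tuple is a product over the boxes.

  The candidates \<open>\<Prod>\<^sub>s (1 - a q\<^bsup>2(s - i)\<^esup> u)\<close>, \<open>1 \<le> s \<le> lam i\<close>, satisfy the same comparisons and have the same product.  The
  coefficients of the differences of logarithms are therefore geometric in \<open>i\<close> with ratio a power of \<open>q\<close> and have sum 0; since
  \<open>q\<close> is not a root of unity they vanish (\<open>Q_value\<close>).  The ratios in the theorem follow by cancelling linear factors.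

  All this needs concrete models of the presented algebras.  The generators of the double Ringel--Hall algebra act on the whole
  tensor algebra as skew derivations, those of the affine Hecke algebra by a rule for two neighbouring letters; the relations hold for these
  operators (\<open>D_rel_op\<close>, \<open>H_rel_op\<close>), so the maps on residue classes are given by representatives.\<close>

section \<open>Linear maps between free algebras\<close>

lemma lookup_cst_times [simp]: "Poly_Mapping.lookup (cst c * x) w = c * Poly_Mapping.lookup x w"
 by (simp add: cst_def mult_map_scale_conv_mult [symmetric] map.rep_eq when_def)

lemma fa_expand: "x = (\<Sum>w\<in>Poly_Mapping.keys x. cst (Poly_Mapping.lookup x w) * mon (letters w))"
 by (rule poly_mapping_eqI)
  (simp add: lookup_sum mon_def lookup_single when_def in_keys_iff if_distrib [of "\<lambda>c. _ * c"] cong: if_cong)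

lemma mon_mult: "mon u * mon v = mon (u @ v)"
 by (simp add: mon_def mult_single plus_word_def)

lemma mon_Nil: "mon [] = 1"
 by (simp add: mon_def zero_word_def [symmetric])

lemma cst_0 [simp]: "cst 0 = 0"
 and cst_1 [simp]: "cst 1 = 1"
 and cst_add: "cst (c + d) = cst c + cst d"
 and cst_diff: "cst (c - d) = cst c - cst d"
 and cst_minus: "cst (- c) = - cst c"
 and cst_mult: "cst (c * d) = cst c * cst d"
 by (simp_all add: cst_def single_add single_diff single_uminus mult_single)

lemma cst_mult_assoc: "cst c * (cst d * x) = cst (c * d) * x"
 by (simp add: cst_mult mult.assoc)

lemma keys_mon [simp]: "Poly_Mapping.keys (mon u) = {Word u}"
 by (simp add: mon_def)

lemma lookup_mon: "Poly_Mapping.lookup (mon u) w = (if letters w = u then 1 else 0)"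
 by (cases w) (auto simp: mon_def lookup_single when_def)

lemma mon_eq_iff [simp]: "mon u = mon v \<longleftrightarrow> u = v"
 by (metis keys_mon singleton_inject word.inject)

lemma cst_commute_mon: "mon u * cst c = cst c * mon u"
 by (simp add: cst_def mon_def mult_single)

lemma cst_commute: "x * cst c = cst c * x"
 by (subst (1 2) fa_expand [of x])
  (simp add: sum_distrib_left sum_distrib_right mult.assoc cst_commute_mon,
   simp add: mult.assoc [symmetric] cst_mult [symmetric] mult.commute)

lemma times_cst_left: "x * (cst c * y) = cst c * (x * y)"
 by (simp add: mult.assoc [symmetric] cst_commute)

definition linear_map :: "('a fa => 'b fa) => bool" where
 "linear_map f \<longleftrightarrow> (\<forall>x y. f (x + y) = f x + f y) \<and> (\<forall>c x. f (cst c * x) = cst c * f x)"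

lemma linear_mapI [intro?]:
 "(!!x y. f (x + y) = f x + f y) ==> (!!c x. f (cst c * x) = cst c * f x) ==> linear_map f"
 by (simp add: linear_map_def)

lemma linear_map_add: "linear_map f ==> f (x + y) = f x + f y"
 and linear_map_cst: "linear_map f ==> f (cst c * x) = cst c * f x"
 by (simp_all add: linear_map_def)

lemma linear_map_0: "linear_map f ==> f 0 = 0"
 using linear_map_cst [of f 0 0] by simp

lemma linear_map_minus: "linear_map f ==> f (- x) = - f x"
 using linear_map_cst [of f "-1" x] by (simp add: cst_minus)

lemma linear_map_diff: "linear_map f ==> f (x - y) = f x - f y"
 using linear_map_add [of f x "- y"] linear_map_minus [of f y] by simp

lemma linear_map_sum: "linear_map f ==> f (sum g A) = (\<Sum>a\<in>A. f (g a))"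
 by (induction A rule: infinite_finite_induct) (simp_all add: linear_map_0 linear_map_add)

text \<open>Scalar multiplication as a constant of its own, a normal form for the simplifier: the product
 of two scalars and a vector would otherwise be permuted forever.\<close>

definition sc :: "complex => 'a fa => 'a fa" where
 "sc c x = cst c * x"

lemma sc_simps:
 fixes x y :: "'a fa"
 shows "cst c * x = sc c x" "x * cst c = sc c x" "sc c x * y = sc c (x * y)" "x * sc c y = sc c (x * y)"
  "sc c (sc d x) = sc (c * d) x" "sc c (x + y) = sc c x + sc c y" "sc c (x - y) = sc c x - sc c y"
  "- sc c x = sc (- c) x" "sc c (- x) = sc (- c) x" "sc c 0 = 0" "sc 0 x = 0" "sc 1 x = x"
  "sc c (sum f A) = (\<Sum>a\<in>A. sc c (f a))"
 unfolding sc_def using times_cst_left [of x c y] cst_mult_assoc [of c d x] cst_commute [of x c]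
 by (simp_all add: mult.assoc distrib_left right_diff_distrib cst_minus sum_distrib_left)

lemma lookup_sc [simp]: "Poly_Mapping.lookup (sc c x) w = c * Poly_Mapping.lookup x w"
 by (simp add: sc_def)

lemma linear_map_sc: "linear_map f ==> f (sc c x) = sc c (f x)"
 by (simp add: sc_def linear_map_cst)

lemmas linear_map_simps = linear_map_add linear_map_diff linear_map_minus linear_map_cst
 linear_map_0 linear_map_sum linear_map_sc

lemma linear_map_lin_ext [simp, intro]: "linear_map (lin_ext b)"
proof
 have *: "lin_ext b v = (\<Sum>w\<in>S. cst (Poly_Mapping.lookup v w) * b (letters w))"
  if "finite S" "Poly_Mapping.keys v \<subseteq> S" for v S
  unfolding lin_ext_def by (rule sum.mono_neutral_left) (use that in \<open>auto simp: in_keys_iff\<close>)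
 show "lin_ext b (x + y) = lin_ext b x + lin_ext b y" for x y
  by (subst (1 2 3) *[of "Poly_Mapping.keys x \<union> Poly_Mapping.keys y"])
   (simp_all add: keys_add lookup_add cst_add distrib_right sum.distrib)
 show "lin_ext b (cst c * x) = cst c * lin_ext b x" for c x
  by (subst (1 2) *[of "Poly_Mapping.keys x"])
   (auto simp: sum_distrib_left cst_mult mult.assoc in_keys_iff)
qed

lemma lin_ext_mon [simp]: "lin_ext b (mon w) = b w"
 by (simp add: lin_ext_def lookup_mon)

lemma linear_map_expand:
 "linear_map f ==> f v = (\<Sum>w\<in>Poly_Mapping.keys v. cst (Poly_Mapping.lookup v w) * f (mon (letters w)))"
 by (subst fa_expand [of v]) (simp add: linear_map_simps)

lemma linear_map_id [simp]: "linear_map (\<lambda>v. v)"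
 and linear_map_zero [simp]: "linear_map (\<lambda>v. 0)"
 by (simp_all add: linear_map_def)

lemma linear_map_comp: "linear_map f ==> linear_map g ==> linear_map (\<lambda>v. f (g v))"
 by (simp add: linear_map_def)

lemma linear_map_plus: "linear_map f ==> linear_map g ==> linear_map (\<lambda>v. f v + g v)"
 by (simp add: linear_map_def distrib_left)

lemma linear_map_neg: "linear_map f ==> linear_map (\<lambda>v. - f v)"
 by (simp add: linear_map_def)

lemma linear_map_sub: "linear_map f ==> linear_map g ==> linear_map (\<lambda>v. f v - g v)"
 using linear_map_plus [of f "\<lambda>v. - g v"] by (simp add: linear_map_neg)

lemma linear_map_times_left: "linear_map f ==> linear_map (\<lambda>v. x * f v)"
 by (simp add: linear_map_def distrib_left times_cst_left)

lemma linear_map_times_right: "linear_map f ==> linear_map (\<lambda>v. f v * x)"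
 by (simp add: linear_map_def distrib_right mult.assoc)

lemma linear_map_scale: "linear_map f ==> linear_map (\<lambda>v. cst c * f v)"
 by (rule linear_map_times_left)

lemma linear_map_sums: "(!!a. a : A ==> linear_map (f a)) ==> linear_map (\<lambda>v. \<Sum>a\<in>A. f a v)"
 by (auto simp: linear_map_def sum.distrib sum_distrib_left)

lemma linear_map_foldr: "(!!g. linear_map (\<rho> g)) ==> linear_map (foldr \<rho> w)"
 by (induction w) (auto intro: linear_map_comp simp: comp_def id_def)

lemma linear_map_fold: "(!!g. linear_map (\<rho> g)) ==> linear_map (fold \<rho> w)"
 by (induction w) (auto intro: linear_map_comp simp: comp_def id_def)

text \<open>Subspaces spanned by words.\<close>

definition supp :: "'a list set => 'a fa set" where
 "supp A = {v. \<forall>w\<in>Poly_Mapping.keys v. letters w : A}"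

lemma supp_0 [simp]: "0 : supp A"
 and supp_mon [simp]: "mon w : supp A \<longleftrightarrow> w : A"
 by (simp_all add: supp_def)

lemma supp_add [intro]: "x : supp A ==> y : supp A ==> x + y : supp A"
 using keys_add [of x y] by (fastforce simp: supp_def)

lemma supp_cst [intro]: "x : supp A ==> cst c * x : supp A"
 by (auto simp: supp_def in_keys_iff)

lemma supp_minus [intro]: "x : supp A ==> - x : supp A"
 by (auto simp: supp_def in_keys_iff)

lemma supp_diff [intro]: "x : supp A ==> y : supp A ==> x - y : supp A"
 using supp_add [of x A "- y"] supp_minus [of y A] by simp

lemma supp_sum [intro]: "(!!a. a : S ==> f a : supp A) ==> sum f S : supp A"
 by (induction S rule: infinite_finite_induct) auto

lemma supp_mono: "A \<subseteq> B ==> supp A \<subseteq> supp B"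
 by (auto simp: supp_def)

lemma supp_induct [consumes 1, case_names mon zero add cst]:
 assumes "v : supp A" and "!!w. w : A ==> P (mon w)" and "P 0"
  and "!!x y. P x ==> P y ==> P (x + y)" and "!!c x. P x ==> P (cst c * x)"
 shows "P v"
proof -
 have "P (\<Sum>w\<in>S. cst (Poly_Mapping.lookup v w) * mon (letters w))"
  if "finite S" "S \<subseteq> Poly_Mapping.keys v" for S
  using that assms(1) by (induction S) (auto simp: supp_def assms)
 from this [of "Poly_Mapping.keys v"] show ?thesis by (simp add: fa_expand [symmetric])
qed

lemma supp_UNIV [simp]: "v : supp UNIV"
 by (simp add: supp_def)

lemma fa_induct [case_names mon zero add cst]:
 assumes "!!w. P (mon w)" "P 0" "!!x y. P x ==> P y ==> P (x + y)" "!!c x. P x ==> P (cst c * x)"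
 shows "P v"
proof -
 have "v : supp UNIV" by simp
 then show ?thesis by (induction rule: supp_induct) (use assms in auto)
qed

lemma tensor_induct [case_names one letter zero add cst]:
 assumes "P 1" "!!x v. P v ==> P (mon [x] * v)" "P 0" "!!x y. P x ==> P y ==> P (x + y)"
  "!!c x. P x ==> P (cst c * x)"
 shows "P v"
proof (induction v rule: fa_induct)
 case (mon w)
 show ?case
 proof (induction w)
  case (Cons x w)
  then show ?case using assms(2) [of "mon w" x] by (simp add: mon_mult)
 qed (simp add: mon_Nil assms(1))
qed (use assms in auto)

lemma supp_map:
 "v : supp A ==> linear_map f ==> (!!w. w : A ==> f (mon w) : supp B) ==> f v : supp B"
 by (induction rule: supp_induct) (auto simp: linear_map_simps)

lemma supp_mult:
 assumes "x : supp A" "y : supp B" and "!!u v. u : A ==> v : B ==> u @ v : C"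
 shows "x * y : supp C"
 using assms(1)
proof (induction rule: supp_induct)
 case (mon w)
 with assms(2) show ?case
  by (induction rule: supp_induct) (auto simp: mon_mult assms(3) distrib_left times_cst_left)
qed (auto simp: distrib_right mult.assoc)

lemma linear_map_eqI:
 assumes "linear_map f" "linear_map g" "v : supp A" "!!w. w : A ==> f (mon w) = g (mon w)"
 shows "f v = g v"
 using assms(3) by (induction rule: supp_induct) (simp_all add: assms linear_map_simps)

lemma Omega_supp: "Omega r = supp {w. length w = r}"
 by (simp add: Omega_def supp_def)

lemma Omega_fin_supp: "Omega_fin n r = supp {w. length w = r \<and> set w \<subseteq> {1..int n}}"
 by (auto simp: Omega_fin_def Omega_def supp_def)

lemma left_eval_lin_ext: "left_eval \<rho> x v = lin_ext (\<lambda>w. foldr \<rho> w v) x"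
 and right_eval_lin_ext: "right_eval \<rho>' v' y = lin_ext (\<lambda>w. fold \<rho>' w v') y"
 and subst_eval_lin_ext: "subst_eval \<sigma> z = lin_ext (\<lambda>w. prod_list (map \<sigma> w)) z"
 by (simp_all add: left_eval_def right_eval_def subst_eval_def lin_ext_def)

lemma lin_ext_0 [simp]: "lin_ext b 0 = 0"
 by (simp add: linear_map_simps)

lemma linear_map_lin_ext_param:
 assumes "!!w. linear_map (\<lambda>v. b v w)"
 shows "linear_map (\<lambda>v. lin_ext (b v) x)"
 unfolding lin_ext_def by (intro linear_map_sums linear_map_scale assms)

lemma linear_left_eval: "linear_map (\<lambda>x. left_eval \<rho> x v)"
 and linear_right_eval: "linear_map (\<lambda>x. right_eval \<rho>' v' x)"
 and linear_subst_eval: "linear_map (subst_eval \<sigma>)"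
 by (simp_all add: left_eval_lin_ext right_eval_lin_ext subst_eval_lin_ext [abs_def])

lemma linear_left_eval_arg: "(!!g. linear_map (\<rho> g)) ==> linear_map (left_eval \<rho> x)"
 and linear_right_eval_arg: "(!!g. linear_map (\<rho>' g)) ==> linear_map (\<lambda>v. right_eval \<rho>' v y)"
 unfolding left_eval_lin_ext [abs_def] right_eval_lin_ext
 by (auto intro!: linear_map_lin_ext_param linear_map_foldr linear_map_fold)

lemma left_eval_mon: "left_eval \<rho> (mon w) v = foldr \<rho> w v"
 and right_eval_mon: "right_eval \<rho>' v' (mon w') = fold \<rho>' w' v'"
 and subst_eval_mon: "subst_eval \<sigma> (mon w'') = prod_list (map \<sigma> w'')"
 by (simp_all add: left_eval_lin_ext right_eval_lin_ext subst_eval_lin_ext)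

lemma left_eval_1: "left_eval \<rho> 1 v = v"
 and right_eval_1: "right_eval \<rho>' v' 1 = v'"
 and subst_eval_1: "subst_eval \<sigma> 1 = 1"
 using left_eval_mon [of \<rho> "[]" v] right_eval_mon [of \<rho>' v' "[]"] subst_eval_mon [of \<sigma> "[]"]
 by (simp_all add: mon_Nil)

lemma left_eval_cst: "left_eval \<rho> (cst c) v = cst c * v"
 and right_eval_cst: "right_eval \<rho>' v' (cst c) = cst c * v'"
 and subst_eval_cst: "subst_eval \<sigma> (cst c) = cst c"
 using linear_map_cst [OF linear_left_eval [of \<rho> v], of c 1]
  linear_map_cst [OF linear_right_eval [of \<rho>' v'], of c 1]
  linear_map_cst [OF linear_subst_eval [of \<sigma>], of c 1]
 by (simp_all add: left_eval_1 right_eval_1 subst_eval_1)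

lemma left_eval_mult:
 assumes "!!g. linear_map (\<rho> g)"
 shows "left_eval \<rho> (x * y) v = left_eval \<rho> x (left_eval \<rho> y v)"
proof -
 have "x : supp UNIV" by simp
 then show ?thesis
 proof (induction rule: supp_induct)
  case (mon u)
  have "y : supp UNIV" by simp
  then show ?case
   by (induction rule: supp_induct)
    (simp_all add: left_eval_mon mon_mult linear_map_simps [OF linear_left_eval] distrib_left
     times_cst_left linear_map_simps [OF linear_map_foldr, of \<rho>] assms)
 qed (simp_all add: linear_map_simps [OF linear_left_eval] distrib_right mult.assoc)
qed

lemma right_eval_mult:
 assumes "!!g. linear_map (\<rho> g)"
 shows "right_eval \<rho> v (x * y) = right_eval \<rho> (right_eval \<rho> v x) y"
proof -
 have "x : supp UNIV" by simp
 then show ?thesis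
 proof (induction rule: supp_induct)
  case (mon u)
  have "y : supp UNIV" by simp
  then show ?case
   by (induction rule: supp_induct)
    (simp_all add: right_eval_mon mon_mult linear_map_simps [OF linear_right_eval] distrib_left
     times_cst_left)
 qed (simp_all add: linear_map_simps [OF linear_right_eval]
   linear_map_simps [OF linear_right_eval_arg, OF assms] distrib_right mult.assoc)
qed

lemma subst_eval_mult: "subst_eval \<sigma> (x * y) = subst_eval \<sigma> x * subst_eval \<sigma> y"
proof -
 have "x : supp UNIV" by simp
 then show ?thesis
 proof (induction rule: supp_induct)
  case (mon u)
  have "y : supp UNIV" by simp
  then show ?case
   by (induction rule: supp_induct)
    (simp_all add: subst_eval_mon mon_mult linear_map_simps [OF linear_subst_eval] distrib_left
     times_cst_left)
 qed (simp_all add: linear_map_simps [OF linear_subst_eval] distrib_right mult.assoc)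
qed

lemmas left_eval_simps = linear_map_simps [OF linear_left_eval]
lemmas right_eval_simps = linear_map_simps [OF linear_right_eval]
lemmas subst_eval_simps = linear_map_simps [OF linear_subst_eval] subst_eval_mult subst_eval_cst subst_eval_1

lemma left_eval_gen [simp]: "left_eval \<rho> (gen g) v = \<rho> g v"
 and right_eval_gen [simp]: "right_eval \<rho>' v' (gen g') = \<rho>' g' v'"
 and subst_eval_gen [simp]: "subst_eval \<sigma> (gen g'') = \<sigma> g''"
 by (simp_all add: left_eval_mon right_eval_mon subst_eval_mon)

section \<open>Presented algebras\<close>

abbreviation gens_alg :: "'g set => 'g fa set" where
 "gens_alg G \<equiv> carrier (free_alg G)"

lemma gens_alg_supp: "gens_alg G = supp {w. set w \<subseteq> G}"
 by (simp add: free_alg_def supp_def)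

lemma free_alg_simps [simp]: "mult (free_alg G) = (*)" "one (free_alg G) = 1"
 "zero (free_alg G) = 0" "add (free_alg G) = (+)"
 by (simp_all add: free_alg_def)

lemma gens_alg_closed [simp, intro]:
 shows "0 : gens_alg G" "1 : gens_alg G" "cst c : gens_alg G"
  and "x : gens_alg G ==> y : gens_alg G ==> x + y : gens_alg G"
  and "x : gens_alg G ==> y : gens_alg G ==> x - y : gens_alg G"
  and "x : gens_alg G ==> - x : gens_alg G"
  and "x : gens_alg G ==> y : gens_alg G ==> x * y : gens_alg G"
proof -
 have "mon [] : supp {w. set w \<subseteq> G}" by (simp only: supp_mon) simp
 then show 1: "1 : gens_alg G" by (simp only: mon_Nil gens_alg_supp)
 then show "cst c : gens_alg G" using supp_cst [of 1 _ c] by (simp add: gens_alg_supp)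
 show "x : gens_alg G ==> y : gens_alg G ==> x * y : gens_alg G"
  unfolding gens_alg_supp by (rule supp_mult) auto
qed (auto simp: gens_alg_supp)

lemma gens_alg_mon [simp]: "mon w : gens_alg G \<longleftrightarrow> set w \<subseteq> G"
 by (simp add: gens_alg_supp)

lemma gens_alg_power [simp, intro]: "x : gens_alg G ==> x ^ k : gens_alg G"
 by (induction k) simp_all

lemma gens_alg_sum [simp, intro]: "(!!a. a : A ==> f a : gens_alg G) ==> sum f A : gens_alg G"
 by (simp add: gens_alg_supp supp_sum)

lemma gens_alg_prod_list [simp, intro]: "(!!x. x : set xs ==> x : gens_alg G) ==> prod_list xs : gens_alg G"
 by (induction xs) simp_all

lemma gens_alg_induct [consumes 1, case_names gen one zero mult add cst]:
 assumes "x : gens_alg G" and "!!g. g : G ==> P (gen g)" and "P 1" and "P 0"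
  and "!!g y. g : G ==> P y ==> y : gens_alg G ==> P (gen g * y)"
  and "!!y z. P y ==> P z ==> P (y + z)" and "!!c y. P y ==> P (cst c * y)"
 shows "P x"
 using assms(1) unfolding gens_alg_supp
proof (induction rule: supp_induct)
 case (mon w)
 then have "set w \<subseteq> G" by simp
 then show ?case
 proof (induction w)
  case (Cons g w)
  then have "P (gen g * mon w)" by (intro assms(5)) simp_all
  then show ?case by (simp add: mon_mult)
 qed (simp add: mon_Nil assms(3))
qed (use assms in auto)

lemma free_alg_ring: "ring (free_alg G)"
proof (rule ringI)
 show "abelian_group (free_alg G)"
 proof (rule abelian_groupI)
  show "\<exists>y\<in>gens_alg G. y \<oplus>\<^bsub>free_alg G\<^esub> x = \<zero>\<^bsub>free_alg G\<^esub>" if "x : gens_alg G" for x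
   using that by (intro bexI [of _ "- x"]) auto
 qed (simp_all add: ac_simps)
 show "Group.monoid (free_alg G)" by (rule monoidI) (simp_all add: ac_simps)
qed (simp_all add: distrib_left distrib_right)

text \<open>A set of elements of the free algebra that is closed under the ideal operations.\<close>

lemma free_alg_idealI:
 assumes "I \<subseteq> gens_alg G" "0 : I" "!!x y. x : I ==> y : I ==> x + y : I" "!!x. x : I ==> - x : I"
  "!!x y. x : I ==> y : gens_alg G ==> y * x : I" "!!x y. x : I ==> y : gens_alg G ==> x * y : I"
 shows "ideal I (free_alg G)"
proof (rule idealI [OF free_alg_ring])
 interpret ring "free_alg G" by (rule free_alg_ring)
 show "subgroup I (add_monoid (free_alg G))"
 proof (rule add.subgroupI)
  fix x assume "x : I"
  moreover have "a_inv (free_alg G) x = - x" if "x : gens_alg G"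
   using that by (intro minus_equality) simp_all
  ultimately show "a_inv (free_alg G) x : I"
   using assms by auto
 qed (use assms in auto)
qed (use assms in auto)

locale presentation =
 fixes G :: "'g set" and R :: "'g fa => 'g fa => bool"
 assumes rel_closed: "R x y ==> x : gens_alg G \<and> y : gens_alg G"
begin

abbreviation "I \<equiv> rel_ideal G R"
abbreviation "Q \<equiv> presented G R"
abbreviation "cl \<equiv> cls G R"

sublocale FA: ring "free_alg G" by (rule free_alg_ring)

sublocale ideal I "free_alg G"
 unfolding rel_ideal_def by (rule FA.genideal_ideal) (auto dest: rel_closed)

lemma a_minus_FA: "x : gens_alg G ==> \<ominus>\<^bsub>free_alg G\<^esub> x = - x"
 by (rule FA.minus_equality) simp_all

lemma I_sub: "I \<subseteq> gens_alg G"
 using a_subset by simp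

lemma I_zero: "0 : I"
 using additive_subgroup.zero_closed [OF is_additive_subgroup] by simp

lemma I_add: "x : I ==> y : I ==> x + y : I"
 using additive_subgroup.a_closed [OF is_additive_subgroup] by simp

lemma I_minus: "x : I ==> - x : I"
 using additive_subgroup.a_inv_closed [OF is_additive_subgroup, of x] I_sub a_minus_FA by auto

lemma I_rel: "R x y ==> x - y : I"
 unfolding rel_ideal_def genideal_def by auto

text \<open>Every set with the closure properties of an ideal is a test for membership: a property that is shared by
  all relations and preserved by the ideal operations holds on the ideal.\<close>

lemma I_least:
 assumes "!!x y. R x y ==> x - y : J" and "J \<subseteq> gens_alg G" "0 : J" "!!x y. x : J ==> y : J ==> x + y : J"
  "!!x. x : J ==> - x : J" "!!x y. x : J ==> y : gens_alg G ==> y * x : J"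
  "!!x y. x : J ==> y : gens_alg G ==> x * y : J"
 shows "I \<subseteq> J"
 unfolding rel_ideal_def
 by (rule FA.genideal_minimal [OF free_alg_idealI]) (use assms in auto)

lemma cl_def': "cl x = {i + x | i. i : I}"
 by (auto simp: cls_def a_r_coset_def r_coset_def)

lemma cl_self: "x : cl x"
 using I_zero by (force simp: cl_def')

lemma cl_eqI:
 assumes "x - y : I" shows "cl x = cl y"
proof -
 have "i + x : cl y" if "i : I" for i
  using I_add [OF that assms] by (auto simp: cl_def' intro!: exI [of _ "i + (x - y)"])
 moreover have "i + y : cl x" if "i : I" for i
  using I_add [OF that I_minus [OF assms]]
  by (auto simp: cl_def' diff_add_eq intro!: exI [of _ "i + - (x - y)"])
 ultimately show ?thesis by (auto simp: cl_def')
qed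

lemma cl_eqD: "cl x = cl y ==> x - y : I"
 using cl_self [of x] by (auto simp: cl_def')

lemma cl_eq_iff: "cl x = cl y \<longleftrightarrow> x - y : I"
 using cl_eqI cl_eqD by blast

lemma cl_rel: "R x y ==> cl x = cl y"
 by (rule cl_eqI) (rule I_rel)

lemma cl_closed [simp, intro]: "x : gens_alg G ==> cl x : carrier Q"
 unfolding presented_def FactRing_def cls_def using FA.a_rcosetsI [OF a_subset] by simp

lemma Q_carrier: "carrier Q = cl ` gens_alg G"
 by (auto simp: presented_def FactRing_def cls_def A_RCOSETS_defs a_r_coset_def r_coset_def)

lemma cl_mult: "x : gens_alg G ==> y : gens_alg G ==> cl x \<otimes>\<^bsub>Q\<^esub> cl y = cl (x * y)"
 unfolding presented_def FactRing_def cls_def using rcoset_mult_add by simp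

lemma cl_add: "x : gens_alg G ==> y : gens_alg G ==> cl x \<oplus>\<^bsub>Q\<^esub> cl y = cl (x + y)"
 unfolding presented_def FactRing_def cls_def using a_rcos_sum [of x y] by simp

lemma cl_one: "\<one>\<^bsub>Q\<^esub> = cl 1"
 by (simp add: presented_def FactRing_def cls_def)

lemma cl_zero: "\<zero>\<^bsub>Q\<^esub> = cl 0"
 unfolding presented_def FactRing_def by (auto simp: cl_def')

sublocale QR: ring Q
 unfolding presented_def by (rule quotient_is_ring)

lemma cl_minus: "x : gens_alg G ==> \<ominus>\<^bsub>Q\<^esub> cl x = cl (- x)"
 by (rule QR.minus_equality) (simp_all add: cl_add cl_zero)

lemma cl_mult_cong:
 assumes "cl x = cl x'" "cl y = cl y'"
  "x : gens_alg G" "y : gens_alg G" "x' : gens_alg G" "y' : gens_alg G"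
 shows "cl (x * y) = cl (x' * y')"
 using assms by (metis cl_mult)

text \<open>Maps that vanish on the ideal are well defined on residue classes.\<close>

lemma the_elem_cl:
 assumes "!!i. i : I ==> h (i + x) = h x"
 shows "the_elem (h ` cl x) = h x"
proof -
 have "h ` cl x = {h x}" using assms cl_self by (force simp: cl_def')
 then show ?thesis by simp
qed

end

section \<open>The double Ringel--Hall algebra on the tensor algebra\<close>

locale qparam =
 fixes n :: nat and q :: complex
 assumes n2: "n \<ge> 2" and q0 [simp]: "q ~= 0" and qroot: "!!k::nat. k \<ge> 1 ==> q ^ k ~= 1"
begin

lemma q_powi_eq_1 [simp]: "q powi k = 1 \<longleftrightarrow> k = 0"
proof -
 have "q powi k ~= 1" if "k > 0" for k
  using qroot [of "nat k"] that by (simp add: power_int_def)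
 from this [of k] this [of "- k"] show ?thesis
  by (cases k "0 :: int" rule: linorder_cases) (auto simp: power_int_minus)
qed

lemma q_powi_inj [simp]: "q powi k = q powi l \<longleftrightarrow> k = l"
 using q_powi_eq_1 [of "k - l"] by (auto simp: power_int_diff)

lemma q_powi_add: "q powi k * q powi l = q powi (k + l)"
 by (simp add: power_int_add)

lemma q2_neq: "q\<^sup>2 ~= 1" "q * q ~= 1"
 using qroot [of 2] by (simp_all add: power2_eq_square)

lemma qdiff_neq: "q - inverse q ~= 0" "q ~= inverse q"
 using q2_neq by (auto simp: field_simps)

lemma qint_neq: "k ~= 0 ==> qint q k ~= 0"
 using qdiff_neq by (simp add: qint_def)

lemma rs_iff: "k : {1..n} ==> rs n x = int k \<longleftrightarrow> int n dvd x - int k"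
proof -
 assume k: "k : {1..n}"
 have "(x - 1) mod int n = int k - 1 \<longleftrightarrow> (x - 1) mod int n = (int k - 1) mod int n"
  using k by simp
 also have "... \<longleftrightarrow> int n dvd (x - 1) - (int k - 1)" by (rule mod_eq_dvd_iff)
 finally show ?thesis by (auto simp: rs_def)
qed

lemma rs_fin: "x : {1..int n} ==> rs n x = x"
 by (simp add: rs_def)

lemma rs_range: "rs n x : {1..int n}"
proof -
 have "0 < int n" using n2 by simp
 then have "(x - 1) mod int n < int n" "0 \<le> (x - 1) mod int n" by (rule pos_mod_bound, rule pos_mod_sign)
 then show ?thesis unfolding rs_def atLeastAtMost_iff by linarith
qed

lemma nx_mem [simp]: "i : {1..n} ==> nx n i : {1..n}"
 using n2 by (auto simp: nx_def)

lemma nx_neq: "i : {1..n} ==> nx n i ~= i"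
 using n2 by (auto simp: nx_def)

lemma nx_inj: "i : {1..n} ==> j : {1..n} ==> nx n i = nx n j \<longleftrightarrow> i = j"
 by (auto simp: nx_def split: if_splits)

lemma rs_nx: "i : {1..n} ==> rs n x = int (nx n i) \<longleftrightarrow> rs n (x - 1) = int i"
proof -
 assume i: "i : {1..n}"
 have "int n dvd x - int (nx n i) \<longleftrightarrow> int n dvd x - 1 - int i"
 proof (cases "i = n")
  case True
  have "x - 1 = (x - 1 - int n) + int n" by simp
  then show ?thesis using True by (metis dvd_add_triv_right_iff nx_def of_nat_1)
 next
  case False
  then show ?thesis by (simp add: nx_def algebra_simps)
 qed
 then show ?thesis using i rs_iff nx_mem by simp
qed

lemma rs_shift [simp]: "rs n (x + k * int n) = rs n x" "rs n (x - k * int n) = rs n x"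
 "rs n (x + int n) = rs n x" "rs n (x - int n) = rs n x"
proof -
 show *: "rs n (x + k * int n) = rs n x" for k
  unfolding rs_def by (metis add.commute add_diff_eq mod_mult_self2 mult.commute)
 show "rs n (x - k * int n) = rs n x" "rs n (x + int n) = rs n x" "rs n (x - int n) = rs n x"
  using *[of "-k"] *[of 1] *[of "-1"] by simp_all
qed

text \<open>The number of letters of a word in a given residue class, and the exponent of
 \<open>K\<^sub>i K\<^sub>i\<^sub>+\<^sub>1\<^sup>-\<^sup>1\<close> on that word.\<close>

definition cnt :: "nat => int list => int" where
 "cnt i w = int (length (filter (\<lambda>s. rs n s = int i) w))"

definition cnt2 :: "nat => int list => int" where
 "cnt2 i w = cnt i w - cnt (nx n i) w"

definition additive :: "(int list => int) => bool" where
 "additive \<chi> \<longleftrightarrow> (\<forall>u v. \<chi> (u @ v) = \<chi> u + \<chi> v)"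

lemma cnt_Nil [simp]: "cnt i [] = 0"
 and cnt_Cons: "cnt i (x # w) = of_bool (rs n x = int i) + cnt i w"
 and cnt_append: "cnt i (u @ v) = cnt i u + cnt i v"
 by (simp_all add: cnt_def)

lemma cnt2_Nil [simp]: "cnt2 i [] = 0"
 and cnt2_append: "cnt2 i (u @ v) = cnt2 i u + cnt2 i v"
 by (simp_all add: cnt2_def cnt_append)

lemma additive_cnt [simp]: "additive (cnt i)" "additive (\<lambda>w. - cnt i w)"
  "additive (cnt2 i)" "additive (\<lambda>w. - cnt2 i w)"
 by (simp_all add: additive_def cnt_append cnt2_append)

lemma additive_Nil: "additive \<chi> ==> \<chi> [] = 0"
 unfolding additive_def by (metis add_cancel_right_right append_Nil2)

lemma additive_Cons: "additive \<chi> ==> \<chi> (x # w) = \<chi> [x] + \<chi> w"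
 by (metis additive_def append_Cons append_Nil)

definition dg :: "(int list => int) => int fa => int fa" where
 "dg \<chi> = lin_ext (\<lambda>w. cst (q powi \<chi> w) * mon w)"

lemma linear_dg [simp]: "linear_map (dg \<chi>)"
 by (simp add: dg_def)

lemma dg_mon: "dg \<chi> (mon w) = cst (q powi \<chi> w) * mon w"
 by (simp add: dg_def)

lemmas dg_simps = linear_map_simps [OF linear_dg]

lemma dg_dg: "dg \<chi> (dg \<psi> v) = dg (\<lambda>w. \<chi> w + \<psi> w) v"
 by (induction v rule: fa_induct) (simp_all add: dg_mon dg_simps sc_simps power_int_add mult.commute)

lemma dg_commute: "dg \<chi> (dg \<psi> v) = dg \<psi> (dg \<chi> v)"
 by (simp add: dg_dg add.commute)

lemma dg_zero [simp]: "dg (\<lambda>w. 0) v = v"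
 by (induction v rule: fa_induct) (simp_all add: dg_mon dg_simps)

lemma dg_mult: "additive \<chi> ==> dg \<chi> (x * y) = dg \<chi> x * dg \<chi> y"
proof (induction x rule: fa_induct)
 case (mon u)
 then show ?case
  by (induction y rule: fa_induct)
   (simp_all add: dg_mon mon_mult dg_simps distrib_left sc_simps additive_def
     power_int_add mult.assoc mult.commute)
qed (simp_all add: dg_simps distrib_right mult.assoc)

lemma dg_letter: "additive \<chi> ==> dg \<chi> (mon [x] * v) = cst (q powi \<chi> [x]) * (mon [x] * dg \<chi> v)"
 by (simp add: dg_mult dg_mon mult.assoc)

lemma dg_1 [simp]: "additive \<chi> ==> dg \<chi> 1 = 1"
 using dg_mon [of \<chi> "[]"] by (simp add: additive_Nil mon_Nil)

text \<open>The generators as operators on the whole tensor algebra: the \<open>E\<^sub>i\<close> and \<open>F\<^sub>i\<close> are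
 skew derivations, the \<open>\<z>\<^sub>s\<close> are derivations.\<close>

primrec Ew :: "nat => int list => int fa" where
 "Ew i [] = 0"
| "Ew i (x # w) = (if int (nx n i) = rs n x then cst (q powi cnt2 i w) * mon ((x - 1) # w) else 0) + mon [x] * Ew i w"

primrec Fw :: "nat => int list => int fa" where
 "Fw i [] = 0"
| "Fw i (x # w) = (if int i = rs n x then mon ((x + 1) # w) else 0) + cst (q powi (- cnt2 i [x])) * mon [x] * Fw i w"

primrec Zw :: "int => int list => int fa" where
 "Zw d [] = 0"
| "Zw d (x # w) = mon ((x - d) # w) + mon [x] * Zw d w"

definition opE :: "nat => int fa => int fa" where "opE i = lin_ext (Ew i)"
definition opF :: "nat => int fa => int fa" where "opF i = lin_ext (Fw i)"
definition opZ :: "int => int fa => int fa" where "opZ d = lin_ext (Zw d)"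
abbreviation "opK i \<equiv> dg (cnt i)"
abbreviation "opKi i \<equiv> dg (\<lambda>w. - cnt i w)"
abbreviation "opKt i \<equiv> dg (cnt2 i)"
abbreviation "opKti i \<equiv> dg (\<lambda>w. - cnt2 i w)"

fun opD :: "dgen => int fa => int fa" where
 "opD (dEg i) = opE i"
| "opD (dFg i) = opF i"
| "opD (dKg i) = opK i"
| "opD (dKig i) = opKi i"
| "opD (dZg e t) = opZ (sg e * int t * int n)"

lemma linear_opE [simp]: "linear_map (opE i)"
 and linear_opF [simp]: "linear_map (opF i)"
 and linear_opZ [simp]: "linear_map (opZ d)"
 by (simp_all add: opE_def opF_def opZ_def)

lemma linear_opD [simp]: "linear_map (opD g)"
 by (cases g) simp_all

lemmas op_simps = linear_map_simps [OF linear_opE] linear_map_simps [OF linear_opF]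
 linear_map_simps [OF linear_opZ] dg_simps

lemma op_1 [simp]: "opE i 1 = 0" "opF i 1 = 0" "opZ d 1 = 0"
 by (simp_all add: opE_def opF_def opZ_def mon_Nil [symmetric])

lemma mon_Cons: "mon (x # w) = mon [x] * mon w"
 by (simp add: mon_mult)

lemma opE_letter: "opE i (mon [x] * v) =
  (if rs n x = int (nx n i) then mon [x - 1] * opKt i v else 0) + mon [x] * opE i v"
proof (induction v rule: fa_induct)
 case (mon w)
 show ?case by (simp add: mon_mult) (auto simp: opE_def dg_mon sc_simps mon_mult)
qed (auto simp: op_simps algebra_simps sc_simps)

lemma opF_letter: "opF i (mon [x] * v) =
  (if rs n x = int i then mon [x + 1] * v else 0) + cst (q powi (- cnt2 i [x])) * (mon [x] * opF i v)"
proof (induction v rule: fa_induct)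
 case (mon w)
 show ?case by (simp add: mon_mult) (auto simp: opF_def mult.assoc)
next
 case (cst c v)
 then show ?case by (simp add: op_simps sc_simps distrib_left sc_simps mult.commute)
qed (auto simp: op_simps algebra_simps)

lemma opZ_letter: "opZ d (mon [x] * v) = mon [x - d] * v + mon [x] * opZ d v"
proof (induction v rule: fa_induct)
 case (mon w)
 show ?case by (simp add: mon_mult) (auto simp: opZ_def)
qed (auto simp: op_simps algebra_simps sc_simps)

lemma opE_mult: "opE i (x * y) = opE i x * opKt i y + x * opE i y"
 by (induction x rule: tensor_induct)
  (simp_all add: opE_letter op_simps mult.assoc distrib_right distrib_left dg_mult)

lemma opF_mult: "opF i (x * y) = opF i x * y + opKti i x * opF i y"
 by (induction x rule: tensor_induct)
  (simp_all add: opF_letter op_simps mult.assoc distrib_right distrib_left dg_letter)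

lemma dg_E:
 assumes "additive \<chi>" and "!!x. rs n x = int (nx n i) ==> \<chi> [x - 1] = \<chi> [x] + d"
 shows "dg \<chi> (opE i v) = cst (q powi d) * opE i (dg \<chi> v)"
proof (induction v rule: tensor_induct)
 case (letter x v)
 then show ?case using assms(1)
  by (simp add: opE_letter dg_letter op_simps sc_simps distrib_left
    dg_commute [of "cnt2 i" \<chi>] assms(2) power_int_add mult_ac)
qed (simp_all add: op_simps assms distrib_left sc_simps mult.commute)

lemma dg_F:
 assumes "additive \<chi>" and "!!x. rs n x = int i ==> \<chi> [x + 1] = \<chi> [x] + d"
 shows "dg \<chi> (opF i v) = cst (q powi d) * opF i (dg \<chi> v)"
proof (induction v rule: tensor_induct)
 case (letter x v)
 then show ?case using assms(1)
  by (simp add: opF_letter dg_letter op_simps sc_simps distrib_left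
    assms(2) power_int_add mult_ac)
qed (simp_all add: op_simps assms distrib_left sc_simps mult.commute)

lemma dg_Z:
 assumes "additive \<chi>" and "!!x. \<chi> [x - d] = \<chi> [x]"
 shows "dg \<chi> (opZ d v) = opZ d (dg \<chi> v)"
proof (induction v rule: tensor_induct)
 case (letter x v)
 then show ?case using assms
  by (simp add: opZ_letter dg_letter op_simps sc_simps distrib_left)
qed (simp_all add: op_simps assms)

lemma cnt_single: "cnt i [x] = of_bool (rs n x = int i)"
 by (simp add: cnt_Cons)

lemma rs_up: "i : {1..n} ==> rs n x = int i ==> rs n (x + 1) = int (nx n i)"
 using rs_nx [of i "x + 1"] by simp

lemma cnt_E: "i : {1..n} ==> rs n x = int (nx n i) ==>
  cnt k [x - 1] = cnt k [x] + (of_bool (k = i) - of_bool (k = nx n i))"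
 using rs_nx [of i x] by (auto simp: cnt_single)

lemma cnt_F: "i : {1..n} ==> rs n x = int i ==>
  cnt k [x + 1] = cnt k [x] + (of_bool (k = nx n i) - of_bool (k = i))"
 by (auto simp: cnt_single rs_up)

lemma cnt2_E: "i : {1..n} ==> k : {1..n} ==> rs n x = int (nx n i) ==>
  cnt2 k [x - 1] = cnt2 k [x] + cartan n k i"
 using cnt_E [of i x k] cnt_E [of i x "nx n k"]
 by (simp add: cnt2_def cartan_def nx_inj eq_commute [of i "nx n k"])

lemma cnt2_F: "i : {1..n} ==> k : {1..n} ==> rs n x = int i ==>
  cnt2 k [x + 1] = cnt2 k [x] - cartan n k i"
 using cnt_F [of i x k] cnt_F [of i x "nx n k"]
 by (simp add: cnt2_def cartan_def nx_inj eq_commute [of i "nx n k"])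

lemma K_E: "i : {1..n} ==> opK k (opE i v) = cst (q powi (of_bool (k = i) - of_bool (k = nx n i))) * opE i (opK k v)"
 by (rule dg_E) (simp_all add: cnt_E)

lemma K_F: "i : {1..n} ==> opK k (opF i v) = cst (q powi (of_bool (k = nx n i) - of_bool (k = i))) * opF i (opK k v)"
 by (rule dg_F) (simp_all add: cnt_F)

lemma Ki_F: "i : {1..n} ==> opKi k (opF i v) = cst (q powi (of_bool (k = i) - of_bool (k = nx n i))) * opF i (opKi k v)"
 by (rule dg_F) (simp_all add: cnt_F)

lemma Kt_E: "i : {1..n} ==> k : {1..n} ==> opKt k (opE i v) = cst (q powi cartan n k i) * opE i (opKt k v)"
 by (rule dg_E) (simp_all add: cnt2_E)

lemma Kt_F: "i : {1..n} ==> k : {1..n} ==> opKt k (opF i v) = cst (q powi (- cartan n k i)) * opF i (opKt k v)"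
 by (rule dg_F) (simp_all add: cnt2_F)

lemma K_Ki [simp]: "opK i (opKi i v) = v" "opKi i (opK i v) = v"
 and Kt_Kti [simp]: "opKt i (opKti i v) = v" "opKti i (opKt i v) = v"
 by (simp_all add: dg_dg)

lemma cartan_sym: "cartan n i j = cartan n j i"
 by (auto simp: cartan_def)

lemma E_F:
 assumes i: "i : {1..n}" and j: "j : {1..n}"
 shows "opE i (opF j v) - opF j (opE i v) =
  (if i = j then cst (inverse (q - inverse q)) * (opKt i v - opKti i v) else 0)"
proof (induction v rule: tensor_induct)
 case (letter x v)
 have c: "cnt2 j [x - 1] = cnt2 j [x] + cartan n j i" if "rs n x = int (nx n i)"
  using cnt2_E i j that by blast
 have r: "rs n x = int (nx n i) \<longleftrightarrow> rs n (x - 1) = int i" "rs n (x + 1) = int (nx n i) \<longleftrightarrow> rs n x = int i"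
  using rs_nx [OF i, of x] rs_nx [OF i, of "x + 1"] by simp_all
 let ?q = "q powi (- cnt2 j [x])"
 have "opE i (opF j (mon [x] * v)) = of_bool (rs n x = int j \<and> rs n x = int i) * (mon [x] * opKt i v)
   + of_bool (rs n x = int j) * (mon [x + 1] * opE i v)
   + of_bool (rs n x = int (nx n i)) * (cst ?q * (mon [x - 1] * opKt i (opF j v)))
   + cst ?q * (mon [x] * opE i (opF j v))"
  using r by (auto simp: opF_letter opE_letter op_simps distrib_left)
 moreover have "opF j (opE i (mon [x] * v)) =
   of_bool (rs n x = int (nx n i) \<and> rs n (x - 1) = int j) * (mon [x] * opKt i v)
   + of_bool (rs n x = int j) * (mon [x + 1] * opE i v)
   + of_bool (rs n x = int (nx n i)) * (cst (q powi (- cnt2 j [x - 1])) * (mon [x - 1] * opF j (opKt i v)))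
   + cst ?q * (mon [x] * opF j (opE i v))"
  by (auto simp: opF_letter opE_letter op_simps distrib_left)
 moreover have "of_bool (rs n x = int (nx n i)) * (cst ?q * (mon [x - 1] * opKt i (opF j v))) =
   of_bool (rs n x = int (nx n i)) * (cst (q powi (- cnt2 j [x - 1])) * (mon [x - 1] * opF j (opKt i v)))"
  using c i j by (auto simp: Kt_F sc_simps q_powi_add cartan_sym [of i j] minus_diff_commute)
 ultimately have "opE i (opF j (mon [x] * v)) - opF j (opE i (mon [x] * v)) =
  (of_bool (rs n x = int j \<and> rs n x = int i) - of_bool (rs n x = int (nx n i) \<and> rs n (x - 1) = int j)) * (mon [x] * opKt i v)
  + cst ?q * (mon [x] * (opE i (opF j v) - opF j (opE i v)))"
  by (simp add: algebra_simps)
 also have "... = (if i = j then cst (inverse (q - inverse q)) * (opKt i (mon [x] * v) - opKti i (mon [x] * v)) else 0)"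
 proof (cases "i = j")
  case True
  have "(of_bool (rs n x = int j \<and> rs n x = int i) - of_bool (rs n x = int (nx n i) \<and> rs n (x - 1) = int j)) * (mon [x] * opKt i v)
    = cst (inverse (q - inverse q) * (q powi cnt2 i [x] - q powi (- cnt2 i [x]))) * (mon [x] * opKt i v)"
  proof -
   have "cnt2 i [x] = of_bool (rs n x = int i) - of_bool (rs n x = int (nx n i))"
    by (auto simp: cnt2_def cnt_single)
   moreover have "\<not> (rs n x = int i \<and> rs n x = int (nx n i))" using nx_neq [OF i] by auto
   moreover have "inverse (q - inverse q) * (q - inverse q) = 1" using qdiff_neq by simp
   moreover from this have "inverse (q - inverse q) * (inverse q - q) = -1"
    by (metis minus_diff_eq mult_minus_right)
   ultimately show ?thesis using True r
    by (auto simp: cst_minus power_int_minus)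
  qed
  moreover have "opE j (opF j v) - opF j (opE j v) = cst (inverse (q - inverse q)) * (opKt j v - opKti j v)"
   using letter True by simp
  ultimately show ?thesis using True
   by (intro poly_mapping_eqI)
    (simp add: dg_letter sc_simps lookup_add lookup_minus right_diff_distrib [of "mon _"],
     simp add: algebra_simps)
 next
  case False
  then show ?thesis using letter i j by (auto simp: rs_nx)
 qed
 finally show ?case .
next
 case (cst c v)
 have "opE i (opF j (cst c * v)) - opF j (opE i (cst c * v)) = cst c * (opE i (opF j v) - opF j (opE i v))"
  by (simp add: op_simps right_diff_distrib)
 then show ?case unfolding cst by (simp add: op_simps sc_simps mult.commute)
qed (auto simp: op_simps algebra_simps)

lemma Z_E: "(!!x. rs n (x - d) = rs n x) ==> opZ d (opE i v) = opE i (opZ d v)"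
proof (induction v rule: tensor_induct)
 case (letter x v)
 have "dg (cnt2 i) (opZ d v) = opZ d (dg (cnt2 i) v)"
  by (rule dg_Z) (simp_all add: cnt2_def cnt_single letter.prems)
 with letter show ?case
  by (simp add: opE_letter opZ_letter op_simps algebra_simps)
qed (simp_all add: op_simps)

lemma Z_F: "(!!x. rs n (x - d) = rs n x) ==> opZ d (opF i v) = opF i (opZ d v)"
proof (induction v rule: tensor_induct)
 case (letter x v)
 then show ?case
  by (simp add: opF_letter opZ_letter op_simps algebra_simps sc_simps cnt2_def cnt_single)
qed (simp_all add: op_simps)

lemma Z_Z: "opZ d (opZ d' v) = opZ d' (opZ d v)"
proof (induction v rule: tensor_induct)
 case (letter x v)
 then show ?case
  by (simp add: opZ_letter op_simps algebra_simps)
qed (simp_all add: op_simps)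

end

context qparam begin

text \<open>The quantum Serre expressions of degree \<open>N = 1, 2, 3\<close> as operators.\<close>

definition srr :: "nat => (int fa => int fa) => (int fa => int fa) => int fa => int fa" where
 "srr N x y v = (if N = 1 then y (x v) - x (y v)
   else if N = 2 then y (x (x v)) - cst (q + inverse q) * x (y (x v)) + x (x (y v))
   else y (x (x (x v))) - cst (q\<^sup>2 + 1 + inverse q ^ 2) * x (y (x (x v)))
    + cst (q\<^sup>2 + 1 + inverse q ^ 2) * x (x (y (x v))) - x (x (x (y v))))"

lemma qint_vals: "qint q 1 = 1" "qint q 2 = q + inverse q" "qint q 3 = q\<^sup>2 + 1 + inverse q ^ 2"
proof -
 show "qint q 1 = 1" using qdiff_neq by (simp add: qint_def power_int_minus)
 have "q powi 2 - q powi (- 2) = (q + inverse q) * (q - inverse q)"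
  by (simp add: power_int_minus field_simps power2_eq_square power4_eq_xxxx)
 then show "qint q 2 = q + inverse q" using qdiff_neq
  by (simp add: qint_def)
 have "q powi 3 - q powi (- 3) = (q\<^sup>2 + 1 + inverse q ^ 2) * (q - inverse q)"
  by (simp add: power_int_minus field_simps power2_eq_square power3_eq_cube)
 then show "qint q 3 = q\<^sup>2 + 1 + inverse q ^ 2" using qdiff_neq
  by (simp add: qint_def)
qed

lemma qbinom_vals: "qbinom q 1 0 = 1" "qbinom q 1 1 = 1" "qbinom q 2 0 = 1"
  "qbinom q 2 1 = q + inverse q" "qbinom q 2 2 = 1" "qbinom q 3 0 = 1"
  "qbinom q 3 1 = q\<^sup>2 + 1 + inverse q ^ 2" "qbinom q 3 2 = q\<^sup>2 + 1 + inverse q ^ 2" "qbinom q 3 3 = 1"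
proof -
 have f: "qfact q 0 = 1" "qfact q 1 = 1" "qfact q 2 = qint q 2" "qfact q 3 = qint q 2 * qint q 3"
  using qint_vals(1) by (simp_all add: qfact_def numeral_eq_Suc prod.atLeast_Suc_atMost_Suc_shift
    flip: of_nat_Suc) (simp_all add: prod.nat_ivl_Suc' mult.commute)
 have nz: "qint q 2 ~= 0" "qint q 3 ~= 0" by (simp_all add: qint_neq)
 show "qbinom q 1 0 = 1" "qbinom q 1 1 = 1" "qbinom q 2 0 = 1"
  "qbinom q 2 1 = q + inverse q" "qbinom q 2 2 = 1" "qbinom q 3 0 = 1"
  "qbinom q 3 1 = q\<^sup>2 + 1 + inverse q ^ 2" "qbinom q 3 2 = q\<^sup>2 + 1 + inverse q ^ 2" "qbinom q 3 3 = 1"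
  using f nz qint_vals by (simp_all add: qbinom_def)
qed

lemma qbinom_vals_Suc: "qbinom q (Suc 0) 0 = 1" "qbinom q (Suc 0) (Suc 0) = 1" "qbinom q (Suc (Suc 0)) 0 = 1"
  "qbinom q (Suc (Suc 0)) (Suc 0) = q + inverse q" "qbinom q (Suc (Suc 0)) (Suc (Suc 0)) = 1"
  "qbinom q (Suc (Suc (Suc 0))) 0 = 1"
  "qbinom q (Suc (Suc (Suc 0))) (Suc 0) = q\<^sup>2 + 1 + inverse q ^ 2"
  "qbinom q (Suc (Suc (Suc 0))) (Suc (Suc 0)) = q\<^sup>2 + 1 + inverse q ^ 2"
  "qbinom q (Suc (Suc (Suc 0))) (Suc (Suc (Suc 0))) = 1"
 using qbinom_vals by (simp_all add: numeral_eq_Suc)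

lemma left_eval_serre:
 assumes "cartan n i j : {0, -1, -2}"
 shows "left_eval opD (serre n q g i j) v =
  srr (nat (1 - cartan n i j)) (left_eval opD (g i)) (left_eval opD (g j)) v"
 using assms
 by (auto simp: serre_def Let_def srr_def left_eval_simps left_eval_mult left_eval_cst qbinom_vals_Suc
   sum.atLeast0_atMost_Suc numeral_eq_Suc left_eval_1 cst_minus)
  (intro poly_mapping_eqI, simp add: lookup_add lookup_minus algebra_simps)+

text \<open>The Serre expression is an iterated \<open>q\<close>-commutator, and the parameters may be taken in
 either order.  This makes it additive on q-commuting summands: with the parameters in increasing
 order the outer summand drops out of each bracket, with those in decreasing order the inner one.\<close>

definition brk :: "complex => (int fa => int fa) => (int fa => int fa) => int fa => int fa" where
 "brk b f g v = f (g v) - cst b * g (f v)"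

lemma linear_brk: "linear_map f ==> linear_map g ==> linear_map (brk b f g)"
 by (simp add: linear_map_def brk_def algebra_simps sc_simps mult.commute)

lemma srr_brk:
 assumes "linear_map x" "linear_map y"
 shows "srr 2 x y v = brk q x (brk (inverse q) x y) v" "srr 2 x y v = brk (inverse q) x (brk q x y) v"
  "srr 3 x y v = - brk (q\<^sup>2) x (brk 1 x (brk (inverse q ^ 2) x y)) v"
  "srr 3 x y v = - brk (inverse q ^ 2) x (brk 1 x (brk (q\<^sup>2) x y)) v"
 using assms
 by (intro poly_mapping_eqI,
   simp add: srr_def brk_def linear_map_simps sc_simps lookup_add lookup_minus field_simps power2_eq_square)+

lemma brk_drop:
 assumes "linear_map D" "!!v. A (D v) = cst b * D (A v)"
 shows "brk b (\<lambda>v. A v + B v) D = brk b B D" "brk b (\<lambda>v. B v + A v) D = brk b B D"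
 by (rule ext, simp add: brk_def assms linear_map_simps distrib_left)+

lemma brk_comm:
 assumes "linear_map A" "linear_map B" "linear_map D"
  and "!!v. A (B v) = cst s * B (A v)" "!!v. A (D v) = cst b * D (A v)" "s * b = t"
 shows "A (brk b' B D v) = cst t * brk b' B D (A v)"
 using assms(1-3) unfolding assms(6) [symmetric]
 by (simp add: brk_def assms(4,5) linear_map_simps sc_simps right_diff_distrib mult_ac)

lemma srr_add:
 assumes "linear_map x" "linear_map C" "linear_map D"
 shows "srr N x (\<lambda>v. C v + D v) v = srr N x C v + srr N x D v"
 using assms by (simp add: srr_def linear_map_simps algebra_simps)

text \<open>Expressing the Serre sum by iterated brackets reduces it to the two parts of an operator that act on the
  first letter and on the rest.\<close>

lemma srr_sum:
 assumes lin: "linear_map A" "linear_map B" "linear_map C" "linear_map D"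
  and AB: "!!v. A (B v) = cst (q\<^sup>2) * B (A v)"
  and AD: "!!v. A (D v) = cst (q powi c) * D (A v)"
  and CB: "!!v. C (B v) = cst (q powi c) * B (C v)"
  and c: "c : {0, -1, -2}"
 shows "srr (nat (1 - c)) (\<lambda>v. A v + B v) (\<lambda>v. C v + D v) v = srr (nat (1 - c)) A C v + srr (nat (1 - c)) B D v"
proof -
 let ?S = "\<lambda>v. A v + B v"
 have BA: "B (A v) = cst (inverse q ^ 2) * A (B v)" for v
  by (simp add: AB cst_mult_assoc power_mult_distrib [symmetric])
 have BC: "B (C v) = cst (q powi (- c)) * C (B v)" for v
  by (simp add: CB cst_mult_assoc power_int_minus)
 have S: "linear_map ?S" by (rule linear_map_plus) (use lin in auto)
 note ls = lin linear_brk
 from c consider "c = 0" | "c = -1" | "c = -2" by auto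
 then have "srr (nat (1 - c)) ?S C v = srr (nat (1 - c)) A C v \<and> srr (nat (1 - c)) ?S D v = srr (nat (1 - c)) B D v"
 proof cases
  case 1
  then show ?thesis using AD CB lin by (simp add: srr_def linear_map_simps)
 next
  case 2
  have "brk q ?S C = brk q A C" by (rule brk_drop) (use 2 BC lin in auto)
  moreover have "brk (inverse q) ?S (brk q A C) = brk (inverse q) A (brk q A C)"
   by (rule brk_drop) (use 2 in \<open>auto intro!: brk_comm [where A = B and B = A and D = "C", OF _ _ _ BA BC] ls simp: power2_eq_square\<close>)
  moreover have "brk (inverse q) ?S D = brk (inverse q) B D"
   by (rule brk_drop) (use 2 AD lin in \<open>auto simp: power_int_minus\<close>)
  moreover have "brk q ?S (brk (inverse q) B D) = brk q B (brk (inverse q) B D)"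
   by (rule brk_drop) (use 2 in \<open>auto intro!: brk_comm [where A = A and B = B and D = "D", OF _ _ _ AB AD] ls simp: power2_eq_square power_int_minus\<close>)
  ultimately show ?thesis using 2
   by (simp add: srr_brk(2) [OF S lin(3)] srr_brk(2) [OF lin(1,3)] srr_brk(1) [OF S lin(4)] srr_brk(1) [OF lin(2,4)])
 next
  case 3
  have q2: "q powi 2 = q\<^sup>2" "q powi - 2 = inverse q ^ 2"
   by (simp_all add: power_int_def power_inverse)
  have "brk (q\<^sup>2) ?S C = brk (q\<^sup>2) A C" by (rule brk_drop) (use 3 BC lin in auto)
  moreover have C1: "B (brk (q\<^sup>2) A C v) = cst 1 * brk (q\<^sup>2) A C (B v)" for v
   using 3 by (intro brk_comm [where A = B and B = A and D = "C", OF _ _ _ BA BC] ls) (auto simp: power_mult_distrib [symmetric])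
  then have "brk 1 ?S (brk (q\<^sup>2) A C) = brk 1 A (brk (q\<^sup>2) A C)"
   by (intro brk_drop ls)
  moreover have "brk (inverse q ^ 2) ?S (brk 1 A (brk (q\<^sup>2) A C)) = brk (inverse q ^ 2) A (brk 1 A (brk (q\<^sup>2) A C))"
   by (intro brk_drop brk_comm [where A = B and B = A and D = "brk (q\<^sup>2) A C", OF _ _ _ BA C1] ls) auto
  moreover have "brk (inverse q ^ 2) ?S D = brk (inverse q ^ 2) B D"
   by (rule brk_drop) (use 3 AD lin q2 in auto)
  moreover have D1: "A (brk (inverse q ^ 2) B D v) = cst 1 * brk (inverse q ^ 2) B D (A v)" for v
   using 3 q2 by (intro brk_comm [where A = A and B = B and D = "D", OF _ _ _ AB AD] ls) (auto simp: power_mult_distrib [symmetric])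
  then have "brk 1 ?S (brk (inverse q ^ 2) B D) = brk 1 B (brk (inverse q ^ 2) B D)"
   by (intro brk_drop ls)
  moreover have "brk (q\<^sup>2) ?S (brk 1 B (brk (inverse q ^ 2) B D)) = brk (q\<^sup>2) B (brk 1 B (brk (inverse q ^ 2) B D))"
   by (intro brk_drop brk_comm [where A = A and B = B and D = "brk (inverse q ^ 2) B D", OF _ _ _ AB D1] ls) auto
  ultimately show ?thesis using 3
   by (simp add: srr_brk(4) [OF S lin(3)] srr_brk(4) [OF lin(1,3)] srr_brk(3) [OF S lin(4)] srr_brk(3) [OF lin(2,4)])
 qed
 then show ?thesis using srr_add [OF S lin(3,4)] by simp
qed

definition onhead :: "(int => int fa => int fa) => int fa => int fa" where
 "onhead f = lin_ext (\<lambda>w. case w of [] => 0 | x # w' => f x (mon w'))"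

lemma linear_onhead [simp]: "linear_map (onhead f)"
 by (simp add: onhead_def)

lemma onhead_1 [simp]: "onhead f 1 = 0"
 by (simp add: onhead_def mon_Nil [symmetric])

lemma onhead_letter: "(!!x. linear_map (f x)) ==> onhead f (mon [x] * v) = f x v"
proof (induction v rule: fa_induct)
 case (mon w)
 then show ?case by (simp add: mon_mult onhead_def)
qed (simp_all add: linear_map_simps distrib_left sc_simps)

definition "EA i = onhead (\<lambda>x v. if rs n x = int (nx n i) then mon [x - 1] * opKt i v else 0)"
definition "EB i = onhead (\<lambda>x v. mon [x] * opE i v)"
definition "FA i = onhead (\<lambda>x v. if rs n x = int i then mon [x + 1] * v else 0)"
definition "FB i = onhead (\<lambda>x v. cst (q powi (- cnt2 i [x])) * (mon [x] * opF i v))"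

lemma onhead_vals:
 "EA i (mon [x] * v) = (if rs n x = int (nx n i) then mon [x - 1] * opKt i v else 0)"
 "EB i (mon [x] * v) = mon [x] * opE i v"
 "FA i (mon [x] * v) = (if rs n x = int i then mon [x + 1] * v else 0)"
 "FB i (mon [x] * v) = cst (q powi (- cnt2 i [x])) * (mon [x] * opF i v)"
 unfolding EA_def EB_def FA_def FB_def
 by (subst onhead_letter; simp add: linear_map_def op_simps distrib_left sc_simps mult.commute)+

lemma linear_AB [simp]: "linear_map (EA i)" "linear_map (EB i)" "linear_map (FA i)" "linear_map (FB i)"
 by (simp_all add: EA_def EB_def FA_def FB_def)

lemma AB_1 [simp]: "EA i 1 = 0" "EB i 1 = 0" "FA i 1 = 0" "FB i 1 = 0"
 by (simp_all add: EA_def EB_def FA_def FB_def)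

lemmas AB_simps = linear_AB [THEN linear_map_add] linear_AB [THEN linear_map_cst]
 linear_AB [THEN linear_map_0] linear_AB [THEN linear_map_sc] linear_AB [THEN linear_map_diff]

lemma E_split: "opE i v = EA i v + EB i v"
 by (induction v rule: tensor_induct) (simp_all add: op_simps AB_simps opE_letter onhead_vals algebra_simps)

lemma F_split: "opF i v = FB i v + FA i v"
 by (induction v rule: tensor_induct) (simp_all add: op_simps AB_simps opF_letter onhead_vals algebra_simps)

lemma EA_EB: "i : {1..n} ==> j : {1..n} ==> EA i (EB j v) = cst (q powi cartan n i j) * EB j (EA i v)"
proof (induction v rule: tensor_induct)
 case (letter x v)
 then show ?case by (simp add: onhead_vals Kt_E AB_simps sc_simps)
qed (simp_all add: AB_simps distrib_left sc_simps mult.commute)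

lemma FB_FA: "i : {1..n} ==> j : {1..n} ==> FB j (FA i v) = cst (q powi cartan n j i) * FA i (FB j v)"
proof (induction v rule: tensor_induct)
 case (letter x v)
 then show ?case by (auto simp: onhead_vals AB_simps sc_simps cnt2_F q_powi_add)
qed (simp_all add: AB_simps distrib_left sc_simps mult.commute)

lemma cartan_vals: "i : {1..n} ==> j : {1..n} ==> i ~= j ==> cartan n i j : {0, -1, -2}"
 and cartan_diag: "i : {1..n} ==> cartan n i i = 2"
 using nx_neq [of i] by (auto simp: cartan_def)

lemma EA_vanish:
 assumes i: "i : {1..n}" and j: "j : {1..n}" and ij: "i ~= j"
 shows "EA i (EA i v) = 0" "cartan n i j = 0 ==> EA i (EA j v) = 0"
  "cartan n i j = -1 ==> EA i (EA j (EA i v)) = 0"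
proof -
 have r: "rs n x = int (nx n k) \<longleftrightarrow> rs n (x - 1) = int k" if "k : {1..n}" for k x
  using rs_nx that by blast
 show "EA i (EA i v) = 0"
  by (induction v rule: tensor_induct) (use r [OF i] nx_neq [OF i] in \<open>auto simp: AB_simps onhead_vals\<close>)
 show "EA i (EA j v) = 0" if "cartan n i j = 0"
  by (induction v rule: tensor_induct)
   (use r [OF i] r [OF j] that ij in \<open>auto simp: AB_simps onhead_vals cartan_def of_bool_def split: if_splits\<close>)
 show "EA i (EA j (EA i v)) = 0" if "cartan n i j = -1"
 proof (induction v rule: tensor_induct)
  case (letter x v)
  have False if "rs n x = int (nx n i)" "rs n (x - 1) = int (nx n j)" "rs n (x - 1 - 1) = int (nx n i)"
   using r [OF i, of x] r [OF j, of "x - 1"] that \<open>cartan n i j = -1\<close> ij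
   by (auto simp: cartan_def of_bool_def split: if_splits)
  then show ?case by (auto simp: AB_simps onhead_vals op_simps dg_letter)
 qed (simp_all add: AB_simps)
qed

lemma FA_vanish:
 assumes i: "i : {1..n}" and j: "j : {1..n}" and ij: "i ~= j"
 shows "FA i (FA i v) = 0" "cartan n i j = 0 ==> FA i (FA j v) = 0"
  "cartan n i j = -1 ==> FA i (FA j (FA i v)) = 0"
proof -
 have r: "rs n x = int k ==> rs n (x + 1) = int (nx n k)" if "k : {1..n}" for k x
  using rs_up that by blast
 show "FA i (FA i v) = 0"
  by (induction v rule: tensor_induct) (use r [OF i] nx_neq [OF i] in \<open>auto simp: AB_simps onhead_vals\<close>)
 show "FA i (FA j v) = 0" if "cartan n i j = 0"
  by (induction v rule: tensor_induct)
   (use r [OF i] r [OF j] that ij in \<open>auto simp: AB_simps onhead_vals cartan_def of_bool_def split: if_splits\<close>)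
 show "FA i (FA j (FA i v)) = 0" if "cartan n i j = -1"
 proof (induction v rule: tensor_induct)
  case (letter x v)
  have False if "rs n x = int i" "rs n (x + 1) = int j" "rs n (x + 1 + 1) = int i"
   using r [OF i, of x] r [OF j, of "x + 1"] that \<open>cartan n i j = -1\<close> ij
   by (auto simp: cartan_def of_bool_def split: if_splits)
  then show ?case by (auto simp: AB_simps onhead_vals)
 qed (simp_all add: AB_simps)
qed

lemma srr_linear: "linear_map x ==> linear_map y ==> linear_map (srr N x y)"
 unfolding srr_def [abs_def] linear_map_def
 by (simp add: distrib_left sc_simps mult.commute)

text \<open>The part acting on the first letter and the part acting on the rest commute up to a power of
  \<open>q\<close>, so the mixed terms drop out of the brackets; the second part is handled by induction on the
  word.\<close>

lemma serre_E:
 assumes i: "i : {1..n}" and j: "j : {1..n}" and ij: "i ~= j"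
 shows "srr (nat (1 - cartan n i j)) (opE i) (opE j) v = 0"
proof -
 let ?N = "nat (1 - cartan n i j)"
 note c = cartan_vals [OF i j ij]
 have sum: "srr ?N (opE i) (opE j) v = srr ?N (EA i) (EA j) v + srr ?N (EB i) (EB j) v" for v
 proof -
  have "srr ?N (\<lambda>v. EA i v + EB i v) (\<lambda>v. EA j v + EB j v) v = srr ?N (EA i) (EA j) v + srr ?N (EB i) (EB j) v"
   by (rule srr_sum)
    (use c EA_EB [OF i j] EA_EB [OF i i] EA_EB [OF j i] cartan_diag [OF i] cartan_sym [of i j] in auto)
  moreover have "opE k = (\<lambda>v. EA k v + EB k v)" for k by (rule ext) (rule E_split)
  ultimately show ?thesis by simp
 qed
 have A: "srr ?N (EA i) (EA j) v = 0" for v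
  using c EA_vanish [OF i j ij] EA_vanish(2) [OF j i ij [symmetric]] cartan_sym [of i j]
  by (auto simp: srr_def AB_simps)
 show ?thesis
 proof (induction v rule: tensor_induct)
  case one
  then show ?case by (simp add: srr_def op_simps)
 next
  case (letter x v)
  have "srr ?N (EB i) (EB j) (mon [x] * v) = mon [x] * srr ?N (opE i) (opE j) v"
   using c by (auto simp: srr_def onhead_vals algebra_simps sc_simps)
  with letter A sum show ?case by simp
 qed (use linear_map_simps [OF srr_linear [OF linear_opE linear_opE]] in simp_all)
qed

lemma serre_F:
 assumes i: "i : {1..n}" and j: "j : {1..n}" and ij: "i ~= j"
 shows "srr (nat (1 - cartan n i j)) (opF i) (opF j) v = 0"
proof -
 let ?N = "nat (1 - cartan n i j)"
 note c = cartan_vals [OF i j ij]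
 have sum: "srr ?N (opF i) (opF j) v = srr ?N (FB i) (FB j) v + srr ?N (FA i) (FA j) v" for v
 proof -
  have "srr ?N (\<lambda>v. FB i v + FA i v) (\<lambda>v. FB j v + FA j v) v = srr ?N (FB i) (FB j) v + srr ?N (FA i) (FA j) v"
   by (rule srr_sum)
    (use c FB_FA [OF i j] FB_FA [OF i i] FB_FA [OF j i] cartan_diag [OF i] cartan_sym [of i j] in auto)
  moreover have "opF k = (\<lambda>v. FB k v + FA k v)" for k by (rule ext) (rule F_split)
  ultimately show ?thesis by simp
 qed
 have A: "srr ?N (FA i) (FA j) v = 0" for v
  using c FA_vanish [OF i j ij] FA_vanish(2) [OF j i ij [symmetric]] cartan_sym [of i j]
  by (auto simp: srr_def AB_simps)
 show ?thesis
 proof (induction v rule: tensor_induct)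
  case one
  then show ?case by (simp add: srr_def op_simps)
 next
  case (letter x v)
  have "\<exists>k. srr ?N (FB i) (FB j) (mon [x] * v) = cst k * (mon [x] * srr ?N (opF i) (opF j) v)"
  proof (rule exI)
   show "srr ?N (FB i) (FB j) (mon [x] * v) =
     cst ((q powi (- cnt2 i [x])) ^ ?N * q powi (- cnt2 j [x])) * (mon [x] * srr ?N (opF i) (opF j) v)"
    using c by (auto simp: srr_def onhead_vals AB_simps algebra_simps sc_simps numeral_eq_Suc mult_ac)
  qed
  with letter A sum show ?case by auto
 qed (use linear_map_simps [OF srr_linear [OF linear_opF linear_opF]] in simp_all)
qed

lemma K_K: "opK i (opK j v) = opK j (opK i v)"
 by (rule dg_commute)

lemma left_eval_gen_fun: "left_eval \<rho> (gen g) = \<rho> g"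
 by (rule ext) simp

lemma D_rel_op: "D_rel n q x y ==> left_eval opD x v = left_eval opD y v"
proof (induction rule: D_rel.induct)
 case (4 i j)
 then show ?case by (simp add: left_eval_mult left_eval_simps K_E sc_simps)
next
 case (5 i j)
 then show ?case by (simp add: left_eval_mult left_eval_simps K_F sc_simps)
next
 case (6 i j)
 have "opK a (opKi b v) = dg (\<lambda>w. cnt a w - cnt b w) v" for a b
  by (simp add: dg_dg)
 then show ?case using E_F [OF 6, of v] 6
  by (auto simp: left_eval_mult left_eval_cst left_eval_simps cnt2_def [abs_def])
next
 case (7 i j)
 then show ?case
  using cartan_vals [of i j] serre_E [of i j v]
  by (simp add: left_eval_serre left_eval_gen_fun left_eval_simps)
next
 case (8 i j)
 then show ?case
  using cartan_vals [of i j] serre_F [of i j v]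
  by (simp add: left_eval_serre left_eval_gen_fun left_eval_simps)
next
 case (9 s g e)
 then show ?case
  by (auto simp: left_eval_mult D_gens_def Z_E Z_F Z_Z intro!: dg_Z [symmetric] dg_Z simp: cnt_single)
qed (simp_all add: left_eval_mult K_K left_eval_1)

lemma Ew_supp: "Ew i w : supp {w'. length w' = length w}"
 and Fw_supp: "Fw i w : supp {w'. length w' = length w}"
 and Zw_supp: "Zw d w : supp {w'. length w' = length w}"
 by (induction w) (auto intro!: supp_add supp_cst supp_mult [where A = "{w. length w = 1}"] simp: mult.assoc)

lemma opD_Omega: "v : Omega r ==> opD g v : Omega r"
 unfolding Omega_supp using Ew_supp Fw_supp Zw_supp
 by (elim supp_map [OF _ linear_opD]; cases g) (auto simp: opE_def opF_def opZ_def dg_mon)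

lemma linear_tens_act [simp]: "linear_map (tens_act n q r g)"
 by (induction n q r g rule: tens_act.induct) simp_all

lemma tens_act_opD: "v : Omega (Suc r) ==> tens_act n q (Suc r) g v = opD g v"
proof (induction r arbitrary: g v)
 case 0
 show ?case
 proof (rule linear_map_eqI [OF linear_tens_act linear_opD 0 [unfolded Omega_supp]])
  fix w :: "int list" assume "w : {w. length w = Suc 0}"
  then obtain x where w: "w = [x]" by (cases w) auto
  show "tens_act n q (Suc 0) g (mon w) = opD g (mon w)"
   by (cases g) (auto simp: w opE_def opF_def opZ_def dg_mon cnt_single sc_simps mon_Nil)
 qed
next
 case (Suc r)
 show ?case
 proof (rule linear_map_eqI [OF linear_tens_act linear_opD Suc.prems [unfolded Omega_supp]])
  fix w :: "int list" assume "w : {w. length w = Suc (Suc r)}"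
  then obtain x w' where w: "w = x # w'" and l: "length w' = Suc r" by (cases w) auto
  have "mon w' : Omega (Suc r)" using l by (simp add: Omega_supp)
  then have IH: "tens_act n q (Suc r) h (mon w') = opD h (mon w')" for h
   by (rule Suc.IH)
  have IH2: "tens_act n q (Suc r) (dKg i) (opKi k (mon w')) = opK i (opKi k (mon w'))" for i k
   using opD_Omega [of "mon w'" "Suc r" "dKig k"] l by (subst Suc.IH) (simp_all add: Omega_supp)
  have e: "tens_act n q (Suc (Suc r)) g (mon w) =
    (\<Sum>(u, v)\<leftarrow>comult n g. foldr (\<lambda>h. lin_ext (\<lambda>js. omega_act n q h (hd js))) u (mon [x]) *
     foldr (\<lambda>h. tens_act n q (Suc r) h) v (mon w'))"
   by (simp add: w)
  show "tens_act n q (Suc (Suc r)) g (mon w) = opD g (mon w)"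
  proof (cases g)
   case (dEg i)
   then show ?thesis unfolding e
    by (simp add: IH IH2 w mon_Cons [of x w'] opE_letter dg_dg cnt2_def [abs_def] eq_commute [of "rs n x"] del: tens_act.simps)
  next
   case (dFg i)
   then show ?thesis unfolding e
    by (simp add: IH w mon_Cons [of x w'] opF_letter cnt2_def cnt_single linear_map_simps sc_simps
      power_int_add power_int_diff power_int_minus mult.commute inverse_eq_divide eq_commute [of "rs n x"] del: tens_act.simps)
  next
   case (dKg i)
   then show ?thesis unfolding e
    by (simp add: IH w mon_Cons [of x w'] dg_letter cnt_single sc_simps eq_commute [of "rs n x"] del: tens_act.simps)
  next
   case (dKig i)
   then show ?thesis unfolding e
    by (simp add: IH w mon_Cons [of x w'] dg_letter cnt_single sc_simps eq_commute [of "rs n x"] del: tens_act.simps)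
  next
   case (dZg e t)
   then show ?thesis unfolding \<open>tens_act n q (Suc (Suc r)) g (mon w) = _\<close>
    by (simp add: IH w mon_Cons [of x w'] opZ_letter del: tens_act.simps)
  qed
 qed
qed

end

section \<open>The affine Hecke algebra on tensor space\<close>

locale hecke = qparam +
 fixes r :: nat
begin

abbreviation "tT k \<equiv> hecke_act n q (hTg k)"
abbreviation "tX k \<equiv> hecke_act n q (hXg k)"
abbreviation "tXi k \<equiv> hecke_act n q (hXig k)"

lemma linear_hecke [simp]: "linear_map (hecke_act n q h)"
 by (cases h) simp_all

lemmas hecke_lin = linear_map_simps [OF linear_hecke]

text \<open>The combination of \<open>T_act\<close> with the two letters replaced through an arbitrary function.\<close>

definition Tput :: "int => int => (int => int => int fa) => int fa" where
 "Tput x y put = (let a = rs n x; b = rs n y; c = (x - a) div int n; d = (y - b) div int n in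
  (if a = b then cst (q\<^sup>2) * put (a + d * int n) (b + c * int n)
    else if a < b then cst q * put (b + d * int n) (a + c * int n)
    else cst q * put (b + d * int n) (a + c * int n) +
      cst (q\<^sup>2 - 1) * put (a + d * int n) (b + c * int n))
  + cst (q\<^sup>2 - 1) * (\<Sum>j<nat (c - d). put (a + (c - int j) * int n) (b + (d + int j) * int n))
  - cst (q\<^sup>2 - 1) * (\<Sum>j<nat (d - c). put (a + (d - int j) * int n) (b + (c + int j) * int n)))"

lemma T_act_Tput: "T_act n q k w = Tput (w ! (k - 1)) (w ! k) (\<lambda>u v. mon (w[k - 1 := u, k := v]))"
 by (simp add: T_act_def Tput_def Let_def)

lemma Tput_linear: "linear_map f ==> f (Tput x y p) = Tput x y (\<lambda>u v. f (p u v))"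
 by (simp add: Tput_def Let_def linear_map_simps)

lemma Tput_ab:
 assumes "a : {1..int n}" "b : {1..int n}"
 shows "Tput (a + c * int n) (b + d * int n) put =
  (if a = b then cst (q\<^sup>2) * put (a + d * int n) (b + c * int n)
    else if a < b then cst q * put (b + d * int n) (a + c * int n)
    else cst q * put (b + d * int n) (a + c * int n) +
      cst (q\<^sup>2 - 1) * put (a + d * int n) (b + c * int n))
  + cst (q\<^sup>2 - 1) * (\<Sum>j<nat (c - d). put (a + (c - int j) * int n) (b + (d + int j) * int n))
  - cst (q\<^sup>2 - 1) * (\<Sum>j<nat (d - c). put (a + (d - int j) * int n) (b + (c + int j) * int n))"
 using n2 assms by (simp add: Tput_def Let_def rs_fin)

lemma ab_exists: "\<exists>a c. a : {1..int n} \<and> x = a + c * int n"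
proof (intro exI conjI)
 show "rs n x : {1..int n}" by (rule rs_range)
 show "x = rs n x + ((x - 1) div int n) * int n" by (simp add: rs_def)
qed

lemma Tput_fin:
 assumes "x : {1..int n}" "y : {1..int n}"
 shows "Tput x y put = (if x = y then cst (q\<^sup>2) * put x y else if x < y then cst q * put y x
   else cst q * put y x + cst (q\<^sup>2 - 1) * put x y)"
 using Tput_ab [OF assms, of 0 0 put] by simp

text \<open>The two sums in the rule for \<open>T\<^sub>k\<close> telescope when a letter is shifted by
  \<open>n\<close>; these identities assemble the one term that survives.\<close>

lemma combine_diff:
 fixes f s s' t t' p k :: "int fa"
 shows "s - t = s' - t' - p ==> f + k * s - k * t = f + k * s' - k * t' - k * p"
  and "s - t = s' - t' + p ==> f + k * s - k * t = f + k * s' - k * t' + k * p"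
proof -
 have *: "f + k * s - k * t = f + k * (s - t)" for s t by (simp add: algebra_simps)
 show "f + k * s - k * t = f + k * s' - k * t' - k * p" if e: "s - t = s' - t' - p"
  unfolding *[of s t] e by (simp add: algebra_simps)
 show "f + k * s - k * t = f + k * s' - k * t' + k * p" if e: "s - t = s' - t' + p"
  unfolding *[of s t] e by (simp add: algebra_simps)
qed

text \<open>The Bernstein relations for \<open>T\<^sub>k\<close>, \<open>X\<^sub>k\<close> and the next variable, at the level of letters.\<close>

lemma Tput_shift1:
 "Tput (x - int n) y p = Tput x y (\<lambda>u v. p u (v - int n)) - cst (q\<^sup>2 - 1) * p x (y - int n)"
proof -
 obtain a c where a: "a : {1..int n}" and x: "x = a + c * int n" using ab_exists by blast
 obtain b d where b: "b : {1..int n}" and y: "y = b + d * int n" using ab_exists by blast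
 have x': "x - int n = a + (c - 1) * int n" by (simp add: x algebra_simps)
 have *: "u + z * int n - int n = u + (z - 1) * int n" for u z :: int by (simp add: algebra_simps)
 let ?P = "\<lambda>u v. p (a + u * int n) (b + v * int n)"
 have "(\<Sum>j<nat (c - 1 - d). ?P (c - 1 - int j) (d + int j)) - (\<Sum>j<nat (d - (c - 1)). ?P (d - int j) (c - 1 + int j))
   = (\<Sum>j<nat (c - d). ?P (c - int j) (d + int j - 1)) - (\<Sum>j<nat (d - c). ?P (d - int j) (c + int j - 1)) - ?P c (d - 1)"
 proof (cases "c > d")
  case True
  then have "nat (c - d) = Suc (nat (c - 1 - d))" "nat (d - (c - 1)) = 0" "nat (d - c) = 0" by simp_all
  moreover have "(\<Sum>j<nat (c - 1 - d). ?P (c - 1 - int j) (d + int j)) = (\<Sum>j<nat (c - 1 - d). ?P (c - int (Suc j)) (d + int (Suc j) - 1))"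
   by (intro sum.cong) (simp_all add: algebra_simps)
  ultimately show ?thesis by (simp only: sum.lessThan_Suc_shift) simp
 next
  case False
  then have "nat (d - (c - 1)) = Suc (nat (d - c))" "nat (c - d) = 0" "nat (c - 1 - d) = 0" "int (nat (d - c)) = d - c" by simp_all
  then show ?thesis using False by (simp add: algebra_simps)
 qed
 then show ?thesis
  unfolding x' unfolding x y Tput_ab [OF a b] * by (rule combine_diff(1))
qed

lemma Tput_shift2:
 "Tput x (y - int n) p = Tput x y (\<lambda>u v. p (u - int n) v) + cst (q\<^sup>2 - 1) * p x (y - int n)"
proof -
 obtain a c where a: "a : {1..int n}" and x: "x = a + c * int n" using ab_exists by blast
 obtain b d where b: "b : {1..int n}" and y: "y = b + d * int n" using ab_exists by blast
 have y': "y - int n = b + (d - 1) * int n" by (simp add: y algebra_simps)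
 have *: "u + z * int n - int n = u + (z - 1) * int n" for u z :: int by (simp add: algebra_simps)
 let ?P = "\<lambda>u v. p (a + u * int n) (b + v * int n)"
 have "(\<Sum>j<nat (c - (d - 1)). ?P (c - int j) (d - 1 + int j)) - (\<Sum>j<nat (d - 1 - c). ?P (d - 1 - int j) (c + int j))
   = (\<Sum>j<nat (c - d). ?P (c - int j - 1) (d + int j)) - (\<Sum>j<nat (d - c). ?P (d - int j - 1) (c + int j)) + ?P c (d - 1)"
 proof (cases "d > c")
  case True
  then have "nat (d - c) = Suc (nat (d - 1 - c))" "nat (c - (d - 1)) = 0" "nat (c - d) = 0" "int (nat (d - 1 - c)) = d - 1 - c" by simp_all
  then show ?thesis using True by (simp add: algebra_simps)
 next
  case False
  then have "nat (c - (d - 1)) = Suc (nat (c - d))" "nat (d - c) = 0" "nat (d - 1 - c) = 0" by simp_all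
  moreover have "(\<Sum>j<nat (c - d). ?P (c - int j - 1) (d + int j)) = (\<Sum>j<nat (c - d). ?P (c - int (Suc j)) (d - 1 + int (Suc j)))"
   by (intro sum.cong) (simp_all add: algebra_simps)
  ultimately show ?thesis by (simp only: sum.lessThan_Suc_shift) simp
 qed
 then show ?thesis
  unfolding y' unfolding x y Tput_ab [OF a b] * by (rule combine_diff(2))
qed

lemma T_mon: "tT k (mon w) = Tput (w ! (k - 1)) (w ! k) (\<lambda>u v. mon (w[k - 1 := u, k := v]))"
 by (simp add: T_act_Tput)

lemma X_mon: "tX k (mon w) = mon (w[k - 1 := w ! (k - 1) - int n])"
 and Xi_mon: "tXi k (mon w) = mon (w[k - 1 := w ! (k - 1) + int n])"
 by simp_all

lemma Tput_supp: "(!!u v. p u v : supp A) ==> Tput x y p : supp A"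
 unfolding Tput_def Let_def by (auto intro!: supp_add supp_diff supp_cst supp_sum)

lemma hecke_Omega: "v : Omega s ==> hecke_act n q h v : Omega s"
 unfolding Omega_supp by (elim supp_map [OF _ linear_hecke]; cases h) (auto simp: T_act_Tput intro!: Tput_supp)

lemma Omega_closed:
 "v : Omega s ==> w : Omega s ==> v + w : Omega s" "v : Omega s ==> w : Omega s ==> v - w : Omega s"
 "v : Omega s ==> cst c * v : Omega s" "0 : Omega s" "mon u : Omega s \<longleftrightarrow> length u = s"
 unfolding Omega_supp by auto

lemma Omega_induct [consumes 1, case_names mon zero add cst]:
 assumes "v : Omega s" and "!!w. length w = s ==> P (mon w)" and "P 0"
  and "!!x y. P x ==> P y ==> P (x + y)" and "!!c x. P x ==> P (cst c * x)"
 shows "P v"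
 using assms(1) unfolding Omega_supp by (induction rule: supp_induct) (use assms in auto)

lemma X_Xi: "v : Omega s ==> tX k (tXi k v) = v" "v : Omega s ==> tXi k (tX k v) = v"
proof -
 have *: "w[m := z, m := w[m := z] ! m + d] = w[m := z + d]" for w :: "int list" and m z d
  by (cases "m < length w") (simp_all add: list_update_beyond)
 have **: "w[m := w ! m] = w" for w :: "int list" and m
  by (rule list_update_id)
 show "v : Omega s ==> tX k (tXi k v) = v"
  by (induction rule: Omega_induct)
   (use * [where d = "- int n"] in \<open>simp_all add: hecke_lin del: hecke_act.simps add: X_mon Xi_mon\<close>)
 show "v : Omega s ==> tXi k (tX k v) = v"
  by (induction rule: Omega_induct)
   (use * [where d = "int n"] in \<open>simp_all add: hecke_lin del: hecke_act.simps add: X_mon Xi_mon\<close>)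
qed

declare hecke_act.simps [simp del]

lemma X_X: "j : {1..s} ==> k : {1..s} ==> v : Omega s ==> tX j (tX k v) = tX k (tX j v)"
proof (cases "j = k")
 case False
 assume jk: "j : {1..s}" "k : {1..s}" "v : Omega s"
 from jk(3) show ?thesis
 proof (induction rule: Omega_induct)
  case (mon w)
  have "j - 1 ~= k - 1" using False jk by auto
  then show ?case by (simp add: X_mon list_update_swap)
 qed (simp_all add: hecke_lin)
qed simp

lemma T_X_far: "k : {1..<s} ==> j : {1..s} ==> j ~= k ==> j ~= k + 1 ==> v : Omega s ==> tT k (tX j v) = tX j (tT k v)"
proof -
 assume k: "k : {1..<s}" and j: "j : {1..s}" and ne: "j ~= k" "j ~= k + 1" and v: "v : Omega s"
 from v show ?thesis
 proof (induction rule: Omega_induct)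
  case (mon w)
  have "j - 1 ~= k - 1" "j - 1 ~= k" using k j ne by auto
  then show ?case
   by (simp add: X_mon T_mon Tput_linear [OF linear_hecke] list_update_swap [of "j - Suc 0"])
 qed (simp_all add: hecke_lin)
qed

lemma Bernstein1: "k : {1..<s} ==> v : Omega s ==> tT k (tX k v) = tX (k + 1) (tT k v) - cst (q\<^sup>2 - 1) * tX (k + 1) v"
proof -
 assume k: "k : {1..<s}" and v: "v : Omega s"
 from v show ?thesis
 proof (induction rule: Omega_induct)
  case (mon w)
  have l: "k - 1 < length w" "k < length w" "k - 1 ~= k" using k mon by auto
  then have "tT k (tX k (mon w)) = Tput (w ! (k - 1) - int n) (w ! k) (\<lambda>u v. mon (w[k - 1 := u, k := v]))"
   by (simp add: X_mon T_mon)
  also have "... = Tput (w ! (k - 1)) (w ! k) (\<lambda>u v. mon (w[k - 1 := u, k := v - int n]))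
    - cst (q\<^sup>2 - 1) * mon (w[k - 1 := w ! (k - 1), k := w ! k - int n])"
   by (rule Tput_shift1)
  also have "... = tX (k + 1) (tT k (mon w)) - cst (q\<^sup>2 - 1) * tX (k + 1) (mon w)"
   using l by (simp add: X_mon T_mon Tput_linear [OF linear_hecke])
  finally show ?case .
 next
  case (add x y)
  then show ?case by (simp add: hecke_lin) (simp add: algebra_simps)
 qed (simp_all add: hecke_lin sc_simps mult.commute)
qed

lemma Bernstein2: "k : {1..<s} ==> v : Omega s ==> tT k (tX (k + 1) v) = tX k (tT k v) + cst (q\<^sup>2 - 1) * tX (k + 1) v"
proof -
 assume k: "k : {1..<s}" and v: "v : Omega s"
 from v show ?thesis
 proof (induction rule: Omega_induct)
  case (mon w)
  have l: "k - 1 < length w" "k < length w" "k - 1 ~= k" using k mon by auto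
  then have "tT k (tX (k + 1) (mon w)) = Tput (w ! (k - 1)) (w ! k - int n) (\<lambda>u v. mon (w[k - 1 := u, k := v]))"
   by (simp add: X_mon T_mon list_update_swap [of k])
  also have "... = Tput (w ! (k - 1)) (w ! k) (\<lambda>u v. mon (w[k - 1 := u - int n, k := v]))
    + cst (q\<^sup>2 - 1) * mon (w[k - 1 := w ! (k - 1), k := w ! k - int n])"
   by (rule Tput_shift2)
  also have "... = tX k (tT k (mon w)) + cst (q\<^sup>2 - 1) * tX (k + 1) (mon w)"
   using l by (simp add: X_mon T_mon Tput_linear [OF linear_hecke] list_update_swap [of k])
  finally show ?case .
 next
  case (add x y)
  then show ?case by (simp add: hecke_lin) (simp add: algebra_simps)
 qed (simp_all add: hecke_lin sc_simps mult.commute)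
qed

text \<open>Every word of length \<open>s\<close> arises from a word with letters in \<open>{1..n}\<close> by shifts.\<close>

definition fin_word :: "int list => bool" where
 "fin_word w \<longleftrightarrow> set w \<subseteq> {1..int n}"

lemma affine_word_induct:
 assumes "length w = s" and fin: "!!w. length w = s ==> fin_word w ==> P w"
  and step: "!!w j. length w = s ==> j < s ==> P w \<longleftrightarrow> P (w[j := w ! j - int n])"
 shows "P w"
proof -
 have "\<forall>w. length w = s \<longrightarrow> (\<forall>j<s. j \<ge> k \<longrightarrow> w ! j : {1..int n}) \<longrightarrow> P w" for k
 proof (induction k)
  case 0
  then show ?case using fin by (auto simp: fin_word_def in_set_conv_nth subset_iff)
 next
  case (Suc k)
  show ?case
  proof (intro allI impI)
   fix w :: "int list" assume l: "length w = s" and w: "\<forall>j<s. j \<ge> Suc k \<longrightarrow> w ! j : {1..int n}"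
   show "P w"
   proof (cases "k < s")
    case True
    obtain a c where a: "a : {1..int n}" and wk: "w ! k = a + c * int n" using ab_exists by blast
    have "P (w[k := a + c * int n])" for c
    proof (induction c rule: int_induct [where k = 0])
     case base
     show ?case using Suc l w a by (auto simp: nth_list_update not_less_eq_eq)
    next
     case (step1 i)
     have "P (w[k := a + (i + 1) * int n]) \<longleftrightarrow> P ((w[k := a + (i + 1) * int n])[k := w[k := a + (i + 1) * int n] ! k - int n])"
      by (rule step) (use l True in auto)
     also have "(w[k := a + (i + 1) * int n])[k := w[k := a + (i + 1) * int n] ! k - int n] = w[k := a + i * int n]"
      using l True by (simp add: algebra_simps)
     finally show ?case using step1 by simp
    next
     case (step2 i)
     have "P (w[k := a + i * int n]) \<longleftrightarrow> P ((w[k := a + i * int n])[k := w[k := a + i * int n] ! k - int n])"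
      by (rule step) (use l True in auto)
     also have "(w[k := a + i * int n])[k := w[k := a + i * int n] ! k - int n] = w[k := a + (i - 1) * int n]"
      using l True by (simp add: algebra_simps)
     finally show ?case using step2 by simp
    qed
    from this [of c] show ?thesis by (simp flip: wk)
   next
    case False
    then show ?thesis using fin l w Suc by auto
   qed
  qed
 qed
 from this [of s] show ?thesis using assms(1) by auto
qed

text \<open>An operator that intertwines the \<open>X\<^sub>j\<close> with injective operators is determined on the finite tensor space.\<close>

lemma affine_vanish:
 assumes lin: "linear_map D" and D: "!!v. v : Omega s ==> D v : U"
  and X: "!!j v. j : {1..s} ==> v : Omega s ==> D (tX j v) = Y j (D v)"
  and inj: "!!j u. j : {1..s} ==> u : U ==> Y j u = 0 \<longleftrightarrow> u = 0"
  and fin: "!!w. length w = s ==> fin_word w ==> D (mon w) = 0"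
  and v: "v : Omega s"
 shows "D v = 0"
 using v
proof (induction rule: Omega_induct)
 case (mon w)
 then show ?case
 proof (rule affine_word_induct [where P = "\<lambda>w. D (mon w) = 0"])
  fix w :: "int list" and j assume w: "length w = s" and j: "j < s"
  have "D (tX (Suc j) (mon w)) = Y (Suc j) (D (mon w))" by (rule X) (use w j in \<open>auto simp: Omega_supp\<close>)
  moreover have "D (mon w) : U" by (rule D) (simp add: Omega_supp w)
  ultimately show "D (mon w) = 0 \<longleftrightarrow> D (mon (w[j := w ! j - int n])) = 0"
   using inj [of "Suc j"] j by (simp add: X_mon)
 qed (rule fin)
qed (simp_all add: linear_map_simps [OF lin])

lemma X_eq_0: "j : {1..s} ==> v : Omega s ==> tX j v = 0 \<longleftrightarrow> v = 0"
 using X_Xi(2) [of v s j] by (auto simp: hecke_lin)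

lemma affine_vanish':
 assumes lin: "linear_map D" and D: "!!v. v : Omega s ==> D v : Omega s"
  and indep: "\<sigma> ` {1..s} \<subseteq> {1..s}" "!!j v. j : {1..s} ==> v : Omega s ==> D (tX j v) = tX (\<sigma> j) (D v)"
  and fin: "!!w. length w = s ==> fin_word w ==> D (mon w) = 0"
  and v: "v : Omega s"
 shows "D v = 0"
proof (rule affine_vanish [where D = D and U = "Omega s" and Y = "\<lambda>j. tX (\<sigma> j)" and s = s])
 fix j u assume "j : {1..s}" "u : Omega s"
 moreover from this(1) have "\<sigma> j : {1..s}" using indep(1) by blast
 ultimately show "tX (\<sigma> j) u = 0 \<longleftrightarrow> u = 0" using X_eq_0 by blast
qed (use assms in auto)

lemma T_fin:
 assumes "x : {1..int n}" "y : {1..int n}"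
 shows "tT (Suc (length u)) (mon (u @ x # y # v)) =
  (if x = y then cst (q\<^sup>2) * mon (u @ x # y # v) else if x < y then cst q * mon (u @ y # x # v)
   else cst q * mon (u @ y # x # v) + cst (q\<^sup>2 - 1) * mon (u @ x # y # v))"
 using Tput_fin [OF assms] by (simp add: T_mon nth_append list_update_append)

lemma T_fin2:
 assumes "y : {1..int n}" "z : {1..int n}"
 shows "tT (Suc (Suc (length u))) (mon (u @ x # y # z # v)) =
  (if y = z then cst (q\<^sup>2) * mon (u @ x # y # z # v) else if y < z then cst q * mon (u @ x # z # y # v)
   else cst q * mon (u @ x # z # y # v) + cst (q\<^sup>2 - 1) * mon (u @ x # y # z # v))"
 using T_fin [OF assms, of "u @ [x]" v] by simp

lemma word_split2: fixes w :: "int list" shows "k : {1..<s} ==> length w = s ==> \<exists>u x y v. w = u @ x # y # v \<and> k = Suc (length u)"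
proof -
 assume k: "k : {1..<s}" "length w = s"
 then have "w = take (k - 1) w @ w ! (k - 1) # w ! k # drop (k + 1) w"
  by (metis (no_types, lifting) Cons_nth_drop_Suc One_nat_def Suc_eq_plus1 Suc_pred append_take_drop_id
    atLeastLessThan_iff le_simps(3) less_imp_diff_less)
 moreover have "k = Suc (length (take (k - 1) w))" using k by auto
 ultimately show ?thesis by blast
qed

lemma word_split3: fixes w :: "int list" shows "k : {1..<s} ==> k + 1 : {1..<s} ==> length w = s ==>
  \<exists>u x y z v. w = u @ x # y # z # v \<and> k = Suc (length u)"
proof -
 assume k: "k : {1..<s}" "k + 1 : {1..<s}" and w: "length w = s"
 obtain u x y v where *: "w = u @ x # y # v" "k = Suc (length u)" using word_split2 [OF k(1) w] by blast
 then obtain z v' where "v = z # v'" using k w by (cases v) auto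
 then show ?thesis using * by blast
qed

lemma quadratic: "k : {1..<s} ==> v : Omega s ==> tT k (tT k v) = cst (q\<^sup>2 - 1) * tT k v + cst (q\<^sup>2) * v"
proof -
 assume k: "k : {1..<s}" and v: "v : Omega s"
 define D where "D v = tT k (tT k v) - cst (q\<^sup>2 - 1) * tT k v - cst (q\<^sup>2) * v" for v
 have lin: "linear_map D"
  by (simp add: linear_map_def D_def hecke_lin algebra_simps sc_simps mult.commute)
 have Om: "v : Omega s ==> D v : Omega s" for v
  unfolding D_def by (intro Omega_closed hecke_Omega)
 have X: "D (tX j v) = tX j (D v)" if j: "j : {1..s}" and v: "v : Omega s" for j v
 proof -
  have O: "tT k v : Omega s" "tX j v : Omega s" "tT k (tT k v) : Omega s" by (intro hecke_Omega v)+
  consider "j = k" | "j = k + 1" | "j ~= k" "j ~= k + 1" by blast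
  then show ?thesis
  proof cases
   case 1
   show ?thesis unfolding 1 D_def
    by (simp add: Bernstein1 [OF k] Bernstein2 [OF k] v O hecke_lin del: One_nat_def add_Suc_right,
      (intro poly_mapping_eqI, simp add: lookup_add lookup_minus algebra_simps)?)
  next
   case 2
   show ?thesis unfolding 2 D_def
    by (simp add: Bernstein1 [OF k] Bernstein2 [OF k] v O hecke_lin del: One_nat_def add_Suc_right,
      (intro poly_mapping_eqI, simp add: lookup_add lookup_minus algebra_simps)?)
  next
   case 3
   then show ?thesis unfolding D_def
    by (simp add: T_X_far [OF k j] v O hecke_lin)
  qed
 qed
 have fin: "D (mon w) = 0" if w: "length w = s" "fin_word w" for w
 proof -
  obtain u x y v where *: "w = u @ x # y # v" and k': "k = Suc (length u)" using word_split2 [OF k w(1)] by blast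
  have xy: "x : {1..int n}" "y : {1..int n}" using w(2) * by (auto simp: fin_word_def)
  note T = xy [THEN T_fin, OF xy(1)] xy [THEN T_fin, OF xy(2)]
  show ?thesis unfolding * D_def k'
   by (cases x y rule: linorder_cases)
    (simp_all add: T hecke_lin sc_simps power2_eq_square,
     (intro poly_mapping_eqI, simp add: lookup_add lookup_minus algebra_simps)+)
 qed
 have "D v = 0"
  by (rule affine_vanish' [where \<sigma> = id and s = s]) (use lin Om X fin v in auto)
 then show ?thesis by (simp add: D_def algebra_simps)
qed

lemma braid: "k : {1..<s} ==> k + 1 : {1..<s} ==> v : Omega s ==>
  tT k (tT (k + 1) (tT k v)) = tT (k + 1) (tT k (tT (k + 1) v))"
proof -
 assume k: "k : {1..<s}" and k1: "k + 1 : {1..<s}" and v: "v : Omega s"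
 define D where "D v = tT k (tT (k + 1) (tT k v)) - tT (k + 1) (tT k (tT (k + 1) v))" for v
 have lin: "linear_map D"
  by (simp add: linear_map_def D_def hecke_lin algebra_simps)
 have Om: "v : Omega s ==> D v : Omega s" for v
  unfolding D_def by (intro Omega_closed hecke_Omega)
 define \<sigma> where "\<sigma> j = (if j = k then k + 2 else if j = k + 2 then k else j)" for j
 have X: "D (tX j v) = tX (\<sigma> j) (D v)" if j: "j : {1..s}" and v: "v : Omega s" for j v
 proof -
  have O: "hecke_act n q g v : Omega s" "hecke_act n q g (hecke_act n q h v) : Omega s" for g h
   by (intro hecke_Omega v)+
  have k2: "k + 2 : {1..s}" "k : {1..s}" "k + 1 : {1..s}" using k k1 by auto
  have B: "tT (k + 1) (tX (k + 1) v) = tX (k + 2) (tT (k + 1) v) - cst (q\<^sup>2 - 1) * tX (k + 2) v"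
    "tT (k + 1) (tX (k + 2) v) = tX (k + 1) (tT (k + 1) v) + cst (q\<^sup>2 - 1) * tX (k + 2) v"
    "tT (k + 1) (tX k v) = tX k (tT (k + 1) v)" "tT k (tX (k + 2) v) = tX (k + 2) (tT k v)"
   if "v : Omega s" for v
   using Bernstein1 [OF k1 that] Bernstein2 [OF k1 that] T_X_far [OF k1 k2(2) _ _ that]
    T_X_far [OF k k2(1) _ _ that] by simp_all
  note BB = B Bernstein1 [OF k] Bernstein2 [OF k] quadratic [OF k] quadratic [OF k1]
  consider "j = k" | "j = k + 1" | "j = k + 2" | "j ~= k" "j ~= k + 1" "j ~= k + 2" by blast
  then show ?thesis
  proof cases
   case 1
   show ?thesis unfolding 1 D_def
    by (simp add: BB v O hecke_lin \<sigma>_def del: One_nat_def add_Suc_right add_2_eq_Suc')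
     (intro poly_mapping_eqI, simp add: lookup_add lookup_minus algebra_simps)
  next
   case 2
   show ?thesis unfolding 2 D_def
    by (simp add: BB v O hecke_lin \<sigma>_def del: One_nat_def add_Suc_right add_2_eq_Suc')
     (intro poly_mapping_eqI, simp add: lookup_add lookup_minus algebra_simps)
  next
   case 3
   show ?thesis unfolding 3 D_def
    by (simp add: BB v O hecke_lin \<sigma>_def del: One_nat_def add_Suc_right add_2_eq_Suc')
     (intro poly_mapping_eqI, simp add: lookup_add lookup_minus algebra_simps)
  next
   case 4
   then show ?thesis unfolding D_def
    by (simp add: T_X_far [OF k j] T_X_far [OF k1 j, simplified] v O hecke_lin \<sigma>_def)
  qed
 qed
 have fin: "D (mon w) = 0" if w: "length w = s" "fin_word w" for w
 proof -
  obtain u x y z v where *: "w = u @ x # y # z # v" and k': "k = Suc (length u)"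
   using word_split3 [OF k k1 w(1)] by blast
  have xyz: "x : {1..int n}" "y : {1..int n}" "z : {1..int n}" using w(2) * by (auto simp: fin_word_def)
  note T = xyz [THEN T_fin, OF xyz(1)] xyz [THEN T_fin, OF xyz(2)] xyz [THEN T_fin, OF xyz(3)]
   xyz [THEN T_fin2, OF xyz(1)] xyz [THEN T_fin2, OF xyz(2)] xyz [THEN T_fin2, OF xyz(3)]
  show ?thesis unfolding * D_def k'
   by (cases x y rule: linorder_cases; cases y z rule: linorder_cases; cases x z rule: linorder_cases)
    (simp_all add: T hecke_lin, (intro poly_mapping_eqI, simp add: lookup_add lookup_minus algebra_simps power2_eq_square)+)
 qed
 have "D v = 0"
  by (rule affine_vanish' [where \<sigma> = \<sigma> and s = s])
   (use lin Om X fin v k k1 in \<open>auto simp: \<sigma>_def\<close>)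
 then show ?thesis by (simp add: D_def)
qed

definition swp :: "nat => int list => int list" where
 "swp k w = w[k - 1 := w ! k, k := w ! (k - 1)]"

lemma length_swp [simp]: "length (swp k w) = length w"
 by (simp add: swp_def)

lemma fin_word_nth: "fin_word w ==> i < length w ==> w ! i : {1..int n}"
 unfolding fin_word_def by (rule subsetD) auto

lemma T_mon_fin:
 assumes "fin_word w" "k : {1..<length w}"
 shows "tT k (mon w) = (if w ! (k - 1) = w ! k then cst (q\<^sup>2) * mon w
  else if w ! (k - 1) < w ! k then cst q * mon (swp k w)
  else cst q * mon (swp k w) + cst (q\<^sup>2 - 1) * mon w)"
proof -
 have k: "k - 1 < length w" "k < length w" using assms by auto
 show ?thesis
  unfolding T_mon Tput_fin [OF fin_word_nth [OF assms(1) k(1)] fin_word_nth [OF assms(1) k(2)]]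
  unfolding swp_def list_update_id by simp
qed

lemma fin_word_swp: "fin_word w ==> k : {1..<length w} ==> fin_word (swp k w)"
 using set_swap [of "k - 1" w k] by (auto simp: fin_word_def swp_def)

lemma swp_nth: "k : {1..<length w} ==> i < length w ==>
  swp k w ! i = (if i = k then w ! (k - 1) else if i = k - 1 then w ! k else w ! i)"
 by (auto simp: swp_def nth_list_update)

lemma T_T_far: "k : {1..<s} ==> j : {1..<s} ==> \<bar>int k - int j\<bar> > 1 ==> v : Omega s ==>
  tT k (tT j v) = tT j (tT k v)"
proof -
 assume k: "k : {1..<s}" and j: "j : {1..<s}" and kj: "\<bar>int k - int j\<bar> > 1" and v: "v : Omega s"
 define D where "D v = tT k (tT j v) - tT j (tT k v)" for v
 have lin: "linear_map D"
  by (simp add: linear_map_def D_def hecke_lin algebra_simps)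
 have Om: "v : Omega s ==> D v : Omega s" for v
  unfolding D_def by (intro Omega_closed hecke_Omega)
 define \<sigma> where "\<sigma> i = (if i = k then k + 1 else if i = k + 1 then k else if i = j then j + 1 else if i = j + 1 then j else i)" for i
 have ne: "k ~= j" "k ~= j + 1" "k + 1 ~= j" "k + 1 ~= j + 1" using kj by auto
 have X: "D (tX i v) = tX (\<sigma> i) (D v)" if i: "i : {1..s}" and v: "v : Omega s" for i v
 proof -
  have O: "hecke_act n q g v : Omega s" "hecke_act n q g (hecke_act n q h v) : Omega s" for g h
   by (intro hecke_Omega v)+
  have m: "k : {1..s}" "k + 1 : {1..s}" "j : {1..s}" "j + 1 : {1..s}" using k j by auto
  note far = T_X_far [OF k m(3)] T_X_far [OF k m(4)] T_X_far [OF j m(1)] T_X_far [OF j m(2)]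
  note B = Bernstein1 [OF k] Bernstein2 [OF k] Bernstein1 [OF j] Bernstein2 [OF j]
  consider "i = k" | "i = k + 1" | "i = j" | "i = j + 1" | "i ~= k" "i ~= k + 1" "i ~= j" "i ~= j + 1" by blast
  then show ?thesis
   by (cases; use ne in \<open>simp add: D_def far B T_X_far [OF k i] T_X_far [OF j i] v O hecke_lin \<sigma>_def del: One_nat_def add_Suc_right\<close>; (simp add: algebra_simps)?)
 qed
 have fin: "D (mon w) = 0" if w: "length w = s" "fin_word w" for w
 proof -
  have l: "k : {1..<length w}" "j : {1..<length w}" using k j w by auto
  have "swp k (swp j w) = swp j (swp k w)"
  proof (rule nth_equalityI)
   fix i assume "i < length (swp k (swp j w))"
   moreover have "k - 1 ~= j" "k ~= j - 1" "k - 1 ~= j - 1" using ne l by auto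
   ultimately show "swp k (swp j w) ! i = swp j (swp k w) ! i"
    using l ne by (simp add: swp_nth)
  qed simp
  moreover have "swp k w ! j = w ! j" "swp k w ! (j - 1) = w ! (j - 1)"
    "swp j w ! k = w ! k" "swp j w ! (k - 1) = w ! (k - 1)"
   using l ne by (auto simp: swp_nth)
  ultimately show ?thesis unfolding D_def
   using l fin_word_swp [OF w(2)] w(2)
   by (simp add: T_mon_fin hecke_lin distrib_left sc_simps mult.commute)
 qed
 have "D v = 0"
  by (rule affine_vanish' [where \<sigma> = \<sigma> and s = s])
   (use lin Om X fin v k j in \<open>auto simp: \<sigma>_def\<close>)
 then show ?thesis by (simp add: D_def)
qed

lemma H_rel_op: "H_rel s q x y ==> v : Omega s ==> right_eval (hecke_act n q) v x = right_eval (hecke_act n q) v y"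
proof (induction rule: H_rel.induct)
 case (1 i)
 then show ?case
  by (simp add: right_eval_mult right_eval_simps right_eval_cst right_eval_1 quadratic [of i s] hecke_lin)
   (intro poly_mapping_eqI, simp add: lookup_add lookup_minus algebra_simps)
next
 case (2 i)
 then show ?case using braid [of i s v] by (simp add: right_eval_mult)
next
 case (3 i j)
 then show ?case using T_T_far [of j s i v] by (simp add: right_eval_mult)
next
 case (4 i j)
 then show ?case using X_X [of j s i v] by (simp add: right_eval_mult)
next
 case (7 i)
 then show ?case
  by (simp add: right_eval_mult right_eval_simps right_eval_cst Bernstein1 [of i s] quadratic [of i s] hecke_Omega hecke_lin del: One_nat_def)
next
 case (8 i j)
 then show ?case using T_X_far [of i s j v] by (simp add: right_eval_mult)
qed (simp_all add: right_eval_mult right_eval_1 X_Xi)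

end

section \<open>The evaluation map\<close>

context Group.monoid begin

primrec jm :: "(nat => 'a) => nat => 'a" where
 "jm t 0 = \<one>"
| "jm t (Suc k) = (if k = 0 then \<one> else t k \<otimes> jm t k \<otimes> t k)"

context
 fixes t :: "nat => 'a" and r :: nat
 assumes closed: "!!i. i : {1..<r} ==> t i : carrier G"
  and far: "!!i j. i : {1..<r} ==> j : {1..<r} ==> i + 1 < j ==> t i \<otimes> t j = t j \<otimes> t i"
  and braid: "!!i. i : {1..<r} ==> i + 1 : {1..<r} ==> t i \<otimes> t (i + 1) \<otimes> t i = t (i + 1) \<otimes> t i \<otimes> t (i + 1)"
begin

lemma jm_closed: "k \<le> r ==> jm t k : carrier G"
 by (induction k) (auto simp: closed)

text \<open>Commutation survives conjugation; this carries the commutation relations from one Jucys--Murphy element to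
  the next.\<close>

lemma conj_commute:
 assumes "x : carrier G" "y : carrier G" "s : carrier G" "x \<otimes> s = s \<otimes> x" "y \<otimes> s = s \<otimes> y"
 shows "(x \<otimes> y \<otimes> x) \<otimes> s = s \<otimes> (x \<otimes> y \<otimes> x)"
 using assms by (metis m_assoc m_closed)

lemma jm_above: "k < i ==> i : {1..<r} ==> jm t k \<otimes> t i = t i \<otimes> jm t k"
proof (induction k)
 case (Suc k)
 show ?case
 proof (cases "k = 0")
  case False
  have "t k \<otimes> t i = t i \<otimes> t k" by (rule far) (use Suc False in auto)
  moreover have "jm t k \<otimes> t i = t i \<otimes> jm t k" using Suc by simp
  ultimately show ?thesis using conj_commute [of "t k" "jm t k" "t i"] closed jm_closed Suc False by simp
 qed (use Suc closed in simp)
qed (use closed in simp)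

lemma jm_below: "i + 1 < k ==> 1 \<le> i ==> k \<le> r ==> jm t k \<otimes> t i = t i \<otimes> jm t k"
proof (induction k)
 case (Suc k)
 have c: "t k : carrier G" "t i : carrier G" "jm t k : carrier G" "jm t i : carrier G"
  using Suc closed jm_closed by auto
 show ?case
 proof (cases "i + 1 = k")
  case True
  have b: "t i \<otimes> t k \<otimes> t i = t k \<otimes> t i \<otimes> t k" using braid [of i] True Suc by auto
  have a: "jm t i \<otimes> t k = t k \<otimes> jm t i" using jm_above [of i k] True Suc by auto
  have "jm t (Suc k) = t k \<otimes> (t i \<otimes> jm t i \<otimes> t i) \<otimes> t k"
   using True Suc by (auto simp flip: True)
  then have "jm t (Suc k) \<otimes> t i = t k \<otimes> t i \<otimes> jm t i \<otimes> (t i \<otimes> t k \<otimes> t i)"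
   using c by (simp add: m_assoc)
  also have "... = t k \<otimes> t i \<otimes> (jm t i \<otimes> t k) \<otimes> t i \<otimes> t k" unfolding b using c by (simp add: m_assoc)
  also have "... = (t k \<otimes> t i \<otimes> t k) \<otimes> jm t i \<otimes> t i \<otimes> t k" unfolding a using c by (simp add: m_assoc)
  also have "... = t i \<otimes> (t k \<otimes> (t i \<otimes> jm t i \<otimes> t i) \<otimes> t k)" unfolding b [symmetric] using c by (simp add: m_assoc)
  also have "t k \<otimes> (t i \<otimes> jm t i \<otimes> t i) \<otimes> t k = jm t (Suc k)" using True Suc by (auto simp flip: True)
  finally show ?thesis .
 next
  case False
  have "t k \<otimes> t i = t i \<otimes> t k" by (rule far [symmetric]) (use Suc False in auto)
  moreover have "jm t k \<otimes> t i = t i \<otimes> jm t k" using Suc False by simp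
  ultimately show ?thesis using conj_commute [of "t k" "jm t k" "t i"] c Suc by simp
 qed
qed simp

lemma jm_commute_less: "j < k ==> k \<le> r ==> jm t k \<otimes> jm t j = jm t j \<otimes> jm t k"
proof (induction j)
 case (Suc j)
 show ?case
 proof (cases "j = 0")
  case False
  have c: "t j : carrier G" "jm t k : carrier G" "jm t j : carrier G"
   using Suc closed jm_closed False by auto
  have "jm t k \<otimes> t j = t j \<otimes> jm t k" by (rule jm_below) (use Suc False in auto)
  then show ?thesis using conj_commute [of "t j" "jm t j" "jm t k"] Suc False c by simp
 qed (use jm_closed Suc in simp)
qed (use jm_closed in simp)

lemma jm_commute: "j \<le> r ==> k \<le> r ==> jm t k \<otimes> jm t j = jm t j \<otimes> jm t k"
 using jm_commute_less [of j k] jm_commute_less [of k j] by (cases j k rule: linorder_cases) auto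

end

lemma jm_inverse:
 assumes "!!i. i : {1..<r} ==> t i : carrier G" "!!i. i : {1..<r} ==> t' i : carrier G"
  "!!i. i : {1..<r} ==> t i \<otimes> t' i = \<one>" and k: "k \<le> r"
 shows "jm t k : carrier G \<and> jm t' k : carrier G \<and> jm t k \<otimes> jm t' k = \<one>"
 using k
proof (induction k)
 case (Suc k)
 show ?case
 proof (cases "k = 0")
  case False
  then have k: "k : {1..<r}" using Suc by auto
  have c: "t k : carrier G" "t' k : carrier G" "jm t k : carrier G" "jm t' k : carrier G"
   and i: "t k \<otimes> t' k = \<one>" "jm t k \<otimes> jm t' k = \<one>"
   using Suc k assms by auto
  have "(t k \<otimes> jm t k \<otimes> t k) \<otimes> (t' k \<otimes> jm t' k \<otimes> t' k) = t k \<otimes> (jm t k \<otimes> ((t k \<otimes> t' k) \<otimes> jm t' k)) \<otimes> t' k"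
   using c by (simp add: m_assoc)
  also have "... = \<one>" using c i by simp
  finally show ?thesis using c False by simp
 qed simp
qed simp

end

locale evalm = hecke +
 fixes a :: complex
 assumes r1: "r \<ge> 1" and a0 [simp]: "a ~= 0"
begin

lemma H_rel_closed: "H_rel r q x y ==> x : gens_alg (H_gens r) \<and> y : gens_alg (H_gens r)"
 by (induction rule: H_rel.induct) (auto simp: H_gens_def)

sublocale H: presentation "H_gens r" "H_rel r q"
 by standard (rule H_rel_closed)

lemma H_cls_eq: "H_cls r q = H.cl"
 by (rule ext) (simp add: H_cls_def)

abbreviation "hev v x \<equiv> right_eval (hecke_act n q) v x"

lemma hev_Omega: "v : Omega r ==> hev v x : Omega r"
proof (induction x rule: fa_induct)
 case (mon w)
 then show ?case unfolding right_eval_mon by (induction w arbitrary: v) (auto simp: hecke_Omega)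
qed (auto simp: right_eval_simps Omega_closed)

lemma hev_ideal:
 assumes "i : H.I" "v : Omega r"
 shows "hev v i = 0"
proof -
 have "H.I \<subseteq> {x : gens_alg (H_gens r). \<forall>v\<in>Omega r. hev v x = 0}"
 proof (rule H.I_least)
  fix x y assume "H_rel r q x y"
  then show "x - y : {x : gens_alg (H_gens r). \<forall>v\<in>Omega r. hev v x = 0}"
   using H_rel_op H_rel_closed by (auto simp: right_eval_simps)
 qed (auto simp: right_eval_simps right_eval_mult hev_Omega linear_map_0 [OF linear_right_eval_arg])
 then show ?thesis using assms by blast
qed

lemma hev_cong: "H.cl x = H.cl y ==> v : Omega r ==> hev v x = hev v y"
 using hev_ideal [of "x - y" v] by (simp add: H.cl_eq_iff right_eval_simps)

lemma hecke_right_cl: "v : Omega r ==> hecke_right n q v (H.cl x) = hev v x"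
 unfolding hecke_right_def by (rule H.the_elem_cl) (simp add: right_eval_simps hev_ideal)

abbreviation "tw \<equiv> ev_gen q a"

lemma hT_inv_closed: "i : {1..<r} ==> hT_inv q i : gens_alg (H_gens r)"
 by (auto simp: hT_inv_def H_gens_def)

abbreviation "JP j \<equiv> prod_list (map (\<lambda>i. hT i) (rev [1..<j] @ [1..<j]))"
abbreviation "JN j \<equiv> prod_list (map (hT_inv q) (rev [1..<j] @ [1..<j]))"

lemma JP_Suc: "j \<ge> 1 ==> JP (Suc j) = hT j * JP j * hT j"
 and JN_Suc: "j \<ge> 1 ==> JN (Suc j) = hT_inv q j * JN j * hT_inv q j"
 by (simp_all add: mult.assoc)

abbreviation "ct i \<equiv> H.cl (hT i)"
abbreviation "cti i \<equiv> H.cl (hT_inv q i)"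

lemma hT_closed: "i : {1..<r} ==> hT i : gens_alg (H_gens r)"
 by (auto simp: H_gens_def)

lemma JP_closed: "j \<le> r ==> JP j : gens_alg (H_gens r)"
 and JN_closed: "j \<le> r ==> JN j : gens_alg (H_gens r)"
 by (auto intro!: gens_alg_closed gens_alg_prod_list hT_closed hT_inv_closed simp del: gens_alg_mon)

lemma ev_gen_closed: "g : H_gens r ==> tw g : gens_alg (H_gens r)"
proof -
 assume "g : H_gens r"
 then consider i where "g = hTg i" "i : {1..<r}" | j where "g = hXg j" "j \<le> r" | j where "g = hXig j" "j \<le> r"
  by (auto simp: H_gens_def)
 then show ?thesis
 proof cases
  case 1
  then show ?thesis using hT_closed by (simp del: gens_alg_mon)
 next
  case 2
  then show ?thesis using JP_closed [of j] by (simp del: map_append)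
 next
  case 3
  then show ?thesis using JN_closed [of j] by (simp del: map_append)
 qed
qed

lemma subst_closed: "x : gens_alg (H_gens r) ==> subst_eval tw x : gens_alg (H_gens r)"
 by (induction rule: gens_alg_induct) (auto simp: subst_eval_simps ev_gen_closed)

lemma JP_jm: "1 \<le> j ==> j \<le> r ==> H.cl (JP j) = H.QR.jm ct j"
proof (induction j)
 case (Suc j)
 show ?case
 proof (cases "j = 0")
  case False
  have "H.cl (JP (Suc j)) = ct j \<otimes>\<^bsub>H.Q\<^esub> H.cl (JP j) \<otimes>\<^bsub>H.Q\<^esub> ct j"
   using False Suc.prems hT_closed [of j] JP_closed [of j] by (subst JP_Suc) (simp_all add: H.cl_mult del: gens_alg_mon map_append)
  then show ?thesis using Suc False by simp
 qed (simp add: H.cl_one)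
qed simp

lemma JN_jm: "1 \<le> j ==> j \<le> r ==> H.cl (JN j) = H.QR.jm cti j"
proof (induction j)
 case (Suc j)
 show ?case
 proof (cases "j = 0")
  case False
  have "H.cl (JN (Suc j)) = cti j \<otimes>\<^bsub>H.Q\<^esub> H.cl (JN j) \<otimes>\<^bsub>H.Q\<^esub> cti j"
   using False Suc.prems hT_inv_closed [of j] JN_closed [of j] by (subst JN_Suc) (simp_all add: H.cl_mult del: gens_alg_mon map_append)
  then show ?thesis using Suc False by simp
 qed (simp add: H.cl_one)
qed simp

lemma ct_far: "i : {1..<r} ==> j : {1..<r} ==> i + 1 < j ==> ct i \<otimes>\<^bsub>H.Q\<^esub> ct j = ct j \<otimes>\<^bsub>H.Q\<^esub> ct i"
 using H.cl_rel [OF H_rel.intros(3)] hT_closed by (simp add: H.cl_mult del: gens_alg_mon)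

lemma ct_braid: "i : {1..<r} ==> i + 1 : {1..<r} ==>
  ct i \<otimes>\<^bsub>H.Q\<^esub> ct (i + 1) \<otimes>\<^bsub>H.Q\<^esub> ct i = ct (i + 1) \<otimes>\<^bsub>H.Q\<^esub> ct i \<otimes>\<^bsub>H.Q\<^esub> ct (i + 1)"
 using H.cl_rel [OF H_rel.intros(2), of i] hT_closed by (simp add: H.cl_mult del: gens_alg_mon)

lemma ct_inv:
 assumes "i : {1..<r}"
 shows "H.cl (hT i * hT_inv q i) = H.cl 1" "H.cl (hT_inv q i * hT i) = H.cl 1"
proof -
 have e: "hT i * hT_inv q i = hT_inv q i * hT i"
  by (simp add: hT_inv_def algebra_simps sc_simps)
 have "cst (inverse (q\<^sup>2)) * ((hT i + 1) * (hT i - cst (q\<^sup>2)) - 0) = hT i * hT_inv q i - 1"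
 proof -
  have cst_sc: "cst c = sc c (1 :: hgen fa)" for c by (simp add: sc_def)
  show ?thesis
   by (intro poly_mapping_eqI, unfold hT_inv_def cst_sc)
    (simp add: distrib_left distrib_right left_diff_distrib right_diff_distrib sc_simps(3-) lookup_add
     lookup_minus, (simp add: field_simps)?)
 qed
 moreover have "cst (inverse (q\<^sup>2)) * ((hT i + 1) * (hT i - cst (q\<^sup>2)) - 0) : H.I"
  using H.I_l_closed [OF H.I_rel [OF H_rel.intros(1) [OF assms]], of "cst (inverse (q\<^sup>2))"] by simp
 ultimately show "H.cl (hT i * hT_inv q i) = H.cl 1" using H.cl_eqI by simp
 then show "H.cl (hT_inv q i * hT i) = H.cl 1" by (simp add: e)
qed

lemma JP_JN: "1 \<le> j ==> j \<le> r ==> H.cl (JP j * JN j) = H.cl 1 \<and> H.cl (JN j * JP j) = H.cl 1"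
proof -
 assume j: "1 \<le> j" "j \<le> r"
 have "H.QR.jm ct j \<otimes>\<^bsub>H.Q\<^esub> H.QR.jm cti j = \<one>\<^bsub>H.Q\<^esub>"
  by (rule H.QR.jm_inverse [where r = r, THEN conjunct2, THEN conjunct2])
   (use j hT_closed hT_inv_closed ct_inv in \<open>simp_all add: H.cl_mult H.cl_one del: gens_alg_mon\<close>)
 moreover have "H.QR.jm cti j \<otimes>\<^bsub>H.Q\<^esub> H.QR.jm ct j = \<one>\<^bsub>H.Q\<^esub>"
  by (rule H.QR.jm_inverse [where r = r, THEN conjunct2, THEN conjunct2])
   (use j hT_closed hT_inv_closed ct_inv in \<open>simp_all add: H.cl_mult H.cl_one del: gens_alg_mon\<close>)
 ultimately show ?thesis
  using j JP_closed [of j] JN_closed [of j]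
  by (simp add: JP_jm [symmetric] JN_jm [symmetric] H.cl_mult H.cl_one del: map_append)
qed

lemma JP_commute: "1 \<le> j ==> j \<le> r ==> 1 \<le> k ==> k \<le> r ==> H.cl (JP k * JP j) = H.cl (JP j * JP k)"
proof -
 assume j: "1 \<le> j" "j \<le> r" "1 \<le> k" "k \<le> r"
 have "H.QR.jm ct k \<otimes>\<^bsub>H.Q\<^esub> H.QR.jm ct j = H.QR.jm ct j \<otimes>\<^bsub>H.Q\<^esub> H.QR.jm ct k"
  by (rule H.QR.jm_commute [where r = r]) (use j hT_closed ct_far ct_braid in auto)
 then show ?thesis
  using j JP_closed [of j] JP_closed [of k]
  by (simp add: JP_jm [symmetric] H.cl_mult del: map_append)
qed

lemma JP_T: "1 \<le> j ==> j \<le> r ==> i : {1..<r} ==> j ~= i ==> j ~= i + 1 ==> H.cl (JP j * hT i) = H.cl (hT i * JP j)"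
proof -
 assume j: "1 \<le> j" "j \<le> r" and i: "i : {1..<r}" and ne: "j ~= i" "j ~= i + 1"
 have "H.QR.jm ct j \<otimes>\<^bsub>H.Q\<^esub> ct i = ct i \<otimes>\<^bsub>H.Q\<^esub> H.QR.jm ct j"
 proof (cases "j < i")
  case True
  show ?thesis by (rule H.QR.jm_above [where r = r]) (use True i hT_closed ct_far ct_braid in auto)
 next
  case False
  show ?thesis by (rule H.QR.jm_below [where r = r]) (use False ne j i hT_closed ct_far ct_braid in auto)
 qed
 then show ?thesis
  using j i JP_closed [of j] hT_closed [of i]
  by (simp add: JP_jm [symmetric] H.cl_mult del: map_append gens_alg_mon)
qed

lemma cl_cst_mult: "x : gens_alg (H_gens r) ==> y : gens_alg (H_gens r) ==> H.cl x = H.cl y ==> H.cl (cst c * x) = H.cl (cst c * y)"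
 by (rule H.cl_mult_cong) auto

text \<open>The images of the \<open>X\<^sub>j\<close> are Jucys--Murphy elements, whose relations follow from those
  of the \<open>T\<^sub>i\<close>.\<close>

lemma ev_rel: "H_rel r q x y ==> H.cl (subst_eval tw x) = H.cl (subst_eval tw y)"
proof (induction rule: H_rel.induct)
 case (1 i)
 then show ?case using H.cl_rel [OF H_rel.intros(1)] by (simp add: subst_eval_simps)
next
 case (2 i)
 then show ?case using H.cl_rel [OF H_rel.intros(2)] by (simp add: subst_eval_simps)
next
 case (3 i j)
 then show ?case using H.cl_rel [OF H_rel.intros(3)] by (simp add: subst_eval_simps)
next
 case (4 i j)
 have e: "tw (hXg i) * tw (hXg j) = cst (a * q powi (- 2 * (int i - 1)) * (a * q powi (- 2 * (int j - 1)))) * (JP i * JP j)" for i j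
  by (simp add: sc_simps mult_ac del: map_append)
 show ?case using 4 JP_commute [of j i] JP_closed [of i] JP_closed [of j]
  by (simp only: subst_eval_simps subst_eval_gen e, subst mult.commute, intro cl_cst_mult) auto
next
 case (5 i)
 have e: "tw (hXg i) * tw (hXig i) = cst 1 * (JP i * JN i)"
  by (simp add: sc_simps power_int_minus power_int_diff del: map_append)
 have "H.cl (cst 1 * (JP i * JN i)) = H.cl (cst 1 * 1)"
  by (rule cl_cst_mult) (use 5 JP_JN [of i] JP_closed [of i] JN_closed [of i] in auto)
 then show ?case unfolding subst_eval_simps subst_eval_gen e by simp
next
 case (6 i)
 have e: "tw (hXig i) * tw (hXg i) = cst 1 * (JN i * JP i)"
  by (simp add: sc_simps power_int_minus power_int_diff del: map_append)
 have "H.cl (cst 1 * (JN i * JP i)) = H.cl (cst 1 * 1)"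
  by (rule cl_cst_mult) (use 6 JP_JN [of i] JP_closed [of i] JN_closed [of i] in auto)
 then show ?case unfolding subst_eval_simps subst_eval_gen e by simp
next
 case (7 i)
 have "q powi (- 2 * (int i - 1)) = q\<^sup>2 * q powi (- 2 * (int (i + 1) - 1))"
  using q_powi_add [of 2 "- 2 * (int (i + 1) - 1)"] by (simp add: algebra_simps)
 moreover have "JP (i + 1) = hT i * JP i * hT i" using JP_Suc [of i] 7 by (simp del: upt_Suc)
 ultimately have "subst_eval tw (hT i * hX i * hT i) = subst_eval tw (cst (q\<^sup>2) * hX (i + 1))"
  by (simp add: subst_eval_simps sc_simps mult.assoc mult.commute mult.left_commute del: upt_Suc map_append)
 then show ?case by simp
next
 case (8 i j)
 have "subst_eval tw (hX j * hT i) = cst (a * q powi (- 2 * (int j - 1))) * (JP j * hT i)"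
  "subst_eval tw (hT i * hX j) = cst (a * q powi (- 2 * (int j - 1))) * (hT i * JP j)"
  by (simp_all add: subst_eval_simps sc_simps del: map_append)
 moreover have "H.cl (cst (a * q powi (- 2 * (int j - 1))) * (JP j * hT i)) = H.cl (cst (a * q powi (- 2 * (int j - 1))) * (hT i * JP j))"
  by (rule cl_cst_mult) (use 8 JP_T [of j i] JP_closed [of j] hT_closed [of i] in \<open>auto simp del: gens_alg_mon\<close>)
 ultimately show ?case by simp
qed

lemma ev_ideal: "i : H.I ==> subst_eval tw i : H.I"
proof -
 have "H.I \<subseteq> {x : gens_alg (H_gens r). subst_eval tw x : H.I}"
 proof (rule H.I_least)
  fix x y assume "H_rel r q x y"
  then show "x - y : {x : gens_alg (H_gens r). subst_eval tw x : H.I}"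
   using ev_rel [of x y] H_rel_closed [of x y] by (auto simp: subst_eval_simps H.cl_eq_iff)
 next
  fix x y assume "x : {x : gens_alg (H_gens r). subst_eval tw x : H.I}" and y: "y : gens_alg (H_gens r)"
  then show "y * x : {x : gens_alg (H_gens r). subst_eval tw x : H.I}"
   "x * y : {x : gens_alg (H_gens r). subst_eval tw x : H.I}"
   using H.I_l_closed [OF _ subst_closed [OF y]] H.I_r_closed [OF _ subst_closed [OF y]]
   by (auto simp: subst_eval_simps)
 qed (auto simp: subst_eval_simps H.I_zero H.I_add H.I_minus)
 then show "i : H.I ==> subst_eval tw i : H.I" by blast
qed

lemma ev_cl: "x : gens_alg (H_gens r) ==> ev r q a (H.cl x) = H.cl (subst_eval tw x)"
 unfolding ev_def H_cls_eq
 by (rule H.the_elem_cl) (rule H.cl_eqI, simp add: subst_eval_simps ev_ideal)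

definition opJ :: "nat => int fa => int fa" where "opJ j v = hev v (tw (hXg j))"
definition opJi :: "nat => int fa => int fa" where "opJi j v = hev v (tw (hXig j))"

lemma linear_opJ [simp]: "linear_map (opJ j)" "linear_map (opJi j)"
 unfolding opJ_def [abs_def] opJi_def [abs_def] by (intro linear_right_eval_arg linear_hecke)+

lemmas J_lin = linear_opJ [THEN linear_map_add] linear_opJ [THEN linear_map_diff] linear_opJ [THEN linear_map_cst]
 linear_opJ [THEN linear_map_0] linear_opJ [THEN linear_map_sum] linear_opJ [THEN linear_map_sc]

lemma J_Omega: "v : Omega r ==> opJ j v : Omega r" "v : Omega r ==> opJi j v : Omega r"
 by (simp_all add: opJ_def opJi_def hev_Omega del: ev_gen.simps)

lemma J_rel:
 assumes "H_rel r q x y" "v : Omega r"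
 shows "hev v (subst_eval tw x) = hev v (subst_eval tw y)"
 using hev_cong [OF ev_rel] assms by blast

lemma J_J: "i : {1..r} ==> j : {1..r} ==> v : Omega r ==> opJ j (opJ i v) = opJ i (opJ j v)"
 using J_rel [OF H_rel.intros(4), of i j v]
 by (simp add: subst_eval_simps right_eval_mult opJ_def del: ev_gen.simps)

lemma J_Ji: "i : {1..r} ==> v : Omega r ==> opJi i (opJ i v) = v"
 "i : {1..r} ==> v : Omega r ==> opJ i (opJi i v) = v"
 using J_rel [OF H_rel.intros(5), of i v] J_rel [OF H_rel.intros(6), of i v]
 by (simp_all add: subst_eval_simps right_eval_mult right_eval_1 opJ_def opJi_def del: ev_gen.simps)

lemma T_J_T: "i : {1..<r} ==> v : Omega r ==> tT i (opJ i (tT i v)) = cst (q\<^sup>2) * opJ (i + 1) v"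
 using J_rel [OF H_rel.intros(7), of i v]
 by (simp add: subst_eval_simps right_eval_mult right_eval_cst right_eval_simps opJ_def ev_gen.simps(1) del: ev_gen.simps(2,3))

lemma T_J_far: "i : {1..<r} ==> j : {1..r} ==> j ~= i ==> j ~= i + 1 ==> v : Omega r ==> tT i (opJ j v) = opJ j (tT i v)"
 using J_rel [OF H_rel.intros(8), of i j v]
 by (simp add: subst_eval_simps right_eval_mult opJ_def ev_gen.simps(1) del: ev_gen.simps(2,3))

lemma J_1: "v : Omega r ==> opJ 1 v = cst a * v"
 by (simp add: opJ_def right_eval_simps right_eval_1 right_eval_cst)

lemma J_Suc: "i : {1..<r} ==> v : Omega r ==> opJ (i + 1) v = cst (inverse (q\<^sup>2)) * tT i (opJ i (tT i v))"
 by (simp add: T_J_T cst_mult_assoc)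

lemma T_cancel: "i : {1..<r} ==> v : Omega r ==> tT i (tT i v - cst (q\<^sup>2 - 1) * v) = cst (q\<^sup>2) * v"
 by (simp add: hecke_lin quadratic [of i r])

lemma J_Bernstein1: "i : {1..<r} ==> v : Omega r ==> tT i (opJ i v) = opJ (i + 1) (tT i v) - cst (q\<^sup>2 - 1) * opJ (i + 1) v"
proof -
 assume i: "i : {1..<r}" and v: "v : Omega r"
 let ?w = "cst (inverse (q\<^sup>2)) * (tT i v - cst (q\<^sup>2 - 1) * v)"
 have w: "?w : Omega r" by (intro Omega_closed hecke_Omega v)
 have "tT i ?w = v" by (simp only: linear_map_cst [OF linear_hecke] T_cancel [OF i v] cst_mult_assoc) simp
 then have "tT i (opJ i v) = cst (q\<^sup>2) * opJ (i + 1) ?w" using T_J_T [OF i w] by simp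
 then show ?thesis by (simp add: J_lin cst_mult_assoc)
qed

lemma J_Bernstein2: "i : {1..<r} ==> v : Omega r ==> tT i (opJ (i + 1) v) = opJ i (tT i v) + cst (q\<^sup>2 - 1) * opJ (i + 1) v"
proof -
 assume i: "i : {1..<r}" and v: "v : Omega r"
 have "opJ i (tT i v) : Omega r" by (intro J_Omega hecke_Omega v)
 then show ?thesis using i v
  by (simp add: J_Suc [simplified] hecke_lin quadratic [of i r] distrib_left cst_mult_assoc)
   (simp add: sc_simps algebra_simps)
qed

end

context evalm begin

definition Jz :: "nat => int => int fa => int fa" where
 "Jz j c v = (if c \<ge> 0 then (opJi j ^^ nat c) v else (opJ j ^^ nat (- c)) v)"

lemma J_pow_Omega: "v : Omega r ==> (opJ j ^^ t) v : Omega r" "v : Omega r ==> (opJi j ^^ t) v : Omega r"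
 by (induction t) (simp_all add: J_Omega)

lemma Jz_Omega: "v : Omega r ==> Jz j c v : Omega r"
 by (simp add: Jz_def J_pow_Omega)

lemma Jz_0 [simp]: "Jz j 0 v = v"
 by (simp add: Jz_def)

lemma Jz_pred: "j : {1..r} ==> v : Omega r ==> Jz j (c - 1) v = opJ j (Jz j c v)"
proof (cases "c > 0")
 case True
 assume j: "j : {1..r}" "v : Omega r"
 have "nat c = Suc (nat (c - 1))" using True by simp
 then show ?thesis using True j J_Ji(2) [of j "(opJi j ^^ nat (c - 1)) v"] J_pow_Omega
  by (simp add: Jz_def del: nat_diff_distrib)
next
 case False
 then have "nat (- (c - 1)) = Suc (nat (- c))" by simp
 then show ?thesis using False by (auto simp: Jz_def)
qed

lemma J_Ji_comm: "i : {1..r} ==> j : {1..r} ==> v : Omega r ==> opJ i (opJi j v) = opJi j (opJ i v)"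
 using J_J [of i j "opJi j v"] J_Ji(1) [of j "opJ i (opJi j v)"] J_Ji(2) [of j v] J_Omega by simp

lemma J_Jz: "i : {1..r} ==> j : {1..r} ==> v : Omega r ==> Jz j c (opJ i v) = opJ i (Jz j c v)"
proof -
 assume ij: "i : {1..r}" "j : {1..r}" "v : Omega r"
 have "(opJi j ^^ t) (opJ i v) = opJ i ((opJi j ^^ t) v)" "(opJ j ^^ t) (opJ i v) = opJ i ((opJ j ^^ t) v)" for t
  by (induction t) (use ij J_Ji_comm J_J J_pow_Omega in auto)
 then show ?thesis by (simp add: Jz_def)
qed

definition shft :: "int list => nat => int" where
 "shft w j = (w ! j - rs n (w ! j)) div int n"

text \<open>The tensor space is free over the Laurent polynomials in the \<open>X\<^sub>j\<close> on the finite words; the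
 evaluation map sends the \<open>X\<^sub>j\<close> to the Jucys--Murphy operators.\<close>

definition epsw :: "int list => int fa" where
 "epsw w = fold (\<lambda>j. Jz (Suc j) (shft w j)) [0..<length w] (mon (map (rs n) w))"

lemma epsw_fin: "fin_word w ==> epsw w = mon w"
proof -
 assume w: "fin_word w"
 have "fold (\<lambda>j. Jz (Suc j) (shft w j)) [0..<length w] v = fold (\<lambda>j v. v) [0..<length w] v" for v
  by (rule fold_cong) (use fin_word_nth [OF w] in \<open>auto simp: fun_eq_iff shft_def rs_fin\<close>)
 moreover have "fold (\<lambda>j v. v) xs v = v" for xs :: "nat list" and v :: "int fa"
  by (induction xs) auto
 moreover have "map (rs n) w = w"
  using w by (auto simp: fin_word_def intro!: map_idI rs_fin)
 ultimately show ?thesis by (simp add: epsw_def)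
qed

lemma fold_Jz:
 assumes "set xs \<subseteq> {..<r}" "v : Omega r" "i : {1..r}"
 shows "fold (\<lambda>j. Jz (Suc j) (c j)) xs (opJ i v) = opJ i (fold (\<lambda>j. Jz (Suc j) (c j)) xs v)"
 using assms
proof (induction xs arbitrary: v)
 case (Cons j xs)
 then have "Jz (Suc j) (c j) (opJ i v) = opJ i (Jz (Suc j) (c j) v)" by (intro J_Jz) auto
 then show ?case using Cons Jz_Omega by simp
qed simp

lemma fold_Jz_Omega: "v : Omega r ==> fold (\<lambda>j. Jz (Suc j) (c j)) xs v : Omega r"
 by (induction xs arbitrary: v) (auto simp: Jz_Omega)

lemma epsw_shift:
 assumes w: "length w = r" and j: "j < r"
 shows "epsw (w[j := w ! j - int n]) = opJ (Suc j) (epsw w)"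
proof -
 let ?w = "w[j := w ! j - int n]"
 let ?f = "\<lambda>w xs v. fold (\<lambda>j. Jz (Suc j) (shft w j)) xs v"
 have m: "map (rs n) ?w = map (rs n) w"
  by (rule nth_equalityI) (use w j in \<open>auto simp: nth_list_update\<close>)
 have split: "[0..<r] = [0..<j] @ j # [Suc j..<r]"
  using upt_add_eq_append [of 0 j "r - j"] j by (simp add: upt_conv_Cons)
 have "(w ! j - int n - rs n (w ! j)) div int n = (w ! j - rs n (w ! j)) div int n - 1"
  using div_mult_self1 [of "int n" "w ! j - rs n (w ! j)" "-1"] n2 by (simp add: algebra_simps)
 then have c: "shft ?w j = shft w j - 1" using w j by (simp add: shft_def)
 have c': "shft ?w i = shft w i" if "i ~= j" for i using that by (simp add: shft_def)
 have f: "?f ?w xs v = ?f w xs v" if "j \<notin> set xs" for xs v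
 proof (rule fold_cong)
  fix i assume "i : set xs"
  then have "i ~= j" using that by auto
  then show "Jz (Suc i) (shft ?w i) = Jz (Suc i) (shft w i)" using c' by simp
 qed simp_all
 let ?v = "?f w [0..<j] (mon (map (rs n) w))"
 have v: "?v : Omega r" by (rule fold_Jz_Omega) (simp add: Omega_closed w)
 have "epsw ?w = ?f w [Suc j..<r] (Jz (Suc j) (shft w j - 1) ?v)"
  using f [of "[0..<j]"] f [of "[Suc j..<r]"] by (simp add: epsw_def m w split c)
 also have "Jz (Suc j) (shft w j - 1) ?v = opJ (Suc j) (Jz (Suc j) (shft w j) ?v)"
  by (rule Jz_pred) (use j v in auto)
 also have "?f w [Suc j..<r] \<dots> = opJ (Suc j) (?f w [Suc j..<r] (Jz (Suc j) (shft w j) ?v))"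
  by (rule fold_Jz) (use j v Jz_Omega in auto)
 also have "?f w [Suc j..<r] (Jz (Suc j) (shft w j) ?v) = epsw w"
  by (simp add: epsw_def w split)
 finally show ?thesis .
qed

definition epsl :: "int fa => int fa" where "epsl = lin_ext epsw"

lemma linear_epsl [simp]: "linear_map epsl"
 by (simp add: epsl_def)

lemmas eps_lin = linear_map_simps [OF linear_epsl]

lemma Omega_fin_supp': "Omega_fin n s = supp {w. length w = s \<and> fin_word w}"
 by (simp add: Omega_fin_supp fin_word_def)

lemma Omega_fin_induct [consumes 1, case_names mon zero add cst]:
 assumes "v : Omega_fin n s" and "!!w. length w = s ==> fin_word w ==> P (mon w)" and "P 0"
  and "!!x y. P x ==> P y ==> P (x + y)" and "!!c x. P x ==> P (cst c * x)"
 shows "P v"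
 using assms(1) unfolding Omega_fin_supp' by (induction rule: supp_induct) (use assms in auto)

lemma Omega_fin_closed:
 "v : Omega_fin n s ==> w : Omega_fin n s ==> v + w : Omega_fin n s"
 "v : Omega_fin n s ==> w : Omega_fin n s ==> v - w : Omega_fin n s"
 "v : Omega_fin n s ==> cst c * v : Omega_fin n s" "0 : Omega_fin n s"
 "mon u : Omega_fin n s \<longleftrightarrow> length u = s \<and> fin_word u"
 "(!!i. i : A ==> f i : Omega_fin n s) ==> sum f A : Omega_fin n s"
 unfolding Omega_fin_supp' by auto

lemma Omega_fin_Omega: "v : Omega_fin n s ==> v : Omega s"
 by (simp add: Omega_fin_def)

lemma epsl_fin: "v : Omega_fin n r ==> epsl v = v"
proof (induction rule: Omega_fin_induct)
 case (mon w)
 then show ?case by (simp add: epsl_def epsw_fin)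
qed (simp_all add: eps_lin)

lemma epsl_Omega: "v : Omega r ==> epsl v : Omega r"
proof (induction rule: Omega_induct)
 case (mon w)
 then show ?case unfolding epsl_def lin_ext_mon epsw_def by (intro fold_Jz_Omega) (simp add: Omega_closed)
qed (auto simp: eps_lin Omega_closed)

lemma epsl_X: "j : {1..r} ==> v : Omega r ==> epsl (tX j v) = opJ j (epsl v)"
proof -
 assume j: "j : {1..r}" and v: "v : Omega r"
 from v show ?thesis
 proof (induction rule: Omega_induct)
  case (mon w)
  moreover have "j - 1 < r" "Suc (j - 1) = j" using j by auto
  ultimately show ?case using epsw_shift [OF mon, of "j - 1"] by (simp add: X_mon epsl_def)
 qed (simp_all add: eps_lin hecke_lin J_lin)
qed

lemma J_eq_0: "j : {1..r} ==> v : Omega r ==> opJ j v = 0 \<longleftrightarrow> v = 0"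
 using J_Ji(1) [of j v] linear_map_0 [OF linear_opJ(2)] by (auto simp: J_lin)

lemma epsl_Xi: "j : {1..r} ==> v : Omega r ==> epsl (tXi j v) = opJi j (epsl v)"
proof -
 assume j: "j : {1..r}" and v: "v : Omega r"
 have "opJ j (epsl (tXi j v)) = epsl v"
  using epsl_X [OF j, of "tXi j v"] X_Xi [OF v] hecke_Omega [OF v] by simp
 then show ?thesis using J_Ji(1) [OF j, of "epsl (tXi j v)"] epsl_Omega hecke_Omega [OF v] by simp
qed

lemma tT_Omega_fin: "v : Omega_fin n s ==> k : {1..<s} ==> tT k v : Omega_fin n s"
proof (induction rule: Omega_fin_induct)
 case (mon w)
 then have "fin_word (swp k w)" by (intro fin_word_swp) auto
 then show ?case using mon by (auto simp: T_mon_fin Omega_fin_closed)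
qed (auto simp: hecke_lin Omega_fin_closed)

lemma epsl_T: "k : {1..<r} ==> v : Omega r ==> epsl (tT k v) = tT k (epsl v)"
proof -
 assume k: "k : {1..<r}" and v: "v : Omega r"
 define \<sigma> where "\<sigma> j = (if j = k then k + 1 else if j = k + 1 then k else j)" for j
 define D where "D v = epsl (tT k v) - tT k (epsl v)" for v
 have X: "D (tX j v) = opJ (\<sigma> j) (D v)" if j: "j : {1..r}" and v: "v : Omega r" for j v
 proof -
  have e: "epsl v : Omega r" "tT k v : Omega r" by (intro epsl_Omega hecke_Omega v)+
  have k': "k : {1..r}" "k + 1 : {1..r}" using k by auto
  consider "j = k" | "j = k + 1" | "j ~= k" "j ~= k + 1" by blast
  then show ?thesis
  proof cases
   case 1
   then show ?thesis using Bernstein1 [OF k v] J_Bernstein1 [OF k e(1)]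
    by (simp add: D_def \<sigma>_def eps_lin epsl_X [OF k'(1)] epsl_X [OF k'(2), simplified] v e J_lin)
  next
   case 2
   then show ?thesis using Bernstein2 [OF k v] J_Bernstein2 [OF k e(1)]
    by (simp add: D_def \<sigma>_def eps_lin epsl_X [OF k'(1)] epsl_X [OF k'(2), simplified] v e J_lin)
  next
   case 3
   then show ?thesis using T_X_far [OF k j 3 v] T_J_far [OF k j 3 e(1)]
    by (simp add: D_def \<sigma>_def epsl_X [OF j] v e J_lin)
  qed
 qed
 have "D v = 0"
 proof (rule affine_vanish [where D = D and U = "Omega r" and Y = "\<lambda>j. opJ (\<sigma> j)" and s = r])
  show "linear_map D" by (simp add: linear_map_def D_def eps_lin hecke_lin algebra_simps)
  show "D v : Omega r" if "v : Omega r" for v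
   unfolding D_def by (intro Omega_closed hecke_Omega epsl_Omega that)
  show "opJ (\<sigma> j) u = 0 \<longleftrightarrow> u = 0" if "j : {1..r}" "u : Omega r" for j u
   by (rule J_eq_0) (use that k in \<open>auto simp: \<sigma>_def\<close>)
  show "D (mon w) = 0" if w: "length w = r" "fin_word w" for w
  proof -
   have "mon w : Omega_fin n r" using w by (simp add: Omega_fin_closed)
   then show ?thesis using tT_Omega_fin [OF _ k] by (simp add: D_def epsl_fin)
  qed
 qed (use X v in auto)
 then show ?thesis by (simp add: D_def)
qed

lemma epsl_hev:
 assumes "x : gens_alg (H_gens r)" "v : Omega r"
 shows "epsl (hev v x) = hev (epsl v) (subst_eval tw x)"
 using assms
proof (induction x arbitrary: v rule: gens_alg_induct)
 have *: "epsl (hecke_act n q g v) = hev (epsl v) (tw g)" if g: "g : H_gens r" and v: "v : Omega r" for g v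
 proof -
  from g consider i where "g = hTg i" "i : {1..<r}" | j where "g = hXg j" "j : {1..r}" | j where "g = hXig j" "j : {1..r}"
   by (auto simp: H_gens_def)
  then show ?thesis
   by cases (simp_all add: epsl_T epsl_X epsl_Xi v opJ_def opJi_def del: ev_gen.simps(2,3))
 qed
 case (gen g)
 then show ?case using * by simp
next
 have *: "epsl (hecke_act n q g v) = hev (epsl v) (tw g)" if g: "g : H_gens r" and v: "v : Omega r" for g v
 proof -
  from g consider i where "g = hTg i" "i : {1..<r}" | j where "g = hXg j" "j : {1..r}" | j where "g = hXig j" "j : {1..r}"
   by (auto simp: H_gens_def)
  then show ?thesis
   by cases (simp_all add: epsl_T epsl_X epsl_Xi v opJ_def opJi_def del: ev_gen.simps(2,3))
 qed
 case (mult g y)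
 then show ?case using *[of g v] by (simp add: right_eval_mult subst_eval_simps hecke_Omega)
qed (simp_all add: right_eval_1 subst_eval_simps right_eval_simps eps_lin)

lemma hev_T_fin: "x : gens_alg (hTg ` {1..<r}) ==> v : Omega_fin n r ==> hev v x : Omega_fin n r"
 by (induction x arbitrary: v rule: gens_alg_induct)
  (auto simp: right_eval_simps right_eval_1 right_eval_mult Omega_fin_closed tT_Omega_fin)

lemma tw_T: "g : H_gens r ==> tw g : gens_alg (hTg ` {1..<r})"
proof -
 assume "g : H_gens r"
 then consider i where "g = hTg i" "i : {1..<r}" | j where "g = hXg j" "j \<le> r" | j where "g = hXig j" "j \<le> r"
  by (auto simp: H_gens_def)
 then show ?thesis
  by cases (auto intro!: gens_alg_closed gens_alg_prod_list simp: hT_inv_def)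
qed

lemma J_Omega_fin: "j : {1..r} ==> v : Omega_fin n r ==> opJ j v : Omega_fin n r"
 "j : {1..r} ==> v : Omega_fin n r ==> opJi j v : Omega_fin n r"
 unfolding opJ_def opJi_def by (auto intro!: hev_T_fin tw_T simp: H_gens_def simp del: ev_gen.simps)

lemma Jz_Omega_fin: "j : {1..r} ==> v : Omega_fin n r ==> Jz j c v : Omega_fin n r"
proof -
 assume j: "j : {1..r}" "v : Omega_fin n r"
 have "(opJ j ^^ t) v : Omega_fin n r \<and> (opJi j ^^ t) v : Omega_fin n r" for t
  by (induction t) (use j J_Omega_fin in auto)
 then show ?thesis by (simp add: Jz_def)
qed

lemma epsl_Omega_fin: "v : Omega r ==> epsl v : Omega_fin n r"
proof (induction rule: Omega_induct)
 case (mon w)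
 have "fold (\<lambda>j. Jz (Suc j) (c j)) xs v : Omega_fin n r" if "set xs \<subseteq> {..<r}" "v : Omega_fin n r" for c xs v
  using that by (induction xs arbitrary: v) (auto simp: Jz_Omega_fin)
 moreover have "fin_word (map (rs n) w)" using rs_range by (auto simp: fin_word_def)
 ultimately show ?case using mon by (simp add: epsl_def epsw_def Omega_fin_closed lessThan_atLeast0)
qed (auto simp: eps_lin Omega_fin_closed)

text \<open>The shifts of the letters by multiples of \<open>n\<close> are the action of the \<open>X\<^sub>j\<close>,
  so every word comes from a finite word; this makes the evaluation map unique.\<close>

lemma aff_word_gen:
 assumes "length w = r"
 shows "\<exists>u x. fin_word u \<and> length u = r \<and> x : gens_alg (H_gens r) \<and> mon w = hev (mon u) x"
 using assms
proof (rule affine_word_induct)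
 fix w :: "int list" assume "length w = r" "fin_word w"
 then show "\<exists>u x. fin_word u \<and> length u = r \<and> x : gens_alg (H_gens r) \<and> mon w = hev (mon u) x"
  by (intro exI [of _ w] exI [of _ 1]) (simp add: right_eval_1)
next
 fix w :: "int list" and j assume w: "length w = r" and j: "j < r"
 let ?P = "\<lambda>w. \<exists>u x. fin_word u \<and> length u = r \<and> x : gens_alg (H_gens r) \<and> mon w = hev (mon u) x"
 have e: "mon (w[j := w ! j - int n]) = tX (Suc j) (mon w)" by (simp add: X_mon)
 then have e': "mon w = tXi (Suc j) (mon (w[j := w ! j - int n]))"
  using X_Xi(2) [of "mon w" r "Suc j"] w by (simp add: Omega_closed)
 have g: "hX (Suc j) : gens_alg (H_gens r)" "hXi (Suc j) : gens_alg (H_gens r)"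
  using j by (auto simp: H_gens_def)
 show "?P w \<longleftrightarrow> ?P (w[j := w ! j - int n])"
 proof
  assume "?P w"
  then obtain u x where "fin_word u" "length u = r" "x : gens_alg (H_gens r)" "mon w = hev (mon u) x" by blast
  then show "?P (w[j := w ! j - int n])"
   using g by (intro exI [of _ u] exI [of _ "x * hX (Suc j)"]) (simp add: e right_eval_mult del: gens_alg_mon)
 next
  assume "?P (w[j := w ! j - int n])"
  then obtain u x where "fin_word u" "length u = r" "x : gens_alg (H_gens r)"
   "mon (w[j := w ! j - int n]) = hev (mon u) x" by blast
  then show "?P w"
   using g by (intro exI [of _ u] exI [of _ "x * hXi (Suc j)"]) (simp add: e' right_eval_mult del: gens_alg_mon)
 qed
qed

lemma Hr_carrier: "carrier (Hr r q) = H.cl ` gens_alg (H_gens r)"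
 using H.Q_carrier by (simp add: Hr_def)

lemma linear_on_cong:
 assumes "linear_on (Omega r) W f" "linear_on (Omega r) W' g" "!!w. length w = r ==> f (mon w) = g (mon w)"
  and v: "v : Omega r"
 shows "f v = g v"
proof -
 have "f v = g v \<and> v : Omega r"
  using v
 proof (induction rule: Omega_induct)
  case zero
  have "h 0 = 0" if "linear_on (Omega r) W h" for h W
   using that Omega_closed(4) [of r] unfolding linear_on_def by (metis cst_0 mult_zero_left)
  then show ?case using assms(1,2) Omega_closed(4) by metis
 qed (use assms Omega_closed in \<open>auto simp: linear_on_def\<close>)
 then show ?thesis by simp
qed

text \<open>Existence is the explicit map on words; uniqueness holds because the finite words generate the tensor
  space over the affine Hecke algebra.\<close>

lemma eps_eq: "eps n q r a = restrict epsl (Omega r)"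
 unfolding eps_def
proof (rule the_equality)
 have lin: "linear_on (Omega r) (Omega_fin n r) (restrict epsl (Omega r))"
  unfolding linear_on_def by (auto simp: epsl_Omega_fin eps_lin Omega_closed)
 have spec: "hecke_right n q x h : Omega r \<and> epsl (hecke_right n q x h) = hecke_right n q x (ev r q a h)"
  if x: "x : Omega_fin n r" and h: "h : carrier (Hr r q)" for x h
 proof -
  have x': "x : Omega r" using x by (rule Omega_fin_Omega)
  from h obtain y where y: "y : gens_alg (H_gens r)" "h = H.cl y" by (auto simp: Hr_carrier)
  then show ?thesis
   using epsl_hev [OF y(1) x'] by (simp add: hecke_right_cl x' hev_Omega ev_cl epsl_fin x)
 qed
 then show "restrict epsl (Omega r) : extensional (Omega r) \<and> linear_on (Omega r) (Omega_fin n r) (restrict epsl (Omega r)) \<and>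
   (\<forall>x\<in>Omega_fin n r. \<forall>h\<in>carrier (Hr r q).
    restrict epsl (Omega r) (hecke_right n q x h) = hecke_right n q x (ev r q a h))"
  using lin by auto
 fix e assume e: "e : extensional (Omega r) \<and> linear_on (Omega r) (Omega_fin n r) e \<and>
   (\<forall>x\<in>Omega_fin n r. \<forall>h\<in>carrier (Hr r q). e (hecke_right n q x h) = hecke_right n q x (ev r q a h))"
 have "e v = restrict epsl (Omega r) v" if "v : Omega r" for v
 proof (rule linear_on_cong [OF _ lin _ that])
  show "linear_on (Omega r) (Omega_fin n r) e" using e by blast
  fix w :: "int list" assume "length w = r"
  then obtain u x where u: "fin_word u" "length u = r" and x: "x : gens_alg (H_gens r)" and w: "mon w = hev (mon u) x"
   using aff_word_gen by blast
  have m: "mon u : Omega_fin n r" "mon u : Omega r" using u by (simp_all add: Omega_fin_closed Omega_closed)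
  have h: "H.cl x : carrier (Hr r q)" using x by (simp add: Hr_carrier)
  have "mon w = hecke_right n q (mon u) (H.cl x)" using m by (simp add: hecke_right_cl w)
  then show "e (mon w) = restrict epsl (Omega r) (mon w)" using e spec [OF m(1) h] m(1) h by simp
 qed
 then show "e = restrict epsl (Omega r)" using e by (auto intro!: extensionalityI [of e "Omega r"])
qed

end

context evalm begin

section \<open>The two actions on tensor space commute\<close>

lemma T_left: "x : Omega l ==> y : Omega s ==> k : {1..<s} ==> tT (l + k) (x * y) = x * tT k y"
proof (induction rule: Omega_induct)
 case (mon u)
 from mon(2) show ?case
 proof (induction rule: Omega_induct)
  case (mon w)
  obtain k' where k': "k = Suc k'" using \<open>k : {1..<s}\<close> by (cases k) auto
  have "mon u * tT k (mon w) = Tput (w ! (k - 1)) (w ! k) (\<lambda>x y. mon u * mon (w[k - 1 := x, k := y]))"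
   unfolding T_mon by (rule Tput_linear) (rule linear_map_times_left, rule linear_map_id)
  then show ?case using \<open>length u = l\<close>
   by (simp only: mon_mult) (simp add: T_mon k' nth_append list_update_append mon_mult)
 qed (simp_all add: hecke_lin distrib_left sc_simps)
qed (simp_all add: hecke_lin distrib_right sc_simps)

lemma T_right: "x : Omega s ==> k : {1..<s} ==> tT k (x * y) = tT k x * y"
proof (induction rule: Omega_induct)
 case (mon u)
 show ?case
 proof (induction y rule: fa_induct)
  case (mon w)
  have "tT k (mon u) * mon w = Tput (u ! (k - 1)) (u ! k) (\<lambda>x y. mon (u[k - 1 := x, k := y]) * mon w)"
   unfolding T_mon by (rule Tput_linear) (rule linear_map_times_right, rule linear_map_id)
  moreover have "k - 1 < length u" "k < length u" using \<open>length u = s\<close> \<open>k : {1..<s}\<close> by auto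
  ultimately show ?case
   by (simp only: mon_mult) (simp add: T_mon nth_append list_update_append mon_mult)
 qed (simp_all add: hecke_lin distrib_left sc_simps)
qed (simp_all add: hecke_lin distrib_right sc_simps)

lemma swp_split: "swp (Suc (length u)) (u @ x # y # v) = u @ y # x # v"
 by (simp add: swp_def nth_append list_update_append)

lemma additive_swp: "additive \<chi> ==> k : {1..<length w} ==> \<chi> (swp k w) = \<chi> w"
proof -
 assume \<chi>: "additive \<chi>" and k: "k : {1..<length w}"
 obtain u x y v where w: "w = u @ x # y # v" "k = Suc (length u)" using word_split2 [OF k refl] by blast
 have "\<chi> (x # y # v) = \<chi> (y # x # v)"
  by (simp add: additive_Cons [OF \<chi>, of x "y # v"] additive_Cons [OF \<chi>, of y v]
    additive_Cons [OF \<chi>, of y "x # v"] additive_Cons [OF \<chi>, of x v])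
 then show ?thesis using \<chi> by (simp add: w swp_split additive_def)
qed

lemma dg_T: "additive \<chi> ==> v : Omega_fin n s ==> k : {1..<s} ==> dg \<chi> (tT k v) = tT k (dg \<chi> v)"
proof -
 assume \<chi>: "additive \<chi>" and v: "v : Omega_fin n s" and k: "k : {1..<s}"
 from v show ?thesis
 proof (induction rule: Omega_fin_induct)
  case (mon w)
  then show ?case using k additive_swp [OF \<chi>, of k w]
   by (simp add: T_mon_fin dg_simps dg_mon hecke_lin sc_simps mult.commute)
 qed (simp_all add: hecke_lin dg_simps)
qed

lemma T2_fin: "x : {1..int n} ==> y : {1..int n} ==> tT (Suc 0) (mon [x, y]) =
  (if x = y then cst (q\<^sup>2) * mon [x, y] else if x < y then cst q * mon [y, x]
   else cst q * mon [y, x] + cst (q\<^sup>2 - 1) * mon [x, y])"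
 using T_fin [of x y "[]" "[]"] by simp

lemma T2_zero1: "y : {1..int n} ==> tT (Suc 0) (mon [0, y]) = (if y = int n then mon [int n, 0] else cst q * mon [y, 0])"
proof -
 assume y: "y : {1..int n}"
 have "int n : {1..int n}" using n2 by simp
 from Tput_ab [OF this y, of "-1" 0 "\<lambda>u v. mon [u, v]"] show ?thesis using y
  by (auto simp: T_mon cst_diff left_diff_distrib)
qed

lemma T2_zero2: "x : {1..int n} ==> tT (Suc 0) (mon [x, 0]) =
  (if x = int n then cst (q\<^sup>2) * mon [0, int n] else cst q * mon [0, x]) + cst (q\<^sup>2 - 1) * mon [x, 0]"
proof -
 assume x: "x : {1..int n}"
 have "int n : {1..int n}" using n2 by simp
 from Tput_ab [OF x this, of 0 "-1" "\<lambda>u v. mon [u, v]"] show ?thesis using x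
  by (auto simp: T_mon)
qed

lemma opE_2: "opE i (mon [x, y]) = (if rs n x = int (nx n i) then cst (q powi cnt2 i [y]) * mon [x - 1, y] else 0)
  + (if rs n y = int (nx n i) then mon [x, y - 1] else 0)"
 by (auto simp: opE_def mon_mult)

lemma opF_2: "opF i (mon [x, y]) = (if rs n x = int i then mon [x + 1, y] else 0)
  + (if rs n y = int i then cst (q powi (- cnt2 i [x])) * mon [x, y + 1] else 0)"
 by (auto simp: opF_def mon_mult mult.assoc)

lemma cnt2_fin: "x : {1..int n} ==> cnt2 i [x] = of_bool (x = int i) - of_bool (x = int (nx n i))"
 by (auto simp: cnt2_def cnt_single rs_fin)

lemma E_T2:
 assumes i: "i : {1..n}" and x: "x : {1..int n}" and y: "y : {1..int n}"
 shows "opE i (tT (Suc 0) (mon [x, y])) = tT (Suc 0) (opE i (mon [x, y]))"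
proof (cases "i = n")
 case False
 then have nx: "nx n i = Suc i" and i1: "1 \<le> int i" "int i < int n" using i by (auto simp: nx_def)
 have f: "int i : {1..int n}" "1 + int i : {1..int n}" using i1 by auto
 show ?thesis
 proof (cases x y rule: linorder_cases)
  case less
  then show ?thesis using x y f
   by (auto simp: opE_2 T2_fin op_simps hecke_lin nx cnt2_fin rs_fin power_int_minus sc_simps,
     (intro poly_mapping_eqI, simp add: lookup_add lookup_minus field_simps power2_eq_square)+)
 next
  case equal
  then show ?thesis using x y f
   by (auto simp: opE_2 T2_fin op_simps hecke_lin nx cnt2_fin rs_fin power_int_minus sc_simps,
     (intro poly_mapping_eqI, simp add: lookup_add lookup_minus field_simps power2_eq_square)+)
 next
  case greater
  then show ?thesis using x y f
   by (auto simp: opE_2 T2_fin op_simps hecke_lin nx cnt2_fin rs_fin power_int_minus sc_simps,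
     (intro poly_mapping_eqI, simp add: lookup_add lookup_minus field_simps power2_eq_square)+)
 qed
next
 case True
 have nx: "nx n n = 1" by (simp add: nx_def)
 have nn: "1 < int n" using n2 by simp
 then have f: "1 : {1..int n}" "int n : {1..int n}" by auto
 have "opE n (tT (Suc 0) (mon [x, y])) = tT (Suc 0) (opE n (mon [x, y]))"
 proof (cases x y rule: linorder_cases)
  case less
  then show ?thesis using x y f nn
   by (auto simp: opE_2 T2_fin T2_zero1 T2_zero2 op_simps hecke_lin nx cnt2_fin rs_fin power_int_minus sc_simps,
     ((intro poly_mapping_eqI, simp add: lookup_add lookup_minus field_simps power2_eq_square)+)?)
 next
  case equal
  then show ?thesis using x y f nn
   by (auto simp: opE_2 T2_fin T2_zero1 T2_zero2 op_simps hecke_lin nx cnt2_fin rs_fin power_int_minus sc_simps,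
     ((intro poly_mapping_eqI, simp add: lookup_add lookup_minus field_simps power2_eq_square)+)?)
 next
  case greater
  then show ?thesis using x y f nn
   by (auto simp: opE_2 T2_fin T2_zero1 T2_zero2 op_simps hecke_lin nx cnt2_fin rs_fin power_int_minus sc_simps,
     ((intro poly_mapping_eqI, simp add: lookup_add lookup_minus field_simps power2_eq_square)+)?)
 qed
 then show ?thesis using True by simp
qed

lemma F_T2:
 assumes i: "i : {1..<n}" and x: "x : {1..int n}" and y: "y : {1..int n}"
 shows "opF i (tT (Suc 0) (mon [x, y])) = tT (Suc 0) (opF i (mon [x, y]))"
proof -
 have nx: "nx n i = Suc i" and i1: "1 \<le> int i" "int i < int n" using i by (auto simp: nx_def)
 have f: "int i : {1..int n}" "1 + int i : {1..int n}" "int i + 1 : {1..int n}" using i1 by auto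
 show ?thesis
 proof (cases x y rule: linorder_cases)
  case less
  then show ?thesis using x y f
   by (auto simp: opF_2 T2_fin op_simps hecke_lin nx cnt2_fin rs_fin power_int_minus sc_simps,
     (intro poly_mapping_eqI, simp add: lookup_add lookup_minus field_simps power2_eq_square)+)
 next
  case equal
  then show ?thesis using x y f
   by (auto simp: opF_2 T2_fin op_simps hecke_lin nx cnt2_fin rs_fin power_int_minus sc_simps,
     (intro poly_mapping_eqI, simp add: lookup_add lookup_minus field_simps power2_eq_square)+)
 next
  case greater
  then show ?thesis using x y f
   by (auto simp: opF_2 T2_fin op_simps hecke_lin nx cnt2_fin rs_fin power_int_minus sc_simps,
     (intro poly_mapping_eqI, simp add: lookup_add lookup_minus field_simps power2_eq_square)+)
 qed
qed

lemma op_Omega: "v : Omega s ==> opE i v : Omega s" "v : Omega s ==> opF i v : Omega s" "v : Omega s ==> opK i v : Omega s"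
  "v : Omega s ==> opKi i v : Omega s" "v : Omega s ==> opZ (sg e * int t * int n) v : Omega s"
 using opD_Omega [of v s "dEg i"] opD_Omega [of v s "dFg i"] opD_Omega [of v s "dKg i"]
  opD_Omega [of v s "dKig i"] opD_Omega [of v s "dZg e t"] by simp_all

lemma dg_Omega: "v : Omega s ==> dg \<chi> v : Omega s"
 by (induction rule: Omega_induct) (auto simp: dg_simps dg_mon Omega_closed)

lemma dg_Omega_fin: "v : Omega_fin n s ==> dg \<chi> v : Omega_fin n s"
 by (induction rule: Omega_fin_induct) (auto simp: dg_simps dg_mon Omega_fin_closed)

lemma mon_split: "mon (u @ x # y # v) = mon u * (mon [x, y] * mon v)"
 by (simp add: mon_mult)

lemma T_split:
 assumes "x : Omega l" "m : Omega 2" "y : Omega s'" "k = Suc l"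
 shows "tT k (x * (m * y)) = x * (tT (Suc 0) m * y)"
proof -
 have "m * y : Omega (2 + s')" using assms unfolding Omega_supp by (intro supp_mult) auto
 then show ?thesis using T_left [OF assms(1), of "m * y" "2 + s'" "Suc 0"] T_right [OF assms(2), of "Suc 0" y] assms(4)
  by simp
qed

text \<open>The operators are skew derivations and \<open>T\<^sub>k\<close> sees two letters only, so the claim
  reduces to words of length two.\<close>

lemma E_T: "i : {1..n} ==> v : Omega_fin n s ==> k : {1..<s} ==> opE i (tT k v) = tT k (opE i v)"
proof -
 assume i: "i : {1..n}" and v: "v : Omega_fin n s" and k: "k : {1..<s}"
 from v show ?thesis
 proof (induction rule: Omega_fin_induct)
  case (mon w)
  obtain u x y v where w: "w = u @ x # y # v" and k': "k = Suc (length u)" using word_split2 [OF k mon(1)] by blast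
  have xy: "x : {1..int n}" "y : {1..int n}" using mon(2) w by (auto simp: fin_word_def)
  let ?m = "mon [x, y]"
  have O: "mon u : Omega (length u)" "?m : Omega 2" "mon v : Omega (length v)" by (simp_all add: Omega_closed)
  have "?m : Omega_fin n 2" using xy by (simp add: Omega_fin_closed fin_word_def)
  then have K: "opKt i (tT (Suc 0) ?m) = tT (Suc 0) (opKt i ?m)" by (intro dg_T) auto
  show ?case unfolding w mon_split
   by (simp add: T_split [OF _ _ _ k', where s' = "length v"] O op_Omega dg_Omega opE_mult dg_mult hecke_lin K E_T2 [OF i xy] distrib_left distrib_right)
 qed (simp_all add: hecke_lin op_simps)
qed

lemma F_T: "i : {1..<n} ==> v : Omega_fin n s ==> k : {1..<s} ==> opF i (tT k v) = tT k (opF i v)"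
proof -
 assume i: "i : {1..<n}" and v: "v : Omega_fin n s" and k: "k : {1..<s}"
 from v show ?thesis
 proof (induction rule: Omega_fin_induct)
  case (mon w)
  obtain u x y v where w: "w = u @ x # y # v" and k': "k = Suc (length u)" using word_split2 [OF k mon(1)] by blast
  have xy: "x : {1..int n}" "y : {1..int n}" using mon(2) w by (auto simp: fin_word_def)
  let ?m = "mon [x, y]"
  have O: "mon u : Omega (length u)" "?m : Omega 2" "mon v : Omega (length v)" by (simp_all add: Omega_closed)
  have "?m : Omega_fin n 2" using xy by (simp add: Omega_fin_closed fin_word_def)
  then have K: "opKti i (tT (Suc 0) ?m) = tT (Suc 0) (opKti i ?m)" by (intro dg_T) auto
  show ?case unfolding w mon_split
   by (simp add: T_split [OF _ _ _ k', where s' = "length v"] O op_Omega dg_Omega opF_mult dg_mult hecke_lin K F_T2 [OF i xy] distrib_left distrib_right)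
 qed (simp_all add: hecke_lin op_simps)
qed

lemma E_Omega_fin:
 assumes i: "i : {1..<n}" and v: "v : Omega_fin n s"
 shows "opE i v : Omega_fin n s"
 using v
proof (induction rule: Omega_fin_induct)
 have *: "fin_word w ==> i : {1..<n} ==> Ew i w : Omega_fin n (length w)" for w
 proof (induction w)
  case (Cons x w)
  have "mon [x] * Ew i w : Omega_fin n (Suc (length w))"
   unfolding Omega_fin_supp' using Cons unfolding Omega_fin_supp'
   by (intro supp_mult [where A = "{[x]}" and B = "{u. length u = length w \<and> fin_word u}"]) (auto simp: fin_word_def)
  then show ?case using Cons
   by (auto simp: Omega_fin_closed fin_word_def rs_fin nx_def intro!: Omega_fin_closed)
 qed (simp add: Omega_fin_closed)
 case (mon w)
 then show ?case using *[of w] i by (simp add: opE_def)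
qed (auto simp: op_simps Omega_fin_closed)

lemma F_Omega_fin:
 assumes i: "i : {1..<n}" and v: "v : Omega_fin n s"
 shows "opF i v : Omega_fin n s"
 using v
proof (induction rule: Omega_fin_induct)
 have *: "fin_word w ==> i : {1..<n} ==> Fw i w : Omega_fin n (length w)" for w
 proof (induction w)
  case (Cons x w)
  have "mon [x] * Fw i w : Omega_fin n (Suc (length w))"
   unfolding Omega_fin_supp' using Cons unfolding Omega_fin_supp'
   by (intro supp_mult [where A = "{[x]}" and B = "{u. length u = length w \<and> fin_word u}"]) (auto simp: fin_word_def)
  then show ?case using Cons
   by (auto simp: Omega_fin_closed fin_word_def rs_fin mult.assoc intro!: Omega_fin_closed)
 qed (simp add: Omega_fin_closed)
 case (mon w)
 then show ?case using *[of w] i by (simp add: opF_def)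
qed (auto simp: op_simps Omega_fin_closed)

text \<open>The central elements act through power sums.\<close>

lemma X_pow_mon: "j : {1..length w} ==> (tX j ^^ t) (mon w) = mon (w[j - 1 := w ! (j - 1) - int t * int n])"
 by (induction t) (auto simp: X_mon algebra_simps)

lemma Zw_sum: "Zw d w = (\<Sum>j<length w. mon (w[j := w ! j - d]))"
proof (induction w)
 case (Cons x w)
 then show ?case by (simp add: sum.lessThan_Suc_shift sum_distrib_left mon_mult del: sum.lessThan_Suc)
qed simp

lemma opZ_X: "v : Omega s ==> opZ (int t * int n) v = (\<Sum>j\<in>{1..s}. (tX j ^^ t) v)"
proof (induction rule: Omega_induct)
 case (mon w)
 have "(\<Sum>j\<in>{1..s}. (tX j ^^ t) (mon w)) = (\<Sum>j\<in>{1..s}. mon (w[j - 1 := w ! (j - 1) - int t * int n]))"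
  by (rule sum.cong) (use mon X_pow_mon in auto)
 also have "... = (\<Sum>j<s. mon (w[j := w ! j - int t * int n]))"
  by (rule sum.reindex_bij_witness [where i = Suc and j = "\<lambda>j. j - 1"]) auto
 finally show ?case using mon by (simp add: opZ_def Zw_sum)
next
 case zero
 have "(tX j ^^ t) 0 = 0" for j by (induction t) (simp_all add: hecke_lin)
 then show ?case by (simp add: op_simps)
next
 case (add x y)
 have "(tX j ^^ t) (x + y) = (tX j ^^ t) x + (tX j ^^ t) y" for j by (induction t) (simp_all add: hecke_lin)
 then show ?case using add by (simp add: op_simps sum.distrib)
next
 case (cst c x)
 have "(tX j ^^ t) (cst c * x) = cst c * (tX j ^^ t) x" for j by (induction t) (simp_all add: hecke_lin)
 then show ?case using cst by (simp add: op_simps sum_distrib_left)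
qed

definition opC :: "nat => int fa => int fa" where
 "opC t v = (\<Sum>j\<in>{1..r}. (opJ j ^^ t) v)"

lemma linear_J_pow: "linear_map (opJ j ^^ t)"
 by (induction t) (auto simp: linear_map_def J_lin)

lemma linear_opC [simp]: "linear_map (opC t)"
 unfolding opC_def by (intro linear_map_sums linear_J_pow)

lemma epsl_X_pow: "j : {1..r} ==> v : Omega r ==> epsl ((tX j ^^ t) v) = (opJ j ^^ t) (epsl v)"
proof (induction t)
 case (Suc t)
 have "(tX j ^^ t) v : Omega r" by (induction t) (use Suc hecke_Omega in auto)
 then show ?case using Suc by (simp add: epsl_X)
qed simp

lemma epsl_opZ: "v : Omega_fin n r ==> epsl (opZ (int t * int n) v) = opC t v"
 using Omega_fin_Omega [of v r]
 by (simp add: opZ_X [of v r] eps_lin opC_def epsl_X_pow epsl_fin)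

lemma opC_Omega_fin: "v : Omega_fin n r ==> opC t v : Omega_fin n r"
proof -
 assume v: "v : Omega_fin n r"
 have "(opJ j ^^ t) v : Omega_fin n r" if "j : {1..r}" for j
  by (induction t) (use that v J_Omega_fin in auto)
 then show ?thesis unfolding opC_def by (intro Omega_fin_closed)
qed

lemma T_J_pow_far: "k : {1..<r} ==> j : {1..r} ==> j ~= k ==> j ~= k + 1 ==> v : Omega r ==> tT k ((opJ j ^^ t) v) = (opJ j ^^ t) (tT k v)"
 by (induction t) (simp_all add: T_J_far J_pow_Omega)

text \<open>Power sums of two neighbouring Jucys--Murphy operators commute with \<open>T\<^sub>k\<close>, by Newton's recursion.\<close>

lemma T_J_pow:
 assumes k: "k : {1..<r}" and v: "v : Omega r"
 shows "tT k ((opJ k ^^ t) v + (opJ (k + 1) ^^ t) v) = (opJ k ^^ t) (tT k v) + (opJ (k + 1) ^^ t) (tT k v)"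
 using v
proof (induction t arbitrary: v rule: less_induct)
 case (less t)
 note B = J_Bernstein1 [OF k] J_Bernstein2 [OF k]
 have kr: "k : {1..r}" "k + 1 : {1..r}" using k by auto
 let ?e1 = "\<lambda>v. opJ k v + opJ (k + 1) v" and ?e2 = "\<lambda>v. opJ k (opJ (k + 1) v)"
 have e1: "tT k (?e1 v) = ?e1 (tT k v)" if "v : Omega r" for v
  using that by (simp add: hecke_lin B del: One_nat_def add_Suc_right)
 have e2: "tT k (?e2 v) = ?e2 (tT k v)" if "v : Omega r" for v
  using that J_J [OF kr] hecke_Omega [OF that]
  by (simp add: B J_Omega J_lin del: One_nat_def add_Suc_right)
 consider "t = 0" | "t = 1" | t' where "t = Suc (Suc t')"
  by (metis One_nat_def not0_implies_Suc)
 then show ?case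
 proof cases
  case 1
  then show ?thesis by (simp add: hecke_lin)
 next
  case 2
  then show ?thesis using e1 less by simp
 next
  case 3
  have N: "(opJ k ^^ t) v + (opJ (k + 1) ^^ t) v =
   ((opJ k ^^ Suc t') (?e1 v) + (opJ (k + 1) ^^ Suc t') (?e1 v)) - ((opJ k ^^ t') (?e2 v) + (opJ (k + 1) ^^ t') (?e2 v))"
   if v: "v : Omega r" for v
  proof -
   have 1: "(opJ k ^^ Suc t') (opJ (k + 1) v) = (opJ k ^^ t') (?e2 v)" for v by (simp add: funpow_swap1)
   have 2: "(opJ (k + 1) ^^ Suc t') (opJ k v) = (opJ (k + 1) ^^ t') (?e2 v)" using J_J [OF kr v] by (simp add: funpow_swap1)
   have 3: "(opJ k ^^ Suc t') (opJ k v) = (opJ k ^^ t) v" "(opJ (k + 1) ^^ Suc t') (opJ (k + 1) v) = (opJ (k + 1) ^^ t) v"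
    by (simp_all only: \<open>t = Suc (Suc t')\<close> funpow_Suc_right comp_def)
   show ?thesis
    by (simp only: linear_map_add [OF linear_J_pow] 1 2 3) simp
  qed
  have O: "?e1 v : Omega r" "?e2 v : Omega r" "tT k v : Omega r"
   using less.prems by (auto intro!: Omega_closed J_Omega hecke_Omega)
  have a: "tT k ((opJ k ^^ Suc t') (?e1 v) + (opJ (k + 1) ^^ Suc t') (?e1 v)) =
    (opJ k ^^ Suc t') (?e1 (tT k v)) + (opJ (k + 1) ^^ Suc t') (?e1 (tT k v))"
   unfolding e1 [OF less.prems, symmetric] by (rule less.IH) (use 3 O in auto)
  have b: "tT k ((opJ k ^^ t') (?e2 v) + (opJ (k + 1) ^^ t') (?e2 v)) =
    (opJ k ^^ t') (?e2 (tT k v)) + (opJ (k + 1) ^^ t') (?e2 (tT k v))"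
   unfolding e2 [OF less.prems, symmetric] by (rule less.IH) (use 3 O in auto)
  show ?thesis
   unfolding N [OF less.prems] N [OF O(3)] linear_map_diff [OF linear_hecke] a b by (rule refl)
 qed
qed

text \<open>Only the two operators at the positions \<open>k\<close> and \<open>k + 1\<close> are moved by
  \<open>T\<^sub>k\<close>, and their power sum is symmetric.\<close>

lemma opC_T: "k : {1..<r} ==> v : Omega r ==> tT k (opC t v) = opC t (tT k v)"
proof -
 assume k: "k : {1..<r}" and v: "v : Omega r"
 have s: "(\<Sum>j\<in>{1..r}. f j) = f k + f (k + 1) + (\<Sum>j\<in>{1..r} - {k, k + 1}. f j)" for f :: "nat => int fa"
  using k by (subst sum.subset_diff [of "{k, k + 1}"]) (auto simp: add.commute)
 have far: "(\<Sum>j\<in>{1..r} - {k, k + 1}. tT k ((opJ j ^^ t) v)) = (\<Sum>j\<in>{1..r} - {k, k + 1}. (opJ j ^^ t) (tT k v))"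
  by (rule sum.cong) (use T_J_pow_far k v in auto)
 show ?thesis unfolding opC_def s using T_J_pow [OF k v, of t] far
  by (simp add: hecke_lin)
qed

section \<open>The Schur algebra and the evaluation homomorphism\<close>

lemma serre_closed: "x i : gens_alg G ==> x j : gens_alg G ==> serre n q x i j : gens_alg G"
 by (auto simp: serre_def Let_def intro!: gens_alg_sum gens_alg_closed gens_alg_power)

lemma D_gens_simps: "dEg i : D_gens n \<longleftrightarrow> i : {1..n}" "dFg i : D_gens n \<longleftrightarrow> i : {1..n}"
  "dKg i : D_gens n \<longleftrightarrow> i : {1..n}" "dKig i : D_gens n \<longleftrightarrow> i : {1..n}" "dZg e t : D_gens n \<longleftrightarrow> 1 \<le> t"
 by (auto simp: D_gens_def)

lemma D_rel_closed: "D_rel n q x y ==> x : gens_alg (D_gens n) \<and> y : gens_alg (D_gens n)"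
 by (induction rule: D_rel.induct)
  (simp_all add: D_gens_simps serre_closed nx_mem [unfolded atLeastAtMost_iff] del: One_nat_def)

sublocale D: presentation "D_gens n" "D_rel n q"
 by standard (rule D_rel_closed)

lemma D_cls_eq: "D_cls n q = D.cl"
 by (rule ext) (simp add: D_cls_def)

lemma Dn_eq: "Dn n q = D.Q"
 by (simp add: Dn_def)

abbreviation "lev x \<equiv> left_eval opD x"

lemma lev_Omega: "v : Omega r ==> lev x v : Omega r"
proof (induction x rule: fa_induct)
 case (mon w)
 then show ?case unfolding left_eval_mon by (induction w) (auto simp: opD_Omega)
qed (auto simp: left_eval_simps Omega_closed)

lemma lev_tens: "v : Omega r ==> left_eval (tens_act n q r) x v = lev x v"
proof (induction x rule: fa_induct)
 case (mon w)
 then show ?case unfolding left_eval_mon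
 proof (induction w)
  case (Cons g w)
  have "foldr opD w v : Omega r" using lev_Omega [OF mon, of "mon w"] by (simp add: left_eval_mon)
  then show ?case using Cons tens_act_opD [of "foldr opD w v" "r - 1" g] r1 by simp
 qed simp
qed (auto simp: left_eval_simps)

lemma lev_ideal:
 assumes "i : D.I" "v : Omega r"
 shows "lev i v = 0"
proof -
 have "D.I \<subseteq> {x : gens_alg (D_gens n). \<forall>v\<in>Omega r. lev x v = 0}"
 proof (rule D.I_least)
  fix x y assume "D_rel n q x y"
  then show "x - y : {x : gens_alg (D_gens n). \<forall>v\<in>Omega r. lev x v = 0}"
   using D_rel_op D_rel_closed by (auto simp: left_eval_simps)
 qed (auto simp: left_eval_simps left_eval_mult lev_Omega linear_map_0 [OF linear_left_eval_arg])
 then show ?thesis using assms by blast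
qed

lemma zeta_aff_cl: "zeta_aff n q r (D_cls n q x) = restrict (lev x) (Omega r)"
proof -
 have r: "restrict (left_eval (tens_act n q r) x) (Omega r) = restrict (lev x) (Omega r)" for x
  by (auto simp: lev_tens)
 show ?thesis
  unfolding zeta_aff_def D_cls_eq r
  by (rule D.the_elem_cl) (auto simp: left_eval_simps lev_ideal)
qed

lemma zeta_fin_cl: "zeta_fin n q r (D_cls n q x) = restrict (lev x) (Omega_fin n r)"
 by (auto simp: zeta_fin_def zeta_aff_cl Omega_fin_Omega)

lemma ev_schur_cl: "ev_schur n q r a (zeta_aff n q r (D_cls n q x)) = (\<lambda>v\<in>Omega_fin n r. epsl (lev x v))"
 by (auto simp: ev_schur_def zeta_aff_cl eps_eq Omega_fin_Omega lev_Omega)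

end

context evalm begin

section \<open>The evaluation of the affine raising operator\<close>

primrec wsum :: "int list => nat" where
 "wsum [] = 0"
| "wsum (x # w) = Suc (length w) * nat x + wsum w"

lemma wsum_swap: "y < x ==> 0 < x ==> wsum (u @ y # x # v) < wsum (u @ x # y # v)"
 by (induction u) (auto simp: algebra_simps)

text \<open>As an \<open>H(r)\<close>-module the finite tensor space is generated by the weakly increasing words.\<close>

lemma sorted_generate:
 assumes lin: "linear_map f" "linear_map g"
  and fT: "!!k v. k : {1..<s} ==> v : Omega_fin n s ==> f (tT k v) = tT k (f v)"
  and gT: "!!k v. k : {1..<s} ==> v : Omega_fin n s ==> g (tT k v) = tT k (g v)"
  and eq: "!!w. length w = s ==> fin_word w ==> sorted w ==> f (mon w) = g (mon w)"
  and v: "v : Omega_fin n s"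
 shows "f v = g v"
 using v
proof (induction rule: Omega_fin_induct)
 case (mon w)
 then show ?case
 proof (induction "wsum w" arbitrary: w rule: less_induct)
  case less
  show ?case
  proof (cases "sorted w")
   case False
   then obtain i where i: "Suc i < length w" "w ! Suc i < w ! i"
    by (auto simp: sorted_iff_nth_Suc not_le)
   then have k: "Suc i : {1..<s}" using less by auto
   obtain u x y v where w: "w = u @ x # y # v" "Suc i = Suc (length u)"
    using word_split2 [OF k less.prems(1)] by blast
   have yx: "y < x" using i w by (simp add: nth_append)
   have fin: "x : {1..int n}" "y : {1..int n}" "fin_word (u @ y # x # v)"
    using less.prems w by (auto simp: fin_word_def)
   have T: "tT (Suc i) (mon (u @ y # x # v)) = cst q * mon w"
    using T_fin [OF fin(2,1), of u v] yx w by simp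
   have m: "mon (u @ y # x # v) : Omega_fin n s" using fin less.prems w by (simp add: Omega_fin_closed)
   have "f (mon (u @ y # x # v)) = g (mon (u @ y # x # v))"
    by (rule less.hyps) (use wsum_swap [OF yx] fin less.prems w in auto)
   then have "cst q * f (mon w) = cst q * g (mon w)"
    using fT [OF k m] gT [OF k m] by (simp add: T linear_map_cst [OF lin(1)] linear_map_cst [OF lin(2)])
   then have "cst (inverse q) * (cst q * f (mon w)) = cst (inverse q) * (cst q * g (mon w))" by simp
   then show ?thesis by (simp add: cst_mult_assoc)
  qed (use eq less in auto)
 qed
qed (use lin in \<open>simp_all add: linear_map_simps\<close>)

text \<open>The Jucys--Murphy operator at a letter \<open>z\<close> that is preceded by a weakly increasing word with smaller
 letters: apart from the identity it exchanges \<open>z\<close> with each of the earlier letters.\<close>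

definition occ :: "int list => nat => nat" where
 "occ u j = count_list (drop (Suc j) u) (u ! j)"

lemma count_list_append: "count_list (u @ v) x = count_list u x + count_list v x"
 by (induction u) auto

lemma J_formula:
 assumes "sorted u" "\<forall>x\<in>set u. x < z" "fin_word (u @ z # v)" "length (u @ z # v) = r"
 shows "opJ (Suc (length u)) (mon (u @ z # v)) =
  cst a * (mon (u @ z # v) + cst (q - inverse q) * (\<Sum>j<length u. cst (q ^ occ u j) * mon (u[j := z] @ u ! j # v)))"
 using assms
proof (induction u arbitrary: v rule: rev_induct)
 case Nil
 then show ?case using J_1 [of "mon (z # v)"] by (simp add: Omega_closed)
next
 case (snoc c u)
 let ?k = "length u"
 have k: "Suc ?k : {1..<r}" using snoc.prems by auto
 have f: "c : {1..int n}" "z : {1..int n}" "!!x. x : set u ==> x : {1..int n}" and cz: "c < z"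
  using snoc.prems by (auto simp: fin_word_def)
 have su: "!!x. x : set u ==> x \<le> c" "sorted u" using snoc.prems by (auto simp: sorted_append)
 have O: "mon (u @ c # z # v) : Omega r" using snoc.prems by (simp add: Omega_closed)
 have IH: "opJ (Suc ?k) (mon (u @ z # c # v)) =
  cst a * (mon (u @ z # c # v) + cst (q - inverse q) * (\<Sum>j<?k. cst (q ^ occ u j) * mon (u[j := z] @ u ! j # c # v)))"
  by (rule snoc.IH) (use snoc.prems su in \<open>auto simp: fin_word_def\<close>)
 have T: "tT (Suc ?k) (mon (u[j := z] @ u ! j # c # v)) = cst (q * q ^ of_bool (u ! j = c)) * mon (u[j := z] @ c # u ! j # v)"
  if "j < ?k" for j
 proof -
  have "u ! j : set u" using that by simp
  then show ?thesis using T_fin [OF f(3) f(1), of "u ! j" "u[j := z]" v] su(1) [of "u ! j"]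
   by (auto simp: power2_eq_square)
 qed
 have occ: "occ (u @ [c]) j = occ u j + of_bool (u ! j = c)" if "j < ?k" for j
  using that by (auto simp: occ_def nth_append count_list_append)
 have occ': "occ (u @ [c]) ?k = 0" by (simp add: occ_def)
 have ring: "cst (inverse (q\<^sup>2)) * (cst (q * a) * (cst q * x + cst (q\<^sup>2 - 1) * y + cst (q - inverse q) * (cst q * t))) =
   cst a * (x + cst (q - inverse q) * (t + y))" for x y t :: "int fa"
  by (intro poly_mapping_eqI) (simp add: lookup_add field_simps power2_eq_square)
 have "opJ (Suc (Suc ?k)) (mon (u @ c # z # v)) = cst (inverse (q\<^sup>2)) * tT (Suc ?k) (opJ (Suc ?k) (tT (Suc ?k) (mon (u @ c # z # v))))"
  using J_Suc [OF k O] by simp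
 also have "tT (Suc ?k) (mon (u @ c # z # v)) = cst q * mon (u @ z # c # v)"
  using T_fin [OF f(1,2), of u v] cz by simp
 also have "tT (Suc ?k) (opJ (Suc ?k) (cst q * mon (u @ z # c # v))) =
   cst (q * a) * (tT (Suc ?k) (mon (u @ z # c # v)) + cst (q - inverse q) * (\<Sum>j<?k. cst (q ^ occ u j) * tT (Suc ?k) (mon (u[j := z] @ u ! j # c # v))))"
  by (simp add: J_lin IH hecke_lin cst_mult_assoc)
 also have "tT (Suc ?k) (mon (u @ z # c # v)) = cst q * mon (u @ c # z # v) + cst (q\<^sup>2 - 1) * mon (u @ z # c # v)"
  using T_fin [OF f(2,1), of u v] cz by simp
 also have "(\<Sum>j<?k. cst (q ^ occ u j) * tT (Suc ?k) (mon (u[j := z] @ u ! j # c # v))) =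
   cst q * (\<Sum>j<?k. cst (q ^ occ (u @ [c]) j) * mon (u[j := z] @ c # u ! j # v))"
  unfolding sum_distrib_left
  by (rule sum.cong) (simp_all add: T occ cst_mult_assoc power_add mult_ac)
 also have "cst (inverse (q\<^sup>2)) * (cst (q * a) * (cst q * mon (u @ c # z # v) + cst (q\<^sup>2 - 1) * mon (u @ z # c # v) +
   cst (q - inverse q) * (cst q * (\<Sum>j<?k. cst (q ^ occ (u @ [c]) j) * mon (u[j := z] @ c # u ! j # v))))) =
  cst a * (mon (u @ c # z # v) + cst (q - inverse q) * ((\<Sum>j<?k. cst (q ^ occ (u @ [c]) j) * mon (u[j := z] @ c # u ! j # v)) + mon (u @ z # c # v)))"
  by (rule ring)
 also have "(\<Sum>j<?k. cst (q ^ occ (u @ [c]) j) * mon (u[j := z] @ c # u ! j # v)) + mon (u @ z # c # v) =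
  (\<Sum>j<length (u @ [c]). cst (q ^ occ (u @ [c]) j) * mon ((u @ [c])[j := z] @ (u @ [c]) ! j # v))"
  by (simp add: occ' nth_append list_update_append)
 finally show ?case by simp
qed

lemma op_none:
 "(!!x. x : set w ==> rs n x ~= int (nx n i)) ==> opE i (mon w) = 0"
 "(!!x. x : set w ==> rs n x ~= int i) ==> opF i (mon w) = 0"
 "(!!x. x : set w ==> rs n x ~= int i) ==> cnt i w = 0"
proof -
 show "(!!x. x : set w ==> rs n x ~= int (nx n i)) ==> opE i (mon w) = 0"
  unfolding opE_def lin_ext_mon by (induction w) (auto, metis)
 show "(!!x. x : set w ==> rs n x ~= int i) ==> opF i (mon w) = 0"
  unfolding opF_def lin_ext_mon by (induction w) (auto, metis)
 show "(!!x. x : set w ==> rs n x ~= int i) ==> cnt i w = 0"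
  by (induction w) (auto simp: cnt_Cons)
qed

lemma dg_1_mon: "\<chi> w = 0 ==> dg \<chi> (mon w) = mon w"
 by (simp add: dg_mon)

text \<open>Root vectors: \<open>rv c d\<close> turns letters \<open>c\<close> into \<open>c + d + 1\<close>.\<close>

primrec rv :: "nat => nat => int fa => int fa" where
 "rv c 0 = opF c"
| "rv c (Suc d) = (\<lambda>v. opF (c + d + 1) (rv c d v) - cst (inverse q) * rv c d (opF (c + d + 1) v))"

lemma linear_rv [simp]: "linear_map (rv c d)"
 by (induction d) (auto simp: linear_map_def op_simps algebra_simps sc_simps mult.commute)

lemmas rv_lin = linear_map_simps [OF linear_rv]

definition exch :: "nat => nat => nat => int fa" where
 "exch c d m = (\<Sum>j<m. cst (q powi (- int j)) * mon (replicate j (int c) @ (int c + int d + 1) # replicate (m - 1 - j) (int c)))"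

lemma F_replicate:
 assumes c: "1 \<le> c" "c < n"
 shows "opF c (mon (replicate m (int c))) = exch c 0 m"
proof (induction m)
 case 0
 then show ?case by (simp add: exch_def mon_Nil)
next
 case (Suc m)
 have r: "rs n (int c) = int c" using c by (simp add: rs_fin)
 have k: "cnt2 c [int c] = 1" using c by (simp add: cnt2_def cnt_single r nx_def)
 have "opF c (mon (replicate (Suc m) (int c))) = opF c (mon [int c] * mon (replicate m (int c)))"
  by (simp add: mon_mult)
 also have "... = mon ((int c + 1) # replicate m (int c)) + cst (q powi - 1) * (mon [int c] * exch c 0 m)"
  by (simp only: opF_letter r k Suc) (simp add: mon_mult sc_simps)
 also have "cst (q powi - 1) * (mon [int c] * exch c 0 m) =
  (\<Sum>j<m. cst (q powi (- int (Suc j))) * mon (replicate (Suc j) (int c) @ (int c + 1) # replicate (m - 1 - j) (int c)))"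
  unfolding exch_def sum_distrib_left
 proof (rule sum.cong)
  fix j assume "j : {..<m}"
  have "q powi (- int (Suc j)) = q powi - 1 * q powi (- int j)"
   unfolding q_powi_add by simp
  then show "cst (q powi - 1) * (mon [int c] * (cst (q powi - int j) * mon (replicate j (int c) @ (int c + int 0 + 1) # replicate (m - 1 - j) (int c)))) =
   cst (q powi - int (Suc j)) * mon (replicate (Suc j) (int c) @ (int c + 1) # replicate (m - 1 - j) (int c))"
   by (simp add: sc_simps mon_mult mult.commute)
 qed simp
 finally show ?case by (simp add: exch_def sum.lessThan_Suc_shift del: sum.lessThan_Suc)
qed

lemma F_exch:
 assumes c: "1 \<le> c" "z < n" and z: "z = c + d + 1"
 shows "opF z (exch c d m) = exch c (Suc d) m" "opKti z (exch c d m) = cst (inverse q) * exch c d m"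
proof -
 have r: "rs n (int c) = int c" "rs n (int z) = int z" and cz: "c < z" using c z by (simp_all add: rs_fin)
 have zi: "int c + int d + 1 = int z" "int c + int (Suc d) + 1 = int z + 1" using z by simp_all
 have nx: "nx n z = Suc z" using c by (simp add: nx_def)
 have cn: "cnt i (replicate j (int c)) = 0" if "c < i" for i j
  by (rule op_none(3)) (use r that in auto)
 have K: "opKti z (mon (replicate j (int c))) = mon (replicate j (int c))" for j
  by (rule dg_1_mon) (use cz in \<open>simp add: cnt2_def nx cn\<close>)
 have F0: "opF z (mon (replicate j (int c))) = 0" for j by (rule op_none(2)) (use r cz in auto)
 have e: "mon (replicate j (int c) @ x # replicate k (int c)) =
   mon (replicate j (int c)) * (mon [x] * mon (replicate k (int c)))" for j k x by (simp add: mon_mult)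
 have "opF z (mon (replicate j (int c) @ int z # replicate k (int c))) =
   mon (replicate j (int c) @ (int z + 1) # replicate k (int c))" for j k
  unfolding e by (simp only: opF_mult [of _ "mon (replicate j (int c))"] F0 K opF_letter r(2)) simp
 then show "opF z (exch c d m) = exch c (Suc d) m" unfolding exch_def zi by (simp add: op_simps)
 have "cnt2 z (replicate j (int c) @ int z # replicate k (int c)) = 1" for j k
  using cz by (simp add: cnt2_def cnt_append cnt_Cons cn nx r(2))
 then show "opKti z (exch c d m) = cst (inverse q) * exch c d m"
  unfolding exch_def zi by (simp add: op_simps dg_mon sc_simps power_int_minus sum_distrib_left mult.commute)
qed

lemma F_upper:
 assumes z: "z < n" "int c \<le> int z" and v: "v : supp {w. set w \<subseteq> {int c<..int n}}"
 shows "opF z v : supp {w. set w \<subseteq> {int c<..int n}}"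
proof (rule supp_map [OF v linear_opF])
 fix w assume "w : {w. set w \<subseteq> {int c<..int n}}"
 then have "set w \<subseteq> {int c<..int n}" by simp
 then show "opF z (mon w) : supp {w. set w \<subseteq> {int c<..int n}}"
  unfolding opF_def lin_ext_mon
 proof (induction w)
  case (Cons x w)
  have "mon [x] * Fw z w : supp {w. set w \<subseteq> {int c<..int n}}"
   using Cons by (intro supp_mult [where A = "{[x]}" and B = "{w. set w \<subseteq> {int c<..int n}}"]) auto
  then show ?case using Cons z rs_fin [of x] by (auto simp: mult.assoc)
 qed simp
qed

text \<open>Only the letters \<open>c\<close> are affected: the commutator with the next lowering operator pushes the
  new letter up by one, and its terms on the remaining letters cancel.\<close>

lemma rv_formula:
 assumes c: "1 \<le> c" "c + d < n" and u: "\<forall>x\<in>set u. x : {1..<int c}"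
  and v: "v : supp {w. set w \<subseteq> {int c<..int n}}"
 shows "rv c d (mon u * (mon (replicate m (int c)) * v)) = mon u * (exch c d m * v)"
 using assms(2) v
proof (induction d arbitrary: v)
 case 0
 have uf: "rs n x = x" if "x : set u" for x using u c that by (intro rs_fin) auto
 have cu: "cnt i u = 0" if "c \<le> i" for i by (rule op_none(3)) (use uf u that in force)
 have Fu: "opF c (mon u) = 0" by (rule op_none(2)) (use uf u in force)
 have Ku: "opKti c (mon u) = mon u" by (rule dg_1_mon) (use 0 in \<open>simp add: cnt2_def cu nx_def\<close>)
 have "opF c v = 0"
  using 0(2)
 proof (induction rule: supp_induct)
  case (mon w)
  show ?case by (rule op_none(2)) (use mon c rs_fin in force)
 qed (simp_all add: op_simps)
 then show ?case using 0 c by (simp add: opF_mult Fu Ku F_replicate)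
next
 case (Suc d)
 define z where z: "z = c + d + 1"
 have zn: "z < n" and cz: "c < z" using Suc z by simp_all
 have uf: "rs n x = x" if "x : set u" for x using u c that by (intro rs_fin) auto
 have cu: "cnt i u = 0" if "c \<le> i" for i by (rule op_none(3)) (use uf u that in force)
 have Fu: "opF z (mon u) = 0" by (rule op_none(2)) (use uf u cz in force)
 have Ku: "opKti z (mon u) = mon u" by (rule dg_1_mon) (use zn cz in \<open>simp add: cnt2_def cu nx_def\<close>)
 have rc: "rs n (int c) = int c" using c by (simp add: rs_fin)
 have Fm: "opF z (mon (replicate m (int c))) = 0" by (rule op_none(2)) (use rc cz in auto)
 have cm: "cnt i (replicate m (int c)) = 0" if "c < i" for i
  by (rule op_none(3)) (use that rc in auto)
 have Km: "opKti z (mon (replicate m (int c))) = mon (replicate m (int c))"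
  by (rule dg_1_mon) (use zn cz in \<open>simp add: cnt2_def nx_def cm\<close>)
 have v: "opF z v : supp {w. set w \<subseteq> {int c<..int n}}"
  by (rule F_upper) (use zn cz Suc.prems in auto)
 have IH: "rv c d (mon u * (mon (replicate m (int c)) * v)) = mon u * (exch c d m * v)"
  "rv c d (mon u * (mon (replicate m (int c)) * opF z v)) = mon u * (exch c d m * opF z v)"
  using Suc.IH [OF _ Suc.prems(2)] Suc.IH [OF _ v] Suc.prems(1) by simp_all
 have "rv c (Suc d) (mon u * (mon (replicate m (int c)) * v)) =
  opF z (mon u * (exch c d m * v)) - cst (inverse q) * rv c d (opF z (mon u * (mon (replicate m (int c)) * v)))"
  by (simp only: rv.simps IH z)
 also have "opF z (mon u * (mon (replicate m (int c)) * v)) = mon u * (mon (replicate m (int c)) * opF z v)"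
  by (simp add: opF_mult Fu Ku Fm Km)
 also note IH(2)
 also have "opF z (mon u * (exch c d m * v)) = mon u * (exch c (Suc d) m * v) + cst (inverse q) * (mon u * (exch c d m * opF z v))"
  using F_exch [OF c(1) zn z] by (simp add: opF_mult Fu Ku distrib_left sc_simps)
 finally show ?case by simp
qed

lemma rv_T: "1 \<le> c ==> c + d < n ==> v : Omega_fin n s ==> k : {1..<s} ==>
  rv c d v : Omega_fin n s \<and> rv c d (tT k v) = tT k (rv c d v)"
proof (induction d arbitrary: v)
 case (Suc d)
 have i: "c + d + 1 : {1..<n}" using Suc by auto
 have F: "opF (c + d + 1) v : Omega_fin n s" by (rule F_Omega_fin) (use i Suc in auto)
 show ?case using Suc.IH [of v] Suc.IH [OF _ _ F] F_Omega_fin [OF i] F_T [OF i _ Suc.prems(4)] Suc.prems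
  by (auto simp: hecke_lin intro!: Omega_fin_closed)
qed (auto simp: F_T F_Omega_fin)

lemma sorted_split_min:
 assumes "sorted w" "\<forall>x\<in>set w. (c :: int) \<le> x"
 shows "\<exists>m w'. w = replicate m c @ w' \<and> (\<forall>x\<in>set w'. c < x) \<and> sorted w'"
 using assms
proof (induction w)
 case Nil
 then show ?case by (intro exI [of _ 0] exI [of _ "[]"]) auto
next
 case (Cons x w)
 show ?case
 proof (cases "x = c")
  case True
  obtain m w' where "w = replicate m c @ w'" "\<forall>x\<in>set w'. c < x" "sorted w'" using Cons by auto
  then show ?thesis using True by (intro exI [of _ "Suc m"] exI [of _ w']) auto
 next
  case False
  then show ?thesis using Cons by (intro exI [of _ 0] exI [of _ "x # w"]) fastforce
 qed
qed

lemma En_replicate: "opE n (mon (replicate m 1)) =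
  (\<Sum>k<m. cst (q powi (- int (m - 1 - k))) * mon (replicate k 1 @ 0 # replicate (m - 1 - k) 1))"
proof (induction m)
 case 0
 then show ?case by (simp add: mon_Nil)
next
 case (Suc m)
 have r: "rs n 1 = 1" "nx n n = 1" using n2 by (simp_all add: rs_fin nx_def)
 have "cnt n (replicate m 1) = 0" "cnt 1 (replicate m 1) = int m"
  using n2 r by (auto intro!: op_none(3)) (simp add: cnt_def r)
 then have k: "cnt2 n (replicate m 1) = - int m" by (simp add: cnt2_def r)
 have "opE n (mon (replicate (Suc m) 1)) = opE n (mon [1] * mon (replicate m 1))" by (simp add: mon_mult)
 also have "... = cst (q powi (- int m)) * mon (0 # replicate m 1) + mon [1] * opE n (mon (replicate m 1))"
  by (simp only: opE_letter) (simp add: r dg_mon k sc_simps mon_mult)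
 also have "mon [1] * opE n (mon (replicate m 1)) =
  (\<Sum>k<m. cst (q powi (- int (m - 1 - k))) * mon (replicate (Suc k) 1 @ 0 # replicate (m - 1 - k) 1))"
  by (simp add: Suc sum_distrib_left sc_simps mon_mult)
 finally show ?case by (simp add: sum.lessThan_Suc_shift del: sum.lessThan_Suc)
qed

lemma sum_triangle: "(\<Sum>k<(m :: nat). \<Sum>j<k. f k j) = (\<Sum>j<m. \<Sum>k\<in>{Suc j..<m}. (f k j :: 'a :: comm_monoid_add))"
proof (induction m)
 case (Suc m)
 have "(\<Sum>j<Suc m. \<Sum>k\<in>{Suc j..<Suc m}. f k j) = (\<Sum>j<m. (\<Sum>k\<in>{Suc j..<m}. f k j) + f m j)"
  by simp
 then show ?case by (simp add: Suc sum.distrib)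
qed simp

text \<open>The coefficient with which a letter \<open>1\<close> is replaced at a given position: the direct term and
  the exchange terms of the Jucys--Murphy operators form a geometric sum.\<close>

lemma telescope_coeff:
 "j < m ==> q powi (- int (m - 1 - j)) + (\<Sum>k\<in>{Suc j..<m}. q powi (- int (m - 1 - k)) * ((q - inverse q) * q ^ (k - 1 - j))) = q powi int (m - 1 - j)"
proof (induction m)
 case (Suc m)
 show ?case
 proof (cases "j = m")
  case False
  then have j: "j < m" using Suc by simp
  have "(\<Sum>k\<in>{Suc j..<m}. q powi (- int (m - k)) * ((q - inverse q) * q ^ (k - 1 - j))) =
   inverse q * (\<Sum>k\<in>{Suc j..<m}. q powi (- int (m - 1 - k)) * ((q - inverse q) * q ^ (k - 1 - j)))"
   unfolding sum_distrib_left
  proof (rule sum.cong)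
   fix k assume "k : {Suc j..<m}"
   then have "- int (m - k) = - 1 + - int (m - 1 - k)" by auto
   then have "q powi (- int (m - k)) = inverse q * q powi (- int (m - 1 - k))"
    using q_powi_add [of "-1" "- int (m - 1 - k)"] by (simp add: power_int_minus)
   then show "q powi (- int (m - k)) * ((q - inverse q) * q ^ (k - 1 - j)) =
    inverse q * (q powi (- int (m - 1 - k)) * ((q - inverse q) * q ^ (k - 1 - j)))" by simp
  qed simp
  also have "(\<Sum>k\<in>{Suc j..<m}. q powi (- int (m - 1 - k)) * ((q - inverse q) * q ^ (k - 1 - j))) =
    q powi int (m - 1 - j) - q powi (- int (m - 1 - j))"
   unfolding eq_diff_eq using Suc.IH [OF j] by (simp only: add.commute)
  finally have s: "(\<Sum>k\<in>{Suc j..<m}. q powi (- int (m - k)) * ((q - inverse q) * q ^ (k - 1 - j))) =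
   inverse q * (q powi int (m - 1 - j) - q powi (- int (m - 1 - j)))" .
  define M where "M = m - 1 - j"
  have e: "Suc m - 1 - j = Suc M" using j by (simp add: M_def)
  have pw: "q powi (- int (Suc M)) = inverse q * q powi (- int M)" "q powi int (Suc M) = q * q powi int M"
   using q_powi_add [of "-1" "- int M"] q_powi_add [of 1 "int M"] by (simp_all add: power_int_minus)
  have "(\<Sum>k\<in>{Suc j..<Suc m}. q powi (- int (Suc m - 1 - k)) * ((q - inverse q) * q ^ (k - 1 - j))) =
   inverse q * (q powi int M - q powi (- int M)) + (q - inverse q) * q powi int M"
  proof -
   have split: "(\<Sum>k\<in>{Suc j..<Suc m}. f k) = (\<Sum>k\<in>{Suc j..<m}. f k) + f m" for f :: "nat => complex"
    using j by simp
   have last: "q powi (- int (m - m)) * ((q - inverse q) * q ^ (m - 1 - j)) = (q - inverse q) * q powi int M"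
    unfolding M_def power_int_of_nat by simp
   show ?thesis unfolding split diff_Suc_1 s last M_def ..
  qed
  then show ?thesis unfolding e pw by (simp only:) (simp add: algebra_simps)
 qed simp
qed simp

text \<open>Both sides commute with the Hecke algebra, so it suffices to compare them on increasing words.\<close>

lemma eps_En:
 assumes "v : Omega_fin n r"
 shows "epsl (opE n v) = cst (a * inverse q) * rv 1 (n - 2) (opK 1 (opK n v))"
proof (rule sorted_generate [where s = r, OF _ _ _ _ _ assms])
 show "linear_map (\<lambda>v. epsl (opE n v))" by (simp add: linear_map_def op_simps eps_lin)
 show "linear_map (\<lambda>v. cst (a * inverse q) * rv 1 (n - 2) (opK 1 (opK n v)))"
  by (simp add: linear_map_def op_simps rv_lin distrib_left sc_simps mult_ac)
 show "epsl (opE n (tT k v)) = tT k (epsl (opE n v))" if k: "k : {1..<r}" and v: "v : Omega_fin n r" for k v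
  using n2 E_T [OF _ v k, of n] epsl_T [OF k] op_Omega(1) [OF Omega_fin_Omega [OF v]] by simp
 show "cst (a * inverse q) * rv 1 (n - 2) (opK 1 (opK n (tT k v))) = tT k (cst (a * inverse q) * rv 1 (n - 2) (opK 1 (opK n v)))"
  if k: "k : {1..<r}" and v: "v : Omega_fin n r" for k v
  using n2 by (simp add: dg_T [OF _ v k] dg_T [OF _ dg_Omega_fin [OF v] k] hecke_lin
    rv_T [OF _ _ dg_Omega_fin [OF dg_Omega_fin [OF v]] k])
 fix w :: "int list" assume w: "length w = r" "fin_word w" "sorted w"
 then have "\<forall>x\<in>set w. 1 \<le> x" by (auto simp: fin_word_def)
 then obtain m w' where ww: "w = replicate m 1 @ w'" and w': "\<forall>x\<in>set w'. 1 < x"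
  using sorted_split_min [OF w(3)] by blast
 have nx: "nx n n = 1" and r1: "rs n 1 = 1" using n2 by (simp_all add: nx_def rs_fin)
 have fw: "x : {1..int n} \<and> rs n x = x" if "x : set w'" for x
  using w(2) ww that rs_fin by (auto simp: fin_word_def)
 have c1: "cnt 1 w' = 0" by (rule op_none(3)) (use fw w' in auto)
 have E0: "opE n (mon w') = 0" by (rule op_none(1)) (use fw w' nx in auto)
 define V where "V j = mon (replicate j 1 @ int n # replicate (m - 1 - j) 1 @ w')" for j
 have J: "epsl (mon (replicate k 1 @ 0 # replicate (m - 1 - k) 1 @ w')) =
   cst a * (V k + (\<Sum>j<k. cst ((q - inverse q) * q ^ (k - 1 - j)) * V j))" if k: "k < m" for k
 proof -
  let ?x = "replicate k 1 @ int n # replicate (m - 1 - k) 1 @ w'"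
  have l: "length ?x = r" "fin_word ?x" using w ww k n2 by (auto simp: fin_word_def)
  have "mon (replicate k 1 @ 0 # replicate (m - 1 - k) 1 @ w') = tX (Suc k) (mon ?x)"
   by (simp add: X_mon nth_append list_update_append)
  moreover have "Suc k : {1..r}" using w ww k by auto
  ultimately have "epsl (mon (replicate k 1 @ 0 # replicate (m - 1 - k) 1 @ w')) = opJ (Suc k) (mon ?x)"
   using l by (simp add: epsl_X Omega_closed epsl_fin Omega_fin_closed)
  also have "... = cst a * (mon ?x + cst (q - inverse q) *
   (\<Sum>j<k. cst (q ^ occ (replicate k 1) j) *
    mon ((replicate k 1)[j := int n] @ replicate k 1 ! j # replicate (m - 1 - k) 1 @ w')))"
   using J_formula [of "replicate k 1" "int n" "replicate (m - 1 - k) 1 @ w'"] l n2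
   unfolding length_replicate by auto
  also have "(\<Sum>j<k. cst (q ^ occ (replicate k 1) j) *
    mon ((replicate k 1)[j := int n] @ replicate k 1 ! j # replicate (m - 1 - k) 1 @ w')) = (\<Sum>j<k. cst (q ^ (k - 1 - j)) * V j)"
  proof (rule sum.cong)
   fix j assume j: "j : {..<k}"
   have "count_list (replicate l (1 :: int)) 1 = l" for l by (induction l) auto
   then have "occ (replicate k 1) j = k - 1 - j" using j by (simp add: occ_def)
   moreover have "(replicate k 1)[j := int n] @ replicate k 1 ! j # replicate (m - 1 - k) 1 =
     replicate j (1 :: int) @ int n # replicate (m - 1 - j) 1"
    by (rule nth_equalityI) (use j k in \<open>auto simp: nth_append nth_list_update nth_Cons split: nat.split\<close>)
   ultimately show "cst (q ^ occ (replicate k 1) j) * mon ((replicate k 1)[j := int n] @ replicate k 1 ! j # replicate (m - 1 - k) 1 @ w') =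
     cst (q ^ (k - 1 - j)) * V j"
    unfolding V_def by (metis append.assoc append_Cons)
  qed simp
  also have "mon ?x = V k" by (simp add: V_def)
  finally show ?thesis by (simp add: sum_distrib_left cst_mult_assoc)
 qed
 have "epsl (opE n (mon w)) = cst (q powi cnt n w') *
   (\<Sum>k<m. cst (q powi (- int (m - 1 - k))) * epsl (mon (replicate k 1 @ 0 # replicate (m - 1 - k) 1 @ w')))"
  unfolding ww
  by (simp add: mon_mult [symmetric] opE_mult E0 En_replicate dg_mon cnt2_def nx c1 [simplified] sum_distrib_right eps_lin sc_simps)
   (simp add: mon_mult sum_distrib_left eps_lin sc_simps)
 also have "(\<Sum>k<m. cst (q powi (- int (m - 1 - k))) * epsl (mon (replicate k 1 @ 0 # replicate (m - 1 - k) 1 @ w'))) =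
   cst a * (\<Sum>k<m. cst (q powi (- int (m - 1 - k))) * V k + (\<Sum>j<k. cst (q powi (- int (m - 1 - k)) * ((q - inverse q) * q ^ (k - 1 - j))) * V j))"
  unfolding sum_distrib_left
 proof (rule sum.cong)
  fix k assume "k : {..<m}"
  then have k: "k < m" by simp
  show "cst (q powi (- int (m - 1 - k))) * epsl (mon (replicate k 1 @ 0 # replicate (m - 1 - k) 1 @ w')) =
   cst a * (cst (q powi (- int (m - 1 - k))) * V k + (\<Sum>j<k. cst (q powi (- int (m - 1 - k)) * ((q - inverse q) * q ^ (k - 1 - j))) * V j))"
   unfolding J [OF k] by (simp add: distrib_left sum_distrib_left sc_simps mult_ac)
 qed simp
 also have "(\<Sum>k<m. cst (q powi (- int (m - 1 - k))) * V k + (\<Sum>j<k. cst (q powi (- int (m - 1 - k)) * ((q - inverse q) * q ^ (k - 1 - j))) * V j)) =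
   (\<Sum>j<m. cst (q powi (- int (m - 1 - j)) + (\<Sum>k\<in>{Suc j..<m}. q powi (- int (m - 1 - k)) * ((q - inverse q) * q ^ (k - 1 - j)))) * V j)"
 proof -
  have "cst (sum g A) * x = (\<Sum>i\<in>A. cst (g i) * x)" for g :: "nat => complex" and A and x :: "int fa"
   by (induction A rule: infinite_finite_induct) (simp_all add: cst_add distrib_right)
  then show ?thesis by (simp add: sum.distrib sum_triangle cst_add distrib_right)
 qed
 also have "... = (\<Sum>j<m. cst (q powi int (m - 1 - j)) * V j)"
  by (rule sum.cong) (simp_all only: telescope_coeff lessThan_iff)
 finally have L: "epsl (opE n (mon w)) = cst (q powi cnt n w') * (cst a * (\<Sum>j<m. cst (q powi int (m - 1 - j)) * V j))" .
 have cw: "cnt 1 w = int m" "cnt n w = cnt n w'"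
  using n2 c1 by (simp_all add: ww cnt_append) (simp_all add: cnt_def r1)
 have n1: "1 + int (n - 2) + 1 = int n" using n2 by simp
 have "rv 1 (n - 2) (mon [] * (mon (replicate m (int 1)) * mon w')) = mon [] * (exch 1 (n - 2) m * mon w')"
  by (rule rv_formula) (use n2 w' fw in auto)
 then have "rv 1 (n - 2) (mon w) = (\<Sum>j<m. cst (q powi (- int j)) * V j)"
  by (simp add: ww mon_mult exch_def sum_distrib_right V_def n1 mult.assoc mon_Nil)
 then have R: "cst (a * inverse q) * rv 1 (n - 2) (opK 1 (opK n (mon w))) =
   cst (a * inverse q * q powi (cnt n w' + int m)) * (\<Sum>j<m. cst (q powi (- int j)) * V j)"
  by (simp add: dg_mon op_simps rv_lin cw cw(1) [simplified] sc_simps power_int_add mult_ac)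
 show "epsl (opE n (mon w)) = cst (a * inverse q) * rv 1 (n - 2) (opK 1 (opK n (mon w)))"
  unfolding L R sum_distrib_left
 proof (rule sum.cong)
  fix j assume "j : {..<m}"
  then have "int (m - 1 - j) = - 1 + int m + - int j" by auto
  then have "q powi int (m - 1 - j) = inverse q * q powi int m * q powi (- int j)"
   by (simp only: power_int_add q0 simp_thms) (simp add: power_int_minus)
  then show "cst (q powi cnt n w') * (cst a * (cst (q powi int (m - 1 - j)) * V j)) =
   cst (a * inverse q * q powi (cnt n w' + int m)) * (cst (q powi (- int j)) * V j)"
   by (simp add: sc_simps power_int_add mult_ac)
 qed simp
qed

end

section \<open>Highest weight vectors of the quantum loop algebra\<close>

text \<open>Congruence modulo a left ideal.  In the applications the ideal consists of the elements that annihilate a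
  vector, and congruent elements have the same effect on it.\<close>

locale lcong =
 fixes G :: "'g set" and N :: "'g fa set"
 assumes N_sub: "N \<subseteq> gens_alg G" and N_zero: "0 : N" and N_add: "x : N ==> y : N ==> x + y : N"
  and N_lmult: "u : gens_alg G ==> x : N ==> u * x : N"
begin

abbreviation "A \<equiv> gens_alg G"

definition eqv :: "'g fa => 'g fa => bool" (infix "~~" 50) where
 "x ~~ y \<longleftrightarrow> x - y : N"

lemma N_minus: "x : N ==> - x : N"
 using N_lmult [of "- 1" x] by simp

lemma eqv_refl [simp, intro]: "x ~~ x"
 by (simp add: eqv_def N_zero)

lemma eqv_sym: "x ~~ y ==> y ~~ x"
 using N_minus [of "x - y"] by (simp add: eqv_def)

lemma eqv_trans [trans]: "x ~~ y ==> y ~~ z ==> x ~~ z"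
 using N_add [of "x - y" "y - z"] by (simp add: eqv_def)

lemma eqv_add: "x ~~ y ==> x' ~~ y' ==> x + x' ~~ y + y'"
 using N_add [of "x - y" "x' - y'"] by (simp add: eqv_def algebra_simps)

lemma eqv_diff: "x ~~ y ==> x' ~~ y' ==> x - x' ~~ y - y'"
 using N_add [of "x - y" "- (x' - y')"] N_minus [of "x' - y'"] by (simp add: eqv_def algebra_simps)

lemma eqv_lmult: "u : A ==> x ~~ y ==> u * x ~~ u * y"
 using N_lmult [of u "x - y"] by (simp add: eqv_def right_diff_distrib)

lemma eqv_cst: "x ~~ y ==> cst c * x ~~ cst c * y"
 by (rule eqv_lmult) simp_all

lemma eqv_sum: "(!!i. i : S ==> f i ~~ g i) ==> sum f S ~~ sum g S"
 by (induction S rule: infinite_finite_induct) (auto intro: eqv_add)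

lemma eqv_0: "x ~~ 0 \<longleftrightarrow> x : N"
 by (simp add: eqv_def)

lemma eqv_cancel: "cst c * x ~~ cst d * y ==> c ~= 0 ==> x ~~ cst (d / c) * y"
 using eqv_cst [of "cst c * x" "cst d * y" "inverse c"] by (simp add: cst_mult_assoc divide_inverse mult.commute)

definition eq2 :: "'g fa => 'g fa => bool" where
 "eq2 x y \<longleftrightarrow> (\<forall>w\<in>A. x * w ~~ y * w)"

lemma eq2_refl [simp, intro]: "eq2 x x"
 and eq2_sym: "eq2 x y ==> eq2 y x"
 and eq2_trans [trans]: "eq2 x y ==> eq2 y z ==> eq2 x z"
 and eq2_add: "eq2 x y ==> eq2 x' y' ==> eq2 (x + x') (y + y')"
 and eq2_diff: "eq2 x y ==> eq2 x' y' ==> eq2 (x - x') (y - y')"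
 and eq2_lmult: "u : A ==> eq2 x y ==> eq2 (u * x) (u * y)"
 and eq2_rmult: "u : A ==> eq2 x y ==> eq2 (x * u) (y * u)"
 unfolding eq2_def
 by (auto simp: distrib_right left_diff_distrib mult.assoc intro: eqv_sym eqv_trans eqv_add eqv_diff eqv_lmult)

lemma eq2_cst: "eq2 x y ==> eq2 (cst c * x) (cst c * y)"
 by (rule eq2_lmult) simp_all

lemma eq2D: "eq2 x y ==> w : A ==> x * w ~~ y * w"
 by (simp add: eq2_def)

lemma eq2D1: "eq2 x y ==> x ~~ y"
 using eq2D [of x y 1] by simp

lemma eq2_mult: "eq2 x x' ==> eq2 y y' ==> x' : A ==> y : A ==> eq2 (x * y) (x' * y')"
 by (meson eq2_lmult eq2_rmult eq2_trans)

end

text \<open>The left ideal stands for the annihilator of a highest weight vector of weights \<open>q\<^bsup>d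
  i\<^esup>\<close> in some module of the quantum loop algebra.\<close>

locale loop = qparam + lcong "U_gens n" N for N :: "ugen fa set" +
 fixes d :: "nat => nat"
 assumes rel: "U_rel n q x y ==> w : gens_alg (U_gens n) ==> (x - y) * w : N"
  and hwX: "i : {1..<n} ==> uX Pos i s : N"
  and hwK: "i : {1..n} ==> uK i - cst (q ^ d i) : N"
begin

lemma rel2: "U_rel n q x y ==> eq2 x y"
 using rel by (simp add: eq2_def eqv_def left_diff_distrib)

lemma U_gens_simps [simp]: "uXg e i s : U_gens n \<longleftrightarrow> i : {1..<n}" "uKg i : U_gens n \<longleftrightarrow> i : {1..n}"
  "uKig i : U_gens n \<longleftrightarrow> i : {1..n}" "uGg i t : U_gens n \<longleftrightarrow> i : {1..n} \<and> t ~= 0"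
 by (auto simp: U_gens_def)

abbreviation "eE i \<equiv> uX Pos i 0"
abbreviation "eF i \<equiv> uX Neg i 0"
abbreviation "eF1 i \<equiv> uX Neg i 1"

lemma eE_closed: "i : {1..<n} ==> eE i : A"
 by auto

lemma qbr_closed [simp, intro]: "x : A ==> y : A ==> qbr b x y : A"
 by (simp add: qbr_def)

lemma eq2_qbr: "eq2 x x' ==> eq2 y y' ==> x : A ==> y : A ==> x' : A ==> y' : A ==> eq2 (qbr b x y) (qbr b x' y')"
 unfolding qbr_def mult.assoc by (intro eq2_diff eq2_cst eq2_mult)

lemma comm_qbr:
 assumes "e : A" "x : A" "y : A" "eq2 (e * x) (x * e)" "eq2 (e * y) (y * e)"
 shows "eq2 (e * qbr b x y) (qbr b x y * e)"
proof -
 have *: "eq2 (e * (x * y)) (x * y * e)" if "x : A" "y : A" "eq2 (e * x) (x * e)" "eq2 (e * y) (y * e)" for x y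
 proof -
  have "eq2 (e * x * y) (x * e * y)" by (rule eq2_rmult) (use that in auto)
  also have "eq2 (x * (e * y)) (x * (y * e))" by (rule eq2_lmult) (use that in auto)
  then have "eq2 (x * e * y) (x * y * e)" by (simp add: mult.assoc)
  finally show ?thesis by (simp add: mult.assoc)
 qed
 have "eq2 (e * (x * y) - cst b * (e * (y * x))) (x * y * e - cst b * (y * x * e))"
  by (intro eq2_diff eq2_cst *) (use assms in auto)
 then show ?thesis by (simp add: qbr_def algebra_simps times_cst_left)
qed

lemma qbr_assoc:
 assumes A: "x : A" "y : A" "z : A" and c: "eq2 (x * z) (z * x)"
 shows "eq2 (qbr c x (qbr b y z)) (qbr b (qbr c x y) z)"
proof -
 have "qbr c x (qbr b y z) = (x * y * z - cst b * (x * z * y)) - (cst c * (y * (z * x)) - cst (c * b) * (z * y * x))"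
  by (simp add: qbr_def algebra_simps sc_simps)
 also have "eq2 \<dots> ((x * y * z - cst b * (z * x * y)) - (cst c * (y * (x * z)) - cst (c * b) * (z * y * x)))"
  by (intro eq2_diff eq2_cst eq2_refl eq2_rmult [OF A(2) c] eq2_lmult [OF A(2) eq2_sym [OF c]])
 also have "... = qbr b (qbr c x y) z"
  by (simp add: qbr_def algebra_simps sc_simps mult.commute)
 finally show ?thesis .
qed

lemma XX_comm: "i : {1..<n} ==> j : {1..<n} ==> i ~= j ==> eq2 (uX Pos i s * uX Neg j t) (uX Neg j t * uX Pos i s)"
proof -
 assume ij: "i : {1..<n}" "j : {1..<n}" "i ~= j"
 have "eq2 (uX Pos i s * uX Neg j t - uX Neg j t * uX Pos i s + uX Neg j t * uX Pos i s) (0 + uX Neg j t * uX Pos i s)"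
  using rel2 [OF U_rel.intros(10) [of i n j q s t]] ij by (intro eq2_add) auto
 then show ?thesis by simp
qed

lemma FF_comm: "i : {1..<n} ==> j : {1..<n} ==> \<bar>int i - int j\<bar> > 1 ==> eq2 (uX e i s * uX e j t) (uX e j t * uX e i s)"
 by (rule rel2) (rule U_rel.intros)

text \<open>The Drinfeld relation between neighbouring indices moves the degree from one factor of a commutator to the
  other, at the price of a power of \<open>q\<close>.\<close>

lemma F_exchange: "i : {1..<n} ==> Suc i : {1..<n} ==>
  eq2 (qbr (inverse q) (eF (Suc i)) (eF1 i)) (cst (inverse q) * qbr q (eF1 (Suc i)) (eF i))"
proof -
 assume i: "i : {1..<n}" "Suc i : {1..<n}"
 have c: "cartan n i (Suc i) = -1" using i by (auto simp: cartan_def nx_def)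
 have "eq2 (qbr q (eF1 i) (eF (Suc i))) (- qbr q (eF1 (Suc i)) (eF i))"
  using rel2 [OF U_rel.intros(12) [of i n "Suc i" q Neg 0 0]] i c by simp
 moreover have "cst (- inverse q) * qbr q (eF1 i) (eF (Suc i)) = qbr (inverse q) (eF (Suc i)) (eF1 i)"
  "cst (- inverse q) * - qbr q (eF1 (Suc i)) (eF i) = cst (inverse q) * qbr q (eF1 (Suc i)) (eF i)"
  by (intro poly_mapping_eqI, simp add: qbr_def mult.assoc lookup_minus field_simps)+
 ultimately show ?thesis
  using eq2_cst [of "qbr q (eF1 i) (eF (Suc i))" "- qbr q (eF1 (Suc i)) (eF i)" "- inverse q"] by simp
qed

lemma phi_0: "phi n q e i 0 = uKt n e i"
 by (simp add: phi_def phi_series_def fexp_def)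

lemma XX_same: "i : {1..<n} ==> w : A ==> uX Pos i s * (uX Neg i t * w) ~~
  uX Neg i t * (uX Pos i s * w) + cst (inverse (q - inverse q)) * ((phi n q Pos i (s + t) - phi n q Neg i (s + t)) * w)"
proof -
 assume i: "i : {1..<n}" and w: "w : A"
 have "(uX Pos i s * uX Neg i t - uX Neg i t * uX Pos i s) * w ~~
   cst (inverse (q - inverse q)) * (phi n q Pos i (s + t) - phi n q Neg i (s + t)) * w"
  using eq2D [OF rel2 [OF U_rel.intros(10) [of i n i q s t]] w] i by simp
 from eqv_add [OF eqv_refl [of "uX Neg i t * (uX Pos i s * w)"] this] show ?thesis
  by (simp add: algebra_simps)
qed

definition wt :: "nat => int => ugen fa => bool" where
 "wt i k z \<longleftrightarrow> z : A \<and> uK i * z ~~ cst (q powi k) * z"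

lemma wt_inv:
 assumes "i : {1..n}" "wt i k z"
 shows "uKi i * z ~~ cst (q powi (- k)) * z"
proof -
 have z: "z : A" using assms by (simp add: wt_def)
 have "uKi i * (uK i * z) ~~ uKi i * (cst (q powi k) * z)" by (rule eqv_lmult) (use assms in \<open>auto simp: wt_def\<close>)
 moreover have "uKi i * uK i * z ~~ 1 * z" by (rule eq2D [OF rel2 z]) (rule U_rel.intros, use assms in auto)
 ultimately have "z ~~ uKi i * (cst (q powi k) * z)" by (metis eqv_sym eqv_trans mult.assoc mult_1)
 then have "cst (q powi (- k)) * z ~~ cst (q powi (- k)) * (cst (q powi k) * (uKi i * z))"
  by (intro eqv_cst) (simp only: times_cst_left [of "uKi i"])
 then have "cst (q powi (- k)) * z ~~ uKi i * z" by (simp add: cst_mult_assoc power_int_minus)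
 then show ?thesis by (rule eqv_sym)
qed

lemma wt_Kt:
 assumes i: "i : {1..<n}" and w: "wt i k z" "wt (Suc i) l z"
 shows "uKt n Pos i * z ~~ cst (q powi (k - l)) * z" "uKt n Neg i * z ~~ cst (q powi (l - k)) * z"
proof -
 have nx: "nx n i = Suc i" using i by (simp add: nx_def)
 have A: "uK i : A" "uK (Suc i) : A" using i by auto
 have "uK i * (uKi (Suc i) * z) ~~ uK i * (cst (q powi (- l)) * z)" by (rule eqv_lmult [OF A(1) wt_inv]) (use i w in auto)
 also have "uK i * (cst (q powi (- l)) * z) = cst (q powi (- l)) * (uK i * z)" by (rule times_cst_left)
 also have "... ~~ cst (q powi (- l)) * (cst (q powi k) * z)" by (rule eqv_cst) (use w in \<open>simp add: wt_def\<close>)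
 finally show "uKt n Pos i * z ~~ cst (q powi (k - l)) * z"
  by (simp add: nx mult.assoc cst_mult_assoc q_powi_add)
 have "uK (Suc i) * (uKi i * z) ~~ uK (Suc i) * (cst (q powi (- k)) * z)" by (rule eqv_lmult [OF A(2) wt_inv]) (use i w in auto)
 also have "uK (Suc i) * (cst (q powi (- k)) * z) = cst (q powi (- k)) * (uK (Suc i) * z)" by (rule times_cst_left)
 also have "... ~~ cst (q powi (- k)) * (cst (q powi l) * z)" by (rule eqv_cst) (use w in \<open>simp add: wt_def\<close>)
 finally show "uKt n Neg i * z ~~ cst (q powi (l - k)) * z"
  by (simp add: nx mult.assoc cst_mult_assoc q_powi_add)
qed

lemma EF_wt:
 assumes i: "i : {1..<n}" and w: "wt i k z" "wt (Suc i) l z" and E: "eE i * z ~~ 0"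
 shows "eE i * (eF i * z) ~~ cst (qint q (k - l)) * z"
proof -
 have z: "z : A" using w by (simp add: wt_def)
 have F: "eF i : A" using i by simp
 have "eE i * (eF i * z) ~~ eF i * (eE i * z) + cst (inverse (q - inverse q)) * ((uKt n Pos i - uKt n Neg i) * z)"
  using XX_same [OF i z, of 0 0] by (simp add: phi_0)
 also have "... ~~ eF i * 0 + cst (inverse (q - inverse q)) * (cst (q powi (k - l)) * z - cst (q powi (l - k)) * z)"
  using wt_Kt [OF i w] by (intro eqv_add eqv_cst eqv_lmult [OF F E]) (simp add: left_diff_distrib eqv_diff)
 also have "... = cst (qint q (k - l)) * z"
  by (intro poly_mapping_eqI) (simp add: qint_def lookup_minus divide_inverse algebra_simps)
 finally show ?thesis .
qed

lemma K_X: "i : {1..n} ==> j : {1..<n} ==> wt i k z ==> wt i (k - of_bool (i = j) + of_bool (i = j + 1)) (uX Neg j s * z)"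
proof -
 assume i: "i : {1..n}" and j: "j : {1..<n}" and w: "wt i k z"
 then have z: "z : A" by (simp add: wt_def)
 define ee :: int where "ee = - of_bool (i = j) + of_bool (i = j + 1)"
 have e: "sg Neg * (of_bool (i = j) - of_bool (i = j + 1)) = ee" by (simp add: ee_def)
 have "uK i * uX Neg j s * z ~~ cst (q powi ee) * uX Neg j s * uK i * z"
  using eq2D [OF rel2 [OF U_rel.intros(4) [OF i j, of q Neg s]] z] unfolding e .
 also have "... = cst (q powi ee) * uX Neg j s * (uK i * z)" by (simp add: mult.assoc)
 also have "... ~~ cst (q powi ee) * uX Neg j s * (cst (q powi k) * z)"
  by (rule eqv_lmult) (use w j in \<open>auto simp: wt_def\<close>)
 also have "... = cst (q powi (k + ee)) * (uX Neg j s * z)"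
  by (simp add: mult.assoc times_cst_left [of "uX Neg j s"] cst_mult_assoc q_powi_add add.commute)
 finally have "wt i (k + ee) (uX Neg j s * z)" using z j by (simp add: wt_def mult.assoc)
 then show ?thesis unfolding ee_def by (simp only: add_diff_eq diff_conv_add_uminus add.assoc)
qed

lemma wt_1: "i : {1..n} ==> wt i (int (d i)) 1"
 using hwK by (simp add: wt_def eqv_def)

lemma E_0: "i : {1..<n} ==> z : A ==> eq2 (eE i * z) (z * eE i) ==> eE i * z ~~ 0"
proof -
 assume i: "i : {1..<n}" and z: "z : A" and c: "eq2 (eE i * z) (z * eE i)"
 have "eE i * z ~~ z * eE i" using eq2D1 [OF c] .
 also have "... ~~ z * 0" by (rule eqv_lmult [OF z]) (use hwX [OF i] in \<open>simp add: eqv_0\<close>)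
 finally show ?thesis by simp
qed

text \<open>Removing an outer commutator with \<open>F\<^sub>i\<close> by applying \<open>E\<^sub>i\<close>.  The inner element \<open>z\<close> has weight
 \<open>d\<close> lowered by simple roots such that the \<open>i\<close>-th coroot takes the value \<open>m + 1\<close>.\<close>

lemma peel:
 assumes i: "i : {1..<n}" and z: "z : A" and c: "eq2 (eE i * z) (z * eE i)"
  and w: "wt i k z" "wt (Suc i) l z" and kl: "k - l = int (d i) - int (d (Suc i)) + 1"
 shows "eE i * qbr b (eF i) z ~~ cst (qint q (int (d i) - int (d (Suc i)) + 1) - b * qint q (int (d i) - int (d (Suc i)))) * z"
  and "eE i * qbr b z (eF i) ~~ cst (qint q (int (d i) - int (d (Suc i))) - b * qint q (int (d i) - int (d (Suc i)) + 1)) * z"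
proof -
 let ?m = "int (d i) - int (d (Suc i))"
 have A: "eE i : A" "eF i : A" using i by auto
 have 1: "eE i * (eF i * z) ~~ cst (qint q (?m + 1)) * z"
  using EF_wt [OF i w E_0 [OF i z c]] kl by simp
 have "eE i * (eF i * 1) ~~ cst (qint q ?m) * 1"
  by (rule EF_wt [OF i]) (use i wt_1 hwX [OF i] in \<open>auto simp: eqv_0\<close>)
 then have e: "eE i * eF i ~~ cst (qint q ?m)" by simp
 have "eE i * (z * eF i) ~~ z * eE i * eF i"
  using eq2D [OF c A(2)] by (simp add: mult.assoc)
 also have "... ~~ z * cst (qint q ?m)" using eqv_lmult [OF z e] by (simp add: mult.assoc)
 finally have 2: "eE i * (z * eF i) ~~ cst (qint q ?m) * z" by (simp add: cst_commute)
 have "eE i * (eF i * z) - cst b * (eE i * (z * eF i)) ~~ cst (qint q (?m + 1)) * z - cst b * (cst (qint q ?m) * z)"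
  by (intro eqv_diff eqv_cst 1 2)
 then show "eE i * qbr b (eF i) z ~~ cst (qint q (?m + 1) - b * qint q ?m) * z"
  by (simp add: qbr_def right_diff_distrib left_diff_distrib mult.assoc times_cst_left [of "eE i"] cst_mult_assoc cst_diff)
 have "eE i * (z * eF i) - cst b * (eE i * (eF i * z)) ~~ cst (qint q ?m) * z - cst b * (cst (qint q (?m + 1)) * z)"
  by (intro eqv_diff eqv_cst 1 2)
 then show "eE i * qbr b z (eF i) ~~ cst (qint q ?m - b * qint q (?m + 1)) * z"
  by (simp add: qbr_def right_diff_distrib left_diff_distrib mult.assoc times_cst_left [of "eE i"] cst_mult_assoc cst_diff)
qed

lemma qint_step: "qint q (m + 1) - inverse q * qint q m = q powi m" "qint q m - q * qint q (m + 1) = - (q powi (m + 1))"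
 "qint q m - inverse q * qint q (m + 1) = - (q powi (- m - 1))"
proof -
 have *: "q powi (m + 1) = q * q powi m" "q powi (- (m + 1)) = inverse q * q powi (- m)" "q powi (- m - 1) = inverse q * q powi (- m)"
  using q_powi_add [of 1 m] q_powi_add [of "-1" "- m"] by (simp_all add: power_int_minus add.commute)
 have num: "(q powi (m + 1) - q powi (- (m + 1))) - inverse q * (q powi m - q powi (- m)) = q powi m * (q - inverse q)"
  "(q powi m - q powi (- m)) - q * (q powi (m + 1) - q powi (- (m + 1))) = - (q powi (m + 1)) * (q - inverse q)"
  "(q powi m - q powi (- m)) - inverse q * (q powi (m + 1) - q powi (- (m + 1))) = - (q powi (- m - 1)) * (q - inverse q)"
  unfolding * by (simp_all add: field_simps)
 show "qint q (m + 1) - inverse q * qint q m = q powi m" "qint q m - q * qint q (m + 1) = - (q powi (m + 1))"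
  "qint q m - inverse q * qint q (m + 1) = - (q powi (- m - 1))"
  unfolding qint_def times_divide_eq_right diff_divide_distrib [symmetric] num
  by (rule nonzero_mult_div_cancel_right, rule qdiff_neq)+
qed

primrec ch :: "ugen fa => nat => ugen fa" where
 "ch x 0 = x"
| "ch x (Suc k) = qbr (inverse q) (eF (k + 2)) (ch x k)"

primrec rch :: "complex => ugen fa => nat => nat => ugen fa" where
 "rch b x i 0 = x"
| "rch b x i (Suc j) = qbr b (rch b x i j) (eF (i - 1 - j))"

lemma calX_ch: "calX q k = ch (eF1 1) k"
 by (induction k) simp_all

lemma ch_closed: "k + 1 < n ==> ch (uX Neg 1 s) k : A"
 by (induction k) auto

lemma ch_comm: "k + 1 < i ==> i < n ==> eq2 (eE i * ch (uX Neg 1 s) k) (ch (uX Neg 1 s) k * eE i)"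
proof (induction k)
 case 0
 then show ?case by (simp add: XX_comm)
next
 case (Suc k)
 show ?case unfolding ch.simps
  by (rule comm_qbr) (use Suc ch_closed [of k s] in \<open>auto intro!: XX_comm\<close>)
qed

text \<open>Weights of chains, multiplied by an arbitrary weight vector from the right.\<close>

lemma ch_wt: "k + 1 < n ==> i : {1..n} ==> wt i l z ==>
  wt i (l - of_bool (i = 1) + of_bool (i = k + 2)) (ch (uX Neg 1 s) k * z)"
proof (induction k arbitrary: l z)
 case 0
 then show ?case using K_X [of i 1 l z s] by simp
next
 case (Suc k)
 have z: "z : A" using Suc.prems by (simp add: wt_def)
 have kn: "k + 2 : {1..<n}" using Suc.prems by simp
 let ?C = "ch (uX Neg 1 s) k"
 have C: "?C : A" using ch_closed Suc.prems by simp
 have 1: "wt i (l - of_bool (i = 1) + of_bool (i = Suc k + 2)) (eF (k + 2) * (?C * z))"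
  using K_X [OF Suc.prems(2) kn Suc.IH [OF _ Suc.prems(2,3)], of 0] Suc.prems(1)
  by (cases "i = k + 2") auto
 have 2: "wt i (l - of_bool (i = 1) + of_bool (i = Suc k + 2)) (?C * (eF (k + 2) * z))"
  using Suc.IH [OF _ Suc.prems(2) K_X [OF Suc.prems(2) kn Suc.prems(3), of 0]] Suc.prems(1)
  by (cases "i = k + 2") auto
 have "uK i * (eF (k + 2) * (?C * z)) - cst (inverse q) * (uK i * (?C * (eF (k + 2) * z))) ~~
  cst (q powi (l - of_bool (i = 1) + of_bool (i = Suc k + 2))) * (eF (k + 2) * (?C * z)) -
  cst (inverse q) * (cst (q powi (l - of_bool (i = 1) + of_bool (i = Suc k + 2))) * (?C * (eF (k + 2) * z)))"
  using 1 2 by (intro eqv_diff eqv_cst) (auto simp: wt_def)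
 then show ?case using C z kn
  by (simp add: wt_def qbr_def left_diff_distrib right_diff_distrib mult.assoc times_cst_left [of "uK i"]
    cst_mult_assoc mult.commute [of "inverse q"])
qed

text \<open>Removing the raising operators from the left end of the chain.\<close>

lemma ch_descend:
 assumes "ch (eF1 1) k ~~ cst c * ch (eF 1) k" "k + 1 < n" "j \<le> k"
 shows "ch (eF1 1) j ~~ cst c * ch (eF 1) j"
 using assms(3,1,2)
proof (induction rule: inc_induct)
 case base
 then show ?case by simp
next
 case (step j)
 have IH: "ch (eF1 1) (Suc j) ~~ cst c * ch (eF 1) (Suc j)" using step by simp
 let ?i = "j + 2"
 have i: "?i : {1..<n}" using step by simp
 let ?m = "int (d ?i) - int (d (Suc ?i))"
 have p: "eE ?i * ch (uX Neg 1 s) (Suc j) ~~ cst (q powi ?m) * ch (uX Neg 1 s) j" for s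
 proof -
  have A: "ch (uX Neg 1 s) j : A" using step ch_closed by simp
  have w: "wt ?i (int (d ?i) + 1) (ch (uX Neg 1 s) j)" "wt (Suc ?i) (int (d (Suc ?i))) (ch (uX Neg 1 s) j)"
   using ch_wt [of j ?i _ 1 s, OF _ _ wt_1] ch_wt [of j "Suc ?i" _ 1 s, OF _ _ wt_1] step by simp_all
  have "eE ?i * ch (uX Neg 1 s) (Suc j) ~~ cst (qint q (?m + 1) - inverse q * qint q ?m) * ch (uX Neg 1 s) j"
   unfolding ch.simps by (rule peel(1) [OF i A ch_comm w]) (use step in auto)
  then show ?thesis by (simp only: qint_step)
 qed
 have "eE ?i * ch (eF1 1) (Suc j) ~~ eE ?i * (cst c * ch (eF 1) (Suc j))"
  by (rule eqv_lmult [OF _ IH]) (use i in simp)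
 then have e: "eE ?i * ch (eF1 1) (Suc j) ~~ cst c * (eE ?i * ch (eF 1) (Suc j))"
  by (simp only: times_cst_left [of "eE ?i"])
 have "cst (q powi ?m) * ch (eF1 1) j ~~ eE ?i * ch (eF1 1) (Suc j)" by (rule eqv_sym) (rule p)
 also have "eE ?i * ch (eF1 1) (Suc j) ~~ cst c * (eE ?i * ch (eF 1) (Suc j))" by (rule e)
 also have "... ~~ cst c * (cst (q powi ?m) * ch (eF 1) j)" by (rule eqv_cst) (rule p)
 finally have "cst (q powi ?m) * ch (eF1 1) j ~~ cst (c * q powi ?m) * ch (eF 1) j" by (simp add: cst_mult_assoc)
 from eqv_cancel [OF this] show ?case by simp
qed

lemma rch_closed: "x : A ==> i : {1..<n} ==> j < i ==> rch b x i j : A"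
proof (induction j)
 case (Suc j)
 have "i - 1 - j : {1..<n}" using Suc by auto
 then have "eF (i - 1 - j) : A" by simp
 then show ?case unfolding rch.simps using Suc by (intro qbr_closed) auto
qed simp

lemma rch_scale: "rch b (cst c * x) i j = cst c * rch b x i j"
 by (induction j) (simp_all add: qbr_def algebra_simps sc_simps mult.commute)

lemma rch_eq2: "eq2 x y ==> x : A ==> y : A ==> i : {1..<n} ==> j < i ==> eq2 (rch b x i j) (rch b y i j)"
proof (induction j)
 case (Suc j)
 then show ?case unfolding rch.simps by (intro eq2_qbr) (auto intro!: rch_closed)
qed simp

text \<open>A commutator with \<open>F\<^sub>i\<^sub>+\<^sub>1\<close> can be moved to the inner end of a chain of smaller indices.\<close>

lemma rch_inner:
 assumes "x : A" "i : {1..<n}" "Suc i : {1..<n}"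
 shows "j < i ==> eq2 (qbr c (eF (Suc i)) (rch b x i j)) (rch b (qbr c (eF (Suc i)) x) i j)"
proof (induction j)
 case (Suc j)
 have "eq2 (qbr c (eF (Suc i)) (qbr b (rch b x i j) (eF (i - 1 - j)))) (qbr b (qbr c (eF (Suc i)) (rch b x i j)) (eF (i - 1 - j)))"
  by (rule qbr_assoc) (use Suc assms in \<open>auto intro!: rch_closed FF_comm\<close>)
 also have "eq2 \<dots> (qbr b (rch b (qbr c (eF (Suc i)) x) i j) (eF (i - 1 - j)))"
  by (rule eq2_qbr) (use Suc assms in \<open>auto intro!: rch_closed\<close>)
 finally show ?case by simp
qed simp

lemma rch_shift: "j < i ==> rch b (qbr b x (eF i)) i j = rch b x (Suc i) (Suc j)"
 by (induction j) simp_all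

lemma ch_rch: "k + 1 < n ==> eq2 (ch (eF1 1) k) (cst (inverse q ^ k) * rch q (eF1 (k + 1)) (k + 1) k)
  \<and> eq2 (ch (eF 1) k) (rch (inverse q) (eF (k + 1)) (k + 1) k)"
proof (induction k)
 case (Suc k)
 let ?i = "k + 1"
 have i: "?i : {1..<n}" "Suc ?i : {1..<n}" using Suc by auto
 have IH: "eq2 (ch (eF1 1) k) (cst (inverse q ^ k) * rch q (eF1 ?i) ?i k)"
  "eq2 (ch (eF 1) k) (rch (inverse q) (eF ?i) ?i k)" using Suc by simp_all
 have A: "ch (eF1 1) k : A" "ch (eF 1) k : A" "rch q (eF1 ?i) ?i k : A" "rch (inverse q) (eF ?i) ?i k : A"
  using ch_closed Suc i by (auto intro!: rch_closed)
 have "eq2 (ch (eF1 1) (Suc k)) (qbr (inverse q) (eF (Suc ?i)) (cst (inverse q ^ k) * rch q (eF1 ?i) ?i k))"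
  using eq2_qbr [OF eq2_refl [of "eF (Suc ?i)"] IH(1)] A i by simp
 also have "qbr (inverse q) (eF (Suc ?i)) (cst (inverse q ^ k) * rch q (eF1 ?i) ?i k) =
   cst (inverse q ^ k) * qbr (inverse q) (eF (Suc ?i)) (rch q (eF1 ?i) ?i k)"
  by (simp add: qbr_def algebra_simps sc_simps mult.commute)
 also have "eq2 \<dots> (cst (inverse q ^ k) * rch q (qbr (inverse q) (eF (Suc ?i)) (eF1 ?i)) ?i k)"
  by (intro eq2_cst rch_inner) (use i in auto)
 also have "eq2 \<dots> (cst (inverse q ^ k) * rch q (cst (inverse q) * qbr q (eF1 (Suc ?i)) (eF ?i)) ?i k)"
  by (intro eq2_cst rch_eq2 F_exchange) (use i in auto)
 also have "... = cst (inverse q ^ Suc k) * rch q (eF1 (Suc ?i)) (Suc ?i) (Suc k)"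
  unfolding rch_scale by (subst rch_shift) (simp_all add: cst_mult_assoc mult.commute)
 finally have 1: "eq2 (ch (eF1 1) (Suc k)) (cst (inverse q ^ Suc k) * rch q (eF1 (Suc ?i)) (Suc ?i) (Suc k))" .
 have "eq2 (ch (eF 1) (Suc k)) (qbr (inverse q) (eF (Suc ?i)) (rch (inverse q) (eF ?i) ?i k))"
  using eq2_qbr [OF eq2_refl [of "eF (Suc ?i)"] IH(2)] A i by simp
 also have "eq2 \<dots> (rch (inverse q) (qbr (inverse q) (eF (Suc ?i)) (eF ?i)) ?i k)"
  by (intro rch_inner) (use i in auto)
 also have "... = rch (inverse q) (eF (Suc ?i)) (Suc ?i) (Suc k)" by (subst rch_shift) simp_all
 finally show ?case using 1 by simp
qed simp

lemma rch_comm: "i : {1..<n} ==> j < i ==> l : {1..<n} ==> l < i - j ==>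
  eq2 (eE l * rch b (uX Neg i s) i j) (rch b (uX Neg i s) i j * eE l)"
proof (induction j)
 case 0
 then show ?case by (simp add: XX_comm)
next
 case (Suc j)
 show ?case unfolding rch.simps
  by (rule comm_qbr) (use Suc in \<open>auto intro!: rch_closed XX_comm\<close>)
qed

lemma rch_wt: "i : {1..<n} ==> j < i ==> p : {1..n} ==> wt p l z ==>
  wt p (l - of_bool (p = i - j) + of_bool (p = i + 1)) (rch b (uX Neg i s) i j * z)"
proof (induction j arbitrary: l z)
 case 0
 then show ?case using K_X [of p i l z s] by simp
next
 case (Suc j)
 have z: "z : A" using Suc.prems by (simp add: wt_def)
 let ?f = "i - 1 - j" and ?C = "rch b (uX Neg i s) i j"
 have f: "?f : {1..<n}" and e: "i - j = ?f + 1" "i - Suc j = ?f" using Suc.prems by auto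
 have C: "?C : A" using Suc.prems by (auto intro!: rch_closed)
 let ?t = "l - of_bool (p = i - Suc j) + of_bool (p = i + 1)"
 have 1: "wt p ?t (eF ?f * (?C * z))"
  using K_X [OF Suc.prems(3) f Suc.IH [OF Suc.prems(1) _ Suc.prems(3,4)], of 0] Suc.prems(2) unfolding e
  by (cases "p = ?f + 1") (auto simp: algebra_simps)
 have 2: "wt p ?t (?C * (eF ?f * z))"
  using Suc.IH [OF Suc.prems(1) _ Suc.prems(3) K_X [OF Suc.prems(3) f Suc.prems(4), of 0]] Suc.prems(2) unfolding e
  by (cases "p = ?f + 1") (auto simp: algebra_simps)
 have "uK p * (?C * (eF ?f * z)) - cst b * (uK p * (eF ?f * (?C * z))) ~~
  cst (q powi ?t) * (?C * (eF ?f * z)) - cst b * (cst (q powi ?t) * (eF ?f * (?C * z)))"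
  using 1 2 by (intro eqv_diff eqv_cst) (auto simp: wt_def)
 then show ?case using C z f unfolding rch.simps qbr_def
  by (simp add: wt_def left_diff_distrib right_diff_distrib mult.assoc times_cst_left [of "uK p"]
    cst_mult_assoc mult.commute [of b])
qed

lemma F1_value:
 assumes X: "ch (eF1 1) (n - 2) ~~ cst (a * q powi (2 * int (d 1) - 2)) * ch (eF 1) (n - 2)" and i: "i : {1..<n}"
 shows "eF1 i ~~ cst (a * q powi (2 * int (d i) - 1 - int i)) * eF i"
proof -
 obtain k where k: "i = k + 1" using i by (metis Suc_eq_plus1 Suc_le_D atLeastLessThan_iff One_nat_def)
 have "ch (eF1 1) k ~~ cst (a * q powi (2 * int (d 1) - 2)) * ch (eF 1) k"
  by (rule ch_descend [OF X]) (use i n2 k in auto)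
 moreover have "ch (eF1 1) k ~~ cst (inverse q ^ k) * rch q (eF1 i) i k" "ch (eF 1) k ~~ rch (inverse q) (eF i) i k"
  using ch_rch [of k] i k eq2D1 by auto
 ultimately have "cst (inverse q ^ k) * rch q (eF1 i) i k ~~ cst (a * q powi (2 * int (d 1) - 2)) * rch (inverse q) (eF i) i k"
  by (meson eqv_cst eqv_sym eqv_trans)
 from eqv_cancel [OF this] have "rch q (eF1 i) i k ~~ cst (a * q powi (2 * int (d 1) - 2) / inverse q ^ k) * rch (inverse q) (eF i) i k"
  by simp
 moreover have "a * q powi (2 * int (d 1) - 2) / inverse q ^ k = a * q powi (2 * int (d (i - k)) - 1 - int i + 2 * int k)"
 proof -
  have "q powi (2 * int (d 1) - 2) / inverse q ^ k = q powi (2 * int (d 1) - 2) * q powi int k" by (simp add: divide_inverse power_inverse)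
  also have "... = q powi (2 * int (d (i - k)) - 1 - int i + 2 * int k)" unfolding q_powi_add using k by (simp add: algebra_simps)
  finally have e: "q powi (2 * int (d 1) - 2) / inverse q ^ k = q powi (2 * int (d (i - k)) - 1 - int i + 2 * int k)" .
  show ?thesis unfolding times_divide_eq_right [symmetric] e ..
 qed
 ultimately have start: "rch q (eF1 i) i k ~~ cst (a * q powi (2 * int (d (i - k)) - 1 - int i + 2 * int k)) * rch (inverse q) (eF i) i k"
  by simp
 have "rch q (eF1 i) i j ~~ cst (a * q powi (2 * int (d (i - j)) - 1 - int i + 2 * int j)) * rch (inverse q) (eF i) i j" if "j \<le> k" for j
  using that
 proof (induction rule: inc_induct)
  case base
  then show ?case by (rule start)
 next
  case (step j)
  let ?f = "i - 1 - j"
  let ?m = "int (d ?f) - int (d (Suc ?f))"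
  let ?c = "a * q powi (2 * int (d (i - Suc j)) - 1 - int i + 2 * int (Suc j))"
  have f: "?f : {1..<n}" "i - Suc j = ?f" "i - j = Suc ?f" "j < i" "Suc ?f : {1..n}" "?f : {1..n}" using step i k by auto
  have p: "eE ?f * rch b (uX Neg i s) i (Suc j) ~~ cst (qint q ?m - b * qint q (?m + 1)) * rch b (uX Neg i s) i j" for b s
   unfolding rch.simps
  proof (rule peel(2) [OF f(1)])
   show "rch b (uX Neg i s) i j : A" by (rule rch_closed) (use i f(4) in simp_all)
   show "eq2 (eE ?f * rch b (uX Neg i s) i j) (rch b (uX Neg i s) i j * eE ?f)" by (rule rch_comm) (use i f(1,4) in auto)
   show "wt ?f (int (d ?f)) (rch b (uX Neg i s) i j)"
   proof -
    have "?f ~= i - j" "?f ~= i + 1" using f(3,4) by auto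
    then show ?thesis using rch_wt [OF i f(4) f(6) wt_1 [OF f(6)], of b s] by (simp del: diff_diff_left)
   qed
   show "wt (Suc ?f) (int (d (Suc ?f)) - 1) (rch b (uX Neg i s) i j)"
   proof -
    have "Suc ?f = i - j" "Suc ?f ~= i + 1" using f(3,4) by auto
    then show ?thesis using rch_wt [OF i f(4) f(5) wt_1 [OF f(5)], of b s] by (simp del: diff_diff_left)
   qed
  qed simp
  have "eE ?f * rch q (eF1 i) i (Suc j) ~~ eE ?f * (cst ?c * rch (inverse q) (eF i) i (Suc j))"
  proof (rule eqv_lmult [OF _ step.IH])
   show "eE ?f : A" using f(1) by (rule eE_closed)
  qed
  then have e: "eE ?f * rch q (eF1 i) i (Suc j) ~~ cst ?c * (eE ?f * rch (inverse q) (eF i) i (Suc j))"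
   by (simp only: times_cst_left [of "eE ?f"])
  have "cst (- (q powi (?m + 1))) * rch q (eF1 i) i j ~~ eE ?f * rch q (eF1 i) i (Suc j)"
   using p [of q 1] unfolding qint_step by (rule eqv_sym)
  also have "eE ?f * rch q (eF1 i) i (Suc j) ~~ cst ?c * (eE ?f * rch (inverse q) (eF i) i (Suc j))" by (rule e)
  also have "... ~~ cst ?c * (cst (- (q powi (- ?m - 1))) * rch (inverse q) (eF i) i j)"
   using p [of "inverse q" 0] unfolding qint_step by (rule eqv_cst)
  finally have "cst (- (q powi (?m + 1))) * rch q (eF1 i) i j ~~ cst (?c * - (q powi (- ?m - 1))) * rch (inverse q) (eF i) i j"
   by (simp only: cst_mult_assoc)
  from eqv_cancel [OF this] have "rch q (eF1 i) i j ~~ cst (?c * - (q powi (- ?m - 1)) / - (q powi (?m + 1))) * rch (inverse q) (eF i) i j"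
   using q0 by (simp only: neg_equal_0_iff_equal power_int_eq_0_iff not_False_eq_True simp_thms)
  moreover have "?c * - (q powi (- ?m - 1)) / - (q powi (?m + 1)) = a * q powi (2 * int (d (i - j)) - 1 - int i + 2 * int j)"
  proof -
   have "?c * - (q powi (- ?m - 1)) / - (q powi (?m + 1)) = a * (q powi (2 * int (d (i - Suc j)) - 1 - int i + 2 * int (Suc j)) * q powi (- ?m - 1) * q powi (- (?m + 1)))"
    unfolding power_int_minus [of q "?m + 1"] by (simp only: divide_inverse minus_mult_minus inverse_minus_eq mult.assoc)
   also have "... = a * q powi (2 * int (d (i - j)) - 1 - int i + 2 * int j)"
    unfolding q_powi_add f(2,3) by (simp add: algebra_simps)
   finally show ?thesis .
  qed
  ultimately show ?case by (simp only:)
 qed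
 from this [of 0] show ?thesis by simp
qed

end

section \<open>Exponentials of formal power series\<close>

unbundle fps_syntax

abbreviation fexpc :: "complex fps => complex fps" where "fexpc f \<equiv> fps_exp 1 oo f"

lemma fexpc_deriv: "f $ 0 = 0 ==> fps_deriv (fexpc f) = fexpc f * fps_deriv f"
 by (simp add: fps_compose_deriv)

lemma fexpc_0 [simp]: "fexpc f $ 0 = 1"
 by simp

text \<open>The exponential is the only power series with constant term 1 that satisfies its differential
  equation.\<close>

lemma fexpc_unique:
 fixes y g :: "complex fps"
 assumes "g $ 0 = 0" "fps_deriv y = y * fps_deriv g" "y $ 0 = 1"
 shows "y = fexpc g"
proof -
 let ?E = "fexpc g"
 have E: "?E $ 0 ~= 0" by simp
 have "fps_deriv (y * inverse ?E) = 0"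
  using assms fexpc_deriv [OF assms(1)] E inverse_mult_eq_1 [OF E]
  by (simp add: fps_inverse_deriv [OF E] power2_eq_square algebra_simps)
 then have "y * inverse ?E = fps_const ((y * inverse ?E) $ 0)" by (simp only: fps_deriv_eq_0_iff)
 also have "(y * inverse ?E) $ 0 = 1" using assms by simp
 finally have "y * inverse ?E = 1" by simp
 then have "y * (inverse ?E * ?E) = ?E" by (simp flip: mult.assoc)
 then show ?thesis using inverse_mult_eq_1 [OF E] by simp
qed

lemma fexpc_log: "f $ 0 = 1 ==> \<exists>h. h $ 0 = 0 \<and> fexpc h = (f :: complex fps)"
proof -
 assume f: "f $ 0 = 1"
 let ?h = "fps_integral0 (fps_deriv f * inverse f)"
 have "fps_deriv ?h = fps_deriv f * inverse f" by (simp add: fps_deriv_fps_integral)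
 then have "f * fps_deriv ?h = fps_deriv f * (inverse f * f)" by (simp add: mult_ac)
 also have "inverse f * f = 1" using f by (intro inverse_mult_eq_1) simp
 finally have "f = fexpc ?h" by (intro fexpc_unique) (simp_all add: f)
 then show ?thesis by (intro exI [of _ ?h]) simp
qed

lemma fexpc_add: "f $ 0 = 0 ==> g $ 0 = 0 ==> fexpc (f + g) = fexpc f * fexpc g"
 by (rule fexpc_unique [symmetric]) (simp_all add: fexpc_deriv algebra_simps)

lemma fexpc_sum: "(!!i. i : A ==> f i $ 0 = 0) ==> fexpc (\<Sum>i\<in>A. f i) = (\<Prod>i\<in>A. fexpc (f i))"
proof (induction A rule: infinite_finite_induct)
 case (insert x A)
 then have "(\<Sum>i\<in>A. f i) $ 0 = 0" by (simp add: fps_sum_nth)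
 then show ?case using insert by (simp add: fexpc_add)
qed simp_all

lemma fexpc_inj: "f $ 0 = 0 ==> g $ 0 = 0 ==> fexpc f = fexpc g ==> f = g"
proof -
 assume fg: "f $ 0 = 0" "g $ 0 = 0" and e: "fexpc f = fexpc g"
 have "fexpc f * fps_deriv f = fexpc f * fps_deriv g"
  using fexpc_deriv [OF fg(1)] fexpc_deriv [OF fg(2)] e by metis
 moreover have "fexpc f ~= 0" using fexpc_0 [of f] by (metis fps_zero_nth zero_neq_one)
 ultimately have "fps_deriv f = fps_deriv g" unfolding mult_cancel_left by blast
 then show ?thesis using fg by (simp add: fps_deriv_eq_iff)
qed

lemma log_linear: "fexpc (Abs_fps (\<lambda>t. - (x ^ t) / of_nat t)) = 1 - fps_const x * fps_X"
proof (rule fexpc_unique [symmetric])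
 let ?g = "Abs_fps (\<lambda>t. - (x ^ t) / of_nat t)"
 have "fps_deriv ?g = - (fps_const x * Abs_fps (\<lambda>t. x ^ t))"
  by (rule fps_ext) (simp add: field_simps flip: of_nat_Suc)
 moreover have "(1 - fps_const x * fps_X) * Abs_fps (\<lambda>t. x ^ t) = 1"
 proof (rule fps_ext)
  fix m show "((1 - fps_const x * fps_X) * Abs_fps (\<lambda>t. x ^ t)) $ m = 1 $ m"
   by (cases m) (simp_all add: left_diff_distrib mult.assoc)
 qed
 ultimately show "fps_deriv (1 - fps_const x * fps_X) = (1 - fps_const x * fps_X) * fps_deriv ?g"
  by (simp add: mult.left_commute)
qed simp_all

section \<open>The Drinfeld polynomials\<close>

context loop
begin

text \<open>Elements that act on the highest weight vector by a scalar.\<close>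

definition eig :: "ugen fa => complex => bool" where
 "eig x c \<longleftrightarrow> x : A \<and> x ~~ cst c"

lemma eig_cst: "eig (cst c) c"
 and eig_0: "eig 0 0" and eig_1: "eig 1 1"
 unfolding eig_def using eqv_refl [of "cst 0"] eqv_refl [of "cst 1"] by auto

lemma eig_add: "eig x c ==> eig y d' ==> eig (x + y) (c + d')"
 and eig_diff: "eig x c ==> eig y d' ==> eig (x - y) (c - d')"
 unfolding eig_def by (auto simp: cst_add cst_diff intro: eqv_add eqv_diff)

lemma eig_mult: "eig x c ==> eig y d' ==> eig (x * y) (c * d')"
proof -
 assume x: "eig x c" and y: "eig y d'"
 have "x * y ~~ x * cst d'" using x y by (intro eqv_lmult) (auto simp: eig_def)
 also have "x * cst d' = cst d' * x" by (rule cst_commute)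
 also have "... ~~ cst d' * cst c" using x by (intro eqv_cst) (auto simp: eig_def)
 finally show ?thesis using x y by (simp add: eig_def cst_mult [symmetric] mult.commute)
qed

lemma eig_scale: "eig x c ==> eig (cst k * x) (k * c)"
 by (rule eig_mult [OF eig_cst])

lemma eig_sum: "(!!i. i : S ==> eig (f i) (g i)) ==> eig (sum f S) (sum g S)"
 by (induction S rule: infinite_finite_induct) (auto intro: eig_add simp: eig_0)

lemma eig_unique: "1 \<notin> N ==> eig x c ==> eig x c' ==> c = c'"
proof (rule ccontr)
 assume N: "1 \<notin> N" and x: "eig x c" "eig x c'" and ne: "c ~= c'"
 have "cst c ~~ cst c'" using x eqv_sym eqv_trans by (meson eig_def)
 then have "cst (c - c') : N" by (simp add: eqv_def cst_diff)
 then have "cst (inverse (c - c')) * cst (c - c') : N" by (intro N_lmult) auto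
 then show False using N ne by (simp flip: cst_mult)
qed

definition eigs_below :: "nat => ugen fa fps => complex fps => bool" where
 "eigs_below t F f \<longleftrightarrow> (\<forall>s<t. eig (F $ s) (f $ s))"

lemma eigs_mult: "eigs_below t F f ==> eigs_below t G' g ==> eigs_below t (F * G') (f * g)"
 unfolding eigs_below_def fps_mult_nth by (auto intro!: eig_sum eig_mult)

lemma eigs_one: "eigs_below t 1 1"
 by (simp add: eigs_below_def eig_0 eig_1)

lemma eigs_power: "eigs_below t F f ==> eigs_below t (F ^ k) (f ^ k)"
 by (induction k) (simp_all add: eigs_mult eigs_one)

lemma fexpc_nth: "fexpc f $ s = (\<Sum>k\<le>s. inverse (fact k) * (f ^ k) $ s)"
 by (simp add: fps_compose_nth atLeast0AtMost divide_inverse)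

lemma eigs_fexp: "eigs_below t F f ==> eigs_below t (fexp F) (fexpc f)"
proof -
 assume F: "eigs_below t F f"
 have "eig ((F ^ k) $ s) ((f ^ k) $ s)" if "s < t" for k s
  using eigs_power [OF F] that by (simp add: eigs_below_def)
 then show ?thesis unfolding eigs_below_def fexpc_nth fexp_def by (auto intro!: eig_sum eig_scale)
qed

text \<open>In a power other than the first, the coefficient of degree \<open>t\<close> only involves coefficients of
  smaller degree.  This allows an induction that recovers the logarithm from the exponential.\<close>

lemma eig_power_top:
 assumes F: "eigs_below t F f" and 0: "F $ 0 = 0" "f $ 0 = 0" and k: "k ~= 1" and t: "t > 0"
 shows "eig ((F ^ k) $ t) ((f ^ k) $ t)"
proof (cases k)
 case 0
 then show ?thesis using t by (simp add: eig_0)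
next
 case (Suc l)
 then have l: "l > 0" using k by simp
 have z: "(F ^ l) $ 0 = 0" "(f ^ l) $ 0 = 0" using l 0 by (simp_all add: fps_nth_power_0 cst_def zero_power)
 have "eig (F $ i * (F ^ l) $ (t - i)) (f $ i * (f ^ l) $ (t - i))" if i: "i : {0..t}" for i
 proof (cases "i = 0 \<or> i = t")
  case True
  then have "F $ i * (F ^ l) $ (t - i) = 0" "f $ i * (f ^ l) $ (t - i) = 0" using z 0 by (metis diff_self_eq_0 mult_zero_left mult_zero_right)+
  then show ?thesis by (simp add: eig_0 del: mult_eq_0_iff)
 next
  case False
  then have "i < t" "t - i < t" using i by auto
  then show ?thesis using F eigs_power [OF F, of l] by (intro eig_mult) (auto simp: eigs_below_def)
 qed
 then show ?thesis unfolding Suc power_Suc fps_mult_nth by (rule eig_sum)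
qed

text \<open>The logarithm of an eigenvalue series is the eigenvalue series of the logarithm.\<close>

lemma eig_log:
 assumes 0: "F $ 0 = 0" "h $ 0 = 0" and FA: "!!s. F $ s : A"
  and E: "!!s. eig (fexp F $ s) (fexpc h $ s)"
 shows "eig (F $ t) (h $ t)"
proof (induction t rule: less_induct)
 case (less t)
 show ?case
 proof (cases "t = 0")
  case True
  then show ?thesis using 0 by (simp add: eig_0)
 next
  case False
  have below: "eigs_below t F h" using less by (simp add: eigs_below_def)
  have split: "(\<Sum>k\<le>t. g k) = g 1 + (\<Sum>k\<in>{..t} - {1}. g k)" for g :: "nat => 'z :: comm_monoid_add"
   using False by (intro sum.remove) auto
  have "eig (\<Sum>k\<in>{..t} - {1}. cst (inverse (fact k)) * (F ^ k) $ t) (\<Sum>k\<in>{..t} - {1}. inverse (fact k) * (h ^ k) $ t)"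
   by (intro eig_sum eig_scale eig_power_top [OF below]) (use 0 False in auto)
  from eig_diff [OF E [of t] this]
  show ?thesis unfolding fexpc_nth fexp_def by (simp add: split)
 qed
qed

lemma eigs_all: "(!!s. eig (F $ s) (f $ s)) ==> eig (fexp F $ t) (fexpc f $ t)"
 using eigs_fexp [of "Suc t" F f] by (simp add: eigs_below_def)

end

locale drinfeld = loop +
 fixes Q :: "nat => complex poly" and a :: complex
 assumes hwQ: "i : {1..n} ==> Qcal q Pos i $ s - cst (Polynomial.coeff (Q i) s) : N"
  and N1: "1 \<notin> N"
  and Q0: "i : {1..n} ==> Polynomial.coeff (Q i) 0 = 1"
  and hwF1: "i : {1..<n} ==> eqv (eF1 i) (cst (a * q powi (2 * int (d i) - 1 - int i)) * eF i)"
begin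

definition hlog :: "nat => complex fps" where
 "hlog i = (SOME h. h $ 0 = 0 \<and> fexpc h = fps_of_poly (Q i))"

lemma hlog: assumes "i : {1..n}" shows "hlog i $ 0 = 0" "fexpc (hlog i) = fps_of_poly (Q i)"
 using someI_ex [OF fexpc_log [of "fps_of_poly (Q i)"]] Q0 [OF assms] by (simp_all add: hlog_def)

definition gam :: "nat => nat => complex" where
 "gam i t = - (qint q (int t) * inverse q ^ t * hlog i $ t)"

lemma eig_G: "i : {1..n} ==> t > 0 ==> eig (uG i (int t)) (gam i t)"
proof -
 assume i: "i : {1..n}" and t: "t > 0"
 let ?F = "Abs_fps (\<lambda>t. if t = 0 then 0 else - (cst (q powi (sg Pos * int t) / qint q (int t)) * uG i (sg Pos * int t)))"
 have FA: "?F $ s : A" for s using i by auto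
 have E: "eig (fexp ?F $ s) (fexpc (hlog i) $ s)" for s
 proof -
  have p: "(?F ^ k) $ s : A" for k s
  proof (induction k arbitrary: s)
   case (Suc k)
   show ?case unfolding power_Suc fps_mult_nth by (intro gens_alg_sum gens_alg_closed FA Suc)
  qed simp
  have "fexp ?F $ s : A" unfolding fexp_def fps_nth_Abs_fps [of "\<lambda>s. \<Sum>k\<le>s. _ k s"] by (intro gens_alg_sum gens_alg_closed p)
  then show ?thesis using hwQ [OF i, of s] by (simp add: eig_def eqv_def hlog [OF i] Qcal_def)
 qed
 have "eig (?F $ t) (hlog i $ t)" by (rule eig_log [OF _ _ FA E]) (simp_all add: hlog [OF i])
 then have "eig (- (cst (q ^ t / qint q (int t)) * uG i (int t))) (hlog i $ t)" using t by simp
 from eig_scale [OF this, of "- (qint q (int t) * inverse q ^ t)"]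
 show ?thesis using t qint_neq [of "int t"]
  by (simp add: gam_def cst_minus cst_mult_assoc power_inverse)
qed

text \<open>The eigenvalue series of \<open>\<phi>\<^sup>+\<close> in terms of the Drinfeld polynomials.\<close>

definition kk :: "nat => complex" where "kk i = q powi (int (d i) - int (d (Suc i)))"

definition ex :: "nat => complex fps" where
 "ex i = Abs_fps (\<lambda>m. if m = 0 then 0 else (q - inverse q) * ((q ^ (i - 1)) ^ m * gam i m - (q ^ (i + 1)) ^ m * gam (Suc i) m))"

definition ps :: "nat => complex fps" where "ps i = fps_const (kk i) * fexpc (ex i)"

lemma eig_Kt: "i : {1..<n} ==> eig (uKt n Pos i) (kk i) \<and> eig (uKt n Neg i) (inverse (kk i))"
proof -
 assume i: "i : {1..<n}"
 have "uKt n Pos i : A" "uKt n Neg i : A" using i by (auto simp: nx_def)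
 moreover have "wt i (int (d i)) 1" "wt (Suc i) (int (d (Suc i))) 1" using i by (auto intro: wt_1)
 note wt_Kt [OF i this]
 moreover have "q powi (int (d (Suc i)) - int (d i)) = inverse (kk i)"
  by (simp add: kk_def power_int_minus [symmetric])
 ultimately show ?thesis by (simp add: eig_def kk_def del: uKt.simps)
qed

lemma eig_phi: "i : {1..<n} ==> eig (phi n q Pos i (int s)) (ps i $ s)"
proof -
 assume i: "i : {1..<n}"
 let ?F = "Abs_fps (\<lambda>m. if m = 0 then 0 else cst (of_int (sg Pos) * (q - inverse q)) * uH q i (sg Pos * int m))"
 have "eig (?F $ m) (ex i $ m)" for m
 proof (cases "m = 0")
  case False
  have p: "q powi ((int i - 1) * int m) = (q ^ (i - 1)) ^ m" "q powi ((int i + 1) * int m) = (q ^ (i + 1)) ^ m"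
   using i by (simp_all add: power_int_mult of_nat_diff add.commute flip: power_int_of_nat)
  have "eig (uH q i (int m)) ((q ^ (i - 1)) ^ m * gam i m - (q ^ (i + 1)) ^ m * gam (Suc i) m)"
   unfolding uH_def p Suc_eq_plus1 [symmetric] using i False
   by (intro eig_diff eig_scale eig_G) auto
  from eig_scale [OF this, of "q - inverse q"] show ?thesis using False by (simp add: ex_def)
 qed (simp add: ex_def eig_0)
 then have "eig (fexp ?F $ s) (fexpc (ex i) $ s)" by (rule eigs_all)
 then have "eig (uKt n Pos i * fexp ?F $ s) (kk i * fexpc (ex i) $ s)" using eig_Kt [OF i] by (intro eig_mult) auto
 then show ?thesis by (simp add: phi_def phi_series_def ps_def del: uKt.simps)
qed

lemma eig_psi: "i : {1..<n} ==> eig (phi n q Pos i (int s) - phi n q Neg i (int s)) (if s = 0 then kk i - inverse (kk i) else ps i $ s)"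
proof -
 assume i: "i : {1..<n}"
 show ?thesis
 proof (cases "s = 0")
  case True
  then show ?thesis using eig_diff [of "uKt n Pos i" "kk i" "uKt n Neg i"] eig_Kt [OF i] by (simp add: phi_0 del: uKt.simps)
 next
  case False
  then show ?thesis using eig_phi [OF i, of s] by (simp add: phi_def)
 qed
qed

abbreviation "bb i \<equiv> a * q powi (2 * int (d i) - 1 - int i)"

text \<open>Apply a raising operator of degree \<open>s\<close> to the relation between the lowering operators of
  degree 1 and 0: raising operators kill the vector, so both sides become eigenvalues of \<open>\<phi>\<^sup>+ -
  \<phi>\<^sup>-\<close> in neighbouring degrees.\<close>

lemma ps_rec:
 assumes i: "i : {1..<n}"
 shows "ps i $ Suc s = bb i * (if s = 0 then kk i - inverse (kk i) else ps i $ s)"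
proof -
 let ?c = "inverse (q - inverse q)"
 define psi where "psi s = phi n q Pos i (int s) - phi n q Neg i (int s)" for s
 define pv where "pv s = (if s = 0 then kk i - inverse (kk i) else ps i $ s)" for s
 have e: "eig (psi s) (pv s)" for s unfolding psi_def pv_def by (rule eig_psi [OF i])
 have X: "uX Pos i (int s) : A" "uX Pos i (int s) ~~ 0" using i hwX [OF i] by (auto simp: eqv_0)
 have val: "uX Pos i (int s) * uX Neg i (int t) ~~ cst ?c * psi (s + t)" for t
 proof -
  have "uX Pos i (int s) * (uX Neg i (int t) * 1) ~~ uX Neg i (int t) * (uX Pos i (int s) * 1) + cst ?c * (psi (s + t) * 1)"
   using XX_same [OF i, of 1 "int s" "int t"] by (simp add: psi_def)
  also have "... ~~ uX Neg i (int t) * 0 + cst ?c * (psi (s + t) * 1)"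
   by (intro eqv_add eqv_lmult eqv_refl) (use i X in auto)
  finally show ?thesis by simp
 qed
 have "cst ?c * psi (Suc s) ~~ uX Pos i (int s) * eF1 i" using eqv_sym [OF val [of 1]] by simp
 also have "... ~~ uX Pos i (int s) * (cst (bb i) * eF i)" by (rule eqv_lmult [OF X(1) hwF1 [OF i]])
 also have "... = cst (bb i) * (uX Pos i (int s) * eF i)" by (rule times_cst_left)
 also have "... ~~ cst (bb i) * (cst ?c * psi s)" using val [of 0] by (intro eqv_cst) simp
 finally have "cst ?c * psi (Suc s) ~~ cst (bb i) * (cst ?c * psi s)" .
 moreover have "eig (cst (bb i) * (cst ?c * psi s)) (bb i * (?c * pv s))" by (intro eig_scale e)
 ultimately have "eig (cst ?c * psi (Suc s)) (bb i * (?c * pv s))"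
  using eig_scale [OF e [of "Suc s"], of ?c] by (auto simp: eig_def intro: eqv_trans)
 from eig_unique [OF N1 this eig_scale [OF e [of "Suc s"], of ?c]]
 have "?c * (bb i * pv s) = ?c * pv (Suc s)" by (simp only: mult_ac)
 then have "pv (Suc s) = bb i * pv s" using qdiff_neq by simp
 then show ?thesis by (simp add: pv_def)
qed

lemma ps_eq: "i : {1..<n} ==> (1 - fps_const (bb i) * fps_X) * ps i = fps_const (kk i) - fps_const (bb i * inverse (kk i)) * fps_X"
proof (rule fps_ext)
 fix s assume i: "i : {1..<n}"
 have 0: "ps i $ 0 = kk i" by (simp add: ps_def)
 show "((1 - fps_const (bb i) * fps_X) * ps i) $ s = (fps_const (kk i) - fps_const (bb i * inverse (kk i)) * fps_X) $ s"
 proof (cases s)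
  case 0
  then show ?thesis by (simp add: left_diff_distrib mult.assoc \<open>ps i $ 0 = kk i\<close>)
 next
  case (Suc s')
  then show ?thesis using ps_rec [OF i, of s'] 0
   by (cases s') (simp_all add: left_diff_distrib mult.assoc right_diff_distrib)
 qed
qed

lemma ex_coeff: "m > 0 ==> ex i $ m = (1 - (inverse q ^ 2) ^ m) * ((q ^ (i + 1)) ^ m * hlog (Suc i) $ m - (q ^ (i - 1)) ^ m * hlog i $ m)"
proof -
 assume m: "m > 0"
 have qi: "(q - inverse q) * qint q (int m) = q ^ m - inverse q ^ m"
  using qdiff_neq by (simp add: qint_def power_int_minus power_inverse)
 have e: "(q - inverse q) * (x * gam j m) = - (x * (1 - (inverse q ^ 2) ^ m) * hlog j $ m)" for x j
 proof -
  have "(q - inverse q) * (x * gam j m) = - (x * (((q - inverse q) * qint q (int m)) * inverse q ^ m) * hlog j $ m)"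
   by (simp add: gam_def mult_ac)
  also have "((q - inverse q) * qint q (int m)) * inverse q ^ m = 1 - (inverse q ^ 2) ^ m"
   unfolding qi by (simp add: left_diff_distrib power_mult_distrib [symmetric] power2_eq_square)
  finally show ?thesis .
 qed
 show ?thesis
  using m by (simp add: ex_def right_diff_distrib [of "q - inverse q"] e del: power_Suc) (simp add: algebra_simps del: power_Suc)
qed

lemma geometric_step: "(y :: complex) ~= 0 ==> (1 - inverse y) * (\<Sum>k=1..D. y ^ k) = y ^ D - 1"
proof (induction D)
 case (Suc D)
 have "(1 - inverse y) * y ^ Suc D = y ^ Suc D - y ^ D" using Suc.prems by (simp add: left_diff_distrib)
 then show ?case using Suc by (simp add: distrib_left)
qed simp

text \<open>The recursion makes the eigenvalue series of \<open>\<phi>\<^sup>+\<close> a quotient of two linear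
  polynomials.  Its logarithm is a difference of two powers, which is \<open>1 - q\<^bsup>-2t\<^esup>\<close> times a
  geometric sum; the same factor occurs in the definition of \<open>\<phi>\<^sup>+\<close> and cancels.\<close>

lemma hlog_step:
 assumes i: "i : {1..<n}" and dd: "d (Suc i) \<le> d i" and t: "t > 0"
 shows "(q ^ (i - 1)) ^ t * hlog i $ t - (q ^ (i + 1)) ^ t * hlog (Suc i) $ t =
  - (\<Sum>s=d (Suc i) + 1..d i. (a * q powi (2 * int s - 1 - int i)) ^ t) / of_nat t"
proof -
 define D where "D = d i - d (Suc i)"
 define \<beta> where "\<beta> = a * q powi (2 * int (d (Suc i)) - 1 - int i)"
 define y where "y = q ^ (2 * t)"
 let ?l = "\<lambda>x. Abs_fps (\<lambda>t. - (x ^ t) / of_nat t) :: complex fps"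
 have kD: "kk i = q ^ D" using dd by (simp add: kk_def D_def of_nat_diff flip: power_int_of_nat)
 have shift: "a * q powi (2 * int (d (Suc i) + k) - 1 - int i) = \<beta> * q ^ (2 * k)" for k
 proof -
  have "2 * int (d (Suc i) + k) - 1 - int i = (2 * int (d (Suc i)) - 1 - int i) + int (2 * k)" by simp
  then show ?thesis by (simp only: \<beta>_def power_int_add q0 simp_thms power_int_of_nat mult.assoc)
 qed
 have bD: "bb i = \<beta> * q ^ (2 * D)" using shift [of D] dd by (simp add: D_def)
 have "bb i * inverse (kk i) = kk i * \<beta>" unfolding bD kD using q0 by (simp add: mult_2 power_add)
 then have "fps_const (kk i) - fps_const (bb i * inverse (kk i)) * fps_X = fps_const (kk i) * (1 - fps_const \<beta> * fps_X)"
  by (simp add: right_diff_distrib mult.assoc [symmetric])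
 then have "fps_const (kk i) * ((1 - fps_const (bb i) * fps_X) * fexpc (ex i)) = fps_const (kk i) * (1 - fps_const \<beta> * fps_X)"
  using ps_eq [OF i] by (simp only: ps_def mult.left_commute)
 then have "fexpc (ex i) * fexpc (?l (bb i)) = fexpc (?l \<beta>)"
  unfolding log_linear by (simp add: kk_def mult.commute)
 then have "fexpc (ex i + ?l (bb i)) = fexpc (?l \<beta>)" by (subst fexpc_add) (simp_all add: ex_def)
 then have "ex i + ?l (bb i) = ?l \<beta>" by (rule fexpc_inj [rotated 2]) (simp_all add: ex_def)
 from this have "ex i $ t = (bb i ^ t - \<beta> ^ t) / of_nat t"
 proof -
  assume "ex i + ?l (bb i) = ?l \<beta>"
  from arg_cong [OF this, of "\<lambda>f. f $ t"] have "ex i $ t + - (bb i ^ t) / of_nat t = - (\<beta> ^ t) / of_nat t" by simp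
  then show ?thesis by (simp add: diff_divide_distrib algebra_simps)
 qed
 also have "bb i ^ t - \<beta> ^ t = \<beta> ^ t * (y ^ D - 1)"
  unfolding bD y_def by (simp add: power_mult_distrib right_diff_distrib power_mult [symmetric] mult.commute mult.left_commute)
 also have "\<beta> ^ t * (y ^ D - 1) = (1 - inverse y) * (\<Sum>s=d (Suc i) + 1..d i. (a * q powi (2 * int s - 1 - int i)) ^ t)"
 proof -
  have "(\<Sum>s=d (Suc i) + 1..d i. (a * q powi (2 * int s - 1 - int i)) ^ t) = (\<Sum>k=1..D. (a * q powi (2 * int (d (Suc i) + k) - 1 - int i)) ^ t)"
   by (rule sum.reindex_bij_witness [where j = "\<lambda>s. s - d (Suc i)" and i = "\<lambda>s. d (Suc i) + s"])
    (use dd in \<open>auto simp: D_def\<close>)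
  also have "... = \<beta> ^ t * (\<Sum>k=1..D. y ^ k)"
   unfolding shift sum_distrib_left y_def
   by (intro sum.cong) (simp_all add: power_mult_distrib power_mult [symmetric] mult.commute mult.left_commute)
  finally show ?thesis using geometric_step [of y D] q0 by (simp add: y_def)
 qed
 also have "ex i $ t = (1 - inverse y) * ((q ^ (i + 1)) ^ t * hlog (Suc i) $ t - (q ^ (i - 1)) ^ t * hlog i $ t)"
 proof -
  have "(inverse q ^ 2) ^ t = inverse y" by (simp only: y_def power_mult power_inverse)
  then show ?thesis using ex_coeff [OF t, of i] by simp
 qed
 finally have "(1 - inverse y) * ((q ^ (i + 1)) ^ t * hlog (Suc i) $ t - (q ^ (i - 1)) ^ t * hlog i $ t) =
  (1 - inverse y) * ((\<Sum>s=d (Suc i) + 1..d i. (a * q powi (2 * int s - 1 - int i)) ^ t) / of_nat t)" by simp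
 moreover have "1 - inverse y ~= 0" using qroot [of "2 * t"] t by (auto simp: y_def)
 ultimately have "(q ^ (i + 1)) ^ t * hlog (Suc i) $ t - (q ^ (i - 1)) ^ t * hlog i $ t =
  (\<Sum>s=d (Suc i) + 1..d i. (a * q powi (2 * int s - 1 - int i)) ^ t) / of_nat t" unfolding mult_cancel_left by blast
 then show ?thesis by (simp add: algebra_simps)
qed

text \<open>The factor of index \<open>i\<close> has one root for each box in row \<open>i\<close> of the Young
  diagram.\<close>

definition boxes :: "nat => complex poly" where
 "boxes i = (\<Prod>s=1..d i. [:1, - (a * q powi (2 * (int s - int i))):])"

lemma box_shift: "i \<ge> 1 ==> q ^ (i - 1) * (a * q powi (2 * (int s - int i))) = a * q powi (2 * int s - 1 - int i)"
 "q ^ (i + 1) * (a * q powi (2 * (int s - int (Suc i)))) = a * q powi (2 * int s - 1 - int i)"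
proof -
 show "q ^ (i - 1) * (a * q powi (2 * (int s - int i))) = a * q powi (2 * int s - 1 - int i)" if "i \<ge> 1"
 proof -
  have "2 * int s - 1 - int i = int (i - 1) + 2 * (int s - int i)" using that by simp
  then show ?thesis by (simp only: power_int_add q0 simp_thms power_int_of_nat mult.left_commute [of a])
 qed
 have "2 * int s - 1 - int i = int (i + 1) + 2 * (int s - int (Suc i))" by simp
 then show "q ^ (i + 1) * (a * q powi (2 * (int s - int (Suc i)))) = a * q powi (2 * int s - 1 - int i)"
  by (simp only: power_int_add q0 simp_thms power_int_of_nat mult.left_commute [of a])
qed

lemma boxes_ratio:
 assumes i: "i : {1..<n}" and dd: "d (Suc i) \<le> d i"
 shows "dilate (q ^ (i - 1)) (boxes i) = (\<Prod>s=d (Suc i) + 1..d i. [:1, - (a * q powi (2 * int s - 1 - int i)):]) * dilate (q ^ (i + 1)) (boxes (Suc i))"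
proof -
 let ?g = "\<lambda>s. [:1, - (a * q powi (2 * int s - 1 - int i)):]"
 have lin: "dilate c [:1, - x:] = [:1, - (c * x):]" for c x by (simp add: dilate_def pcompose_pCons)
 have dp: "dilate c (\<Prod>s\<in>S. g s) = (\<Prod>s\<in>S. dilate c (g s))" for c S and g :: "nat => complex poly"
  by (simp add: dilate_def pcompose_prod)
 have 1: "dilate (q ^ (i - 1)) (boxes i) = (\<Prod>s=1..d i. ?g s)"
  unfolding boxes_def dp lin using i by (simp only: box_shift(1) atLeastLessThan_iff)
 have 2: "dilate (q ^ (i + 1)) (boxes (Suc i)) = (\<Prod>s=1..d (Suc i). ?g s)"
  unfolding boxes_def dp lin box_shift(2) ..
 have "{1..d i} = {1..d (Suc i)} \<union> {d (Suc i) + 1..d i}" using dd by auto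
 then show ?thesis unfolding 1 2 by (simp add: prod.union_disjoint mult.commute)
qed

text \<open>The logarithmic coefficients of \<open>Q i\<close> and of \<open>boxes i\<close> satisfy the same
  recursion in \<open>i\<close> and have the same sum over \<open>i\<close>.\<close>

lemma Q_value:
 assumes dd: "!!i. i : {1..<n} ==> d (Suc i) \<le> d i"
  and hwZ: "!!t. t \<ge> 1 ==> eqv (cst (of_nat t * q ^ t / qint q (int t)) * (\<Sum>i=1..n. uG i (int t)))
   (cst (\<Sum>i=1..n. \<Sum>s=1..d i. (a * q powi (2 * (int s - int i))) ^ t))"
  and i: "i : {1..n}"
 shows "Q i = boxes i"
proof -
 define tl where "tl i = (\<Sum>s=1..d i. Abs_fps (\<lambda>t. - ((a * q powi (2 * (int s - int i))) ^ t) / of_nat t))" for i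
 have tl0: "tl i $ 0 = 0" for i by (simp add: tl_def fps_sum_nth)
 have tlt: "tl i $ t = - (\<Sum>s=1..d i. (a * q powi (2 * (int s - int i))) ^ t) / of_nat t" for i t
  by (simp add: tl_def fps_sum_nth sum_negf sum_divide_distrib)
 have tlE: "fexpc (tl i) = fps_of_poly (boxes i)" for i
 proof -
  have "fexpc (tl i) = (\<Prod>s=1..d i. 1 - fps_const (a * q powi (2 * (int s - int i))) * fps_X)"
   unfolding tl_def by (subst fexpc_sum) (simp_all only: log_linear fps_nth_Abs_fps of_nat_0 div_by_0)
  also have "... = (\<Prod>s=1..d i. fps_of_poly [:1, - (a * q powi (2 * (int s - int i))):])"
   by (rule prod.cong) (simp_all add: fps_of_poly_pCons fps_const_neg [symmetric] mult.commute del: fps_const_neg)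
  finally show ?thesis by (simp add: boxes_def fps_of_poly_prod)
 qed
 define \<delta> where "\<delta> i t = hlog i $ t - tl i $ t" for i t
 have d0: "\<delta> i 0 = 0" if "i : {1..n}" for i using hlog(1) [OF that] by (simp add: \<delta>_def tl0)
 have step: "\<delta> (Suc i) t = inverse (q ^ (2 * t)) * \<delta> i t" if i: "i : {1..<n}" for i t
 proof (cases "t = 0")
  case True
  then show ?thesis using d0 [of i] d0 [of "Suc i"] i by simp
 next
  case False
  have "(q ^ (i - 1)) ^ t * tl i $ t - (q ^ (i + 1)) ^ t * tl (Suc i) $ t =
   - (\<Sum>s=d (Suc i) + 1..d i. (a * q powi (2 * int s - 1 - int i)) ^ t) / of_nat t"
  proof -
   let ?g = "\<lambda>s. (a * q powi (2 * int s - 1 - int i)) ^ t"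
   have "(q ^ (i - 1)) ^ t * (\<Sum>s=1..d i. (a * q powi (2 * (int s - int i))) ^ t) = (\<Sum>s=1..d i. ?g s)"
    unfolding sum_distrib_left power_mult_distrib [symmetric]
    using i by (simp only: box_shift(1) atLeastLessThan_iff)
   moreover have "(q ^ (i + 1)) ^ t * (\<Sum>s=1..d (Suc i). (a * q powi (2 * (int s - int (Suc i)))) ^ t) = (\<Sum>s=1..d (Suc i). ?g s)"
    unfolding sum_distrib_left power_mult_distrib [symmetric] box_shift(2) ..
   moreover have "(\<Sum>s=1..d i. ?g s) = (\<Sum>s=1..d (Suc i). ?g s) + (\<Sum>s=d (Suc i) + 1..d i. ?g s)"
   proof -
    have "{1..d i} = {1..d (Suc i)} \<union> {d (Suc i) + 1..d i}" using dd [OF i] by auto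
    then show ?thesis by (simp add: sum.union_disjoint)
   qed
   moreover have "x * (- A / c) - y * (- B / c) = - ((x * A - y * B) / c)" for x y A B c :: complex
    by (simp add: diff_divide_distrib)
   ultimately show ?thesis unfolding tlt by (simp only:) simp
  qed
  from this have "(q ^ (i - 1)) ^ t * \<delta> i t = (q ^ (i + 1)) ^ t * \<delta> (Suc i) t"
  proof -
   assume tl: "(q ^ (i - 1)) ^ t * tl i $ t - (q ^ (i + 1)) ^ t * tl (Suc i) $ t =
    - (\<Sum>s=d (Suc i) + 1..d i. (a * q powi (2 * int s - 1 - int i)) ^ t) / of_nat t"
   have sub: "x * (h - l) = y * (h' - l')" if "x * h - y * h' = R" "x * l - y * l' = R" for x y h h' l l' R :: complex
   proof -
    have "x * h - y * h' = x * l - y * l'" using that by simp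
    then show ?thesis by (simp add: algebra_simps)
   qed
   have "t > 0" using False by simp
   from hlog_step [OF i dd [OF i] this] tl show ?thesis unfolding \<delta>_def by (rule sub)
  qed
  also have "(q ^ (i + 1)) ^ t = (q ^ (i - 1)) ^ t * q ^ (2 * t)"
  proof -
   have "q ^ (i + 1) = q ^ (i - 1) * q ^ 2" using i by (simp flip: power_add)
   then show ?thesis by (simp only: power_mult_distrib power_mult)
  qed
  finally show ?thesis using q0 by (simp add: field_simps)
 qed
 have all: "\<delta> (Suc j) t = inverse (q ^ (2 * t)) ^ j * \<delta> 1 t" if "j < n" for j t
  using that by (induction j) (simp_all add: step)
 have d1: "\<delta> 1 t = 0" for t
 proof (cases "t = 0")
  case True
  then show ?thesis using hlog [of 1] n2 by (simp add: \<delta>_def tl0)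
 next
  case False
  then have t: "t \<ge> 1" by simp
  have "eig (cst (of_nat t * q ^ t / qint q (int t)) * (\<Sum>i=1..n. uG i (int t))) (of_nat t * q ^ t / qint q (int t) * (\<Sum>i=1..n. gam i t))"
   using t by (intro eig_scale eig_sum eig_G) auto
  moreover have "eig (cst (of_nat t * q ^ t / qint q (int t)) * (\<Sum>i=1..n. uG i (int t))) (\<Sum>i=1..n. \<Sum>s=1..d i. (a * q powi (2 * (int s - int i))) ^ t)"
   using hwZ [OF t] calculation by (simp add: eig_def)
  ultimately have "of_nat t * q ^ t / qint q (int t) * (\<Sum>i=1..n. gam i t) = (\<Sum>i=1..n. \<Sum>s=1..d i. (a * q powi (2 * (int s - int i))) ^ t)"
   by (rule eig_unique [OF N1])
  also have "... = (\<Sum>i=1..n. - (of_nat t * tl i $ t))" using False by (simp add: tlt)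
  also have "of_nat t * q ^ t / qint q (int t) * (\<Sum>i=1..n. gam i t) = (\<Sum>i=1..n. - (of_nat t * hlog i $ t))"
   unfolding sum_distrib_left using qint_neq [of "int t"] False q0
   by (intro sum.cong) (simp_all add: gam_def power_inverse field_simps)
  finally have "(\<Sum>i=1..n. \<delta> i t) = 0"
   using False by (simp add: \<delta>_def sum_subtractf sum_negf flip: sum_distrib_left)
  also have "(\<Sum>i=1..n. \<delta> i t) = (\<Sum>j<n. inverse (q ^ (2 * t)) ^ j) * \<delta> 1 t"
  proof -
   have "(\<Sum>i=1..n. \<delta> i t) = (\<Sum>j<n. \<delta> (Suc j) t)" by (simp add: sum.atLeast1_atMost_eq)
   then show ?thesis unfolding sum_distrib_right by (simp add: all del: One_nat_def)
  qed
  finally have "(\<Sum>j<n. inverse (q ^ (2 * t)) ^ j) * \<delta> 1 t = 0" .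
  moreover have "(\<Sum>j<n. inverse (q ^ (2 * t)) ^ j) ~= 0"
  proof -
   have e: "inverse (q ^ (2 * t)) ^ k = q powi (- int (2 * t * k))" for k
    by (simp only: power_int_minus power_int_of_nat power_inverse power_mult)
   have "inverse (q ^ (2 * t)) ^ 1 ~= 1" "inverse (q ^ (2 * t)) ^ n ~= 1"
    unfolding e q_powi_eq_1 using n2 False by auto
   then show ?thesis by (subst geometric_sum) auto
  qed
  ultimately show ?thesis by simp
 qed
 have "hlog i = tl i"
 proof (rule fps_ext)
  fix t
  obtain j where "i = Suc j" "j < n" using i by (cases i) auto
  then have "\<delta> i t = 0" using all [of j t] d1 by simp
  then show "hlog i $ t = tl i $ t" by (simp add: \<delta>_def)
 qed
 then have "fps_of_poly (Q i) = fps_of_poly (boxes i)" using hlog(2) [OF i] tlE [of i] by simp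
 then show ?thesis by (simp add: fps_of_poly_eq_iff)
qed

end

context evalm begin

section \<open>Symmetrizers of the finite Hecke algebra\<close>

text \<open>The operators \<open>1 + T\<^sub>k + T\<^sub>k T\<^sub>k\<^sub>-\<^sub>1 + \<dots>\<close> on positions
  after \<open>o'\<close> are sums over coset representatives of symmetric groups; their product \<open>sy\<close> is
  the symmetrizer on \<open>d\<close> neighbouring positions.\<close>

primrec gT :: "nat => nat => int fa => int fa" where
 "gT o' 0 = (\<lambda>v. v)"
| "gT o' (Suc k) = (\<lambda>v. v + tT (o' + Suc k) (gT o' k v))"

primrec sy :: "nat => nat => int fa => int fa" where
 "sy o' 0 = (\<lambda>v. v)"
| "sy o' (Suc d) = (\<lambda>v. sy o' d (gT o' d v))"

lemma linear_gT [simp]: "linear_map (gT o' k)"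
 by (induction k) (simp_all add: linear_map_plus linear_map_comp [OF linear_hecke])

lemma linear_sy [simp]: "linear_map (sy o' d)"
 by (induction d) (simp_all add: linear_map_comp [OF _ linear_gT])

lemmas sy_lin = linear_map_simps [OF linear_sy] linear_map_simps [OF linear_gT]

lemma gT_Omega: "v : Omega s ==> gT o' k v : Omega s"
 by (induction k) (auto simp: Omega_closed hecke_Omega)

lemma gT_fin: "v : Omega_fin n s ==> o' + k < s ==> gT o' k v : Omega_fin n s"
 by (induction k) (auto intro!: Omega_fin_closed tT_Omega_fin)

lemma sy_fin: "v : Omega_fin n s ==> o' + d \<le> s ==> sy o' d v : Omega_fin n s"
proof (induction d arbitrary: v)
 case (Suc d)
 then show ?case using gT_fin [of v s o' d] by simp
qed simp

lemma sy_Omega: "v : Omega s ==> sy o' d v : Omega s"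
 by (induction d arbitrary: v) (auto intro: gT_Omega)

lemma gT_far: "j : {1..<s} ==> o' + k + 1 < j ==> v : Omega s ==> gT o' k (tT j v) = tT j (gT o' k v)"
proof (induction k)
 case (Suc k)
 then show ?case using T_T_far [of "o' + Suc k" s j "gT o' k v"] gT_Omega [of v s o' k]
  by (simp add: hecke_lin)
qed simp

text \<open>By induction for all maps \<open>P\<close> that absorb the smaller generators at once: composing
  \<open>P\<close> with \<open>T\<^sub>k\<^sub>+\<^sub>1\<close> gives such a map for \<open>k\<close>, and for the
  last generator the quadratic and the braid relation apply.\<close>

lemma gT_absorb:
 assumes "linear_map P" "!!j v. j : {1..<k} ==> v : Omega s ==> P (tT (o' + j) v) = cst (q\<^sup>2) * P v"
  and "o' + k < s" "v : Omega s" "i : {1..k}"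
 shows "P (gT o' k (tT (o' + i) v)) = cst (q\<^sup>2) * P (gT o' k v)"
 using assms
proof (induction k arbitrary: P)
 case (Suc k)
 note P = linear_map_simps [OF Suc.prems(1)]
 show ?case
 proof (cases "i \<le> k")
  case True
  have "P (tT (o' + Suc k) (gT o' k (tT (o' + i) v))) = cst (q\<^sup>2) * P (tT (o' + Suc k) (gT o' k v))"
  proof (rule Suc.IH [of "\<lambda>v. P (tT (o' + Suc k) v)"])
   show "linear_map (\<lambda>v. P (tT (o' + Suc k) v))" by (rule linear_map_comp [OF Suc.prems(1) linear_hecke])
   fix j v assume j: "j : {1..<k}" and v: "v : Omega s"
   have "tT (o' + Suc k) (tT (o' + j) v) = tT (o' + j) (tT (o' + Suc k) v)"
    by (rule T_T_far [of _ s]) (use j v Suc.prems(3) in auto)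
   then show "P (tT (o' + Suc k) (tT (o' + j) v)) = cst (q\<^sup>2) * P (tT (o' + Suc k) v)"
    using Suc.prems(2) [of j] j hecke_Omega [OF v] by simp
  qed (use True Suc.prems in auto)
  moreover have "P (tT (o' + i) v) = cst (q\<^sup>2) * P v" using Suc.prems True by simp
  ultimately show ?thesis by (simp only: gT.simps P distrib_left)
 next
  case False
  then have i: "i = Suc k" using Suc.prems by simp
  have T: "o' + Suc k : {1..<s}" using Suc.prems by simp
  have q: "tT (o' + Suc k) (tT (o' + Suc k) v) = cst (q\<^sup>2 - 1) * tT (o' + Suc k) v + cst (q\<^sup>2) * v"
   by (rule quadratic [OF T Suc.prems(4)])
  show ?thesis
  proof (cases k)
   case 0
   then show ?thesis using q by (simp only: i gT.simps add_0_right) (simp add: P cst_diff left_diff_distrib algebra_simps)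
  next
   case (Suc l)
   define x where "x = gT o' l v"
   have x: "x : Omega s" unfolding x_def by (rule gT_Omega [OF Suc.prems(4)])
   have "gT o' l (tT (o' + Suc k) v) = tT (o' + Suc k) x"
    unfolding x_def by (rule gT_far [of _ s]) (use T Suc Suc.prems in auto)
   then have g: "gT o' k (tT (o' + Suc k) v) = tT (o' + Suc k) v + tT (o' + k) (tT (o' + Suc k) x)"
    unfolding Suc by simp
   have b: "tT (o' + Suc k) (tT (o' + k) (tT (o' + Suc k) x)) = tT (o' + k) (tT (o' + Suc k) (tT (o' + k) x))"
    using braid [of "o' + k" s x] T x Suc by simp
   have a: "P (tT (o' + k) (tT (o' + Suc k) (tT (o' + k) x))) = cst (q\<^sup>2) * P (tT (o' + Suc k) (tT (o' + k) x))"
    using Suc.prems(2) [of k] x Suc by (simp add: hecke_Omega)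
   have gk: "gT o' k v = v + tT (o' + k) x" unfolding Suc x_def by simp
   show ?thesis unfolding i
    by (simp only: gT.simps g gk hecke_lin q b P a)
     (simp add: cst_diff left_diff_distrib algebra_simps)
  qed
 qed
qed simp

lemma sy_absorb: "o' + d \<le> s ==> v : Omega s ==> i : {1..<d} ==> sy o' d (tT (o' + i) v) = cst (q\<^sup>2) * sy o' d v"
proof (induction d arbitrary: v i)
 case (Suc d)
 show ?case unfolding sy.simps
  by (rule gT_absorb [OF linear_sy]) (use Suc in auto)
qed simp

lemma gT_commute:
 assumes "linear_map f" "!!k v. k : {1..<s} ==> v : Omega_fin n s ==> f (tT k v) = tT k (f v)"
  "o' + k < s" "v : Omega_fin n s"
 shows "f (gT o' k v) = gT o' k (f v)"
 using assms(3,4) by (induction k) (simp_all add: linear_map_add [OF assms(1)] assms(2) gT_fin)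

lemma sy_commute:
 assumes "linear_map f" "!!k v. k : {1..<s} ==> v : Omega_fin n s ==> f (tT k v) = tT k (f v)"
  "o' + d \<le> s" "v : Omega_fin n s"
 shows "f (sy o' d v) = sy o' d (f v)"
 using assms(3,4)
proof (induction d arbitrary: v)
 case (Suc d)
 then show ?case using gT_commute [OF assms(1,2), of s o' d v] gT_fin [of v s o' d] by simp
qed simp

lemma gT_left: "x : Omega l ==> y : Omega s ==> o' + k < s ==> gT (l + o') k (x * y) = x * gT o' k y"
proof (induction k)
 case (Suc k)
 then show ?case using T_left [of x l "gT o' k y" s "o' + Suc k"] gT_Omega [of y s o' k]
  by (simp add: distrib_left add.assoc)
qed simp

lemma sy_left: "x : Omega l ==> y : Omega s ==> o' + d \<le> s ==> sy (l + o') d (x * y) = x * sy o' d y"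
 by (induction d arbitrary: y) (simp_all add: gT_left gT_Omega)

lemma gT_right: "x : Omega s ==> o' + k < s ==> gT o' k (x * y) = gT o' k x * y"
proof (induction k)
 case (Suc k)
 then show ?case using T_right [of "gT o' k x" s "o' + Suc k" y] gT_Omega [of x s o' k]
  by (simp add: distrib_right)
qed simp

lemma sy_right: "x : Omega s ==> o' + d \<le> s ==> sy o' d (x * y) = sy o' d x * y"
 by (induction d arbitrary: x) (simp_all add: gT_right gT_Omega)

text \<open>Quantum integers do not vanish because \<open>q\<close> is not a root of unity.\<close>

lemma q2_sum: "(\<Sum>j<Suc k. (q\<^sup>2) ^ j) ~= 0" "(\<Sum>j<Suc k. q ^ (k - j) * inverse q ^ j) ~= 0"
proof -
 have p: "(q\<^sup>2) ^ Suc k = q ^ (2 * Suc k)" by (rule power_mult [symmetric])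
 have "(q\<^sup>2) ^ Suc k ~= 1" unfolding p by (rule qroot) simp
 moreover have "(\<Sum>j<Suc k. (q\<^sup>2) ^ j) = ((q\<^sup>2) ^ Suc k - 1) / (q\<^sup>2 - 1)"
  by (rule geometric_sum) (use q2_neq in simp)
 ultimately show 1: "(\<Sum>j<Suc k. (q\<^sup>2) ^ j) ~= 0" using q2_neq by simp
 have "(\<Sum>j<Suc k. q ^ (k - j) * inverse q ^ j) = (\<Sum>j<Suc k. inverse q ^ k * (q\<^sup>2) ^ (k - j))"
 proof (rule sum.cong)
  fix j assume "j : {..<Suc k}"
  then obtain m where k: "k = j + m" by (metis lessThan_iff less_Suc_eq_le le_Suc_ex)
  show "q ^ (k - j) * inverse q ^ j = inverse q ^ k * (q\<^sup>2) ^ (k - j)"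
   unfolding k by (simp add: power_add power2_eq_square power_mult_distrib power_inverse field_simps)
 qed simp
 also have "... = inverse q ^ k * (\<Sum>j<Suc k. (q\<^sup>2) ^ j)"
  unfolding sum_distrib_left [symmetric] using sum.nat_diff_reindex [of "\<lambda>j. (q\<^sup>2) ^ j" "Suc k"] by simp
 finally show "(\<Sum>j<Suc k. q ^ (k - j) * inverse q ^ j) ~= 0" using 1 by simp
qed

lemma sy_symmetric:
 assumes "!!i. i : {1..<d} ==> tT (o' + i) v = cst (q\<^sup>2) * v"
 shows "\<exists>c. c ~= 0 \<and> sy o' d v = cst c * v"
proof -
 have g: "gT o' k v = cst (\<Sum>j<Suc k. (q\<^sup>2) ^ j) * v" if "k < d" for k
  using that
 proof (induction k)
  case (Suc k)
  have "(\<Sum>j<Suc (Suc k). (q\<^sup>2) ^ j) = 1 + (\<Sum>j<Suc k. (q\<^sup>2) ^ j) * q\<^sup>2"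
   by (subst sum.lessThan_Suc_shift) (simp only: power_Suc2 power_0 sum_distrib_right)
  then show ?case using Suc assms [of "Suc k"]
   by (simp add: hecke_lin cst_mult_assoc cst_add distrib_right del: sum.lessThan_Suc)
 qed simp
 have "\<exists>c. c ~= 0 \<and> sy o' d' v = cst c * v" if "d' \<le> d" for d'
  using that
 proof (induction d')
  case 0
  then show ?case by (intro exI [of _ 1]) simp
 next
  case (Suc d')
  then obtain c where "c ~= 0" "sy o' d' v = cst c * v" by auto
  then show ?case using g [of d'] q2_sum(1) [of d'] Suc.prems
   by (intro exI [of _ "(\<Sum>j<Suc d'. (q\<^sup>2) ^ j) * c"]) (simp add: sy_lin cst_mult_assoc del: sum.lessThan_Suc)
 qed
 then show ?thesis by simp
qed

text \<open>Up to a nonzero factor the symmetrization of a word depends on its content only.\<close>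

abbreviation "es w \<equiv> sy 0 (length w) (mon w)"

lemma es_swap: "fin_word (u @ x # y # v) ==> y < x ==> es (u @ x # y # v) = cst q * es (u @ y # x # v)"
proof -
 assume f: "fin_word (u @ x # y # v)" and ab: "y < x"
 let ?d = "length (u @ y # x # v)"
 have "cst q * sy 0 ?d (mon (u @ x # y # v)) = sy 0 ?d (tT (0 + Suc (length u)) (mon (u @ y # x # v)))"
  using T_fin [of y x u v] f ab by (simp add: fin_word_def sy_lin del: sy.simps list.size length_append)
 also have "... = cst (q\<^sup>2) * sy 0 ?d (mon (u @ y # x # v))"
  by (rule sy_absorb [of _ _ ?d]) (simp_all add: Omega_closed)
 finally have "cst (inverse q) * (cst q * sy 0 ?d (mon (u @ x # y # v))) = cst (inverse q) * (cst (q\<^sup>2) * sy 0 ?d (mon (u @ y # x # v)))"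
  by simp
 moreover have "inverse q * q\<^sup>2 = q" "inverse q * q = 1" by (simp_all add: power2_eq_square)
 ultimately show ?thesis by (simp only: cst_mult_assoc cst_1 mult_1_left length_append length_Cons)
qed

lemma es_move1: "fin_word (u @ x # replicate m y @ v) ==> y < x ==> es (u @ x # replicate m y @ v) = cst (q ^ m) * es (u @ replicate m y @ x # v)"
proof (induction m arbitrary: u)
 case (Suc m)
 have "es (u @ x # replicate (Suc m) y @ v) = cst q * es ((u @ [y]) @ x # replicate m y @ v)"
  using es_swap [of u x y "replicate m y @ v"] Suc.prems by simp
 also have "es ((u @ [y]) @ x # replicate m y @ v) = cst (q ^ m) * es ((u @ [y]) @ replicate m y @ x # v)"
  by (rule Suc.IH) (use Suc.prems in \<open>auto simp: fin_word_def\<close>)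
 finally show ?case by (simp add: cst_mult_assoc)
qed simp

lemma es_move2: "fin_word (replicate m x @ y # v) ==> y < x ==> es (replicate m x @ y # v) = cst (q ^ m) * es (y # replicate m x @ v)"
proof (induction m arbitrary: v)
 case (Suc m)
 have e: "replicate (Suc m) x @ y # v = replicate m x @ x # y # v" "replicate m x @ y # x # v = replicate m x @ y # ([x] @ v)"
  "y # replicate m x @ [x] @ v = y # replicate (Suc m) x @ v"
  by (simp_all add: replicate_app_Cons_same)
 have "es (replicate (Suc m) x @ y # v) = cst q * es (replicate m x @ y # ([x] @ v))"
  using es_swap [of "replicate m x" x y v] Suc.prems unfolding e by simp
 also have "es (replicate m x @ y # ([x] @ v)) = cst (q ^ m) * es (y # replicate m x @ [x] @ v)"
  by (rule Suc.IH) (use Suc.prems in \<open>auto simp: fin_word_def\<close>)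
 finally show ?case unfolding e by (simp add: cst_mult_assoc)
qed simp

lemma es_sort: "fin_word (u @ w) ==> \<exists>c. c ~= 0 \<and> es (u @ w) = cst c * es (u @ sort w)"
proof (induction w arbitrary: u)
 case Nil
 then show ?case by (intro exI [of _ 1]) simp
next
 case (Cons x w)
 have ins: "\<exists>c. c ~= 0 \<and> es (u @ x # w) = cst c * es (u @ insort x w)" if "fin_word (u @ x # w)" for u w
  using that
 proof (induction w arbitrary: u)
  case Nil
  then show ?case by (intro exI [of _ 1]) simp
 next
  case (Cons y w)
  show ?case
  proof (cases "x \<le> y")
   case True
   then show ?thesis by (intro exI [of _ 1]) simp
  next
   case False
   obtain c where c: "c ~= 0" "es ((u @ [y]) @ x # w) = cst c * es ((u @ [y]) @ insort x w)"
    using Cons.IH [of "u @ [y]"] Cons.prems by (auto simp: fin_word_def)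
   then show ?thesis using es_swap [of u x y w] Cons.prems False
    by (intro exI [of _ "q * c"]) (simp add: cst_mult_assoc)
  qed
 qed
 obtain c where c: "c ~= 0" "es ((u @ [x]) @ w) = cst c * es ((u @ [x]) @ sort w)"
  using Cons.IH [of "u @ [x]"] Cons.prems by auto
 have "fin_word (u @ x # sort w)" using Cons.prems by (simp add: fin_word_def)
 from ins [OF this] obtain c' where c': "c' ~= 0" "es (u @ x # sort w) = cst c' * es (u @ insort x (sort w))" by blast
 show ?case using c c' by (intro exI [of _ "c * c'"]) (simp add: cst_mult_assoc)
qed

lemma es_perm:
 assumes "fin_word w" "mset w = mset w'"
 shows "\<exists>c. c ~= 0 \<and> es w = cst c * es w'"
proof -
 have s: "sort w = sort w'" by (rule properties_for_sort) (use assms in auto)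
 have "fin_word w'" using assms by (metis fin_word_def set_mset_mset)
 then obtain c c' where c: "c ~= 0" "es w = cst c * es (sort w)" "c' ~= 0" "es w' = cst c' * es (sort w')"
  using es_sort [of "[]" w] es_sort [of "[]" w'] assms by auto
 then have "es (sort w') = cst (inverse c') * es w'" by (simp add: cst_mult_assoc)
 then have "es w = cst (c * inverse c') * es w'" using c(2) s by (simp only: cst_mult_assoc)
 then show ?thesis using c by (intro exI [of _ "c * inverse c'"]) simp
qed

lemma F_sy: "i : {1..<n} ==> v : Omega_fin n s ==> o' + d \<le> s ==> opF i (sy o' d v) = sy o' d (opF i v)"
 and E_sy: "i : {1..<n} ==> v : Omega_fin n s ==> o' + d \<le> s ==> opE i (sy o' d v) = sy o' d (opE i v)"
 and dg_sy: "additive \<chi> ==> v : Omega_fin n s ==> o' + d \<le> s ==> dg \<chi> (sy o' d v) = sy o' d (dg \<chi> v)"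
 using sy_commute [OF linear_opF, of s i o' d v] sy_commute [OF linear_opE, of s i o' d v]
  sy_commute [OF linear_dg, of s \<chi> o' d v]
 by (simp_all add: F_T E_T dg_T)

lemma F_es:
 assumes i: "i : {1..<n}" and w: "fin_word (replicate (Suc m) (int i) @ v)" and v: "int i \<notin> set v"
 shows "\<exists>c. c ~= 0 \<and> opF i (es (replicate (Suc m) (int i) @ v)) = cst c * es (replicate m (int i) @ (int i + 1) # v)"
proof -
 let ?w = "replicate (Suc m) (int i) @ v" and ?t = "replicate m (int i) @ (int i + 1) # v"
 let ?d = "length ?w"
 have F0: "opF i (mon v) = 0" by (rule op_none(2)) (use w v rs_fin in \<open>auto simp: fin_word_def\<close>)
 have "opF i (es ?w) = sy 0 ?d (opF i (mon ?w))"
  by (rule F_sy [OF i]) (use w in \<open>auto simp: Omega_fin_closed\<close>)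
 also have "opF i (mon ?w) = exch i 0 (Suc m) * mon v"
  unfolding mon_mult [symmetric] opF_mult F0 using F_replicate [of i "Suc m"] i by simp
 also have "... = (\<Sum>j<Suc m. cst (q powi (- int j)) * mon (replicate j (int i) @ (int i + 1) # replicate (m - j) (int i) @ v))"
  unfolding exch_def sum_distrib_right by (simp add: mult.assoc mon_mult del: sum.lessThan_Suc)
 also have "sy 0 ?d \<dots> = (\<Sum>j<Suc m. cst (q powi (- int j)) * (cst (q ^ (m - j)) * es ?t))"
  unfolding sy_lin
 proof (rule sum.cong)
  fix j assume j: "j : {..<Suc m}"
  have r: "replicate j (int i) @ replicate (m - j) (int i) = replicate m (int i)" using j by (simp flip: replicate_add)
  have "es (replicate j (int i) @ (int i + 1) # replicate (m - j) (int i) @ v) = cst (q ^ (m - j)) * es (replicate j (int i) @ replicate (m - j) (int i) @ (int i + 1) # v)"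
   by (rule es_move1) (use w i in \<open>auto simp: fin_word_def\<close>)
  then show "cst (q powi (- int j)) * sy 0 ?d (mon (replicate j (int i) @ (int i + 1) # replicate (m - j) (int i) @ v)) =
    cst (q powi (- int j)) * (cst (q ^ (m - j)) * es ?t)"
   using j r by (metis (no_types, lifting) append.assoc length_append length_Cons length_replicate add_Suc_right add_Suc)
 qed simp
 also have "... = cst (\<Sum>j<Suc m. q ^ (m - j) * inverse q ^ j) * es ?t"
 proof -
  have c: "cst (sum g A) * x = (\<Sum>i\<in>A. cst (g i) * x)" for g :: "nat => complex" and A and x :: "int fa"
   by (induction A rule: infinite_finite_induct) (simp_all add: cst_add distrib_right)
  show ?thesis unfolding c by (intro sum.cong) (simp_all add: cst_mult_assoc power_int_minus power_inverse mult.commute)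
 qed
 finally show ?thesis using q2_sum(2) by blast
qed

lemma E_replicate:
 assumes i: "i : {1..<n}"
 shows "opE i (mon (replicate m (int i + 1))) =
  (\<Sum>k<m. cst (q powi (- int (m - 1 - k))) * mon (replicate k (int i + 1) @ int i # replicate (m - 1 - k) (int i + 1)))"
proof (induction m)
 case 0
 then show ?case by (simp add: mon_Nil)
next
 case (Suc m)
 have r: "rs n (int i + 1) = int i + 1" "nx n i = Suc i" using i by (auto simp: rs_fin nx_def)
 have "cnt i (replicate m (int i + 1)) = 0" "cnt (Suc i) (replicate m (int i + 1)) = int m"
  using r by (auto intro!: op_none(3)) (simp add: cnt_def r)
 then have k: "cnt2 i (replicate m (int i + 1)) = - int m" by (simp add: cnt2_def r)
 have "opE i (mon (replicate (Suc m) (int i + 1))) = opE i (mon [int i + 1] * mon (replicate m (int i + 1)))" by (simp add: mon_mult)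
 also have "... = cst (q powi (- int m)) * mon (int i # replicate m (int i + 1)) + mon [int i + 1] * opE i (mon (replicate m (int i + 1)))"
  by (simp only: opE_letter) (simp add: r dg_mon k sc_simps mon_mult)
 also have "mon [int i + 1] * opE i (mon (replicate m (int i + 1))) =
  (\<Sum>k<m. cst (q powi (- int (m - 1 - k))) * mon (replicate (Suc k) (int i + 1) @ int i # replicate (m - 1 - k) (int i + 1)))"
  by (simp add: Suc sum_distrib_left sc_simps mon_mult)
 finally show ?case by (simp add: sum.lessThan_Suc_shift del: sum.lessThan_Suc)
qed

lemma E_es:
 assumes i: "i : {1..<n}" and w: "fin_word (replicate (Suc m) (int i + 1) @ v)" and v: "int i + 1 \<notin> set v"
 shows "\<exists>c. c ~= 0 \<and> opE i (es (replicate (Suc m) (int i + 1) @ v)) = cst c * es (int i # replicate m (int i + 1) @ v)"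
proof -
 let ?w = "replicate (Suc m) (int i + 1) @ v" and ?t = "int i # replicate m (int i + 1) @ v"
 let ?d = "length ?w"
 have "int (nx n i) = int i + 1" using i by (simp add: nx_def)
 then have E0: "opE i (mon v) = 0" by (intro op_none(1)) (use w v rs_fin in \<open>auto simp: fin_word_def\<close>)
 have "opE i (es ?w) = sy 0 ?d (opE i (mon ?w))"
  by (rule E_sy [OF i]) (use w in \<open>auto simp: Omega_fin_closed\<close>)
 also have "opE i (mon ?w) = (\<Sum>k<Suc m. cst (q powi (- int (m - k))) * mon (replicate k (int i + 1) @ int i # replicate (m - k) (int i + 1))) * (cst (q powi cnt2 i v) * mon v)"
  unfolding mon_mult [symmetric] opE_mult E0 E_replicate [OF i] by (simp add: dg_mon)
 also have "... = cst (q powi cnt2 i v) * (\<Sum>j<Suc m. cst (q powi (- int (m - j))) * mon (replicate j (int i + 1) @ int i # replicate (m - j) (int i + 1) @ v))"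
  unfolding sum_distrib_right sum_distrib_left
  by (simp add: mult.assoc mon_mult times_cst_left [of "mon _"] cst_mult_assoc mult.commute del: sum.lessThan_Suc)
 also have "sy 0 ?d \<dots> = cst (q powi cnt2 i v) * (\<Sum>j<Suc m. cst (q powi (- int (m - j))) * (cst (q ^ j) * es ?t))"
  unfolding sy_lin
 proof (rule arg_cong [where f = "(*) (cst (q powi cnt2 i v))"], rule sum.cong)
  fix j assume j: "j : {..<Suc m}"
  have r: "replicate j (int i + 1) @ replicate (m - j) (int i + 1) = replicate m (int i + 1)" using j by (simp flip: replicate_add)
  have "es (replicate j (int i + 1) @ int i # replicate (m - j) (int i + 1) @ v) = cst (q ^ j) * es (int i # replicate j (int i + 1) @ replicate (m - j) (int i + 1) @ v)"
   by (rule es_move2) (use w i in \<open>auto simp: fin_word_def\<close>)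
  then show "cst (q powi (- int (m - j))) * sy 0 ?d (mon (replicate j (int i + 1) @ int i # replicate (m - j) (int i + 1) @ v)) =
    cst (q powi (- int (m - j))) * (cst (q ^ j) * es ?t)"
   using j r by (metis (no_types, lifting) append.assoc length_append length_Cons length_replicate add_Suc_right add_Suc)
 qed simp
 also have "... = cst (q powi cnt2 i v) * (cst (\<Sum>j<Suc m. q ^ (m - j) * inverse q ^ j) * es ?t)"
 proof -
  have c: "cst (sum g A) * x = (\<Sum>i\<in>A. cst (g i) * x)" for g :: "nat => complex" and A and x :: "int fa"
   by (induction A rule: infinite_finite_induct) (simp_all add: cst_add distrib_right)
  have "(\<Sum>j<Suc m. q ^ (m - j) * inverse q ^ j) = (\<Sum>j<Suc m. q ^ j * inverse q ^ (m - j))"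
   using sum.nat_diff_reindex [of "\<lambda>j. q ^ j * inverse q ^ (m - j)" "Suc m"] by simp
  moreover have "(\<Sum>j<Suc m. cst (q powi (- int (m - j))) * (cst (q ^ j) * es ?t)) = cst (\<Sum>j<Suc m. q ^ j * inverse q ^ (m - j)) * es ?t"
   unfolding c by (intro sum.cong) (simp_all only: cst_mult_assoc power_int_minus power_int_of_nat power_inverse mult.commute)
  ultimately show ?thesis by (simp only:)
 qed
 finally show ?thesis using q2_sum(2) [of m] by (intro exI [of _ "q powi cnt2 i v * (\<Sum>j<Suc m. q ^ (m - j) * inverse q ^ j)"])
  (simp add: cst_mult_assoc del: sum.lessThan_Suc)
qed

text \<open>Subspaces that are stable under the action of the finite quantum group.\<close>

definition subsp :: "int fa set => bool" where
 "subsp X \<longleftrightarrow> 0 : X \<and> (\<forall>x\<in>X. \<forall>y\<in>X. x + y : X) \<and> (\<forall>c. \<forall>x\<in>X. cst c * x : X)"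

definition stable :: "nat => nat => nat => int fa set => bool" where
 "stable k h h' X \<longleftrightarrow> subsp X \<and> (\<forall>x\<in>X. \<forall>i\<in>{1..<h}. opE i x : X) \<and> (\<forall>x\<in>X. \<forall>i\<in>{k..<h'}. opF i x : X)"

lemma subspD: "subsp X ==> 0 : X" "subsp X ==> x : X ==> y : X ==> x + y : X" "subsp X ==> x : X ==> cst c * x : X"
  "subsp X ==> x : X ==> y : X ==> x - y : X"
proof -
 show "subsp X ==> 0 : X" "subsp X ==> x : X ==> y : X ==> x + y : X" "subsp X ==> x : X ==> cst c * x : X"
  for x y c by (simp_all add: subsp_def)
 then show "subsp X ==> x : X ==> y : X ==> x - y : X"
  by (metis add_uminus_conv_diff cst_1 cst_minus mult_minus1)
qed

lemma subsp_cancel: "subsp X ==> cst c * x : X ==> c ~= 0 ==> x : X"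
 using subspD(3) [of X "cst c * x" "inverse c"] by (simp add: cst_mult_assoc)

lemma stableD: "stable k h h' X ==> subsp X" "stable k h h' X ==> x : X ==> i : {1..<h} ==> opE i x : X"
  "stable k h h' X ==> x : X ==> i : {k..<h'} ==> opF i x : X"
 unfolding stable_def by blast+

lemma es_perm_mem:
 assumes X: "subsp X" and w: "fin_word w" "mset w = mset w'" and m: "es w : X"
 shows "es w' : X"
proof -
 obtain c where "c ~= 0" "es w = cst c * es w'" using es_perm [OF w] by blast
 then show ?thesis using subsp_cancel [OF X] m by metis
qed

lemma mset_filter_replicate: "mset w = mset (replicate (count_list w x) x @ filter (\<lambda>y. y ~= x) w)"
 by (induction w) auto

text \<open>Put all letters \<open>i\<close> in front.  The lowering operator changes one of them, and after
  symmetrization all terms agree up to powers of \<open>q\<close> that add up to a quantum integer.\<close>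

lemma es_raise:
 assumes X: "stable k h h' X" and i: "i : {k..<h'}" "i : {1..<n}" and w: "fin_word (int i # v)" and m: "es (int i # v) : X"
 shows "es ((int i + 1) # v) : X"
proof -
 let ?m = "count_list v (int i)" and ?r = "filter (\<lambda>y. y ~= int i) v"
 have fin: "fin_word (replicate (Suc ?m) (int i) @ ?r)" using w by (auto simp: fin_word_def)
 have "es (replicate (Suc ?m) (int i) @ ?r) : X"
  by (rule es_perm_mem [OF stableD(1) [OF X] w _ m]) (use mset_filter_replicate [of v "int i"] in simp)
 then have e: "opF i (es (replicate (Suc ?m) (int i) @ ?r)) : X" using X i by (blast intro: stableD)
 obtain c where "c ~= 0" "opF i (es (replicate (Suc ?m) (int i) @ ?r)) = cst c * es (replicate ?m (int i) @ (int i + 1) # ?r)"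
  using F_es [OF i(2) fin] by auto
 with e have "es (replicate ?m (int i) @ (int i + 1) # ?r) : X" using subsp_cancel [OF stableD(1) [OF X]] by metis
 then show ?thesis
 proof (rule es_perm_mem [OF stableD(1) [OF X], rotated 2])
  show "fin_word (replicate ?m (int i) @ (int i + 1) # ?r)" using fin i by (auto simp: fin_word_def)
  show "mset (replicate ?m (int i) @ (int i + 1) # ?r) = mset ((int i + 1) # v)"
   using mset_filter_replicate [of v "int i"] by simp
 qed
qed

lemma es_lower:
 assumes X: "stable k h h' X" and i: "i : {1..<h}" "i : {1..<n}" and w: "fin_word ((int i + 1) # v)" and m: "es ((int i + 1) # v) : X"
 shows "es (int i # v) : X"
proof -
 let ?m = "count_list v (int i + 1)" and ?r = "filter (\<lambda>y. y ~= int i + 1) v"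
 have fin: "fin_word (replicate (Suc ?m) (int i + 1) @ ?r)" using w by (auto simp: fin_word_def)
 have "es (replicate (Suc ?m) (int i + 1) @ ?r) : X"
  by (rule es_perm_mem [OF stableD(1) [OF X] w _ m]) (use mset_filter_replicate [of v "int i + 1"] in simp)
 then have e: "opE i (es (replicate (Suc ?m) (int i + 1) @ ?r)) : X" using X i by (blast intro: stableD)
 obtain c where "c ~= 0" "opE i (es (replicate (Suc ?m) (int i + 1) @ ?r)) = cst c * es (int i # replicate ?m (int i + 1) @ ?r)"
  using E_es [OF i(2) fin] by auto
 with e have "es (int i # replicate ?m (int i + 1) @ ?r) : X" using subsp_cancel [OF stableD(1) [OF X]] by metis
 then show ?thesis
 proof (rule es_perm_mem [OF stableD(1) [OF X], rotated 2])
  show "fin_word (int i # replicate ?m (int i + 1) @ ?r)" using fin i by (auto simp: fin_word_def)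
  show "mset (int i # replicate ?m (int i + 1) @ ?r) = mset (int i # v)"
   using mset_filter_replicate [of v "int i + 1"] by simp
 qed
qed

text \<open>Raising and lowering one letter at a time leads from the constant word to every word.\<close>

lemma reach:
 assumes X: "stable k h h' X" and k: "1 \<le> k" "k \<le> h" "h \<le> n" "k \<le> h'" "h' \<le> n" and m: "es (replicate d (int k)) : X"
  and w: "length w = d" "set w \<subseteq> {1..int h'}"
 shows "es w : X"
proof -
 have change: "es (x # v) : X" if v: "fin_word v" and x: "x : {1..int h'}" and m: "es (int k # v) : X" for x v
 proof (cases "x \<ge> int k")
  case True
  have "es (int z # v) : X" if "k \<le> z" "z \<le> h'" for z
   using that
  proof (induction z rule: dec_induct)
   case (step z)
   have "es ((int z + 1) # v) : X"
    by (rule es_raise [OF X]) (use step k v in \<open>auto simp: fin_word_def\<close>)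
   then show ?case by (simp add: add.commute)
  qed (use m in simp)
  from this [of "nat x"] show ?thesis using True x by (simp add: le_nat_iff nat_le_iff)
 next
  case False
  have "es (int z # v) : X" if "z \<le> k" "1 \<le> z" for z
   using that
  proof (induction z rule: inc_induct)
   case (step z)
   have "es ((int z + 1) # v) : X" using step by (simp add: add.commute)
   then show ?case by (rule es_lower [OF X, rotated 3]) (use step k v in \<open>auto simp: fin_word_def\<close>)
  qed (use m in simp)
  moreover have "nat x \<le> k" "1 \<le> nat x" "int (nat x) = x" using False x by auto
  ultimately show ?thesis by metis
 qed
 have "es (replicate j (int k) @ v) : X" if "j + length v = d" "set v \<subseteq> {1..int h'}" for j v
  using that
 proof (induction v arbitrary: j)
  case Nil
  then show ?case using m by simp
 next
  case (Cons x v)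
  have "es (replicate (Suc j) (int k) @ v) : X" by (rule Cons.IH) (use Cons.prems in auto)
  then have 1: "es (int k # (replicate j (int k) @ v)) : X" by simp
  have f: "fin_word (replicate j (int k) @ v)" using Cons.prems k by (auto simp: fin_word_def)
  have "es (x # (replicate j (int k) @ v)) : X" by (rule change [OF f _ 1]) (use Cons.prems in auto)
  then show ?case
   by (rule es_perm_mem [OF stableD(1) [OF X], rotated 2]) (use f Cons.prems k in \<open>auto simp: fin_word_def\<close>)
 qed
 from this [of 0 w] show ?thesis using w by simp
qed

section \<open>Symmetric tensors are generated by increasing words\<close>

text \<open>The increasing word whose letters \<open>k, k + 1, \<dots>\<close> occur with multiplicities \<open>\<nu>\<close>, and the product
 of the symmetrizers of its blocks of equal letters.\<close>

primrec om :: "(nat => nat) => nat => nat => int list" where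
 "om \<nu> k 0 = []"
| "om \<nu> k (Suc l) = replicate (\<nu> k) (int k) @ om \<nu> (Suc k) l"

primrec PB :: "(nat => nat) => nat => nat => nat => int fa => int fa" where
 "PB \<nu> k o' 0 = (\<lambda>v. v)"
| "PB \<nu> k o' (Suc l) = (\<lambda>v. sy o' (\<nu> k) (PB \<nu> (Suc k) (o' + \<nu> k) l v))"

abbreviation "sz \<nu> k l \<equiv> length (om \<nu> k l)"

lemma set_om: "set (om \<nu> k l) \<subseteq> {int k..<int (k + l)}"
 by (induction l arbitrary: k) fastforce+

lemma om_fin: "1 \<le> k ==> k + l = n + 1 ==> fin_word (om \<nu> k l)"
 using set_om [of \<nu> k l] by (auto simp: fin_word_def)

lemma linear_PB [simp]: "linear_map (PB \<nu> k o' l)"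
 by (induction l arbitrary: k o') (simp_all add: linear_map_comp [OF linear_sy])

lemmas PB_lin = linear_map_simps [OF linear_PB]

lemma PB_fin: "v : Omega_fin n s ==> o' + sz \<nu> k l \<le> s ==> PB \<nu> k o' l v : Omega_fin n s"
proof (induction l arbitrary: k o')
 case (Suc l)
 then show ?case by (auto intro!: sy_fin)
qed simp

lemma PB_commute:
 assumes "linear_map f" "!!k v. k : {1..<s} ==> v : Omega_fin n s ==> f (tT k v) = tT k (f v)"
  "o' + sz \<nu> k l \<le> s" "v : Omega_fin n s"
 shows "f (PB \<nu> k o' l v) = PB \<nu> k o' l (f v)"
 using assms(3)
proof (induction l arbitrary: k o')
 case (Suc l)
 then have "PB \<nu> (Suc k) (o' + \<nu> k) l v : Omega_fin n s" using assms(4) by (intro PB_fin) auto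
 then show ?case using Suc sy_commute [OF assms(1,2), of s o' "\<nu> k" "PB \<nu> (Suc k) (o' + \<nu> k) l v"] by simp
qed simp

lemma F_PB: "i : {1..<n} ==> v : Omega_fin n s ==> o' + sz \<nu> k l \<le> s ==> opF i (PB \<nu> k o' l v) = PB \<nu> k o' l (opF i v)"
 and E_PB: "i : {1..<n} ==> v : Omega_fin n s ==> o' + sz \<nu> k l \<le> s ==> opE i (PB \<nu> k o' l v) = PB \<nu> k o' l (opE i v)"
 and dg_PB: "additive \<chi> ==> v : Omega_fin n s ==> o' + sz \<nu> k l \<le> s ==> dg \<chi> (PB \<nu> k o' l v) = PB \<nu> k o' l (dg \<chi> v)"
 using PB_commute [OF linear_opF, of s i o' \<nu> k l v] PB_commute [OF linear_opE, of s i o' \<nu> k l v]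
  PB_commute [OF linear_dg, of s \<chi> o' \<nu> k l v]
 by (simp_all add: F_T E_T dg_T)

lemma PB_Omega: "v : Omega s ==> PB \<nu> k o' l v : Omega s"
 by (induction l arbitrary: k o') (auto intro: sy_Omega)

lemma PB_left: "x : Omega m ==> y : Omega s ==> o' + sz \<nu> k l \<le> s ==> PB \<nu> k (m + o') l (x * y) = x * PB \<nu> k o' l y"
proof (induction l arbitrary: k o')
 case (Suc l)
 then show ?case using Suc.IH [of "o' + \<nu> k" "Suc k"] sy_left [OF Suc.prems(1) PB_Omega, of y s o' "\<nu> k"]
  by (simp add: add.assoc)
qed simp

lemma PB_symmetric:
 assumes "!!j i. j < l ==> i : {1..<\<nu> (k + j)} ==> tT (o' + sz \<nu> k j + i) v = cst (q\<^sup>2) * v"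
 shows "\<exists>c. c ~= 0 \<and> PB \<nu> k o' l v = cst c * v"
 using assms
proof (induction l arbitrary: k o')
 case 0
 then show ?case by (intro exI [of _ 1]) simp
next
 case (Suc l)
 have "\<exists>c. c ~= 0 \<and> PB \<nu> (Suc k) (o' + \<nu> k) l v = cst c * v"
 proof (rule Suc.IH)
  fix j i assume "j < l" "i : {1..<\<nu> (Suc k + j)}"
  then show "tT (o' + \<nu> k + sz \<nu> (Suc k) j + i) v = cst (q\<^sup>2) * v"
   using Suc.prems [of "Suc j" i] by (simp add: add.assoc)
 qed
 moreover have "\<exists>c. c ~= 0 \<and> sy o' (\<nu> k) v = cst c * v"
  by (rule sy_symmetric) (use Suc.prems [of 0] in simp)
 ultimately obtain c c' where c: "c ~= 0" "PB \<nu> (Suc k) (o' + \<nu> k) l v = cst c * v" "c' ~= 0" "sy o' (\<nu> k) v = cst c' * v"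
  by blast
 then show ?case by (intro exI [of _ "c * c'"]) (simp add: sy_lin cst_mult_assoc)
qed

definition ustable :: "nat => int fa set => bool" where
 "ustable k N \<longleftrightarrow> stable k n n N \<and> (\<forall>x\<in>N. \<forall>i\<in>{1..n}. opK i x : N \<and> opKi i x : N)"

lemma ustable_Kt: "ustable k N ==> i : {1..<n} ==> x : N ==> opKt i x : N \<and> opKti i x : N"
proof -
 assume N: "ustable k N" and i: "i : {1..<n}" and x: "x : N"
 have "opKt i x = opK i (opKi (Suc i) x)" "opKti i x = opKi i (opK (Suc i) x)"
 proof -
  have "cnt2 i = (\<lambda>w. cnt i w - cnt (Suc i) w)" using i by (auto simp: cnt2_def nx_def)
  then show "opKt i x = opK i (opKi (Suc i) x)" "opKti i x = opKi i (opK (Suc i) x)" by (simp_all add: dg_dg)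
 qed
 then show ?thesis using N i x by (simp add: ustable_def)
qed

lemma low_E:
 assumes i: "i : {1..<n}" and v: "v : supp {w. length w = d \<and> set w \<subseteq> {1..int k}}"
 shows "opE i v : supp {w. length w = d \<and> set w \<subseteq> {1..int k}}"
proof (rule supp_map [OF v linear_opE])
 fix w assume "w : {w. length w = d \<and> set w \<subseteq> {1..int k}}"
 then have w: "length w = d" "set w \<subseteq> {1..int k}" by auto
 then show "opE i (mon w) : supp {w. length w = d \<and> set w \<subseteq> {1..int k}}"
  unfolding opE_def lin_ext_mon
 proof (induction w arbitrary: d)
  case (Cons x w)
  have "mon [x] * Ew i w : supp {w. length w = d \<and> set w \<subseteq> {1..int k}}"
   using Cons by (intro supp_mult [where A = "{[x]}" and B = "{w. length w = d - 1 \<and> set w \<subseteq> {1..int k}}"]) auto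
  moreover have "x - 1 \<ge> 1" if "rs n x = int (nx n i)"
  proof -
   have "x ~= 1" using that i n2 rs_fin [of 1] by (auto simp: nx_def)
   then show ?thesis using Cons.prems by auto
  qed
  ultimately show ?case using Cons.prems unfolding Ew.simps by (intro supp_add) (auto intro!: supp_cst)
 qed simp
qed

lemma low_fin: "k \<le> n ==> v : supp {w. length w = d \<and> set w \<subseteq> {1..int k}} ==> v : Omega_fin n d"
proof -
 assume k: "k \<le> n" and v: "v : supp {w. length w = d \<and> set w \<subseteq> {1..int k}}"
 have "{w :: int list. length w = d \<and> set w \<subseteq> {1..int k}} \<subseteq> {w. length w = d \<and> set w \<subseteq> {1..int n}}" using k by auto
 from supp_mono [OF this] v show ?thesis unfolding Omega_fin_supp by blast
qed

lemma low_dg: "v : supp A ==> dg \<chi> v : supp A"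
 by (rule supp_map [OF _ linear_dg]) (auto simp: dg_mon)

lemma low_F: "k < i ==> i < n ==> v : supp {w. length w = d \<and> set w \<subseteq> {1..int k}} ==> opF i v = 0"
proof -
 assume k: "k < i" "i < n" and "v : supp {w. length w = d \<and> set w \<subseteq> {1..int k}}"
 from this(3) show ?thesis
 proof (induction rule: supp_induct)
  case (mon w)
  show ?case by (rule op_none(2)) (use k mon rs_fin in force)
 qed (simp_all add: op_simps)
qed

text \<open>A space that is stable under all raising operators, under the lowering operators from index \<open>k\<close> on
 and under the torus, and contains the increasing word with smallest letter \<open>k\<close>, contains all tensors that are
 symmetric in the blocks.  By induction the statement holds for the tail of the word and the space of
 those \<open>s\<close> for which all products \<open>x s\<close> with symmetric \<open>x\<close> in the letters up to \<open>k\<close> lie in the given space;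
 the rest follows by changing the first factor.\<close>

lemma generation:
 assumes "1 \<le> k" "k + l = n + 1" "ustable k N" "mon (om \<nu> k l) : N" "v : Omega_fin n (sz \<nu> k l)"
 shows "PB \<nu> k 0 l v : N"
 using assms
proof (induction l arbitrary: k N v)
 case 0
 from 0(5) show ?case
 proof (induction rule: Omega_fin_induct)
  case (mon w)
  then show ?case using 0 by simp
 qed (use 0(3) in \<open>auto simp: PB_lin ustable_def stable_def subsp_def\<close>)
next
 case (Suc l)
 note k = Suc.prems(1,2) and N = Suc.prems(3)
 note N' = stableD(1) [OF N [unfolded ustable_def, THEN conjunct1]]
  stableD(2,3) [OF N [unfolded ustable_def, THEN conjunct1]]
 have NK: "x : N ==> i : {1..n} ==> opK i x : N" "x : N ==> i : {1..n} ==> opKi i x : N" for x i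
  using N by (auto simp: ustable_def)
 note Nt = ustable_Kt [OF N, THEN conjunct1] ustable_Kt [OF N, THEN conjunct2]
 define d where "d = \<nu> k"
 define Lo where "Lo = supp {w :: int list. length w = d \<and> set w \<subseteq> {1..int k}}"
 define S1 where "S1 = {s. \<forall>x\<in>Lo. sy 0 d x * s : N}"
 let ?s0 = "mon (om \<nu> (Suc k) l)"
 have kn: "k \<le> n" "1 \<le> k" using k by simp_all
 have Lo: "x : Lo ==> x : Omega_fin n d" "x : Lo ==> i : {1..<n} ==> opE i x : Lo" "x : Lo ==> dg \<chi> x : Lo"
   "x : Lo ==> i : {Suc k..<n} ==> opF i x = 0" for x i \<chi>
  unfolding Lo_def using low_fin [OF kn(1)] low_E low_dg low_F [of k i x d] by auto
 have dgs: "additive \<chi> ==> x : Lo ==> dg \<chi> (sy 0 d x) = sy 0 d (dg \<chi> x)" for \<chi> x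
  by (rule dg_sy [of _ _ d]) (use Lo in auto)
 have "ustable (Suc k) S1"
  unfolding ustable_def stable_def
 proof (intro conjI ballI)
  show "subsp S1" using subspD(1-3) [OF N'(1)]
   by (auto simp: subsp_def S1_def distrib_left times_cst_left [of "sy 0 d _"])
 next
  fix s i assume s: "s : S1" and i: "i : {1..<n}"
  show "opE i s : S1" unfolding S1_def
  proof (intro CollectI ballI)
   fix x assume x: "x : Lo"
   have "opE i (sy 0 d x) = sy 0 d (opE i x)" by (rule E_sy [OF i, of _ d]) (use x Lo in auto)
   then have e: "sy 0 d x * opE i s = opE i (sy 0 d x * s) - opKt i (sy 0 d (opKti i (opE i x)) * s)"
    using i x Lo dgs [of "\<lambda>w. - cnt2 i w" "opE i x"] by (simp add: opE_mult dg_mult flip: dgs)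
   show "sy 0 d x * opE i s : N" unfolding e
    using s x i Lo unfolding S1_def by (intro subspD(4) [OF N'(1)] N'(2) Nt(1)) auto
  qed
 next
  fix s i assume s: "s : S1" and i: "i : {Suc k..<n}"
  then have i': "i : {1..<n}" "i : {k..<n}" by auto
  show "opF i s : S1" unfolding S1_def
  proof (intro CollectI ballI)
   fix x assume x: "x : Lo"
   have "opF i (sy 0 d (opKt i x)) = sy 0 d (opF i (opKt i x))" by (rule F_sy [OF i'(1), of _ d]) (use x Lo in auto)
   then have "opF i (sy 0 d (opKt i x)) = 0" using Lo(4) [OF Lo(3) [OF x] i] by (simp add: sy_lin)
   then have "sy 0 d x * opF i s = opF i (sy 0 d (opKt i x) * s)"
    using Lo(3) [OF x] by (simp add: opF_mult dgs)
   then show "sy 0 d x * opF i s : N"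
    using N'(3) [OF _ i'(2)] s Lo(3) [OF x] by (simp add: S1_def)
  qed
 next
  fix s i assume s: "s : S1" and i: "i : {1..n}"
  show "opK i s : S1" unfolding S1_def
  proof (intro CollectI ballI)
   fix x assume x: "x : Lo"
   have "sy 0 d x * opK i s = opK i (sy 0 d (opKi i x) * s)" using Lo(3) [OF x] by (simp add: dg_mult dgs)
   then show "sy 0 d x * opK i s : N" using NK(1) [OF _ i] s Lo(3) [OF x] by (simp add: S1_def)
  qed
  show "opKi i s : S1" unfolding S1_def
  proof (intro CollectI ballI)
   fix x assume x: "x : Lo"
   have "sy 0 d x * opKi i s = opKi i (sy 0 d (opK i x) * s)" using Lo(3) [OF x] by (simp add: dg_mult dgs)
   then show "sy 0 d x * opKi i s : N" using NK(2) [OF _ i] s Lo(3) [OF x] by (simp add: S1_def)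
  qed
 qed
 moreover have "?s0 : S1"
 proof -
  define X where "X = {x. x * ?s0 : N}"
  have f0: "fin_word (om \<nu> (Suc k) l)" using k by (intro om_fin) auto
  have X: "stable k k k X"
   unfolding stable_def
  proof (intro conjI ballI)
   show "subsp X" using subspD(1-3) [OF N'(1)] by (auto simp: subsp_def X_def distrib_right mult.assoc)
  next
   fix x i assume x: "x : X" and i: "i : {1..<k}"
   then have i': "i : {1..<n}" using kn by auto
   have "opE i ?s0 = 0"
   proof (rule op_none(1))
    fix y assume "y : set (om \<nu> (Suc k) l)"
    then have "y : {int (Suc k)..<int (Suc k + l)}" using set_om [of \<nu> "Suc k" l] by blast
    then show "rs n y ~= int (nx n i)" using i i' k rs_fin [of y] by (auto simp: nx_def)
   qed
   then have e: "opE i (x * ?s0) = cst (q powi cnt2 i (om \<nu> (Suc k) l)) * (opE i x * ?s0)"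
    by (simp add: opE_mult dg_mon times_cst_left [of "opE i x"])
   have "opE i (x * ?s0) : N" using x i' unfolding X_def by (intro N'(2)) auto
   then show "opE i x : X" unfolding X_def e using subsp_cancel [OF N'(1)] by simp
  qed simp
  have c: "\<exists>c. c ~= 0 \<and> sy 0 d (mon (replicate d (int k))) = cst c * mon (replicate d (int k))"
  proof (rule sy_symmetric)
   fix i assume i: "i : {1..<d}"
   have "replicate d (int k) = replicate (i - 1) (int k) @ int k # int k # replicate (d - i - 1) (int k)"
    by (rule nth_equalityI) (use i in \<open>auto simp: nth_append nth_Cons split: nat.split\<close>)
   then show "tT (0 + i) (mon (replicate d (int k))) = cst (q\<^sup>2) * mon (replicate d (int k))"
    using T_fin [of "int k" "int k" "replicate (i - 1) (int k)" "replicate (d - i - 1) (int k)"] i kn by simp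
  qed
  then have b: "es (replicate d (int k)) : X"
   using Suc.prems(4) subspD(3) [OF N'(1)] by (auto simp: X_def d_def mon_mult mult.assoc)
  have "sy 0 d x * ?s0 : N" if "x : Lo" for x
   using that unfolding Lo_def
  proof (induction rule: supp_induct)
   case (mon w)
   then have "es w : X" by (intro reach [OF X kn(2) _ _ _ _ b]) (use kn in auto)
   then show ?case using mon by (simp add: X_def)
  qed (use subspD(1-3) [OF N'(1)] in \<open>auto simp: sy_lin distrib_right mult.assoc\<close>)
  then show ?thesis by (simp add: S1_def)
 qed
 ultimately have tail: "PB \<nu> (Suc k) 0 l y : S1" if "y : Omega_fin n (sz \<nu> (Suc k) l)" for y
  using Suc.IH [of "Suc k" S1 y] that k by simp
 define RS where "RS = PB \<nu> (Suc k) 0 l ` Omega_fin n (sz \<nu> (Suc k) l)"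
 have RS: "y : RS ==> i : {1..<n} ==> opF i y : RS" "y : RS ==> i : {1..<n} ==> opE i y : RS" "additive \<chi> ==> y : RS ==> dg \<chi> y : RS" for y i \<chi>
  unfolding RS_def by (auto simp: F_PB [of _ _ "sz \<nu> (Suc k) l"] E_PB [of _ _ "sz \<nu> (Suc k) l"] dg_PB [of _ _ "sz \<nu> (Suc k) l"]
    intro!: imageI F_Omega_fin E_Omega_fin dg_Omega_fin)
 define X where "X = {x. \<forall>y\<in>RS. x * y : N}"
 have X: "stable k n n X"
  unfolding stable_def
 proof (intro conjI ballI)
  show "subsp X" using subspD(1-3) [OF N'(1)] by (auto simp: subsp_def X_def distrib_right mult.assoc)
 next
  fix x i assume x: "x : X" and i: "i : {1..<n}"
  show "opE i x : X" unfolding X_def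
  proof (intro CollectI ballI)
   fix y assume y: "y : RS"
   have e: "opE i x * y = opE i (x * opKti i y) - x * opE i (opKti i y)" by (simp add: opE_mult)
   show "opE i x * y : N" unfolding e using x y i RS unfolding X_def
    by (intro subspD(4) [OF N'(1)] N'(2)) auto
  qed
 next
  fix x i assume x: "x : X" and i: "i : {k..<n}"
  then have i': "i : {1..<n}" using kn by auto
  show "opF i x : X" unfolding X_def
  proof (intro CollectI ballI)
   fix y assume y: "y : RS"
   have e: "opF i x * y = opF i (x * y) - opKti i (x * opKt i (opF i y))" by (simp add: opF_mult dg_mult)
   show "opF i x * y : N" unfolding e using x y i i' RS unfolding X_def
    by (intro subspD(4) [OF N'(1)] N'(3) Nt(2)) auto
  qed
 qed
 have b: "es (replicate d (int k)) : X"
 proof -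
  have "mon (replicate d (int k)) : Lo" using kn by (auto simp: Lo_def)
  then show ?thesis using tail unfolding X_def RS_def S1_def length_replicate by blast
 qed
 from Suc.prems(5) show ?case
 proof (induction rule: Omega_fin_induct)
  case (mon w)
  define u u' where "u = take d w" and "u' = drop d w"
  have w: "w = u @ u'" "length u = d" "length u' = sz \<nu> (Suc k) l" "fin_word u" "fin_word u'"
   using mon set_take_subset [of d w] set_drop_subset [of d w] by (auto simp: u_def u'_def d_def fin_word_def)
  have m: "mon u' : Omega_fin n (sz \<nu> (Suc k) l)" using w by (simp add: Omega_fin_closed)
  have "PB \<nu> k 0 (Suc l) (mon w) = sy 0 d (PB \<nu> (Suc k) (d + 0) l (mon u * mon u'))"
   by (simp add: w(1) mon_mult d_def)
  also have "PB \<nu> (Suc k) (d + 0) l (mon u * mon u') = mon u * PB \<nu> (Suc k) 0 l (mon u')"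
   by (rule PB_left [of _ _ _ "sz \<nu> (Suc k) l"]) (use w in \<open>auto simp: Omega_closed\<close>)
  also have "sy 0 d \<dots> = sy 0 d (mon u) * PB \<nu> (Suc k) 0 l (mon u')"
   by (rule sy_right [of _ d]) (use w in \<open>auto simp: Omega_closed\<close>)
  also have "... : N"
  proof -
   have "es u : X" by (rule reach [OF X kn(2,1) _ _ _ b]) (use w kn in \<open>auto simp: fin_word_def\<close>)
   then show ?thesis using m w by (auto simp: X_def RS_def)
  qed
  finally show ?case .
 qed (use subspD(1-3) [OF N'(1)] in \<open>auto simp: PB_lin simp del: PB.simps\<close>)
qed

end

context evalm begin

section \<open>Jucys--Murphy operators on increasing words\<close>

text \<open>The Jucys--Murphy operators are polynomials in the \<open>T\<^sub>k\<close>.\<close>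

lemma J_commute:
 assumes "linear_map f" "!!k v. k : {1..<r} ==> v : Omega_fin n r ==> f (tT k v) = tT k (f v)"
  "!!v. v : Omega_fin n r ==> f v : Omega_fin n r" "j : {1..r}" "v : Omega_fin n r"
 shows "f (opJ j v) = opJ j (f v)"
 using assms(4,5)
proof (induction j arbitrary: v)
 case (Suc j)
 note f = linear_map_simps [OF assms(1)]
 show ?case
 proof (cases "j = 0")
  case True
  then show ?thesis using Suc.prems assms(3) J_1 [OF Omega_fin_Omega] by (simp add: f)
 next
  case False
  then have j: "j : {1..<r}" "j : {1..r}" using Suc.prems by auto
  have T: "tT j v : Omega_fin n r" "opJ j (tT j v) : Omega_fin n r"
   using j Suc.prems tT_Omega_fin J_Omega_fin by auto
  show ?thesis
   using Suc.IH [OF j(2) T(1)] Suc.prems assms(2) [OF j(1)] T J_Suc [OF j(1) Omega_fin_Omega] assms(3)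
   by (simp add: f)
 qed
qed simp

lemma linear_J [simp]: "linear_map (opJ j)"
 using linear_J_pow [of j 1] by simp

lemma J_pow_fin: "j : {1..r} ==> v : Omega_fin n r ==> (opJ j ^^ t) v : Omega_fin n r"
 by (induction t) (auto intro: J_Omega_fin)

lemma C_commute:
 assumes "linear_map f" "!!k v. k : {1..<r} ==> v : Omega_fin n r ==> f (tT k v) = tT k (f v)"
  "!!v. v : Omega_fin n r ==> f v : Omega_fin n r" "v : Omega_fin n r"
 shows "f (opC t v) = opC t (f v)"
proof -
 have "f ((opJ j ^^ t) v) = (opJ j ^^ t) (f v)" if "j : {1..r}" for j
  by (induction t) (use J_commute [OF assms(1-3) that] J_pow_fin [OF that assms(4)] in auto)
 then show ?thesis by (simp add: opC_def linear_map_sum [OF assms(1)])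
qed

text \<open>Tensors that are lowered from somewhere.  Modulo these the increasing words are eigenvectors of
 the Jucys--Murphy operators.\<close>

definition Nl :: "int fa set" where
 "Nl = {\<Sum>j\<in>{1..<n}. opF j (m j) | m. \<forall>j. m j : Omega_fin n r}"

lemma Nl_subsp: "subsp Nl"
 unfolding subsp_def
proof (intro conjI ballI allI)
 show "0 : Nl" unfolding Nl_def by (rule CollectI, rule exI [of _ "\<lambda>_. 0"]) (simp add: op_simps Omega_fin_closed)
next
 fix x y assume "x : Nl" "y : Nl"
 then obtain m m' where m: "x = (\<Sum>j\<in>{1..<n}. opF j (m j))" "y = (\<Sum>j\<in>{1..<n}. opF j (m' j))"
  "\<forall>j. m j : Omega_fin n r" "\<forall>j. m' j : Omega_fin n r" unfolding Nl_def by blast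
 then show "x + y : Nl" unfolding Nl_def
  by (intro CollectI exI [of _ "\<lambda>j. m j + m' j"]) (simp add: op_simps sum.distrib Omega_fin_closed)
next
 fix c x assume "x : Nl"
 then obtain m where m: "x = (\<Sum>j\<in>{1..<n}. opF j (m j))" "\<forall>j. m j : Omega_fin n r" unfolding Nl_def by blast
 then show "cst c * x : Nl" unfolding Nl_def
  by (intro CollectI exI [of _ "\<lambda>j. cst c * m j"]) (simp add: op_simps sum_distrib_left Omega_fin_closed)
qed

lemmas Nl = subspD [OF Nl_subsp]

lemma Nl_sum: "(!!i. i : A ==> f i : Nl) ==> sum f A : Nl"
 by (induction A rule: infinite_finite_induct) (auto intro: Nl)

lemma F_Nl: "j : {1..<n} ==> v : Omega_fin n r ==> opF j v : Nl"
proof -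
 assume j: "j : {1..<n}" and v: "v : Omega_fin n r"
 have "opF j v = (\<Sum>i\<in>{1..<n}. opF i (if i = j then v else 0))"
  using j by (subst sum.remove [of _ j]) (auto simp: op_simps)
 then show ?thesis unfolding Nl_def using v by (intro CollectI exI [of _ "\<lambda>i. if i = j then v else 0"]) (auto simp: Omega_fin_closed)
qed

lemma Nl_map:
 assumes "linear_map f" "!!j v. j : {1..<n} ==> v : Omega_fin n r ==> f (opF j v) = opF j (f v)"
  "!!v. v : Omega_fin n r ==> f v : Omega_fin n r" "x : Nl"
 shows "f x : Nl"
proof -
 obtain m where m: "x = (\<Sum>j\<in>{1..<n}. opF j (m j))" "\<forall>j. m j : Omega_fin n r" using assms(4) unfolding Nl_def by blast
 then have "f x = (\<Sum>j\<in>{1..<n}. opF j (f (m j)))" using assms(2) by (simp add: linear_map_sum [OF assms(1)])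
 then show ?thesis using m(2) assms(3) by (auto intro!: Nl_sum F_Nl)
qed

lemma T_Nl: "k : {1..<r} ==> x : Nl ==> tT k x : Nl"
 by (rule Nl_map) (simp_all add: F_T tT_Omega_fin)

lemma J_Nl: "k : {1..r} ==> x : Nl ==> opJ k x : Nl"
proof -
 assume k: "k : {1..r}" and x: "x : Nl"
 show ?thesis
 proof (rule Nl_map [OF linear_J _ _ x])
  fix j v assume j: "j : {1..<n}" and v: "v : Omega_fin n r"
  show "opJ k (opF j v) = opF j (opJ k v)"
   by (rule J_commute [symmetric, OF linear_opF F_T [OF j] F_Omega_fin [OF j] k v])
 qed (use k in \<open>simp add: J_Omega_fin\<close>)
qed

lemma fin_mult: "x : Omega_fin n s ==> y : Omega_fin n s' ==> x * y : Omega_fin n (s + s')"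
 unfolding Omega_fin_supp' by (erule supp_mult) (auto simp: fin_word_def)

lemma F_row:
 assumes z: "1 \<le> z" "z < n" and y: "y : Omega_fin n s" and rest: "fin_word rest" "\<forall>x\<in>set rest. int z < x" "s + Suc (length rest) = r"
 shows "opF z y * mon (int z # rest) + opKti z y * mon ((int z + 1) # rest) : Nl"
proof -
 have F0: "opF z (mon rest) = 0"
 proof (rule op_none(2))
  fix x assume "x : set rest"
  then have "rs n x = x" "int z < x" using rest rs_fin by (auto simp: fin_word_def)
  then show "rs n x ~= int z" by simp
 qed
 have "opF z (mon [int z] * mon rest) = mon [int z + 1] * mon rest"
  using z rs_fin [of "int z"] by (simp add: opF_letter F0)
 then have "opF z (y * mon (int z # rest)) = opF z y * mon (int z # rest) + opKti z y * mon ((int z + 1) # rest)"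
  by (simp add: opF_mult mon_mult)
 moreover have "y * mon (int z # rest) : Omega_fin n r"
  using fin_mult [OF y, of "mon (int z # rest)" "Suc (length rest)"] rest z by (simp add: Omega_fin_closed fin_word_def)
 ultimately show ?thesis using F_Nl [of z "y * mon (int z # rest)"] z by simp
qed

lemma Omega_rv: "1 \<le> c ==> c + d < n ==> v : Omega_fin n s ==> rv c d v : Omega_fin n s"
proof (induction d arbitrary: v)
 case (Suc d)
 have i: "c + d + 1 : {1..<n}" using Suc by auto
 have F: "opF (c + d + 1) v : Omega_fin n s" by (rule F_Omega_fin) (use i Suc in auto)
 show ?case using Suc.IH [of v] Suc.IH [OF _ _ F] F_Omega_fin [OF i] Suc.prems
  by (auto intro!: Omega_fin_closed)
qed (auto simp: F_Omega_fin)

text \<open>Up to lowered tensors a root vector can be moved from the left factor onto the letter that follows.\<close>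

lemma rv_row:
 assumes c: "1 \<le> c" "c + d < n" and x: "x : Omega_fin n s" and rest: "fin_word rest" "\<forall>x\<in>set rest. int (c + d) < x" "s + Suc (length rest) = r"
 shows "rv c d x * mon (int c # rest) + cst (q powi (- 2 * int d)) * (opKi c (opK (c + d + 1) x) * mon ((int (c + d) + 1) # rest)) : Nl"
 using assms
proof (induction d arbitrary: x)
 case 0
 have "opKti c x = opKi c (opK (Suc c) x)"
 proof -
  have "(\<lambda>w. - cnt2 c w) = (\<lambda>w. - cnt c w + cnt (Suc c) w)" using 0 by (auto simp: cnt2_def nx_def)
  then show ?thesis by (simp add: dg_dg)
 qed
 then show ?case using F_row [of c x s rest] 0 by simp
next
 case (Suc d)
 define z where "z = c + d + 1"
 have z: "1 \<le> z" "z < n" "c < z" "z : {1..<n}" "nx n z = Suc z" using Suc.prems by (auto simp: z_def nx_def)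
 have e: "c + Suc d = z" "int (c + d) + 1 = int z" "c + Suc d + 1 = Suc z" "c + d + 1 = z" by (simp_all add: z_def)
 define y where "y = opKi c (opK z x)"
 have y: "y : Omega_fin n s" unfolding y_def by (intro dg_Omega_fin Suc.prems)
 have c: "cst (q powi (- 2 * int (Suc d))) = cst (inverse q) * (cst (q powi (- 2 * int d)) * cst (inverse q))"
 proof -
  have "- 2 * int (Suc d) = - 1 + (- 2 * int d) + - 1" by simp
  then have "q powi (- 2 * int (Suc d)) = inverse q * (q powi (- 2 * int d) * inverse q)"
   by (simp only: power_int_add q0 simp_thms) (simp add: power_int_minus)
  then show ?thesis by (simp only: cst_mult)
 qed
 let ?w = "mon (int c # rest)" and ?w1 = "mon (int z # rest)" and ?w2 = "mon ((int z + 1) # rest)"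
 have F0: "opF z ?w = 0"
 proof (rule op_none(2))
  fix x assume "x : set (int c # rest)"
  then have "rs n x = x" "x = int c \<or> int z < x" using Suc.prems(1,4,5) z rs_fin by (auto simp: fin_word_def z_def)
  then show "rs n x ~= int z" using z by auto
 qed
 have A: "opF z (rv c d x) * ?w : Nl"
 proof -
  have "opF z (rv c d x * ?w) = opF z (rv c d x) * ?w" by (simp add: opF_mult F0)
  moreover have "rv c d x * ?w : Omega_fin n r"
   using fin_mult [OF Omega_rv [OF Suc.prems(1) _ Suc.prems(3)], of d ?w "Suc (length rest)"] Suc.prems z
   by (simp add: Omega_fin_closed fin_word_def)
  ultimately show ?thesis using F_Nl [OF z(4)] by metis
 qed
 have Fx: "opF z x : Omega_fin n s" by (rule F_Omega_fin [OF z(4) Suc.prems(3)])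
 have "rv c d (opF z x) * ?w + cst (q powi (- 2 * int d)) * (opKi c (opK z (opF z x)) * ?w1) : Nl"
 proof -
  have "\<forall>x\<in>set rest. int (c + d) < x" using Suc.prems(5) by fastforce
  moreover have "c + d < n" using z by (simp add: z_def)
  ultimately show ?thesis using Suc.IH [of "opF z x"] Fx Suc.prems(1,4,6) unfolding e by simp
 qed
 moreover have "opKi c (opK z (opF z x)) = cst (inverse q) * opF z y"
  using z unfolding y_def by (simp add: K_F Ki_F dg_simps power_int_minus)
 ultimately have B: "rv c d (opF z x) * ?w + cst (q powi (- 2 * int d)) * (cst (inverse q) * opF z y * ?w1) : Nl" by simp
 have "opKti z y = opKi c (opK (Suc z) x)"
 proof -
  have "(\<lambda>w. - cnt2 z w) = (\<lambda>w. - cnt z w + cnt (Suc z) w)" using z by (auto simp: cnt2_def)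
  then have "opKti z y = opK (Suc z) (opKi z (opKi c (opK z x)))" by (simp add: dg_dg y_def algebra_simps)
  also have "opKi z (opKi c (opK z x)) = opKi c x" by (simp add: dg_dg)
  finally show ?thesis by (simp add: dg_commute [of "cnt (Suc z)"])
 qed
 then have C: "opF z y * ?w1 + opKi c (opK (Suc z) x) * ?w2 : Nl"
  using F_row [OF z(1,2) y Suc.prems(4) _ Suc.prems(6)] Suc.prems(5) by (simp add: z_def)
 have ring: "(A' - cst (inverse q) * B') * w + cst (inverse q) * (k * cst (inverse q)) * C' =
   A' * w - cst (inverse q) * (B' * w + k * (cst (inverse q) * F' * w1)) + cst (inverse q) * (k * cst (inverse q)) * (F' * w1 + C')"
  for A' B' C' F' w w1 k :: "int fa"
  by (simp add: algebra_simps)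
 have "rv c (Suc d) x * ?w + cst (q powi (- 2 * int (Suc d))) * (opKi c (opK (Suc z) x) * ?w2) =
  opF z (rv c d x) * ?w - cst (inverse q) * (rv c d (opF z x) * ?w + cst (q powi (- 2 * int d)) * (cst (inverse q) * opF z y * ?w1)) +
  cst (q powi (- 2 * int (Suc d))) * (opF z y * ?w1 + opKi c (opK (Suc z) x) * ?w2)"
  unfolding c rv.simps e by (rule ring)
 also have "... : Nl" by (intro Nl A B C)
 finally show ?case unfolding e by simp
qed

lemma occ_append: "occ (p @ w) (length p + j) = occ w j"
 by (simp add: occ_def nth_append)

lemma count_om: "c < k ==> count_list (om \<nu> k l) (int c) = 0"
 using set_om [of \<nu> k l] by (intro count_notin) auto

text \<open>The exchange terms of the Jucys--Murphy operator, sorted by the value \<open>c\<close> of the exchanged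
  letter, are root vectors applied to the part of the word before the operator.\<close>

lemma J_sum_rv:
 assumes p: "set p \<subseteq> {1..<int k}" and k: "1 \<le> k" "k + l \<le> z" "z \<le> n" and W: "W = p @ om \<nu> k l"
 shows "(\<Sum>j<sz \<nu> k l. cst (q ^ occ (om \<nu> k l) j) * mon (p @ (om \<nu> k l)[j := int z] @ om \<nu> k l ! j # v)) =
  (\<Sum>c\<in>{k..<k + l}. cst (q powi (int (\<nu> c) - 1)) * (rv c (z - 1 - c) (mon W) * mon (int c # v)))"
 using assms
proof (induction l arbitrary: k p)
 case (Suc l)
 let ?m = "\<nu> k" and ?o = "om \<nu> (Suc k) l" and ?d = "z - 1 - k"
 let ?R = "replicate ?m (int k)"
 have split: "(\<Sum>j<?m + s. f j) = (\<Sum>j<?m. f j) + (\<Sum>j<s. f (?m + j))" for f :: "nat => int fa" and s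
  by (induction s) (simp_all add: add.assoc)
 have z: "int k + int ?d + 1 = int z" using Suc.prems by simp
 have zk: "{k..<k + Suc l} = insert k {Suc k..<Suc k + l}" using Suc.prems by auto
 have "(\<Sum>j<?m. cst (q ^ occ (?R @ ?o) j) * mon (p @ (?R @ ?o)[j := int z] @ (?R @ ?o) ! j # v)) =
  cst (q powi (int ?m - 1)) * (rv k ?d (mon W) * mon (int k # v))"
 proof -
  have "rv k ?d (mon p * (mon ?R * mon ?o)) = mon p * (exch k ?d ?m * mon ?o)"
  proof (rule rv_formula)
   show "mon ?o : supp {w. set w \<subseteq> {int k<..int n}}" using set_om [of \<nu> "Suc k" l] Suc.prems by fastforce
  qed (use Suc.prems in auto)
  then have rv: "rv k ?d (mon W) = (\<Sum>j<?m. cst (q powi (- int j)) * mon (p @ replicate j (int k) @ int z # replicate (?m - 1 - j) (int k) @ ?o))"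
   unfolding Suc.prems(5) exch_def z by (simp add: mon_mult sum_distrib_left sum_distrib_right times_cst_left [of "mon p"] mult.assoc)
  show ?thesis unfolding rv sum_distrib_left sum_distrib_right
  proof (rule sum.cong)
   fix j assume j: "j : {..<?m}"
   have cr: "count_list (replicate i x) x = i" for i and x :: int by (induction i) auto
   have o: "occ (?R @ ?o) j = ?m - 1 - j"
    using j count_om [of k "Suc k" \<nu> l] by (simp add: occ_def nth_append count_list_append cr)
   have r: "?R[j := int z] = replicate j (int k) @ int z # replicate (?m - 1 - j) (int k)"
    by (rule nth_equalityI) (use j in \<open>auto simp: nth_append nth_list_update nth_Cons split: nat.split\<close>)
   have "int (?m - 1 - j) = (int ?m - 1) + - int j" using j by auto
   then have "q ^ (?m - 1 - j) = q powi (int ?m - 1) * q powi (- int j)"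
    unfolding power_int_of_nat [symmetric] by (simp only: q_powi_add)
   then show "cst (q ^ occ (?R @ ?o) j) * mon (p @ (?R @ ?o)[j := int z] @ (?R @ ?o) ! j # v) =
    cst (q powi (int ?m - 1)) * (cst (q powi (- int j)) * mon (p @ replicate j (int k) @ int z # replicate (?m - 1 - j) (int k) @ ?o) * mon (int k # v))"
    using j unfolding o by (simp add: list_update_append nth_append r mon_mult cst_mult_assoc mult.assoc)
  qed simp
 qed
 moreover have "(\<Sum>j<sz \<nu> (Suc k) l. cst (q ^ occ (?R @ ?o) (?m + j)) * mon (p @ (?R @ ?o)[?m + j := int z] @ (?R @ ?o) ! (?m + j) # v)) =
  (\<Sum>c\<in>{Suc k..<Suc k + l}. cst (q powi (int (\<nu> c) - 1)) * (rv c (z - 1 - c) (mon W) * mon (int c # v)))"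
 proof -
  have "(\<Sum>j<sz \<nu> (Suc k) l. cst (q ^ occ ?o j) * mon ((p @ ?R) @ ?o[j := int z] @ ?o ! j # v)) =
   (\<Sum>c\<in>{Suc k..<Suc k + l}. cst (q powi (int (\<nu> c) - 1)) * (rv c (z - 1 - c) (mon W) * mon (int c # v)))"
   by (rule Suc.IH) (use Suc.prems in auto)
  moreover have "occ (?R @ ?o) (?m + j) = occ ?o j" for j using occ_append [of ?R ?o j] by simp
  ultimately show ?thesis by (simp add: list_update_append nth_append)
 qed
 moreover have "(\<Sum>j<sz \<nu> k (Suc l). cst (q ^ occ (om \<nu> k (Suc l)) j) * mon (p @ (om \<nu> k (Suc l))[j := int z] @ om \<nu> k (Suc l) ! j # v)) =
   (\<Sum>j<?m. cst (q ^ occ (?R @ ?o) j) * mon (p @ (?R @ ?o)[j := int z] @ (?R @ ?o) ! j # v)) +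
   (\<Sum>j<sz \<nu> (Suc k) l. cst (q ^ occ (?R @ ?o) (?m + j)) * mon (p @ (?R @ ?o)[?m + j := int z] @ (?R @ ?o) ! (?m + j) # v))"
  unfolding om.simps length_append length_replicate by (rule split)
 ultimately show ?case unfolding zk by simp
qed simp

lemma sorted_om: "sorted (om \<nu> k l)"
proof (induction l arbitrary: k)
 case (Suc l)
 have "int k \<le> x" if "x : set (om \<nu> (Suc k) l)" for x using set_om [of \<nu> "Suc k" l] that by auto
 then show ?case using Suc by (auto simp: sorted_append)
qed simp

lemma om_cnt: "1 \<le> k ==> k + l \<le> n + 1 ==> cnt c (om \<nu> k l) = (if k \<le> c \<and> c < k + l then int (\<nu> c) else 0)"
proof (induction l arbitrary: k)
 case (Suc l)
 have "rs n (int k) = int k" using Suc.prems by (intro rs_fin) auto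
 then have "cnt c (replicate m (int k)) = (if c = k then int m else 0)" for m by (simp add: cnt_def)
 then show ?case using Suc by (auto simp: cnt_append)
qed simp

lemma om_append: "om \<nu> k (l + l') = om \<nu> k l @ om \<nu> (k + l) l'"
 by (induction l arbitrary: k) simp_all

text \<open>The exchange terms of all smaller letters change the eigenvalue from \<open>a\<close> to \<open>a
  q\<^bsup>-2k\<^esup>\<close>.\<close>

lemma content_sum: "(q - inverse q) * (\<Sum>c\<in>{1..<Suc k}. q powi (- 1 - 2 * int (k - c))) = 1 - q powi (- 2 * int k)"
proof -
 have "(\<Sum>c\<in>{1..<Suc k}. q powi (- 1 - 2 * int (k - c))) = (\<Sum>e<k. q powi (- 1 - 2 * int e))"
  by (rule sum.reindex_bij_witness [where i = "\<lambda>e. k - e" and j = "\<lambda>c. k - c"]) auto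
 also have "(q - inverse q) * \<dots> = 1 - q powi (- 2 * int k)"
 proof (induction k)
  case (Suc k)
  have "q powi (- 1 - 2 * int k) * (q - inverse q) = q powi (- 2 * int k) - q powi (- 2 * int (Suc k))"
  proof -
   have "- 2 * int k = (- 1 - 2 * int k) + 1" "- 2 * int (Suc k) = (- 1 - 2 * int k) + - 1" by simp_all
   then have "q powi (- 2 * int k) = q powi (- 1 - 2 * int k) * q" "q powi (- 2 * int (Suc k)) = q powi (- 1 - 2 * int k) * inverse q"
    by (simp_all only: power_int_add q0 simp_thms) (simp_all add: power_int_minus)
   then show ?thesis by (simp only: right_diff_distrib)
  qed
  then show ?case using Suc by (simp add: distrib_left mult.commute [of "q - inverse q"])
 qed simp
 finally show ?thesis .
qed

text \<open>The Jucys--Murphy operator at the \<open>s\<close>-th letter \<open>z\<close> of the increasing word has the eigenvalue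
 \<open>a q\<^bsup>2 (s - z)\<^esup>\<close>, given by the content \<open>s - z\<close> of the corresponding box of the Young diagram.\<close>

lemma Murphy:
 assumes r: "sz \<nu> 1 n = r" and z: "z : {1..n}" and s: "s : {1..\<nu> z}"
 shows "opJ (sz \<nu> 1 (z - 1) + s) (mon (om \<nu> 1 n)) - cst (a * q powi (2 * (int s - int z))) * mon (om \<nu> 1 n) : Nl"
proof -
 obtain k where k: "z = Suc k" using z by (cases z) auto
 define u where "u = om \<nu> 1 k"
 define v' where "v' = om \<nu> (Suc z) (n - z)"
 have om: "om \<nu> 1 n = u @ replicate (\<nu> z) (int z) @ v'"
 proof -
  have "n = k + Suc (n - z)" using z k by simp
  then have "om \<nu> 1 n = om \<nu> 1 k @ om \<nu> (1 + k) (Suc (n - z))" using om_append [of \<nu> 1 k "Suc (n - z)"] by metis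
  then show ?thesis by (simp add: u_def v'_def k)
 qed
 have fw: "fin_word (om \<nu> 1 n)" using om_fin [of 1 n \<nu>] by simp
 have uz: "set u \<subseteq> {1..<int z}" using set_om [of \<nu> 1 k] k by (simp add: u_def)
 have vz: "x : set v' ==> int z < x" for x using set_om [of \<nu> "Suc z" "n - z"] by (auto simp: v'_def)
 have len: "length (om \<nu> 1 n) = r" using r .
 from s show ?thesis
 proof (induction s)
  case (Suc s)
  show ?case
  proof (cases "s = 0")
   case True
   define v where "v = replicate (\<nu> z - 1) (int z) @ v'"
   have w: "om \<nu> 1 n = u @ int z # v"
   proof -
    have "replicate (\<nu> z) (int z) = int z # replicate (\<nu> z - 1) (int z)"
     using Suc.prems by (cases "\<nu> z") auto
    then show ?thesis unfolding om v_def by (metis append_Cons)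
   qed
   have fv: "fin_word v" "fin_word u" using fw unfolding w by (auto simp: fin_word_def)
   have vz': "\<forall>x\<in>set v. int z \<le> x" using vz by (force simp: v_def)
   let ?S = "\<Sum>j<length u. cst (q ^ occ u j) * mon (u[j := int z] @ u ! j # v)"
   have J: "opJ (Suc (length u)) (mon (u @ int z # v)) = cst a * (mon (u @ int z # v) + cst (q - inverse q) * ?S)"
    by (rule J_formula) (use uz fw len w sorted_om u_def in auto)
   have S: "?S = (\<Sum>c\<in>{1..<1 + k}. cst (q powi (int (\<nu> c) - 1)) * (rv c (z - 1 - c) (mon u) * mon (int c # v)))"
    using J_sum_rv [of "[]" 1 k z u \<nu> v] z k by (simp add: u_def)
   have t: "cst (q powi (int (\<nu> c) - 1)) * (rv c (z - 1 - c) (mon u) * mon (int c # v)) + cst (q powi (- 1 - 2 * int (k - c))) * mon (u @ int z # v) : Nl"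
    if c: "c : {1..<1 + k}" for c
   proof -
    let ?d = "z - 1 - c"
    have d: "1 \<le> c" "c + ?d < n" "c + ?d + 1 = z" "int (c + ?d) + 1 = int z" "?d = k - c" using c z k by auto
    have "mon u : Omega_fin n (length u)" using fv by (simp add: Omega_fin_closed)
    moreover have "length u + Suc (length v) = r" using len w by simp
    moreover have "\<forall>x\<in>set v. int (c + ?d) < x" using vz' d(4) by fastforce
    ultimately have R: "rv c ?d (mon u) * mon (int c # v) + cst (q powi (- 2 * int ?d)) * (opKi c (opK z (mon u)) * mon (int z # v)) : Nl"
     using rv_row [OF d(1,2) _ fv(1)] unfolding d(3,4) by blast
    have uf: "rs n x = x" if "x : set u" for x using fv that rs_fin by (auto simp: fin_word_def)
    have "cnt z u = 0" by (rule op_none(3)) (use uf uz in force)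
    moreover have "cnt c u = int (\<nu> c)" using om_cnt [of 1 k c \<nu>] c k z by (simp add: u_def)
    ultimately have K: "opKi c (opK z (mon u)) = cst (q powi (- int (\<nu> c))) * mon u"
     by (simp add: dg_mon dg_simps)
    have "q powi (int (\<nu> c) - 1) * (q powi (- 2 * int ?d) * q powi (- int (\<nu> c))) = q powi (- 1 - 2 * int (k - c))"
     unfolding q_powi_add d(5) by (rule arg_cong [of _ _ "(powi) q"]) simp
    then have e: "cst (q powi (int (\<nu> c) - 1)) * (cst (q powi (- 2 * int ?d)) * (cst (q powi (- int (\<nu> c))) * mon u * mon (int z # v))) =
     cst (q powi (- 1 - 2 * int (k - c))) * mon (u @ int z # v)"
     by (simp only: mult.assoc mon_mult cst_mult_assoc)
    show ?thesis using Nl(3) [OF R, of "q powi (int (\<nu> c) - 1)"] unfolding K distrib_left e .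
   qed
   have "opJ (Suc (length u)) (mon (u @ int z # v)) - cst (a * q powi (- 2 * int k)) * mon (u @ int z # v) =
    cst (a * (q - inverse q)) * (\<Sum>c\<in>{1..<1 + k}. cst (q powi (int (\<nu> c) - 1)) * (rv c (z - 1 - c) (mon u) * mon (int c # v)) + cst (q powi (- 1 - 2 * int (k - c))) * mon (u @ int z # v))"
   proof -
    have c: "(\<Sum>i\<in>A. cst (g i) * x) = cst (sum g A) * x" for g :: "nat => complex" and A and x :: "int fa"
     by (induction A rule: infinite_finite_induct) (simp_all add: cst_add distrib_right)
    have q: "a * q powi (- 2 * int k) = a - a * (q - inverse q) * (\<Sum>c\<in>{1..<1 + k}. q powi (- 1 - 2 * int (k - c)))"
    proof -
     have "x = a - a * p * y" if "p * y = 1 - x'" "x = a * x'" for x x' y p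
      using that by (simp only: mult.assoc) (simp add: right_diff_distrib)
     then show ?thesis using content_sum [of k] unfolding plus_1_eq_Suc by blast
    qed
    have ring: "cst a * (w + cst e * R) - cst (a - a * e * \<sigma>) * w = cst (a * e) * (R + cst \<sigma> * w)" for w R :: "int fa" and e \<sigma>
     by (intro poly_mapping_eqI) (simp add: lookup_add lookup_minus algebra_simps)
    show ?thesis unfolding J S sum.distrib c q by (rule ring)
   qed
   also have "... : Nl" by (intro Nl(3) Nl_sum t)
   finally have "opJ (Suc (length u)) (mon (om \<nu> 1 n)) - cst (a * q powi (- 2 * int k)) * mon (om \<nu> 1 n) : Nl" unfolding w .
   then show ?thesis using True k by (simp add: u_def)
  next
   case False
   let ?j = "sz \<nu> 1 (z - 1) + s" and ?w = "mon (om \<nu> 1 n)" and ?\<kappa> = "a * q powi (2 * (int s - int z))"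
   have "replicate (\<nu> z) (int z) = replicate (s - 1) (int z) @ int z # int z # replicate (\<nu> z - s - 1) (int z)"
    by (rule nth_equalityI) (use False Suc.prems in \<open>auto simp: nth_append nth_Cons split: nat.split\<close>)
   then have w: "om \<nu> 1 n = (u @ replicate (s - 1) (int z)) @ int z # int z # (replicate (\<nu> z - s - 1) (int z) @ v')"
    unfolding om by (simp only: append.assoc append_Cons)
   have j: "Suc (length (u @ replicate (s - 1) (int z))) = ?j" using False k by (simp add: u_def)
   have T: "tT ?j ?w = cst (q\<^sup>2) * ?w"
    using T_fin [of "int z" "int z" "u @ replicate (s - 1) (int z)" "replicate (\<nu> z - s - 1) (int z) @ v'"] z
    unfolding w [symmetric] j by simp
   have jr: "?j : {1..<r}" using arg_cong [OF w, of length] len j by simp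
   have fin: "?w : Omega r" using len by (simp add: Omega_closed)
   have "tT ?j (opJ ?j ?w - cst ?\<kappa> * ?w) : Nl"
    by (rule T_Nl [OF jr Suc.IH]) (use False Suc.prems in auto)
   moreover have "opJ (?j + 1) ?w = tT ?j (opJ ?j ?w)"
    unfolding J_Suc [OF jr fin] T by (simp add: J_lin hecke_lin cst_mult_assoc)
   moreover have "cst ?\<kappa> * (cst (q\<^sup>2) * ?w) = cst (a * q powi (2 * (int (Suc s) - int z))) * ?w"
   proof -
    have "2 * (int (Suc s) - int z) = 2 * (int s - int z) + 2" by simp
    then have "q powi (2 * (int (Suc s) - int z)) = q powi (2 * (int s - int z)) * q\<^sup>2"
     by (simp only: power_int_add q0 simp_thms) simp
    then show ?thesis by (simp only: cst_mult_assoc mult.assoc)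
   qed
   ultimately have "opJ (?j + 1) ?w - cst (a * q powi (2 * (int (Suc s) - int z))) * ?w : Nl" by (simp only: hecke_lin T)
   then show ?thesis by simp
  qed
 qed simp
qed

lemma sum_blocks: "sum f {1..sz \<nu> 1 l} = (\<Sum>z=1..l. \<Sum>s=1..\<nu> z. f (sz \<nu> 1 (z - 1) + s))" for f :: "nat => 'z :: comm_monoid_add"
proof (induction l)
 case (Suc l)
 have e: "sz \<nu> 1 (Suc l) = sz \<nu> 1 l + \<nu> (Suc l)" using om_append [of \<nu> 1 l 1] by simp
 have "sum f {1..m + m'} = sum f {1..m} + (\<Sum>s=1..m'. f (m + s))" for m m'
  by (induction m') (simp_all add: add.assoc)
 then show ?case unfolding e by (simp only: Suc sum.cl_ivl_Suc) simp
qed simp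

definition csum :: "(nat => nat) => nat => complex" where
 "csum \<nu> t = (\<Sum>z=1..n. \<Sum>s=1..\<nu> z. (a * q powi (2 * (int s - int z))) ^ t)"

lemma C_content:
 assumes r: "sz \<nu> 1 n = r"
 shows "opC t (mon (om \<nu> 1 n)) - cst (csum \<nu> t) * mon (om \<nu> 1 n) : Nl"
proof -
 let ?w = "mon (om \<nu> 1 n)"
 have p: "(opJ j ^^ t) ?w - cst (\<kappa> ^ t) * ?w : Nl" if j: "j : {1..r}" and J: "opJ j ?w - cst \<kappa> * ?w : Nl" for j \<kappa>
 proof (induction t)
  case (Suc t)
  have "opJ j ((opJ j ^^ t) ?w - cst (\<kappa> ^ t) * ?w) + cst (\<kappa> ^ t) * (opJ j ?w - cst \<kappa> * ?w) : Nl"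
   by (intro Nl J_Nl [OF j Suc] J)
  then show ?case by (simp add: J_lin right_diff_distrib cst_mult_assoc mult.commute)
 qed (simp add: Nl)
 have c: "cst (sum g A) * x = (\<Sum>i\<in>A. cst (g i) * x)" for g :: "nat => complex" and A and x :: "int fa"
  by (induction A rule: infinite_finite_induct) (simp_all add: cst_add distrib_right)
 have "opC t ?w - cst (csum \<nu> t) * ?w = (\<Sum>z=1..n. \<Sum>s=1..\<nu> z. (opJ (sz \<nu> 1 (z - 1) + s) ^^ t) ?w - cst ((a * q powi (2 * (int s - int z))) ^ t) * ?w)"
  unfolding opC_def csum_def c sum_subtractf by (subst (1) r [symmetric]) (simp only: sum_blocks)
 also have "... : Nl"
 proof (intro Nl_sum p Murphy [OF r])
  fix z s assume z: "z : {1..n}" and s: "s : {1..\<nu> z}"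
  have "n = z - 1 + Suc (n - z)" "1 + (z - 1) = z" using z by auto
  then have "om \<nu> 1 n = om \<nu> 1 (z - 1) @ om \<nu> z (Suc (n - z))" using om_append [of \<nu> 1 "z - 1" "Suc (n - z)"] by metis
  from arg_cong [OF this, of length] show "sz \<nu> 1 (z - 1) + s : {1..r}" using s r by simp
 qed
 finally show ?thesis .
qed

section \<open>The image of the quantum group of \<open>gl\<^sub>n\<close>\<close>

definition gl :: "dgen set" where
 "gl = (\<Union>i\<in>{1..<n}. {dEg i, dFg i}) \<union> (\<Union>j\<in>{1..n}. {dKg j, dKig j})"

lemma gl_simps [simp]: "dEg i : gl \<longleftrightarrow> i : {1..<n}" "dFg i : gl \<longleftrightarrow> i : {1..<n}" "dKg i : gl \<longleftrightarrow> i : {1..n}" "dKig i : gl \<longleftrightarrow> i : {1..n}"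
 by (auto simp: gl_def)

lemma gl_op: "g : gl ==> v : Omega_fin n s ==> opD g v : Omega_fin n s"
 by (auto simp: gl_def E_Omega_fin F_Omega_fin dg_Omega_fin)

lemma gl_T: "g : gl ==> v : Omega_fin n s ==> k : {1..<s} ==> opD g (tT k v) = tT k (opD g v)"
 by (auto simp: gl_def E_T F_T dg_T)

lemma linear_lev [simp]: "linear_map (lev x)"
proof (induction x rule: fa_induct)
 case (mon w)
 show ?case unfolding left_eval_mon by (rule linear_map_foldr) simp
qed (simp_all add: left_eval_simps linear_map_plus linear_map_scale)

lemmas lev_lin = linear_map_simps [OF linear_lev]

lemma lev_mult: "lev (x * y) v = lev x (lev y v)"
 by (rule left_eval_mult) simp

lemmas lev_simps = left_eval_simps lev_mult left_eval_gen left_eval_1 left_eval_cst opD.simps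

lemma lev_fin: "x : gens_alg gl ==> v : Omega_fin n s ==> lev x v : Omega_fin n s"
 by (induction x arbitrary: v rule: gens_alg_induct) (auto simp: lev_simps gl_op Omega_fin_closed simp del: opD.simps)

lemma lev_T: "x : gens_alg gl ==> v : Omega_fin n s ==> k : {1..<s} ==> lev x (tT k v) = tT k (lev x v)"
proof (induction x arbitrary: v rule: gens_alg_induct)
 case (mult g y)
 then show ?case using gl_T [OF mult(1) lev_fin [OF mult(2)]] by (simp add: lev_simps del: opD.simps)
qed (simp_all add: lev_simps gl_T hecke_lin del: opD.simps)

text \<open>Every tensor that is symmetric in the blocks of an increasing word is obtained from it by the quantum group.\<close>

definition symm :: "(nat => nat) => int fa => bool" where
 "symm \<nu> v \<longleftrightarrow> (\<forall>j<n. \<forall>i\<in>{1..<\<nu> (1 + j)}. tT (sz \<nu> 1 j + i) v = cst (q\<^sup>2) * v)"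

lemma block_range:
 assumes r: "sz \<nu> 1 n = r" and j: "j < n" "i : {1..<\<nu> (1 + j)}"
 shows "sz \<nu> 1 j + i : {1..<r}"
  and "\<exists>u v. om \<nu> 1 n = u @ int (1 + j) # int (1 + j) # v \<and> Suc (length u) = sz \<nu> 1 j + i"
proof -
 have "n = j + Suc (n - j - 1)" using j by simp
 then have om: "om \<nu> 1 n = om \<nu> 1 j @ replicate (\<nu> (1 + j)) (int (1 + j)) @ om \<nu> (2 + j) (n - j - 1)"
  using om_append [of \<nu> 1 j "Suc (n - j - 1)"] by simp
 show "sz \<nu> 1 j + i : {1..<r}" using arg_cong [OF om, of length] r j by simp
 have "replicate (\<nu> (1 + j)) (int (1 + j)) = replicate (i - 1) (int (1 + j)) @ int (1 + j) # int (1 + j) # replicate (\<nu> (1 + j) - i - 1) (int (1 + j))"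
  by (rule nth_equalityI) (use j in \<open>auto simp: nth_append nth_Cons split: nat.split\<close>)
 then show "\<exists>u v. om \<nu> 1 n = u @ int (1 + j) # int (1 + j) # v \<and> Suc (length u) = sz \<nu> 1 j + i"
  using om j by (intro exI [of _ "om \<nu> 1 j @ replicate (i - 1) (int (1 + j))"]
    exI [of _ "replicate (\<nu> (1 + j) - i - 1) (int (1 + j)) @ om \<nu> (2 + j) (n - j - 1)"]) simp
qed

lemma symm_om: "sz \<nu> 1 n = r ==> symm \<nu> (mon (om \<nu> 1 n))"
 unfolding symm_def
proof (intro allI impI ballI)
 fix j i assume r: "sz \<nu> 1 n = r" and j: "j < n" "i : {1..<\<nu> (1 + j)}"
 from block_range(2) [OF this] obtain u v where "om \<nu> 1 n = u @ int (1 + j) # int (1 + j) # v" "Suc (length u) = sz \<nu> 1 j + i"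
  by blast
 then show "tT (sz \<nu> 1 j + i) (mon (om \<nu> 1 n)) = cst (q\<^sup>2) * mon (om \<nu> 1 n)"
  using T_fin [of "int (1 + j)" "int (1 + j)" u v] j by simp
qed

lemma symm_map:
 assumes "linear_map f" "!!k v. k : {1..<r} ==> v : Omega_fin n r ==> f (tT k v) = tT k (f v)"
  "sz \<nu> 1 n = r" "symm \<nu> v" "v : Omega_fin n r"
 shows "symm \<nu> (f v)"
 unfolding symm_def
proof (intro allI impI ballI)
 fix j i assume j: "j < n" "i : {1..<\<nu> (1 + j)}"
 have "tT (sz \<nu> 1 j + i) (f v) = f (tT (sz \<nu> 1 j + i) v)"
  using assms(2) [OF block_range(1) [OF assms(3) j] assms(5)] by simp
 then show "tT (sz \<nu> 1 j + i) (f v) = cst (q\<^sup>2) * f v"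
  using assms(4) j unfolding symm_def by (simp add: linear_map_cst [OF assms(1)])
qed

lemma om_mem: "sz \<nu> 1 n = r ==> mon (om \<nu> 1 n) : Omega_fin n r"
 using om_fin [of 1 n \<nu>] by (simp add: Omega_fin_closed)

text \<open>The images of the increasing word under the quantum group form a stable space to which the generation
  lemma applies.\<close>

lemma cyclic:
 assumes r: "sz \<nu> 1 n = r" and v: "v : Omega_fin n r"
 shows "\<exists>x\<in>gens_alg gl. PB \<nu> 1 0 n v = lev x (mon (om \<nu> 1 n))"
proof -
 let ?w = "mon (om \<nu> 1 n)"
 define N where "N = {lev x ?w | x. x : gens_alg gl}"
 have op: "opD g y : N" if g: "g : gl" and y: "y : N" for g y
 proof -
  obtain x where x: "x : gens_alg gl" "y = lev x ?w" using y unfolding N_def mem_Collect_eq by (elim exE conjE)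
  have "opD g y = lev (gen g * x) ?w" by (simp only: x(2) lev_mult left_eval_gen)
  moreover have "gen g * x : gens_alg gl" using g x(1) by (intro gens_alg_closed) auto
  ultimately show ?thesis unfolding N_def mem_Collect_eq by (intro exI conjI)
 qed
 have "subsp N" unfolding subsp_def N_def
 proof (intro conjI ballI allI)
  show "0 : {lev x ?w | x. x : gens_alg gl}" by (rule CollectI, rule exI [of _ 0]) (simp add: lev_simps)
 next
  fix y z assume "y : {lev x ?w | x. x : gens_alg gl}" "z : {lev x ?w | x. x : gens_alg gl}"
  then obtain x x' where "x : gens_alg gl" "y = lev x ?w" "x' : gens_alg gl" "z = lev x' ?w"
   unfolding mem_Collect_eq by (elim exE conjE)
  then show "y + z : {lev x ?w | x. x : gens_alg gl}" by (intro CollectI exI [of _ "x + x'"]) (simp add: lev_simps)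
 next
  fix c y assume "y : {lev x ?w | x. x : gens_alg gl}"
  then obtain x where "x : gens_alg gl" "y = lev x ?w" unfolding mem_Collect_eq by (elim exE conjE)
  then show "cst c * y : {lev x ?w | x. x : gens_alg gl}" by (intro CollectI exI [of _ "cst c * x"]) (simp add: lev_simps)
 qed
 then have "ustable 1 N" unfolding ustable_def stable_def
  using op [of "dEg _"] op [of "dFg _"] op [of "dKg _"] op [of "dKig _"] by auto
 moreover have "?w : N" unfolding N_def by (rule CollectI, rule exI [of _ 1]) (simp add: lev_simps)
 ultimately have "PB \<nu> 1 0 n v : N" by (intro generation) (use r v in auto)
 then show ?thesis unfolding N_def mem_Collect_eq by (elim exE conjE) (rule bexI)
qed

lemma PB_symm: "symm \<nu> v ==> \<exists>c. c ~= 0 \<and> PB \<nu> 1 0 n v = cst c * v"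
 by (rule PB_symmetric) (auto simp: symm_def)

lemma cyclic_symm:
 assumes r: "sz \<nu> 1 n = r" and v: "v : Omega_fin n r" "symm \<nu> v"
 shows "\<exists>x\<in>gens_alg gl. v = lev x (mon (om \<nu> 1 n))"
proof -
 obtain c where c: "c ~= 0" "PB \<nu> 1 0 n v = cst c * v" using PB_symm [OF v(2)] by blast
 obtain x where x: "x : gens_alg gl" "PB \<nu> 1 0 n v = lev x (mon (om \<nu> 1 n))" using cyclic [OF r v(1)] by blast
 have "lev (cst (inverse c) * x) (mon (om \<nu> 1 n)) = cst (inverse c) * (cst c * v)"
  using c x by (simp add: lev_simps)
 then show ?thesis using c x by (intro bexI [of _ "cst (inverse c) * x"]) (simp_all add: cst_mult_assoc)
qed

text \<open>Projections onto weight spaces, as interpolation polynomials in the torus.\<close>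

definition pr1 :: "nat => nat => dgen fa" where
 "pr1 i m = prod_list (map (\<lambda>s. cst (inverse (q ^ m - q ^ s)) * (dK i - cst (q ^ s))) (filter (\<lambda>s. s ~= m) [0..<Suc r]))"

definition pr :: "(nat => nat) => dgen fa" where
 "pr \<nu> = prod_list (map (\<lambda>i. pr1 i (\<nu> i)) [1..<Suc n])"

lemma pr_closed: "pr \<nu> : gens_alg gl"
 unfolding pr_def pr1_def by (intro gens_alg_prod_list) (auto intro!: gens_alg_prod_list gens_alg_closed)

lemma q_pow_inj: "q ^ m = q ^ s \<longleftrightarrow> m = s"
 using q_powi_inj [of "int m" "int s"] by simp

lemma lev_pr1:
 assumes k: "cnt i w = int k" "k \<le> r" and m: "m \<le> r"
 shows "lev (pr1 i m) (mon w) = (if k = m then mon w else 0)"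
proof -
 have e: "lev (prod_list (map (\<lambda>s. cst (inverse (q ^ m - q ^ s)) * (dK i - cst (q ^ s))) xs)) (mon w) =
   cst (\<Prod>s\<leftarrow>xs. inverse (q ^ m - q ^ s) * (q ^ k - q ^ s)) * mon w" for xs
 proof (induction xs)
  case (Cons s xs)
  let ?c = "inverse (q ^ m - q ^ s)" and ?b = "\<Prod>s\<leftarrow>xs. inverse (q ^ m - q ^ s) * (q ^ k - q ^ s)"
  let ?X = "lev (prod_list (map (\<lambda>s. cst (inverse (q ^ m - q ^ s)) * (dK i - cst (q ^ s))) xs)) (mon w)"
  have "lev (prod_list (map (\<lambda>s. cst (inverse (q ^ m - q ^ s)) * (dK i - cst (q ^ s))) (s # xs))) (mon w) =
    cst ?c * (opK i ?X - cst (q ^ s) * ?X)" by (simp only: list.map prod_list.Cons lev_simps)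
  also have "... = cst (?c * (q ^ k - q ^ s) * ?b) * mon w"
   unfolding Cons dg_simps dg_mon k(1) power_int_of_nat
   by (intro poly_mapping_eqI) (simp add: lookup_minus algebra_simps)
  finally show ?case by simp
 qed (simp add: lev_simps)
 show ?thesis
 proof (cases "k = m")
  case True
  have "(\<Prod>s\<leftarrow>filter (\<lambda>s. s ~= m) xs. inverse (q ^ m - q ^ s) * (q ^ k - q ^ s)) = 1" for xs
   by (induction xs) (use True q_pow_inj in auto)
  then show ?thesis unfolding pr1_def e using True by (simp del: upt_Suc)
 next
  case False
  have "(\<Prod>s\<leftarrow>filter (\<lambda>s. s ~= m) [0..<Suc r]. inverse (q ^ m - q ^ s) * (q ^ k - q ^ s)) = 0"
  proof -
   have "k : set (filter (\<lambda>s. s ~= m) [0..<Suc r])" using False k by (simp del: upt_Suc)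
   then show ?thesis unfolding prod_list_zero_iff set_map by force
  qed
  then show ?thesis unfolding pr1_def e using False by (simp del: upt_Suc)
 qed
qed

lemma cnt_le: "cnt i w \<le> int (length w)" "cnt i w \<ge> 0"
 by (simp_all add: cnt_def)

lemma lev_pr:
 assumes w: "length w = r" and m: "!!i. \<nu> i \<le> r"
 shows "lev (pr \<nu>) (mon w) = (if \<forall>i\<in>{1..n}. cnt i w = int (\<nu> i) then mon w else 0)"
proof -
 have k: "cnt i w = int (nat (cnt i w))" "nat (cnt i w) \<le> r" for i using cnt_le [of i w] w by auto
 have p: "lev (pr1 i (\<nu> i)) (mon w) = (if cnt i w = int (\<nu> i) then mon w else 0)" for i
  using lev_pr1 [OF k m, of i i] cnt_le(2) [of i w] by auto
 have "lev (prod_list (map (\<lambda>i. pr1 i (\<nu> i)) xs)) (mon w) = (if \<forall>i\<in>set xs. cnt i w = int (\<nu> i) then mon w else 0)" for xs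
  by (induction xs) (auto simp: lev_simps lev_lin p)
 then show ?thesis unfolding pr_def by (simp add: atLeastLessThanSuc_atLeastAtMost del: upt_Suc)
qed

lemma sorted_is_om:
 assumes w: "fin_word w" "sorted w"
 shows "w = om (\<lambda>i. nat (cnt i w)) 1 n"
proof -
 let ?\<nu> = "\<lambda>i. nat (cnt i w)"
 have gen: "w = om \<mu> k l" if "sorted w" "set w \<subseteq> {int k..<int (k + l)}" "!!c. c : {k..<k + l} ==> \<mu> c = length (filter (\<lambda>x. x = int c) w)" for \<mu> :: "nat => nat" and k l w
  using that
 proof (induction l arbitrary: k w)
  case (Suc l)
  obtain m w' where w: "w = replicate m (int k) @ w'" "\<forall>x\<in>set w'. int k < x" "sorted w'"
   using sorted_split_min [OF Suc.prems(1), of "int k"] Suc.prems(2) by fastforce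
  have "filter (\<lambda>x. x = int k) w' = []" using w(2) by (auto simp: filter_empty_conv)
  then have "\<mu> k = m" using Suc.prems(3) [of k] w(1) by simp
  moreover have "w' = om \<mu> (Suc k) l"
  proof (rule Suc.IH [OF w(3)])
   show "set w' \<subseteq> {int (Suc k)..<int (Suc k + l)}" using Suc.prems(2) w by fastforce
   fix c assume "c : {Suc k..<Suc k + l}"
   then show "\<mu> c = length (filter (\<lambda>x. x = int c) w')" using Suc.prems(3) [of c] w(1) by simp
  qed
  ultimately show ?case using w(1) by simp
 qed simp
 show ?thesis
 proof (rule gen [OF w(2)])
  show "set w \<subseteq> {int 1..<int (1 + n)}" using w(1) by (auto simp: fin_word_def)
  fix c assume "c : {1..<1 + n}"
  have "filter (\<lambda>x. rs n x = int c) w = filter (\<lambda>x. x = int c) w"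
   by (rule filter_cong) (use w(1) rs_fin in \<open>auto simp: fin_word_def\<close>)
  then show "nat (cnt c w) = length (filter (\<lambda>x. x = int c) w)" by (simp add: cnt_def)
 qed
qed

lemma lev_pr_om:
 assumes r: "sz \<nu> 1 n = r" and m: "!!i. \<nu> i \<le> r" and w: "length w = r" "fin_word w" "sorted w"
 shows "lev (pr \<nu>) (mon w) = (if w = om \<nu> 1 n then mon w else 0)"
proof -
 have "(\<forall>i\<in>{1..n}. cnt i w = int (\<nu> i)) \<longleftrightarrow> w = om \<nu> 1 n"
 proof
  assume e: "\<forall>i\<in>{1..n}. cnt i w = int (\<nu> i)"
  have "om (\<lambda>i. nat (cnt i w)) k l = om \<nu> k l" if "1 \<le> k" "k + l \<le> n + 1" for k l
   using that e by (induction l arbitrary: k) auto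
  from this [of 1 n] show "w = om \<nu> 1 n" using sorted_is_om [OF w(2,3)] by simp
 next
  assume "w = om \<nu> 1 n"
  then show "\<forall>i\<in>{1..n}. cnt i w = int (\<nu> i)" using om_cnt [of 1 n _ \<nu>] by auto
 qed
 then show ?thesis using lev_pr [OF w(1) m] by simp
qed

text \<open>Schur--Weyl duality: the endomorphisms of the \<open>H(r)\<close>-module come from the quantum group.\<close>

lemma schur_weyl:
 assumes f: "linear_map f" "!!k v. k : {1..<r} ==> v : Omega_fin n r ==> f (tT k v) = tT k (f v)"
  "!!v. v : Omega_fin n r ==> f v : Omega_fin n r"
 shows "\<exists>x\<in>gens_alg gl. \<forall>v\<in>Omega_fin n r. f v = lev x v"
proof -
 define S where "S = {w. length w = r \<and> fin_word w \<and> sorted w}"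
 have fS: "finite S"
  by (rule finite_subset [OF _ finite_lists_length_eq [of "{1..int n}" r]]) (auto simp: S_def fin_word_def)
 define nu where "nu w = (\<lambda>i. nat (cnt i w))" for w
 have nu: "w = om (nu w) 1 n" "sz (nu w) 1 n = r" "nu w i \<le> r" if "w : S" for w i
 proof -
  show o: "w = om (nu w) 1 n" using sorted_is_om [of w] that by (simp add: S_def nu_def)
  show "sz (nu w) 1 n = r" using arg_cong [OF o, of length] that by (simp add: S_def)
  show "nu w i \<le> r" using cnt_le [of i w] that by (simp add: S_def nu_def)
 qed
 have "\<exists>x\<in>gens_alg gl. f (mon w) = lev x (mon w)" if w: "w : S" for w
  using cyclic_symm [OF nu(2) [OF w] f(3) [OF om_mem [OF nu(2) [OF w]]] symm_map [OF f(1,2) nu(2) [OF w] symm_om [OF nu(2) [OF w]] om_mem [OF nu(2) [OF w]]]]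
  unfolding nu(1) [OF w, symmetric] .
 then obtain b where b: "!!w. w : S ==> b w : gens_alg gl \<and> f (mon w) = lev (b w) (mon w)" by metis
 define x where "x = (\<Sum>w\<in>S. b w * pr (nu w))"
 have x: "x : gens_alg gl" unfolding x_def using b pr_closed by (intro gens_alg_sum gens_alg_closed) auto
 have "f v = lev x v" if "v : Omega_fin n r" for v
 proof (rule sorted_generate [OF f(1) linear_lev f(2) lev_T [OF x] _ that])
  fix w assume "length w = r" "fin_word w" "sorted w"
  then have w: "w : S" by (simp add: S_def)
  have "lev x (mon w) = (\<Sum>w'\<in>S. lev (b w') (lev (pr (nu w')) (mon w)))" by (simp add: x_def lev_simps)
  also have "... = (\<Sum>w'\<in>S. if w' = w then lev (b w) (mon w) else 0)"
  proof (rule sum.cong)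
   fix w' assume w': "w' : S"
   have "lev (pr (nu w')) (mon w) = (if w = w' then mon w else 0)"
    using lev_pr_om [OF nu(2,3) [OF w'] , of w] w nu(1) [OF w'] by (simp add: S_def)
   then show "lev (b w') (lev (pr (nu w')) (mon w)) = (if w' = w then lev (b w) (mon w) else 0)"
    by (auto simp: lev_lin)
  qed simp
  also have "... = f (mon w)" using b [OF w] w fS by simp
  finally show "f (mon w) = lev x (mon w)" by simp
 qed
 then show ?thesis using x by blast
qed

end

section \<open>Highest weight vectors of modules over the Schur algebra\<close>

text \<open>The annihilator of a highest weight vector in a module on which the quantum group acts through the Schur
  algebra: elements that act by zero on tensor space belong to it.\<close>

locale hwgl = evalm n q r a + lcong "evalm.gl n" N
 for n q r a and N :: "dgen fa set" +
 fixes l :: "nat => nat"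
 assumes kerN: "x : gens_alg (evalm.gl n) ==> (!!v. v : Omega_fin n r ==> lev x v = 0) ==> x : N"
  and hwE: "i : {1..<n} ==> dE i : N"
  and hwK: "i : {1..n} ==> dK i - cst (q ^ l i) : N"
begin

lemma ker_eqv: "x : A ==> y : A ==> (!!v. v : Omega_fin n r ==> lev x v = lev y v) ==> x ~~ y"
 unfolding eqv_def by (rule kerN) (auto simp: lev_simps)

lemma ker_eq2: "x : A ==> y : A ==> (!!v. v : Omega_fin n r ==> lev x v = lev y v) ==> eq2 x y"
 unfolding eq2_def by (intro ballI ker_eqv) (auto simp: lev_mult lev_fin)

abbreviation "FG \<equiv> dFg ` {1..<n}"

definition wtw :: "dgen list => nat => int" where
 "wtw u p = int (l p) + (\<Sum>g\<leftarrow>u. case g of dFg i => of_bool (p = i + 1) - of_bool (p = i) | _ => 0)"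

lemma wtw_Cons: "wtw (dFg i # u) p = wtw u p + of_bool (p = i + 1) - of_bool (p = i)"
 by (simp add: wtw_def)

lemma FG_A: "set u \<subseteq> FG ==> mon u : A"
 by (auto simp: subset_iff)

lemma K_word: "set u \<subseteq> FG ==> p : {1..n} ==> dK p * mon u ~~ cst (q powi wtw u p) * mon u"
proof (induction u)
 case Nil
 then show ?case using hwK [of p] by (simp add: mon_Nil wtw_def eqv_def)
next
 case (Cons g u)
 then obtain i where i: "g = dFg i" "i : {1..<n}" and u: "set u \<subseteq> FG" by auto
 let ?e = "of_bool (p = i + 1) - of_bool (p = i) :: int"
 have "eq2 (dK p * dF i) (cst (q powi ?e) * dF i * dK p)"
 proof (rule ker_eq2)
  fix v
  have "nx n i = i + 1" using i by (simp add: nx_def)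
  then show "lev (dK p * dF i) v = lev (cst (q powi ?e) * dF i * dK p) v"
   using K_F [of i p v] i by (simp add: lev_simps)
 qed (use i Cons.prems in \<open>auto intro!: gens_alg_closed\<close>)
 from eq2D [OF this FG_A [OF u]] have "dK p * mon (g # u) ~~ cst (q powi ?e) * (dF i * (dK p * mon u))"
  by (simp only: i mon_Cons [of "dFg i" u] mult.assoc)
 also have "cst (q powi ?e) * (dF i * (dK p * mon u)) ~~ cst (q powi ?e) * (dF i * (cst (q powi wtw u p) * mon u))"
  by (intro eqv_cst eqv_lmult Cons.IH u Cons.prems) (use i in auto)
 also have "cst (q powi ?e) * (dF i * (cst (q powi wtw u p) * mon u)) = cst (q powi ?e * q powi wtw u p) * mon (g # u)"
  by (simp only: times_cst_left [of "dF i"] cst_mult_assoc i mon_Cons [of "dFg i" u])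
 also have "q powi ?e * q powi wtw u p = q powi wtw (g # u) p"
  unfolding q_powi_add i wtw_Cons by (simp add: algebra_simps)
 finally show ?case .
qed

lemma Ki_word: "set u \<subseteq> FG ==> p : {1..n} ==> dKi p * mon u ~~ cst (q powi (- wtw u p)) * mon u"
proof -
 assume u: "set u \<subseteq> FG" and p: "p : {1..n}"
 have "eq2 (dKi p * dK p) 1" by (rule ker_eq2) (use p in \<open>auto simp: lev_simps\<close>)
 from eq2D [OF this FG_A [OF u]] have "mon u ~~ dKi p * (dK p * mon u)" by (simp add: mult.assoc eqv_sym)
 also have "dKi p * (dK p * mon u) ~~ dKi p * (cst (q powi wtw u p) * mon u)" by (rule eqv_lmult [OF _ K_word [OF u p]]) (use p in simp)
 also have "dKi p * (cst (q powi wtw u p) * mon u) = cst (q powi wtw u p) * (dKi p * mon u)" by (rule times_cst_left)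
 finally have "cst (q powi wtw u p) * (dKi p * mon u) ~~ cst 1 * mon u" by (simp add: eqv_sym)
 from eqv_cancel [OF this] show ?thesis by (simp add: power_int_minus divide_inverse)
qed

lemma E_word: "set u \<subseteq> FG ==> i : {1..<n} ==> \<exists>y\<in>gens_alg FG. dE i * mon u ~~ y"
proof (induction u)
 case Nil
 then show ?case using hwE [of i] by (intro bexI [of _ 0]) (simp_all add: mon_Nil eqv_def)
next
 case (Cons g u)
 then obtain j where j: "g = dFg j" "j : {1..<n}" and u: "set u \<subseteq> FG" by auto
 obtain y where y: "y : gens_alg FG" "dE i * mon u ~~ y" using Cons u by auto
 have nx: "nx n i = i + 1" using Cons.prems by (simp add: nx_def)
 let ?c = "if i = j then inverse (q - inverse q) else 0"
 have "eq2 (dE i * dF j) (dF j * dE i + cst ?c * (dK i * dKi (i + 1) - dK (i + 1) * dKi i))"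
 proof (rule ker_eq2)
  fix v
  have "cnt2 i = (\<lambda>w. cnt i w - cnt (i + 1) w)" by (auto simp: cnt2_def nx)
  then show "lev (dE i * dF j) v = lev (dF j * dE i + cst ?c * (dK i * dKi (i + 1) - dK (i + 1) * dKi i)) v"
   using E_F [of i j v] Cons.prems j by (auto simp: lev_simps dg_dg diff_eq_eq algebra_simps)
 qed (use j Cons.prems in \<open>auto intro!: gens_alg_closed\<close>)
 from eq2D [OF this FG_A [OF u]]
 have "dE i * mon (g # u) ~~ dF j * (dE i * mon u) + cst ?c * (dK i * (dKi (i + 1) * mon u) - dK (i + 1) * (dKi i * mon u))"
  by (simp only: j mon_Cons [of "dFg j" u] distrib_right left_diff_distrib mult.assoc)
 also have "... ~~ dF j * y + cst ?c * (dK i * (cst (q powi (- wtw u (i + 1))) * mon u) - dK (i + 1) * (cst (q powi (- wtw u i)) * mon u))"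
  by (intro eqv_add eqv_lmult eqv_cst eqv_diff y Ki_word u) (use j Cons.prems in auto)
 also have "... = dF j * y + cst ?c * (cst (q powi (- wtw u (i + 1))) * (dK i * mon u) - cst (q powi (- wtw u i)) * (dK (i + 1) * mon u))"
  by (simp add: times_cst_left [of "dK _"])
 also have "... ~~ dF j * y + cst ?c * (cst (q powi (- wtw u (i + 1))) * (cst (q powi wtw u i) * mon u) - cst (q powi (- wtw u i)) * (cst (q powi wtw u (i + 1)) * mon u))"
  by (intro eqv_add eqv_cst eqv_diff K_word u eqv_refl) (use Cons.prems in auto)
 finally show ?case
  by (rule bexI) (use y j u in \<open>auto intro!: gens_alg_closed\<close>)
qed

text \<open>The module is spanned by the images of the highest weight vector under products of lowering operators.\<close>

lemma F_span: "x : A ==> \<exists>y\<in>gens_alg FG. x ~~ y"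
proof (induction x rule: gens_alg_induct)
 case (mult g x)
 then obtain y where y: "y : gens_alg FG" "x ~~ y" by blast
 have gx: "gen g * x ~~ gen g * y" by (rule eqv_lmult [OF _ y(2)]) (use mult in simp)
 have "\<exists>z\<in>gens_alg FG. gen g * y ~~ z"
  using y(1) unfolding gens_alg_supp
 proof (induction rule: supp_induct)
  case (mon u)
  then have u: "set u \<subseteq> FG" by simp
  consider i where "g = dEg i" "i : {1..<n}" | i where "g = dFg i" "i : {1..<n}" | i where "g = dKg i" "i : {1..n}" | i where "g = dKig i" "i : {1..n}"
   using mult(1) by (auto simp: gl_def)
  then show ?case
  proof cases
   case 1
   then show ?thesis using E_word [OF u] by (simp add: gens_alg_supp)
  next
   case 2
   then show ?thesis using u by (intro bexI [of _ "gen g * mon u"]) (auto simp: mon_mult)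
  next
   case 3
   then show ?thesis using K_word [OF u] u by (intro bexI [of _ "cst (q powi wtw u i) * mon u"]) auto
  next
   case 4
   then show ?thesis using Ki_word [OF u] u by (intro bexI [of _ "cst (q powi (- wtw u i)) * mon u"]) auto
  qed
 next
  case zero
  then show ?case by (intro bexI [of _ 0]) auto
 next
  case (add x y)
  then obtain z z' where "z : supp {w. set w \<subseteq> FG}" "gen g * x ~~ z" "z' : supp {w. set w \<subseteq> FG}" "gen g * y ~~ z'" by blast
  then show ?case by (intro bexI [of _ "z + z'"]) (auto simp: distrib_left intro: eqv_add)
 next
  case (cst c x)
  then obtain z where "z : supp {w. set w \<subseteq> FG}" "gen g * x ~~ z" by blast
  then show ?case by (intro bexI [of _ "cst c * z"]) (auto simp: times_cst_left [of "gen g"] intro: eqv_cst)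
 qed
 then show ?case using gx eqv_trans by blast
next
 case (gen g)
 have "\<exists>z\<in>gens_alg FG. gen g * mon [] ~~ z"
 proof -
  consider i where "g = dEg i" "i : {1..<n}" | i where "g = dFg i" "i : {1..<n}" | i where "g = dKg i" "i : {1..n}" | i where "g = dKig i" "i : {1..n}"
   using gen by (auto simp: gl_def)
  then show ?thesis
  proof cases
   case 1
   then show ?thesis using E_word [of "[]"] by simp
  next
   case 2
   then show ?thesis by (intro bexI [of _ "gen g * mon []"]) (auto simp: mon_mult)
  next
   case 3
   then show ?thesis using K_word [of "[]"] by (intro bexI [of _ "cst (q powi wtw [] i) * mon []"]) auto
  next
   case 4
   then show ?thesis using Ki_word [of "[]"] by (intro bexI [of _ "cst (q powi (- wtw [] i)) * mon []"]) auto
  qed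
 qed
 then show ?case by (simp add: mon_Nil)
next
 case (add x y)
 then obtain z z' where "z : gens_alg FG" "x ~~ z" "z' : gens_alg FG" "y ~~ z'" by blast
 then show ?case by (intro bexI [of _ "z + z'"]) (auto intro: eqv_add)
next
 case (cst c x)
 then obtain z where "z : gens_alg FG" "x ~~ z" by blast
 then show ?case by (intro bexI [of _ "cst c * z"]) (auto intro: eqv_cst)
qed (auto intro: bexI [of _ 1] bexI [of _ 0])

text \<open>Applying a torus element minus its eigenvalue on one of the words removes this word and multiplies the
  vector by a nonzero number; after finitely many steps nothing remains.\<close>

lemma weight_sep:
 assumes "finite U" "!!w. w : U ==> set (letters w) \<subseteq> FG" "!!w. w : U ==> \<exists>p\<in>{1..n}. wtw (letters w) p ~= k p"
  and x: "!!p. p : {1..n} ==> dK p * x ~~ cst (q powi k p) * x"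
  and e: "x ~~ (\<Sum>w\<in>U. cst (c w) * mon (letters w))"
 shows "x ~~ 0"
 using assms(1-3) e
proof (induction U arbitrary: c)
 case (insert w U)
 obtain p where p: "p : {1..n}" "wtw (letters w) p ~= k p" using insert.prems(2) by blast
 let ?m = "q powi wtw (letters w) p"
 have K: "dK p : A" using p by simp
 have "cst (q powi k p) * x ~~ dK p * x" by (rule eqv_sym [OF x [OF p(1)]])
 also have "dK p * x ~~ dK p * (\<Sum>w\<in>insert w U. cst (c w) * mon (letters w))" by (rule eqv_lmult [OF K insert.prems(3)])
 also have "dK p * (\<Sum>w\<in>insert w U. cst (c w) * mon (letters w)) = (\<Sum>w\<in>insert w U. cst (c w) * (dK p * mon (letters w)))"
  by (simp add: sum_distrib_left times_cst_left [of "dK p"])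
 also have "... ~~ (\<Sum>w\<in>insert w U. cst (c w) * (cst (q powi wtw (letters w) p) * mon (letters w)))"
  by (intro eqv_sum eqv_cst K_word insert.prems p)
 finally have 1: "cst (q powi k p) * x ~~ (\<Sum>w\<in>insert w U. cst (c w * q powi wtw (letters w) p) * mon (letters w))"
  by (simp only: cst_mult_assoc)
 have "cst (q powi k p) * x - cst ?m * x ~~ (\<Sum>w\<in>insert w U. cst (c w * q powi wtw (letters w) p) * mon (letters w)) -
   cst ?m * (\<Sum>w\<in>insert w U. cst (c w) * mon (letters w))"
  by (intro eqv_diff eqv_cst 1 insert.prems)
 also have "(\<Sum>w\<in>insert w U. cst (c w * q powi wtw (letters w) p) * mon (letters w)) - cst ?m * (\<Sum>w\<in>insert w U. cst (c w) * mon (letters w)) =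
   (\<Sum>v\<in>insert w U. cst (c v * (q powi wtw (letters v) p - ?m)) * mon (letters v))"
  unfolding sum_distrib_left sum_subtractf [symmetric]
  by (intro sum.cong) (simp_all add: cst_mult_assoc cst_diff right_diff_distrib left_diff_distrib mult.commute)
 also have "... = (\<Sum>v\<in>U. cst (c v * (q powi wtw (letters v) p - ?m)) * mon (letters v))"
  using insert.hyps by simp
 finally have "cst (q powi k p - ?m) * x ~~ cst 1 * (\<Sum>v\<in>U. cst (c v * (q powi wtw (letters v) p - ?m)) * mon (letters v))"
  by (simp add: cst_diff left_diff_distrib)
 from eqv_cancel [OF this] p have "x ~~ cst (1 / (q powi k p - ?m)) * (\<Sum>v\<in>U. cst (c v * (q powi wtw (letters v) p - ?m)) * mon (letters v))"
  by simp
 also have "... = (\<Sum>v\<in>U. cst (1 / (q powi k p - ?m) * (c v * (q powi wtw (letters v) p - ?m))) * mon (letters v))"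
  unfolding sum_distrib_left cst_mult_assoc ..
 finally show ?case using insert.prems by (intro insert.IH) auto
qed simp

lemma wtw_sum: "set u \<subseteq> FG ==> j < n ==> (\<Sum>p=1..j. wtw u p) = (\<Sum>p=1..j. int (l p)) - int (count_list u (dFg j))"
proof (induction u)
 case (Cons g u)
 then obtain i where i: "g = dFg i" "i : {1..<n}" by auto
 have "(\<Sum>p=1..j. of_bool (p = i + 1) - of_bool (p = i) :: int) = - of_bool (i = j)"
  using i by (auto simp: sum_subtractf of_bool_def sum.delta)
 then show ?case using Cons i unfolding i(1) wtw_Cons by (simp add: sum.distrib sum_subtractf)
qed (simp add: wtw_def)

text \<open>Lowering operators decrease the partial sums of the weight, and a vector cannot be a combination of
  vectors of different weights only.\<close>

lemma weights_below:
 assumes "x : A" "x \<notin> N" "!!p. p : {1..n} ==> dK p * x ~~ cst (q ^ k p) * x" "j < n"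
 shows "(\<Sum>p=1..j. k p) \<le> (\<Sum>p=1..j. l p)"
proof -
 obtain y where y: "y : gens_alg FG" "x ~~ y" using F_span [OF assms(1)] by blast
 then have e: "x ~~ (\<Sum>w\<in>Poly_Mapping.keys y. cst (Poly_Mapping.lookup y w) * mon (letters w))"
  using fa_expand [of y] by simp
 have U: "w : Poly_Mapping.keys y ==> set (letters w) \<subseteq> FG" for w using y(1) by (auto simp: free_alg_def)
 have "\<not> (\<forall>w\<in>Poly_Mapping.keys y. \<exists>p\<in>{1..n}. wtw (letters w) p ~= int (k p))"
 proof
  assume "\<forall>w\<in>Poly_Mapping.keys y. \<exists>p\<in>{1..n}. wtw (letters w) p ~= int (k p)"
  then have "x ~~ 0" using assms(3) by (intro weight_sep [OF _ U _ _ e, of "\<lambda>p. int (k p)"]) auto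
  then show False using assms(2) by (simp add: eqv_def)
 qed
 then obtain w where w: "w : Poly_Mapping.keys y" "\<forall>p\<in>{1..n}. wtw (letters w) p = int (k p)" by blast
 have "int (\<Sum>p=1..j. k p) = (\<Sum>p=1..j. wtw (letters w) p)" using w(2) assms(4) by simp
 also have "... \<le> int (\<Sum>p=1..j. l p)" unfolding wtw_sum [OF U [OF w(1)] assms(4)] by simp
 finally show ?thesis by linarith
qed

text \<open>All weights of a combination of lowered vectors differ from the highest weight.\<close>

lemma lowered_zero:
 assumes y: "!!j. j : {1..<n} ==> y j : A" and e: "x ~~ (\<Sum>j\<in>{1..<n}. dF j * y j)"
  and K: "!!p. p : {1..n} ==> dK p * x ~~ cst (q ^ l p) * x"
 shows "x ~~ 0"
proof -
 obtain z where z: "!!j. j : {1..<n} ==> z j : gens_alg FG \<and> y j ~~ z j"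
 proof -
  have "\<forall>j. \<exists>z. j : {1..<n} \<longrightarrow> z : gens_alg FG \<and> y j ~~ z" using F_span y by blast
  then show ?thesis using that by metis
 qed
 define Y where "Y = (\<Sum>j\<in>{1..<n}. dF j * z j)"
 have "x ~~ Y" unfolding Y_def
  by (rule eqv_trans [OF e]) (use z in \<open>auto intro!: eqv_sum eqv_lmult\<close>)
 then have e': "x ~~ (\<Sum>w\<in>Poly_Mapping.keys Y. cst (Poly_Mapping.lookup Y w) * mon (letters w))"
  using fa_expand [of Y] by simp
 have "Y : supp {u. set u \<subseteq> FG \<and> u ~= []}" unfolding Y_def
 proof (rule supp_sum)
  fix j assume j: "j : {1..<n}"
  have "dF j : supp {[dFg j]}" "z j : supp {u. set u \<subseteq> FG}" using z [OF j] by (simp_all add: gens_alg_supp)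
  then show "dF j * z j : supp {u. set u \<subseteq> FG \<and> u ~= []}" by (rule supp_mult) (use j in auto)
 qed
 then have U: "w : Poly_Mapping.keys Y ==> set (letters w) \<subseteq> FG \<and> letters w ~= []" for w by (auto simp: supp_def)
 show ?thesis
 proof (rule weight_sep [OF _ _ _ _ e', of "\<lambda>p. int (l p)"])
  fix w assume w: "w : Poly_Mapping.keys Y"
  then obtain j u where j: "letters w = dFg j # u" "j : {1..<n}" using U [OF w] by (cases "letters w") auto
  show "\<exists>p\<in>{1..n}. wtw (letters w) p ~= int (l p)"
  proof (rule ccontr)
   assume "\<not> ?thesis"
   then have "(\<Sum>p=1..j. wtw (letters w) p) = (\<Sum>p=1..j. int (l p))" using j by (intro sum.cong) auto
   then have "count_list (letters w) (dFg j) = 0" using wtw_sum [of "letters w" j] U [OF w] j by simp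
   then show False using j by simp
  qed
 qed (use U K in auto)
qed

lemma pr_eqv: "pr l ~~ 1"
proof -
 have one: "prod_list xs ~~ 1" if "!!x. x : set xs ==> x : A \<and> x ~~ 1" for xs :: "dgen fa list"
  using that
 proof (induction xs)
  case (Cons x xs)
  have "x * prod_list xs ~~ x * 1" by (rule eqv_lmult) (use Cons in auto)
  then show ?case using Cons.prems [of x] eqv_trans by auto
 qed simp
 have "pr1 i (l i) ~~ 1" if i: "i : {1..n}" for i
  unfolding pr1_def
 proof (rule one)
  fix x assume "x : set (map (\<lambda>s. cst (inverse (q ^ l i - q ^ s)) * (dK i - cst (q ^ s))) (filter (\<lambda>s. s ~= l i) [0..<Suc r]))"
  then obtain s where s: "s ~= l i" and x: "x = cst (inverse (q ^ l i - q ^ s)) * (dK i - cst (q ^ s))" by (auto simp del: upt_Suc)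
  have "x ~~ cst (inverse (q ^ l i - q ^ s)) * (cst (q ^ l i) - cst (q ^ s))"
   unfolding x using hwK [OF i] by (intro eqv_cst eqv_diff eqv_refl) (simp add: eqv_def)
  also have "... = 1" using s q_pow_inj [of "l i" s] by (simp flip: cst_diff cst_mult)
  finally show "x : A \<and> x ~~ 1" unfolding x using i by (auto intro!: gens_alg_closed)
 qed
 then show ?thesis unfolding pr_def
  by (intro one) (auto simp: pr1_def intro!: gens_alg_prod_list gens_alg_closed)
qed

text \<open>An element of the quantum group that represents a power sum of the Jucys--Murphy operators acts on the highest
 weight vector by the sum over the boxes of the Young diagram.\<close>

lemma center_value:
 assumes sz: "sz l 1 n = r" and b: "b : A" "!!v. v : Omega_fin n r ==> lev b v = opC t v"
 shows "b ~~ cst (csum l t)"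
proof -
 let ?w = "mon (om l 1 n)"
 have w: "?w : Omega_fin n r" by (rule om_mem [OF sz])
 have lr: "l i \<le> r" if "i : {1..n}" for i
  using om_cnt [of 1 n i l] cnt_le(1) [of i "om l 1 n"] sz that by auto
 have CT: "opC t (tT k v) = tT k (opC t v)" if "k : {1..<r}" "v : Omega_fin n r" for k v
  using opC_T [OF that(1) Omega_fin_Omega [OF that(2)]] by simp
 define y where "y = opC t ?w - cst (csum l t) * ?w"
 have "y : Nl" unfolding y_def by (rule C_content [OF sz])
 then obtain m where m: "y = (\<Sum>j\<in>{1..<n}. opF j (m j))" "\<forall>j. m j : Omega_fin n r" unfolding Nl_def by blast
 have yO: "y : Omega_fin n r" unfolding y_def by (intro Omega_fin_closed opC_Omega_fin w)
 have "symm l (opC t ?w - cst (csum l t) * ?w)"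
 proof (rule symm_map [of "\<lambda>v. opC t v - cst (csum l t) * v"])
  show "linear_map (\<lambda>v. opC t v - cst (csum l t) * v)" by (intro linear_map_sub linear_opC linear_map_scale linear_map_id)
 qed (use sz symm_om w CT in \<open>auto simp: hecke_lin\<close>)
 then obtain c where c: "c ~= 0" "PB l 1 0 n y = cst c * y" using PB_symm [of l y] unfolding y_def by blast
 obtain x where x: "!!j. x j : A \<and> PB l 1 0 n (m j) = lev (x j) ?w" using cyclic [OF sz m(2) [rule_format]] by metis
 define X where "X = cst c * (b - cst (csum l t)) - (\<Sum>j\<in>{1..<n}. dF j * x j)"
 have XA: "X : A" unfolding X_def using b x by (intro gens_alg_closed gens_alg_sum) auto
 have "lev X ?w = cst c * y - (\<Sum>j\<in>{1..<n}. opF j (PB l 1 0 n (m j)))"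
  using x b(2) [OF w] by (simp add: X_def y_def lev_simps)
 also have "(\<Sum>j\<in>{1..<n}. opF j (PB l 1 0 n (m j))) = PB l 1 0 n y"
  unfolding m(1) PB_lin using sz m(2) by (intro sum.cong) (simp_all add: F_PB [of _ _ r])
 finally have Xw: "lev X ?w = 0" using c by simp
 have "X * pr (\<lambda>i. if i : {1..n} then l i else 0) : N"
 proof (rule kerN)
  show "X * pr (\<lambda>i. if i : {1..n} then l i else 0) : A" using XA pr_closed by simp
  fix v assume v: "v : Omega_fin n r"
  let ?l = "\<lambda>i. if i : {1..n} then l i else 0"
  have om: "om ?l k j = om l k j" if "1 \<le> k" "k + j \<le> n + 1" for k j
   using that by (induction j arbitrary: k) auto
  have oml: "om ?l 1 n = om l 1 n" by (rule om) auto
  have "lev (X * pr ?l) v = 0"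
  proof (rule sorted_generate [OF linear_lev linear_map_zero _ _ _ v])
   show "lev (X * pr ?l) (tT k v) = tT k (lev (X * pr ?l) v)" if "k : {1..<r}" "v : Omega_fin n r" for k v
    by (rule lev_T) (use that XA pr_closed in auto)
   show "0 = tT k 0" for k by (simp add: hecke_lin)
   fix w assume "length w = r" "fin_word w" "sorted w"
   then have "lev (pr ?l) (mon w) = (if w = om l 1 n then mon w else 0)"
    using lev_pr_om [of ?l w] sz lr unfolding oml by auto
   then show "lev (X * pr ?l) (mon w) = 0" using Xw by (simp add: lev_mult lev_lin)
  qed
  then show "lev (X * pr ?l) v = 0" .
 qed
 moreover have "pr (\<lambda>i. if i : {1..n} then l i else 0) = pr l"
  unfolding pr_def by (intro arg_cong [where f = prod_list] map_cong) (auto simp del: upt_Suc)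
 moreover have "X * pr l ~~ X * 1" by (rule eqv_lmult [OF XA pr_eqv])
 ultimately have "X ~~ 0" using eqv_sym eqv_trans by (metis eqv_0 mult.right_neutral)
 then have "cst c * (b - cst (csum l t)) ~~ (\<Sum>j\<in>{1..<n}. dF j * x j)" by (simp add: X_def eqv_def)
 moreover have "dK p * (cst c * (b - cst (csum l t))) ~~ cst (q ^ l p) * (cst c * (b - cst (csum l t)))" if p: "p : {1..n}" for p
 proof -
  have "dK p * (cst c * (b - cst (csum l t))) ~~ (cst c * (b - cst (csum l t))) * dK p"
  proof (rule ker_eqv)
   fix v assume v: "v : Omega_fin n r"
   have "opK p (opC t v) = opC t (opK p v)"
    by (rule C_commute) (use v in \<open>auto simp: dg_T dg_Omega_fin\<close>)
   then show "lev (dK p * (cst c * (b - cst (csum l t)))) v = lev ((cst c * (b - cst (csum l t))) * dK p) v"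
    using b(2) v dg_Omega_fin [OF v] by (simp add: lev_simps dg_simps)
  qed (use p b in \<open>auto intro!: gens_alg_closed\<close>)
  also have "(cst c * (b - cst (csum l t))) * dK p ~~ (cst c * (b - cst (csum l t))) * cst (q ^ l p)"
   using hwK [OF p] b by (intro eqv_lmult) (auto simp: eqv_def intro!: gens_alg_closed)
  also have "(cst c * (b - cst (csum l t))) * cst (q ^ l p) = cst (q ^ l p) * (cst c * (b - cst (csum l t)))" by (rule cst_commute)
  finally show ?thesis .
 qed
 ultimately have "cst c * (b - cst (csum l t)) ~~ 0" using x by (intro lowered_zero) auto
 then have "cst c * (b - cst (csum l t)) ~~ cst 0 * 0" by simp
 from eqv_cancel [OF this c(1)] show ?thesis by (simp add: eqv_def)
qed

end

section \<open>The presentation of the quantum loop algebra\<close>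

context qparam begin

lemma fexp_closed: "(!!m. F $ m : gens_alg G) ==> fexp F $ s : gens_alg G"
proof -
 assume F: "!!m. F $ m : gens_alg G"
 have p: "(F ^ k) $ s : gens_alg G" for k s
 proof (induction k arbitrary: s)
  case (Suc k)
  show ?case unfolding power_Suc fps_mult_nth by (intro gens_alg_sum gens_alg_closed F Suc)
 qed simp
 show ?thesis unfolding fexp_def fps_nth_Abs_fps by (intro gens_alg_sum gens_alg_closed p)
qed

lemma U_mem [simp]: "uXg e i s : U_gens n \<longleftrightarrow> i : {1..<n}" "uKg i : U_gens n \<longleftrightarrow> i : {1..n}"
  "uKig i : U_gens n \<longleftrightarrow> i : {1..n}" "uGg i t : U_gens n \<longleftrightarrow> i : {1..n} \<and> t ~= 0"
 by (auto simp: U_gens_def)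

lemma Qcal_closed: "i : {1..n} ==> Qcal q e i $ s : gens_alg (U_gens n)"
 unfolding Qcal_def by (rule fexp_closed) (cases e; auto)

lemma phi_closed: "i : {1..<n} ==> phi n q e i s : gens_alg (U_gens n)"
proof -
 assume i: "i : {1..<n}"
 have "uKt n e i : gens_alg (U_gens n)" using i by (cases e) (auto simp: nx_def)
 moreover have "fexp (Abs_fps (\<lambda>m. if m = 0 then 0 else cst (of_int (sg e) * (q - inverse q)) * uH q i (sg e * int m))) $ s' : gens_alg (U_gens n)" for s'
  by (rule fexp_closed) (use i in \<open>cases e; auto simp: uH_def intro!: gens_alg_closed\<close>)
 ultimately show ?thesis unfolding phi_def phi_series_def by (simp del: uKt.simps)
qed

lemma U_rel_closed: "U_rel n q x y ==> x : gens_alg (U_gens n) \<and> y : gens_alg (U_gens n)"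
proof (induction rule: U_rel.induct)
 case (10 i j s t)
 then show ?case using phi_closed [of i] by (auto intro!: gens_alg_closed)
qed (auto simp: qbr_def intro!: gens_alg_closed)

sublocale U: presentation "U_gens n" "U_rel n q"
 by standard (rule U_rel_closed)

lemma U_cls_eq: "U_cls n q = U.cl"
 by (rule ext) (simp add: U_cls_def)

lemma Uhat_eq: "Uhat n q = U.Q"
 by (simp add: Uhat_def)

end

section \<open>Modules\<close>

context left_module begin

lemma smult_r_zero: "x : carrier R ==> x \<odot>\<^bsub>M\<^esub> \<zero>\<^bsub>M\<^esub> = \<zero>\<^bsub>M\<^esub>"
proof -
 assume x: "x : carrier R"
 have "x \<odot>\<^bsub>M\<^esub> \<zero>\<^bsub>M\<^esub> \<oplus>\<^bsub>M\<^esub> x \<odot>\<^bsub>M\<^esub> \<zero>\<^bsub>M\<^esub> = x \<odot>\<^bsub>M\<^esub> \<zero>\<^bsub>M\<^esub>"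
  using smult_r_distr [OF x, of "\<zero>\<^bsub>M\<^esub>" "\<zero>\<^bsub>M\<^esub>"] by simp
 then show ?thesis using smult_closed [OF x, of "\<zero>\<^bsub>M\<^esub>"] by (simp add: M.add.l_cancel_one)
qed

lemma smult_l_zero: "v : carrier M ==> \<zero>\<^bsub>R\<^esub> \<odot>\<^bsub>M\<^esub> v = \<zero>\<^bsub>M\<^esub>"
proof -
 assume v: "v : carrier M"
 have "\<zero>\<^bsub>R\<^esub> \<odot>\<^bsub>M\<^esub> v \<oplus>\<^bsub>M\<^esub> \<zero>\<^bsub>R\<^esub> \<odot>\<^bsub>M\<^esub> v = \<zero>\<^bsub>R\<^esub> \<odot>\<^bsub>M\<^esub> v"
  using smult_l_distr [of "\<zero>\<^bsub>R\<^esub>" "\<zero>\<^bsub>R\<^esub>" v] v by simp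
 then show ?thesis using smult_closed [of "\<zero>\<^bsub>R\<^esub>" v] v by (simp add: M.add.l_cancel_one)
qed

lemma submoduleI':
 assumes "H \<subseteq> carrier M" "\<zero>\<^bsub>M\<^esub> : H" "!!x y. x : H ==> y : H ==> x \<oplus>\<^bsub>M\<^esub> y : H"
  "!!x. x : H ==> \<ominus>\<^bsub>M\<^esub> x : H" "!!a x. a : carrier R ==> x : H ==> a \<odot>\<^bsub>M\<^esub> x : H"
 shows "submodule H R M"
proof -
 have "subgroup H (add_monoid M)"
  by (rule M.add.subgroupI) (use assms in \<open>auto simp: a_inv_def [symmetric]\<close>)
 then show ?thesis using assms(5) by (simp add: submodule_def submodule_axioms_def)
qed

lemma cyclic_submodule:
 assumes v: "v : carrier M"
 shows "submodule {x \<odot>\<^bsub>M\<^esub> v | x. x : carrier R} R M"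
proof (rule submoduleI')
 show "{x \<odot>\<^bsub>M\<^esub> v | x. x : carrier R} \<subseteq> carrier M" using smult_closed v by auto
 show "\<zero>\<^bsub>M\<^esub> : {x \<odot>\<^bsub>M\<^esub> v | x. x : carrier R}" using smult_l_zero [OF v] by (metis (mono_tags, lifting) R.zero_closed mem_Collect_eq)
next
 fix y z assume "y : {x \<odot>\<^bsub>M\<^esub> v | x. x : carrier R}" "z : {x \<odot>\<^bsub>M\<^esub> v | x. x : carrier R}"
 then obtain s t where "s : carrier R" "t : carrier R" "y = s \<odot>\<^bsub>M\<^esub> v" "z = t \<odot>\<^bsub>M\<^esub> v" by blast
 then show "y \<oplus>\<^bsub>M\<^esub> z : {x \<odot>\<^bsub>M\<^esub> v | x. x : carrier R}" using smult_l_distr [of s t v] v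
  by (intro CollectI exI [of _ "s \<oplus>\<^bsub>R\<^esub> t"]) simp
next
 fix y assume "y : {x \<odot>\<^bsub>M\<^esub> v | x. x : carrier R}"
 then obtain s where s: "s : carrier R" "y = s \<odot>\<^bsub>M\<^esub> v" by blast
 have "(\<ominus>\<^bsub>R\<^esub> s) \<odot>\<^bsub>M\<^esub> v \<oplus>\<^bsub>M\<^esub> s \<odot>\<^bsub>M\<^esub> v = \<zero>\<^bsub>M\<^esub>"
  using smult_l_distr [of "\<ominus>\<^bsub>R\<^esub> s" s v] s v by (simp add: R.l_neg smult_l_zero)
 then have "\<ominus>\<^bsub>M\<^esub> (s \<odot>\<^bsub>M\<^esub> v) = (\<ominus>\<^bsub>R\<^esub> s) \<odot>\<^bsub>M\<^esub> v" using s v by (intro M.minus_equality) (auto intro: smult_closed)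
 then show "\<ominus>\<^bsub>M\<^esub> y : {x \<odot>\<^bsub>M\<^esub> v | x. x : carrier R}" using s by auto
next
 fix s y assume s: "s : carrier R" and "y : {x \<odot>\<^bsub>M\<^esub> v | x. x : carrier R}"
 then obtain t where "t : carrier R" "y = t \<odot>\<^bsub>M\<^esub> v" by blast
 then show "s \<odot>\<^bsub>M\<^esub> y : {x \<odot>\<^bsub>M\<^esub> v | x. x : carrier R}" using s smult_assoc1 [of s t v] v
  by (intro CollectI exI [of _ "s \<otimes>\<^bsub>R\<^esub> t"]) simp
qed

end

text \<open>The multiples of a nonzero vector form a nonzero submodule.\<close>

lemma simple_generated:
 assumes "simple_module R M" "v : carrier M" "v ~= \<zero>\<^bsub>M\<^esub>" "w : carrier M"
 shows "\<exists>x\<in>carrier R. w = x \<odot>\<^bsub>M\<^esub> v"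
proof -
 interpret left_module R M using assms(1) by (simp add: simple_module_def)
 let ?H = "{x \<odot>\<^bsub>M\<^esub> v | x. x : carrier R}"
 have "v : ?H" using smult_one [OF assms(2)] by (metis (mono_tags, lifting) R.one_closed mem_Collect_eq)
 then have "?H ~= {\<zero>\<^bsub>M\<^esub>}" using assms(3) by blast
 then have "?H = carrier M" using assms(1) cyclic_submodule [OF assms(2)] by (auto simp: simple_module_def)
 then show ?thesis using assms(4) by blast
qed

text \<open>A module that is a quotient of the regular module modulo the left ideal generated by a set has a nonzero vector
 that is annihilated by this set.\<close>

lemma quotient_vector:
 fixes R :: "'r ring" and M :: "('r, 'm) module"
 assumes R: "ring R" and M: "left_module R M" "carrier M ~= {\<zero>\<^bsub>M\<^esub>}" and S: "S \<subseteq> carrier R"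
  and \<pi>: "\<pi> : module_hom R (quotient_module (regular_module R) (gen_submodule R (regular_module R) S)) M"
  "\<pi> ` carrier (quotient_module (regular_module R) (gen_submodule R (regular_module R) S)) = carrier M"
 shows "\<exists>v\<in>carrier M. v ~= \<zero>\<^bsub>M\<^esub> \<and> (\<forall>s\<in>S. s \<odot>\<^bsub>M\<^esub> v = \<zero>\<^bsub>M\<^esub>)"
proof -
 interpret R: ring R by (rule R)
 interpret M: left_module R M by (rule M)
 let ?A = "regular_module R"
 define I where "I = gen_submodule R ?A S"
 let ?Q = "quotient_module ?A I"
 have A: "carrier ?A = carrier R" "mult ?A = mult R" "one ?A = one R" "zero ?A = zero R" "add ?A = add R" "smult ?A = mult R"
  by (simp_all add: regular_module_def)
 have inv: "inv\<^bsub>add_monoid ?A\<^esub> x = \<ominus>\<^bsub>R\<^esub> x" for x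
  by (simp add: a_inv_def m_inv_def A)
 have sub: "submodule (carrier R) R ?A"
  unfolding submodule_def submodule_axioms_def
 proof (intro conjI allI impI subgroup.intro)
  fix x assume "x : carrier R"
  then show "inv\<^bsub>add_monoid ?A\<^esub> x : carrier R" unfolding inv by simp
 qed (simp_all add: A)
 have I: "I \<subseteq> carrier R" "S \<subseteq> I" "\<zero>\<^bsub>R\<^esub> : I" "!!x y. x : I ==> y : I ==> x \<oplus>\<^bsub>R\<^esub> y : I"
  "!!x. x : I ==> \<ominus>\<^bsub>R\<^esub> x : I" "!!a x. a : carrier R ==> x : I ==> a \<otimes>\<^bsub>R\<^esub> x : I"
 proof -
  have N: "\<zero>\<^bsub>R\<^esub> : N" "x : N ==> y : N ==> x \<oplus>\<^bsub>R\<^esub> y : N" "x : N ==> \<ominus>\<^bsub>R\<^esub> x : N" "b : carrier R ==> x : N ==> b \<otimes>\<^bsub>R\<^esub> x : N"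
   if "submodule N R ?A" for N x y b
  proof -
   have g: "subgroup N (add_monoid ?A)" using that unfolding submodule_def by simp
   show "\<zero>\<^bsub>R\<^esub> : N" using subgroup.one_closed [OF g] by (simp add: A)
   show "x : N ==> y : N ==> x \<oplus>\<^bsub>R\<^esub> y : N" using subgroup.m_closed [OF g] by (simp add: A)
   show "x : N ==> \<ominus>\<^bsub>R\<^esub> x : N" using subgroup.m_inv_closed [OF g] unfolding inv by simp
   show "b : carrier R ==> x : N ==> b \<otimes>\<^bsub>R\<^esub> x : N" using submodule.smult_closed [OF that, of b x] by (simp add: A)
  qed
  show "I \<subseteq> carrier R" unfolding I_def gen_submodule_def using sub S by blast
  show "S \<subseteq> I" unfolding I_def gen_submodule_def by blast
  show "\<zero>\<^bsub>R\<^esub> : I" unfolding I_def gen_submodule_def using N(1) by blast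
  show "!!x y. x : I ==> y : I ==> x \<oplus>\<^bsub>R\<^esub> y : I" unfolding I_def gen_submodule_def using N(2) by blast
  show "!!x. x : I ==> \<ominus>\<^bsub>R\<^esub> x : I" unfolding I_def gen_submodule_def using N(3) by blast
  show "!!a x. a : carrier R ==> x : I ==> a \<otimes>\<^bsub>R\<^esub> x : I" unfolding I_def gen_submodule_def using N(4) by blast
 qed
 define co where "co x = {i \<oplus>\<^bsub>R\<^esub> x | i. i : I}" for x
 have carQ: "carrier ?Q = co ` carrier R"
  by (auto simp: quotient_module_def A_RCOSETS_def RCOSETS_def r_coset_def co_def A)
 have co_eq: "co x = co y" if xy: "x : carrier R" "y : carrier R" "i : I" "x = i \<oplus>\<^bsub>R\<^esub> y" for x y i
 proof -
  have i: "i : carrier R" using I(1) xy by blast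
  have "j \<oplus>\<^bsub>R\<^esub> x : co y" if j: "j : I" for j
  proof -
   have "j : carrier R" using j I(1) by blast
   then have "j \<oplus>\<^bsub>R\<^esub> x = (j \<oplus>\<^bsub>R\<^esub> i) \<oplus>\<^bsub>R\<^esub> y" using xy i by (simp add: R.a_assoc)
   then show ?thesis using I(4) [OF j xy(3)] by (auto simp: co_def)
  qed
  moreover have "j \<oplus>\<^bsub>R\<^esub> y : co x" if j: "j : I" for j
  proof -
   have jc: "j : carrier R" using j I(1) by blast
   have "(j \<oplus>\<^bsub>R\<^esub> \<ominus>\<^bsub>R\<^esub> i) \<oplus>\<^bsub>R\<^esub> x = j \<oplus>\<^bsub>R\<^esub> (\<ominus>\<^bsub>R\<^esub> i \<oplus>\<^bsub>R\<^esub> i) \<oplus>\<^bsub>R\<^esub> y" using xy i jc by (simp add: R.a_assoc)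
   also have "... = j \<oplus>\<^bsub>R\<^esub> y" using i jc xy by (simp add: R.l_neg)
   finally have "j \<oplus>\<^bsub>R\<^esub> y = (j \<oplus>\<^bsub>R\<^esub> \<ominus>\<^bsub>R\<^esub> i) \<oplus>\<^bsub>R\<^esub> x" by simp
   then show ?thesis using I(4) [OF j I(5) [OF xy(3)]] by (auto simp: co_def)
  qed
  ultimately show ?thesis by (auto simp: co_def)
 qed
 have act: "smult ?Q x (co \<one>\<^bsub>R\<^esub>) = co x" if x: "x : carrier R" for x
 proof -
  have e: "smult ?Q x (co \<one>\<^bsub>R\<^esub>) = (\<Union>y\<in>co \<one>\<^bsub>R\<^esub>. co (x \<otimes>\<^bsub>R\<^esub> y))"
   by (simp add: quotient_module_def a_r_coset_def r_coset_def co_def A) blast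
  have "co (x \<otimes>\<^bsub>R\<^esub> y) = co x" if y: "y : co \<one>\<^bsub>R\<^esub>" for y
  proof -
   obtain i where i: "i : I" "y = i \<oplus>\<^bsub>R\<^esub> \<one>\<^bsub>R\<^esub>" using y by (auto simp: co_def)
   have ic: "i : carrier R" using i I(1) by blast
   have "x \<otimes>\<^bsub>R\<^esub> y = x \<otimes>\<^bsub>R\<^esub> i \<oplus>\<^bsub>R\<^esub> x" unfolding i(2) using x ic by (simp add: R.r_distr)
   then show ?thesis using x ic i I(6) [OF x i(1)] by (intro co_eq) auto
  qed
  moreover have "\<one>\<^bsub>R\<^esub> : co \<one>\<^bsub>R\<^esub>" using I(3) by (auto simp: co_def intro!: exI [of _ "\<zero>\<^bsub>R\<^esub>"])
  ultimately show ?thesis unfolding e by blast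
 qed
 have pi: "\<pi> C : carrier M" if "C : carrier ?Q" for C using \<pi>(1) that unfolding I_def module_hom_def by blast
 have pi_act: "\<pi> (co x) = x \<odot>\<^bsub>M\<^esub> \<pi> (co \<one>\<^bsub>R\<^esub>)" if x: "x : carrier R" for x
 proof -
  have "\<pi> (smult ?Q x (co \<one>\<^bsub>R\<^esub>)) = x \<odot>\<^bsub>M\<^esub> \<pi> (co \<one>\<^bsub>R\<^esub>)"
   using \<pi>(1) x carQ unfolding I_def module_hom_def by auto
  then show ?thesis by (simp add: act [OF x])
 qed
 have v: "\<pi> (co \<one>\<^bsub>R\<^esub>) : carrier M" by (rule pi) (simp add: carQ)
 have zero: "\<pi> (co \<zero>\<^bsub>R\<^esub>) = \<zero>\<^bsub>M\<^esub>" using pi_act [of "\<zero>\<^bsub>R\<^esub>"] M.smult_l_zero [OF v] by simp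
 have "s \<odot>\<^bsub>M\<^esub> \<pi> (co \<one>\<^bsub>R\<^esub>) = \<zero>\<^bsub>M\<^esub>" if s: "s : S" for s
 proof -
  have "co s = co \<zero>\<^bsub>R\<^esub>" by (rule co_eq [of _ _ s]) (use s S I(2) in auto)
  then show ?thesis using pi_act [of s] zero s S by auto
 qed
 moreover have "\<pi> (co \<one>\<^bsub>R\<^esub>) ~= \<zero>\<^bsub>M\<^esub>"
 proof
  assume 0: "\<pi> (co \<one>\<^bsub>R\<^esub>) = \<zero>\<^bsub>M\<^esub>"
  have "carrier M = \<pi> ` co ` carrier R" using \<pi>(2) carQ unfolding I_def by simp
  also have "... \<subseteq> {\<zero>\<^bsub>M\<^esub>}" using pi_act M.smult_r_zero 0 by auto
  finally show False using M(2) M.M.zero_closed by blast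
 qed
 ultimately show ?thesis using v by blast
qed

context evalm begin

text \<open>The quantum Schur algebra consists of the operators given by the quantum group.\<close>

lemma gl_sub: "gl \<subseteq> D_gens n"
 by (auto simp: gl_def D_gens_def)

lemma gl_alg_sub: "x : gens_alg gl ==> x : gens_alg (D_gens n)"
 using gl_sub unfolding gens_alg_supp using supp_mono [of "{w. set w \<subseteq> gl}" "{w. set w \<subseteq> D_gens n}"] by blast

lemma U_gl_eq: "U_gl n q = D.cl ` gens_alg gl"
proof -
 let ?S = "D.cl ` (range cst \<union> (\<Union>i\<in>{1..<n}. {dE i, dF i}) \<union> (\<Union>j\<in>{1..n}. {dK j, dKi j}))"
 have e: "U_gl n q = generate_ring D.Q ?S" by (simp add: U_gl_def Dn_eq D_cls_eq)
 have 1: "u : D.cl ` gens_alg gl" if "u : generate_ring D.Q ?S" for u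
  using that
 proof (induction rule: generate_ring.induct)
  case one
  then show ?case by (auto simp: D.cl_one)
 next
  case (incl h)
  then show ?case by auto
 next
  case (a_inv h)
  then show ?case using D.cl_minus gl_alg_sub by fastforce
 next
  case (eng_add h1 h2)
  then show ?case using D.cl_add gl_alg_sub by fastforce
 next
  case (eng_mult h1 h2)
  then show ?case using D.cl_mult gl_alg_sub by fastforce
 qed
 have "x : gens_alg gl \<and> D.cl x : generate_ring D.Q ?S" if "x : gens_alg gl" for x
  using that
 proof (induction rule: gens_alg_induct)
  case (gen g)
  then show ?case by (auto simp: gl_def intro!: generate_ring.incl)
 next
  case one
  then show ?case using generate_ring.one [of D.Q ?S] by (simp add: D.cl_one)
 next
  case zero
  have "cst 0 : range (cst :: complex => dgen fa)" by (rule rangeI)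
  then have "D.cl (cst 0) : ?S" by blast
  then show ?case using generate_ring.incl [of "D.cl (cst 0)" ?S D.Q] by simp
 next
  case (mult g y)
  have "D.cl (gen g) : generate_ring D.Q ?S" using mult(1) by (intro generate_ring.incl) (auto simp: gl_def)
  then have "D.cl (gen g) \<otimes>\<^bsub>D.Q\<^esub> D.cl y : generate_ring D.Q ?S" using mult by (intro generate_ring.eng_mult) auto
  moreover have g: "gen g : gens_alg gl" "y : gens_alg gl" using mult by auto
  ultimately show ?case using gl_alg_sub [OF g(1)] gl_alg_sub [OF g(2)] by (simp add: D.cl_mult del: gens_alg_mon)
 next
  case (add y z)
  then have "D.cl y \<oplus>\<^bsub>D.Q\<^esub> D.cl z : generate_ring D.Q ?S" by (intro generate_ring.eng_add) auto
  then show ?case using add gl_alg_sub by (simp add: D.cl_add)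
 next
  case (cst c y)
  have "D.cl (cst c) : generate_ring D.Q ?S" by (intro generate_ring.incl) blast
  then have "D.cl (cst c) \<otimes>\<^bsub>D.Q\<^esub> D.cl y : generate_ring D.Q ?S" using cst by (intro generate_ring.eng_mult) auto
  then show ?case using cst gl_alg_sub by (simp add: D.cl_mult)
 qed
 then show ?thesis using 1 unfolding e by blast
qed

lemma schur_carrier: "carrier (schur n q r) = {restrict (lev x) (Omega_fin n r) | x. x : gens_alg gl}"
 unfolding schur_def U_gl_eq by (simp add: image_image zeta_fin_cl [unfolded D_cls_eq] Setcompr_eq_image)

text \<open>The generators of the quantum group in the quantum loop algebra.\<close>

fun tau :: "dgen => ugen fa" where
 "tau (dEg i) = uX Pos i 0"
| "tau (dFg i) = uX Neg i 0"
| "tau (dKg i) = uK i"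
| "tau (dKig i) = uKi i"
| "tau (dZg e s) = 0"

lemma tau_closed: "x : gens_alg gl ==> subst_eval tau x : gens_alg (U_gens n)"
proof (induction rule: gens_alg_induct)
 case (mult g y)
 then have "tau g : gens_alg (U_gens n)" by (auto simp: gl_def)
 then show ?case using mult by (simp add: subst_eval_simps)
qed (auto simp: subst_eval_simps gl_def)

primrec rvp :: "nat => dgen fa" where
 "rvp 0 = dF 1"
| "rvp (Suc d) = dF (d + 2) * rvp d - cst (inverse q) * (rvp d * dF (d + 2))"

lemma rvp_closed: "d + 1 < n ==> rvp d : gens_alg gl"
 by (induction d) (auto intro!: gens_alg_closed)

lemma lev_rvp: "lev (rvp d) v = rv 1 d v"
 by (induction d arbitrary: v) (simp_all add: lev_simps)

primrec chF :: "nat => ugen fa" where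
 "chF 0 = uX Neg 1 0"
| "chF (Suc k) = qbr (inverse q) (uX Neg (k + 2) 0) (chF k)"

lemma tau_rvp: "subst_eval tau (rvp d) = chF d"
 by (induction d) (simp_all add: subst_eval_simps qbr_def mult.assoc)

end

section \<open>The comparison of the two modules\<close>

locale comparison = evalm n q r a for n q r a +
 fixes f :: "dgen fa set => ugen fa set"
  and W :: "(int fa => int fa, 'w) module" and L :: "(ugen fa set, 'm) module"
  and \<phi> :: "'w => 'm"
 assumes f: "is_drinfeld_iso n q f" and W: "simple_module (schur n q r) W" and L: "left_module (Uhat n q) L"
  and hom: "\<phi> : module_hom (Uhat n q) (eval_module n q r a f W) L" and bij: "bij_betw \<phi> (carrier W) (carrier L)"
begin

sublocale W: left_module "schur n q r" W
 using W by (simp add: simple_module_def)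

sublocale L: left_module "Uhat n q" L
 by (rule L)

text \<open>The action of the double Ringel--Hall algebra on the second module.\<close>

definition act :: "dgen fa => 'm => 'm" where
 "act x v = f (D.cl x) \<odot>\<^bsub>L\<^esub> v"

lemma f_hom: "f : ring_hom D.Q U.Q" "bij_betw f (carrier D.Q) (carrier U.Q)"
 using f by (auto simp: is_drinfeld_iso_def ring_iso_def Dn_eq Uhat_eq)

lemma f_closed: "x : gens_alg (D_gens n) ==> f (D.cl x) : carrier U.Q"
 using ring_hom_memE(1) [OF f_hom(1)] by auto

lemma f_cl: "f (D.cl (cst c)) = U.cl (cst c)"
 "i : {1..n} ==> f (D.cl (dK i)) = U.cl (uK i)" "i : {1..n} ==> f (D.cl (dKi i)) = U.cl (uKi i)"
 "j : {1..<n} ==> f (D.cl (dE j)) = U.cl (uX Pos j 0)" "j : {1..<n} ==> f (D.cl (dF j)) = U.cl (uX Neg j 0)"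
 "f (D.cl (dE n)) = U.cl (cst q * calX q (n - 2) * uKt n Pos n)"
 "1 \<le> s ==> f (D.cl (dZ Pos s)) = U.cl (cst (- of_nat s * q powi (int s)) * theta n q Pos s)"
 using f unfolding is_drinfeld_iso_def D_cls_eq U_cls_eq by auto

lemma f_tau: "x : gens_alg gl ==> f (D.cl x) = U.cl (subst_eval tau x)"
proof -
 assume "x : gens_alg gl"
 then have "x : gens_alg gl \<and> f (D.cl x) = U.cl (subst_eval tau x)"
 proof (induction rule: gens_alg_induct)
  case (gen g)
  then show ?case by (auto simp: gl_def f_cl subst_eval_simps)
 next
  case one
  show ?case using ring_hom_memE(4) [OF f_hom(1)] by (simp add: subst_eval_simps D.cl_one U.cl_one)
 next
  case zero
  show ?case using f_cl(1) [of 0] by (simp add: subst_eval_simps)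
 next
  case (mult g y)
  have g: "gen g : gens_alg gl" "f (D.cl (gen g)) = U.cl (tau g)" "tau g : gens_alg (U_gens n)" using mult(1) by (auto simp: gl_def f_cl)
  have "f (D.cl (gen g * y)) = f (D.cl (gen g)) \<otimes>\<^bsub>U.Q\<^esub> f (D.cl y)"
   using ring_hom_memE(2) [OF f_hom(1), of "D.cl (gen g)" "D.cl y"] gl_alg_sub [OF g(1)] gl_alg_sub [of y] mult
   by (simp add: D.cl_mult del: gens_alg_mon)
  then show ?case using g mult tau_closed by (simp add: U.cl_mult subst_eval_simps)
 next
  case (add y z)
  have "f (D.cl (y + z)) = f (D.cl y) \<oplus>\<^bsub>U.Q\<^esub> f (D.cl z)"
   using ring_hom_memE(3) [OF f_hom(1), of "D.cl y" "D.cl z"] gl_alg_sub add by (simp add: D.cl_add)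
  then show ?case using add tau_closed by (simp add: U.cl_add subst_eval_simps)
 next
  case (cst c y)
  have "f (D.cl (cst c * y)) = f (D.cl (cst c)) \<otimes>\<^bsub>U.Q\<^esub> f (D.cl y)"
   using ring_hom_memE(2) [OF f_hom(1), of "D.cl (cst c)" "D.cl y"] gl_alg_sub cst by (simp add: D.cl_mult)
  then show ?case using cst tau_closed by (simp add: U.cl_mult subst_eval_simps f_cl)
 qed
 then show ?thesis by simp
qed

lemma act_closed: "x : gens_alg (D_gens n) ==> v : carrier L ==> act x v : carrier L"
 using L.smult_closed f_closed by (simp add: act_def Uhat_eq)

lemma act_add: "x : gens_alg (D_gens n) ==> y : gens_alg (D_gens n) ==> v : carrier L ==> act (x + y) v = act x v \<oplus>\<^bsub>L\<^esub> act y v"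
 using L.smult_l_distr [of "f (D.cl x)" "f (D.cl y)" v] f_closed ring_hom_memE(3) [OF f_hom(1), of "D.cl x" "D.cl y"]
 by (simp add: act_def Uhat_eq D.cl_add)

lemma act_mult: "x : gens_alg (D_gens n) ==> y : gens_alg (D_gens n) ==> v : carrier L ==> act (x * y) v = act x (act y v)"
 using L.smult_assoc1 [of "f (D.cl x)" "f (D.cl y)" v] f_closed ring_hom_memE(2) [OF f_hom(1), of "D.cl x" "D.cl y"]
 by (simp add: act_def Uhat_eq D.cl_mult)

text \<open>On the image of a vector of the first module the double Ringel--Hall algebra acts through the evaluation map.\<close>

lemma act_phi:
 assumes x: "x : gens_alg (D_gens n)" and w: "w : carrier W"
 shows "act x (\<phi> w) = \<phi> ((\<lambda>v\<in>Omega_fin n r. epsl (lev x v)) \<odot>\<^bsub>W\<^esub> w)"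
proof -
 have "inv_into (carrier (Dn n q)) f (f (D.cl x)) = D.cl x"
  using f_hom(2) x by (simp add: Dn_eq bij_betw_def)
 then have "f (D.cl x) \<odot>\<^bsub>eval_module n q r a f W\<^esub> w = (\<lambda>v\<in>Omega_fin n r. epsl (lev x v)) \<odot>\<^bsub>W\<^esub> w"
  using ev_schur_cl [of x] by (simp add: eval_module_def pullback_module_def D_cls_eq)
 moreover have "\<phi> (f (D.cl x) \<odot>\<^bsub>eval_module n q r a f W\<^esub> w) = f (D.cl x) \<odot>\<^bsub>L\<^esub> \<phi> w"
  using hom f_closed [OF x] w by (auto simp: module_hom_def eval_module_def pullback_module_def Uhat_eq)
 ultimately show ?thesis by (simp add: act_def)
qed

text \<open>Elements of the quantum group of \<open>gl\<^sub>n\<close> preserve the finite tensor space, on which the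
  evaluation map is the identity.\<close>

lemma act_gl:
 assumes x: "x : gens_alg gl" and w: "w : carrier W"
 shows "act x (\<phi> w) = \<phi> (restrict (lev x) (Omega_fin n r) \<odot>\<^bsub>W\<^esub> w)"
proof -
 have "(\<lambda>v\<in>Omega_fin n r. epsl (lev x v)) = restrict (lev x) (Omega_fin n r)"
  using lev_fin [OF x] epsl_fin by (intro restrict_ext) auto
 then show ?thesis using act_phi [OF gl_alg_sub [OF x] w] by simp
qed

lemma phi_zero: "\<phi> \<zero>\<^bsub>W\<^esub> = \<zero>\<^bsub>L\<^esub>"
proof -
 have "\<phi> (\<zero>\<^bsub>W\<^esub> \<oplus>\<^bsub>W\<^esub> \<zero>\<^bsub>W\<^esub>) = \<phi> \<zero>\<^bsub>W\<^esub> \<oplus>\<^bsub>L\<^esub> \<phi> \<zero>\<^bsub>W\<^esub>"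
 proof -
  have "\<forall>x\<in>carrier W. \<forall>y\<in>carrier W. \<phi> (x \<oplus>\<^bsub>W\<^esub> y) = \<phi> x \<oplus>\<^bsub>L\<^esub> \<phi> y"
   using hom by (simp add: module_hom_def eval_module_def pullback_module_def)
  then show ?thesis using W.M.zero_closed by blast
 qed
 moreover have "\<phi> \<zero>\<^bsub>W\<^esub> : carrier L" using bij W.M.zero_closed by (auto simp: bij_betw_def)
 ultimately show ?thesis by (simp add: L.M.add.l_cancel_one)
qed

text \<open>Two elements that are represented by the same operator act in the same way on every vector.\<close>

lemma act_eq:
 assumes "x : gens_alg (D_gens n)" "y : gens_alg (D_gens n)" "v : carrier L"
  and "!!u. u : Omega_fin n r ==> epsl (lev x u) = epsl (lev y u)"
 shows "act x v = act y v"
proof -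
 obtain w where w: "w : carrier W" "v = \<phi> w" using bij assms(3) by (auto simp: bij_betw_def)
 have "(\<lambda>v\<in>Omega_fin n r. epsl (lev x v)) = (\<lambda>v\<in>Omega_fin n r. epsl (lev y v))"
  using assms(4) by (intro restrict_ext) auto
 then show ?thesis using act_phi [OF assms(1) w(1)] act_phi [OF assms(2) w(1)] w(2) by simp
qed

definition ann :: "'m => dgen fa set" where
 "ann v = {x : gens_alg gl. act x v = \<zero>\<^bsub>L\<^esub>}"

lemma ann_lcong: "v : carrier L ==> lcong gl (ann v)"
proof
 assume v: "v : carrier L"
 show "ann v \<subseteq> gens_alg gl" by (auto simp: ann_def)
 have "act 0 v = \<zero>\<^bsub>L\<^esub>"
 proof -
  have "act (0 + 0) v = act 0 v \<oplus>\<^bsub>L\<^esub> act 0 v" by (rule act_add) (use v in auto)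
  then show ?thesis using act_closed [of 0 v] v by (simp add: L.M.add.l_cancel_one)
 qed
 then show "0 : ann v" by (simp add: ann_def)
 show "x + y : ann v" if "x : ann v" "y : ann v" for x y
  using that v gl_alg_sub by (simp add: ann_def act_add)
 show "u * x : ann v" if "u : gens_alg gl" "x : ann v" for u x
  using that v gl_alg_sub L.smult_r_zero [of "f (D.cl u)"] f_closed [of u]
  by (simp add: ann_def act_mult) (simp add: act_def Uhat_eq)
qed

lemma hwglI:
 assumes v: "v : carrier L" and E: "!!i. i : {1..<n} ==> act (dE i) v = \<zero>\<^bsub>L\<^esub>"
  and K: "!!i. i : {1..n} ==> act (dK i - cst (q ^ l i)) v = \<zero>\<^bsub>L\<^esub>"
 shows "hwgl n q r a (ann v) l"
proof -
 interpret lcong gl "ann v" by (rule ann_lcong [OF v])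
 show ?thesis
 proof
  fix x assume x: "x : gens_alg gl" and 0: "!!u. u : Omega_fin n r ==> lev x u = 0"
  have "act x v = act 0 v"
   by (rule act_eq) (use x gl_alg_sub v 0 in \<open>auto simp: lev_simps\<close>)
  then show "x : ann v" using x N_zero by (simp add: ann_def)
 qed (use E K in \<open>auto simp: ann_def intro!: gens_alg_closed\<close>)
qed

lemma hw_generated:
 assumes v: "v : carrier L" "v ~= \<zero>\<^bsub>L\<^esub>" and v': "v' : carrier L"
 shows "\<exists>x\<in>gens_alg gl. v' = act x v"
proof -
 have "carrier L = \<phi> ` carrier W" using bij by (simp add: bij_betw_def)
 then obtain w w' where w: "w : carrier W" "v = \<phi> w" "w' : carrier W" "v' = \<phi> w'" using v(1) v' by blast
 have "w ~= \<zero>\<^bsub>W\<^esub>" using w v phi_zero by auto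
 then obtain s where "s : carrier (schur n q r)" "w' = s \<odot>\<^bsub>W\<^esub> w"
  using simple_generated [OF W w(1) _ w(3)] by blast
 then obtain x where "x : gens_alg gl" "w' = restrict (lev x) (Omega_fin n r) \<odot>\<^bsub>W\<^esub> w"
  unfolding schur_carrier by blast
 then show ?thesis using act_gl [OF _ w(1)] w by auto
qed

lemma act_diff: "x : gens_alg (D_gens n) ==> y : gens_alg (D_gens n) ==> v : carrier L ==> act (x - y) v = \<zero>\<^bsub>L\<^esub> \<longleftrightarrow> act x v = act y v"
 using act_add [of "x - y" y v] act_closed [of "x - y" v] act_closed [of y v] by (auto simp: L.M.add.l_cancel_one)

lemma weight_le:
 assumes v: "v : carrier L" "v ~= \<zero>\<^bsub>L\<^esub>" "!!i. i : {1..<n} ==> act (dE i) v = \<zero>\<^bsub>L\<^esub>" "!!i. i : {1..n} ==> act (dK i - cst (q ^ l i)) v = \<zero>\<^bsub>L\<^esub>"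
  and v': "v' : carrier L" "v' ~= \<zero>\<^bsub>L\<^esub>" "!!i. i : {1..n} ==> act (dK i - cst (q ^ k i)) v' = \<zero>\<^bsub>L\<^esub>"
  and j: "j < n"
 shows "(\<Sum>p=1..j. k p) \<le> (\<Sum>p=1..j. l p)"
proof -
 interpret H: hwgl n q r a "ann v" l by (rule hwglI) (use v in auto)
 obtain x where x: "x : gens_alg gl" "v' = act x v" using hw_generated [OF v(1,2) v'(1)] by blast
 show ?thesis
 proof (rule H.weights_below [OF x(1) _ _ j])
  show "x \<notin> ann v" using x v'(2) by (simp add: ann_def)
  fix p assume p: "p : {1..n}"
  have "act ((dK p - cst (q ^ k p)) * x) v = \<zero>\<^bsub>L\<^esub>"
   using act_mult [of "dK p - cst (q ^ k p)" x v] gl_alg_sub x v v'(3) [OF p] p by (auto simp: gl_alg_sub intro!: gens_alg_closed simp: D_gens_simps)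
  then show "H.eqv (dK p * x) (cst (q ^ k p) * x)"
   using x p unfolding H.eqv_def by (auto simp: ann_def left_diff_distrib intro!: gens_alg_closed)
 qed
qed

definition uann :: "'m => ugen fa set" where
 "uann v = {x : gens_alg (U_gens n). U.cl x \<odot>\<^bsub>L\<^esub> v = \<zero>\<^bsub>L\<^esub>}"

lemma U_closed: "x : gens_alg (U_gens n) ==> v : carrier L ==> U.cl x \<odot>\<^bsub>L\<^esub> v : carrier L"
 by (intro L.smult_closed) (simp_all add: Uhat_eq)

lemma U_add: "x : gens_alg (U_gens n) ==> y : gens_alg (U_gens n) ==> v : carrier L ==>
  U.cl (x + y) \<odot>\<^bsub>L\<^esub> v = U.cl x \<odot>\<^bsub>L\<^esub> v \<oplus>\<^bsub>L\<^esub> U.cl y \<odot>\<^bsub>L\<^esub> v"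
 using L.smult_l_distr [of "U.cl x" "U.cl y" v] by (simp add: Uhat_eq U.cl_add)

lemma U_mult: "x : gens_alg (U_gens n) ==> y : gens_alg (U_gens n) ==> v : carrier L ==>
  U.cl (x * y) \<odot>\<^bsub>L\<^esub> v = U.cl x \<odot>\<^bsub>L\<^esub> (U.cl y \<odot>\<^bsub>L\<^esub> v)"
 using L.smult_assoc1 [of "U.cl x" "U.cl y" v] by (simp add: Uhat_eq U.cl_mult)

lemma uann_diff: "x : gens_alg (U_gens n) ==> y : gens_alg (U_gens n) ==> v : carrier L ==>
  x - y : uann v \<longleftrightarrow> U.cl x \<odot>\<^bsub>L\<^esub> v = U.cl y \<odot>\<^bsub>L\<^esub> v"
 using U_add [of "x - y" y v] U_closed [of "x - y" v] U_closed [of y v] by (auto simp: uann_def L.M.add.l_cancel_one)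

lemma uann_lcong: "v : carrier L ==> lcong (U_gens n) (uann v)"
proof
 assume v: "v : carrier L"
 show "uann v \<subseteq> gens_alg (U_gens n)" by (auto simp: uann_def)
 show "0 : uann v" using uann_diff [of 0 0 v] v by simp
 show "x + y : uann v" if "x : uann v" "y : uann v" for x y
  using that v by (simp add: uann_def U_add)
 show "u * x : uann v" if "u : gens_alg (U_gens n)" "x : uann v" for u x
  using that v L.smult_r_zero [of "U.cl u"] by (simp add: uann_def U_mult Uhat_eq)
qed

text \<open>The vector \<open>v\<close> is the image of the class of 1.  It has weight \<open>lam\<close> because
  \<open>v\<close> and the given highest weight vector generate each other.  The values of \<open>E\<^sub>n\<close>
  and of the central elements on it are transported from the tensor space.\<close>

lemma drinfeld_polynomials:
 assumes Q: "Q : Q_set n q r" and LQ: "is_L_Q n q Q L" and lam: "lam : dominant n r" and Wl: "is_L_weight n q r lam W"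
 shows "i : {1..n} ==> Q i = (\<Prod>s=1..lam i. [:1, - (a * q powi (2 * (int s - int i))):])"
  and "i : {1..<n} ==> Q_ratio q Q i = Fraction_Field.Fract (\<Prod>s=lam (i + 1) + 1..lam i. [:1, - (a * q powi (2 * int s - 1 - int i)):]) 1"
proof -
 define d where "d i = Polynomial.degree (Q i)" for i
 let ?S = "{uX Pos j s | j s. j : {1..<n}} \<union>
   {fps_nth (Qcal q e i) s - cst (Polynomial.coeff (pm_poly e (Q i)) s) | e i s. i : {1..n}} \<union>
   {uK i - cst (q ^ Polynomial.degree (Q i)) | i. i : {1..n}}"
 define SS where "SS = ?S"
 have S: "SS \<subseteq> gens_alg (U_gens n)" unfolding SS_def using Qcal_closed by (auto intro!: gens_alg_closed)
 have L0: "carrier L ~= {\<zero>\<^bsub>L\<^esub>}" using LQ by (simp add: is_L_Q_def simple_module_def)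
 obtain \<pi> where \<pi>: "\<pi> : module_hom (Uhat n q) (quotient_module (regular_module (Uhat n q)) (I_Q n q Q)) L"
  "\<pi> ` carrier (quotient_module (regular_module (Uhat n q)) (I_Q n q Q)) = carrier L"
  using LQ by (auto simp: is_L_Q_def)
 have "\<exists>v\<in>carrier L. v ~= \<zero>\<^bsub>L\<^esub> \<and> (\<forall>s\<in>U.cl ` SS. s \<odot>\<^bsub>L\<^esub> v = \<zero>\<^bsub>L\<^esub>)"
 proof (rule quotient_vector [OF _ L L0])
  show "ring (Uhat n q)" unfolding Uhat_eq by (rule U.QR.ring_axioms)
  show "U.cl ` SS \<subseteq> carrier (Uhat n q)" using S unfolding Uhat_eq U.Q_carrier by blast
 qed (use \<pi> in \<open>simp_all only: I_Q_def U_cls_eq SS_def\<close>)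
 then obtain v where v: "v : carrier L" "v ~= \<zero>\<^bsub>L\<^esub>" and "\<forall>s\<in>U.cl ` SS. s \<odot>\<^bsub>L\<^esub> v = \<zero>\<^bsub>L\<^esub>" by (elim bexE conjE)
 then have N: "SS \<subseteq> uann v" using S by (auto simp: uann_def)
 have NX: "uX Pos j s : uann v" if "j : {1..<n}" for j s
 proof -
  have "uX Pos j s : SS" unfolding SS_def using that by blast
  then show ?thesis using N by (rule rev_subsetD)
 qed
 have NQ: "Qcal q Pos i $ s - cst (Polynomial.coeff (Q i) s) : uann v" if "i : {1..n}" for i s
 proof -
  have "Qcal q Pos i $ s - cst (Polynomial.coeff (pm_poly Pos (Q i)) s) : SS" unfolding SS_def using that by blast
  then show ?thesis using N unfolding pm_poly.simps by (rule rev_subsetD)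
 qed
 have NK: "uK i - cst (q ^ d i) : uann v" if "i : {1..n}" for i
 proof -
  have "uK i - cst (q ^ Polynomial.degree (Q i)) : SS" unfolding SS_def using that by blast
  then show ?thesis using N unfolding d_def by (rule rev_subsetD)
 qed
 have vE: "act (dE i) v = \<zero>\<^bsub>L\<^esub>" if "i : {1..<n}" for i
  using NX [OF that] f_cl(4) [OF that] by (simp add: act_def uann_def)
 have vK: "act (dK i - cst (q ^ d i)) v = \<zero>\<^bsub>L\<^esub>" if "i : {1..n}" for i
  using NK [OF that] f_tau [of "dK i - cst (q ^ d i)"] that by (simp add: act_def uann_def subst_eval_simps gens_alg_closed)
 obtain w where w: "w : carrier W" "w ~= \<zero>\<^bsub>W\<^esub>"
  "!!i. i : {1..<n} ==> zeta_fin n q r (D_cls n q (dE i)) \<odot>\<^bsub>W\<^esub> w = \<zero>\<^bsub>W\<^esub>"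
  "!!j. j : {1..n} ==> zeta_fin n q r (D_cls n q (dK j)) \<odot>\<^bsub>W\<^esub> w = (\<lambda>x\<in>Omega_fin n r. cst (q ^ lam j) * x) \<odot>\<^bsub>W\<^esub> w"
  using Wl by (auto simp: is_L_weight_def)
 have w1: "\<phi> w : carrier L" using bij w by (auto simp: bij_betw_def)
 have w2: "\<phi> w ~= \<zero>\<^bsub>L\<^esub>"
 proof
  assume "\<phi> w = \<zero>\<^bsub>L\<^esub>"
  then have "\<phi> w = \<phi> \<zero>\<^bsub>W\<^esub>" by (simp add: phi_zero)
  then show False using bij w W.M.zero_closed by (auto simp: bij_betw_def inj_on_def)
 qed
 have wE: "act (dE i) (\<phi> w) = \<zero>\<^bsub>L\<^esub>" if "i : {1..<n}" for i
  using act_gl [of "dE i" w] w(1) w(3) [OF that] that by (simp add: zeta_fin_cl phi_zero)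
 have wK: "act (dK i - cst (q ^ lam i)) (\<phi> w) = \<zero>\<^bsub>L\<^esub>" if "i : {1..n}" for i
 proof -
  have "restrict (lev (cst (q ^ lam i))) (Omega_fin n r) = (\<lambda>x\<in>Omega_fin n r. cst (q ^ lam i) * x)"
   by (intro restrict_ext) (simp add: lev_simps)
  then have "act (dK i) (\<phi> w) = act (cst (q ^ lam i)) (\<phi> w)"
   using act_gl [of "dK i" w] act_gl [of "cst (q ^ lam i)" w] w(1) w(4) [OF that] that by (simp add: zeta_fin_cl)
  then show ?thesis using act_diff [of "dK i" "cst (q ^ lam i)" "\<phi> w"] w1 that by (simp add: D_gens_simps)
 qed
 have sums: "(\<Sum>p=1..j. d p) = (\<Sum>p=1..j. lam p)" if "j \<le> n" for j
 proof (cases "j = n")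
  case True
  then show ?thesis using Q lam by (simp add: d_def Q_set_def dominant_def)
 next
  case False
  then have j: "j < n" using that by simp
  show ?thesis
   by (rule antisym) (rule weight_le [OF w1 w2 wE wK v vK j] weight_le [OF v vE vK w1 w2 wK j]; assumption)+
 qed
 have d: "d p = lam p" if p: "p : {1..n}" for p
 proof -
  obtain p' where "p = Suc p'" using p by (cases p) auto
  then show ?thesis using sums [of p] sums [of p'] p by simp
 qed
 interpret H: hwgl n q r a "ann v" d by (rule hwglI [OF v(1) vE vK])
 interpret NL: lcong "U_gens n" "uann v" by (rule uann_lcong [OF v(1)])
 interpret P: loop n q "uann v" d
 proof
  fix x y w assume xy: "U_rel n q x y" and w: "w : gens_alg (U_gens n)"
  have x: "x : gens_alg (U_gens n)" "y : gens_alg (U_gens n)" using U_rel_closed [OF xy] by auto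
  have "U.cl x \<odot>\<^bsub>L\<^esub> (U.cl w \<odot>\<^bsub>L\<^esub> v) = U.cl y \<odot>\<^bsub>L\<^esub> (U.cl w \<odot>\<^bsub>L\<^esub> v)" using U.cl_rel [OF xy] by simp
  then show "(x - y) * w : uann v"
   using uann_diff [of "x * w" "y * w" v] U_mult x w v(1) by (simp add: left_diff_distrib gens_alg_closed)
 qed (use NX NK in auto)
 have chF: "chF k = P.ch (uX Neg 1 0) k" for k by (induction k) simp_all
 have X: "NL.eqv (P.ch (uX Neg 1 1) (n - 2)) (cst (a * q powi (2 * int (d 1) - 2)) * P.ch (uX Neg 1 0) (n - 2))"
 proof -
  have n1: "1 : {1..n}" "n : {1..n}" "n - 2 + 1 < n" "nx n n = 1" using n2 by (auto simp: nx_def)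
  let ?x = "cst (a * inverse q) * (rvp (n - 2) * (dK 1 * dK n))"
  have xA: "?x : gens_alg gl" using rvp_closed [OF n1(3)] n1 by (intro gens_alg_closed) auto
  have "act (dE n) v = act ?x v"
  proof (rule act_eq [OF _ gl_alg_sub [OF xA] v(1)])
   fix u assume u: "u : Omega_fin n r"
   have "epsl (lev ?x u) = lev ?x u" by (rule epsl_fin [OF lev_fin [OF xA u]])
   then show "epsl (lev (dE n) u) = epsl (lev ?x u)" using eps_En [OF u] by (simp add: lev_simps lev_rvp)
  qed (use n2 in \<open>simp add: D_gens_simps\<close>)
  then have "U.cl (cst q * calX q (n - 2) * uKt n Pos n) \<odot>\<^bsub>L\<^esub> v = U.cl (cst (a * inverse q) * (chF (n - 2) * (uK 1 * uK n))) \<odot>\<^bsub>L\<^esub> v"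
   unfolding act_def f_cl(6) f_tau [OF xA] by (simp add: subst_eval_simps tau_rvp)
  moreover have chA: "P.ch (uX Neg 1 s) (n - 2) : gens_alg (U_gens n)" for s by (rule P.ch_closed [OF n1(3)])
  moreover have KA: "uK i : gens_alg (U_gens n)" "uKi i : gens_alg (U_gens n)" if "i : {1..n}" for i using that by simp_all
  ultimately have e: "NL.eqv (cst q * P.ch (uX Neg 1 1) (n - 2) * (uK n * uKi 1)) (cst (a * inverse q) * (P.ch (uX Neg 1 0) (n - 2) * (uK 1 * uK n)))"
   using uann_diff [of "cst q * P.ch (uX Neg 1 1) (n - 2) * (uK n * uKi 1)" "cst (a * inverse q) * (P.ch (uX Neg 1 0) (n - 2) * (uK 1 * uK n))" v] v(1) n1
   unfolding NL.eqv_def chF P.calX_ch by (simp add: gens_alg_closed)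
  have K: "P.eig (uK i) (q ^ d i)" if "i : {1..n}" for i
   using that NK [OF that] by (simp add: P.eig_def NL.eqv_def)
  have Ki: "P.eig (uKi 1) (q powi (- int (d 1)))"
   using P.wt_inv [OF n1(1) P.wt_1 [OF n1(1)]] n1(1) by (simp add: P.eig_def)
  have KK: "NL.eqv (uK n * uKi 1) (cst (q ^ d n * q powi (- int (d 1))))" "NL.eqv (uK 1 * uK n) (cst (q ^ d 1 * q ^ d n))"
   using P.eig_mult [OF K [OF n1(2)] Ki] P.eig_mult [OF K [OF n1(1)] K [OF n1(2)]] by (simp_all add: P.eig_def)
  have "NL.eqv (cst q * P.ch (uX Neg 1 1) (n - 2) * cst (q ^ d n * q powi (- int (d 1)))) (cst q * P.ch (uX Neg 1 1) (n - 2) * (uK n * uKi 1))"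
   by (rule NL.eqv_sym, rule NL.eqv_lmult [OF _ KK(1)]) (use chA in \<open>simp add: gens_alg_closed\<close>)
  also note e
  also have "NL.eqv (cst (a * inverse q) * (P.ch (uX Neg 1 0) (n - 2) * (uK 1 * uK n))) (cst (a * inverse q) * (P.ch (uX Neg 1 0) (n - 2) * cst (q ^ d 1 * q ^ d n)))"
   by (intro NL.eqv_cst NL.eqv_lmult KK chA)
  finally have "NL.eqv (cst (q ^ d n * q powi (- int (d 1)) * q) * P.ch (uX Neg 1 1) (n - 2)) (cst (a * inverse q * (q ^ d 1 * q ^ d n)) * P.ch (uX Neg 1 0) (n - 2))"
  proof -
   have "x * cst c = cst c * x" "cst k * (x * cst c) = cst (k * c) * x" "cst c * (cst k * x) = cst (c * k) * x" for x :: "ugen fa" and c k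
    by (simp_all only: cst_commute [of x c] cst_mult_assoc)
   then show "NL.eqv (cst q * P.ch (uX Neg 1 1) (n - 2) * cst (q ^ d n * q powi (- int (d 1)))) (cst (a * inverse q) * (P.ch (uX Neg 1 0) (n - 2) * cst (q ^ d 1 * q ^ d n))) ==> ?thesis"
    by (simp only:)
  qed
  from NL.eqv_cancel [OF this] have "NL.eqv (P.ch (uX Neg 1 1) (n - 2)) (cst (a * inverse q * (q ^ d 1 * q ^ d n) / (q ^ d n * q powi (- int (d 1)) * q)) * P.ch (uX Neg 1 0) (n - 2))"
   by simp
  moreover have "a * inverse q * (q ^ d 1 * q ^ d n) / (q ^ d n * q powi (- int (d 1)) * q) = a * q powi (2 * int (d 1) - 2)"
  proof -
   have "2 * int (d 1) - 2 = int (d 1) + int (d 1) + - 2" by simp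
   then have pw: "q powi (2 * int (d 1) - 2) = q ^ d 1 * q ^ d 1 * inverse (q\<^sup>2)"
    by (simp only: power_int_add q0 simp_thms power_int_of_nat) (simp add: power_int_minus)
   have frac: "a * inverse q * (x * y) / (y * inverse x * q) = a * (x * x * inverse (q\<^sup>2))" if "x ~= 0" "y ~= 0" for x y
    using that by (simp add: field_simps power2_eq_square)
   have inv: "q powi (- int (d 1)) = inverse (q ^ d 1)" by (simp add: power_int_minus)
   show ?thesis unfolding pw inv by (rule frac) simp_all
  qed
  ultimately show ?thesis by simp
 qed
 interpret R: drinfeld n q "uann v" d Q a
 proof
  show "1 \<notin> uann v" using v L.smult_one [OF v(1)] by (auto simp: uann_def Uhat_eq U.cl_one)
 qed (use NQ Q P.F1_value [OF X] in \<open>auto simp: Q_set_def\<close>)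
 have dd: "d (Suc i) \<le> d i" if "i : {1..<n}" for i
  using lam that d [of i] d [of "Suc i"] by (simp add: dominant_def)
 have sz: "sz d 1 n = r"
 proof -
  have "length (om d k l) = (\<Sum>i\<in>{k..<k + l}. d i)" for k l
   by (induction l arbitrary: k) (simp_all add: sum.atLeast_Suc_lessThan)
  then show ?thesis using Q by (simp add: Q_set_def d_def atLeastLessThanSuc_atLeastAtMost)
 qed
 have Z: "NL.eqv (cst (of_nat t * q ^ t / qint q (int t)) * (\<Sum>i=1..n. uG i (int t)))
   (cst (\<Sum>i=1..n. \<Sum>s=1..d i. (a * q powi (2 * (int s - int i))) ^ t))" if t: "t \<ge> 1" for t
 proof -
  have "opC t (tT k u) = tT k (opC t u)" if "k : {1..<r}" "u : Omega_fin n r" for k u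
   using opC_T [OF that(1) Omega_fin_Omega [OF that(2)]] by simp
  then obtain b where b: "b : gens_alg gl" "!!u. u : Omega_fin n r ==> opC t u = lev b u"
   using schur_weyl [OF linear_opC _ opC_Omega_fin, of t] by blast
  have "act (dZ Pos t) v = act b v"
  proof (rule act_eq [OF _ gl_alg_sub [OF b(1)] v(1)])
   fix u assume u: "u : Omega_fin n r"
   have "epsl (lev b u) = lev b u" by (rule epsl_fin [OF lev_fin [OF b(1) u]])
   then show "epsl (lev (dZ Pos t) u) = epsl (lev b u)" using epsl_opZ [OF u, of t] b(2) [OF u] by (simp add: lev_simps)
  qed (use t in \<open>simp add: D_gens_simps\<close>)
  also have "... = act (cst (csum d t)) v"
  proof -
   have "H.eqv b (cst (csum d t))" by (rule H.center_value [OF sz b(1)]) (simp add: b(2))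
   then have "b - cst (csum d t) : ann v" unfolding H.eqv_def .
   then have "act (b - cst (csum d t)) v = \<zero>\<^bsub>L\<^esub>" by (simp add: ann_def)
   then show ?thesis using act_diff [of b "cst (csum d t)" v] gl_alg_sub [OF b(1)] v(1) by simp
  qed
  finally have "U.cl (cst (- of_nat t * q powi (int t)) * theta n q Pos t) \<odot>\<^bsub>L\<^esub> v = U.cl (cst (csum d t)) \<odot>\<^bsub>L\<^esub> v"
   using f_cl(7) [OF t] f_cl(1) by (simp add: act_def)
  moreover have "cst (- of_nat t * q powi (int t)) * theta n q Pos t = cst (of_nat t * q ^ t / qint q (int t)) * (\<Sum>i=1..n. uG i (int t))"
   by (simp add: theta_def cst_mult_assoc)
  ultimately show ?thesis
   unfolding NL.eqv_def csum_def [symmetric] using t v(1) by (subst uann_diff) (auto intro!: gens_alg_closed)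
 qed
 have QV: "Q i = R.boxes i" if "i : {1..n}" for i
  by (rule R.Q_value [OF dd Z that])
 show "Q i = (\<Prod>s=1..lam i. [:1, - (a * q powi (2 * (int s - int i))):])" if "i : {1..n}"
  using QV [OF that] d [OF that] by (simp add: R.boxes_def)
 show "Q_ratio q Q i = Fraction_Field.Fract (\<Prod>s=lam (i + 1) + 1..lam i. [:1, - (a * q powi (2 * int s - 1 - int i)):]) 1" if i: "i : {1..<n}"
 proof -
  let ?P = "\<Prod>s=d (Suc i) + 1..d i. [:1, - (a * q powi (2 * int s - 1 - int i)):]" and ?B = "dilate (q ^ (i + 1)) (Q (Suc i))"
  have "dilate (q ^ (i - 1)) (Q i) = ?P * ?B"
   using R.boxes_ratio [OF i dd [OF i]] QV [of i] QV [of "Suc i"] i by simp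
  moreover have "?B ~= 0"
  proof -
   have "poly ?B 0 = 1" using Q i by (simp add: Q_set_def dilate_def poly_pcompose poly_0_coeff_0)
   then show ?thesis by auto
  qed
  ultimately have "Q_ratio q Q i = Fraction_Field.Fract ?P 1" by (simp add: Q_ratio_def eq_fract)
  then show ?thesis using d [of i] d [of "Suc i"] i by simp
 qed
qed

end

text \<open>The entries decrease, so the nonzero ones come first.\<close>

lemma parts_initial:
 assumes lam: "lam : dominant n r"
 shows "{i : {1..n}. lam i ~= 0} = {1..card {i : {1..n}. lam i ~= 0}}"
proof -
 let ?S = "{i : {1..n}. lam i ~= 0}"
 have anti: "lam j \<le> lam i" if "i \<le> j" "1 \<le> i" "j \<le> n" for i j
  using that
 proof (induction rule: dec_induct)
  case (step j)
  have "lam (j + 1) \<le> lam j" using lam step by (auto simp: dominant_def)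
  then show ?case using step by simp
 qed simp
 show ?thesis
 proof (cases "?S = {}")
  case True
  then show ?thesis by (simp only: True card.empty) simp
 next
  case False
  define k where "k = Max ?S"
  have k: "k : ?S" unfolding k_def by (rule Max_in) (use False in auto)
  have "?S = {1..k}"
  proof
   show "?S \<subseteq> {1..k}" unfolding k_def by (auto intro!: Max_ge)
   show "{1..k} \<subseteq> ?S" using k anti [of _ k] by fastforce
  qed
  then show ?thesis by simp
 qed
qed

theorem theorem7p2:
  fixes n r m :: nat and q a :: complex and lam :: "nat \<Rightarrow> nat"
    and f :: "dgen fa set \<Rightarrow> ugen fa set"
    and W :: "(int fa \<Rightarrow> int fa, 'w) module"
    and Q :: "nat \<Rightarrow> complex poly"
    and L :: "(ugen fa set, 'm) module"
  assumes "n \<ge> 2" and "r \<ge> 1"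
    and "q \<noteq> 0" and "\<And>k::nat. k \<ge> 1 \<Longrightarrow> q ^ k \<noteq> 1"
    and "a \<noteq> 0"
    and "lam \<in> dominant n r" and "m = card {i \<in> {1..n}. lam i \<noteq> 0}"
    and "is_drinfeld_iso n q f"
    and "is_L_weight n q r lam W"
    and "Q \<in> Q_set n q r" and "is_L_Q n q Q L"
    and "module_isomorphic (Uhat n q) (eval_module n q r a f W) L"
  shows "(\<forall>i\<in>{m+1..n}. Q i = 1) \<and>
    (\<forall>i\<in>{1..m-1}. Q_ratio q Q i =
       Fraction_Field.Fract (\<Prod>s=lam (i+1) + 1..lam i. [:1, - (a * q powi (2 * int s - 1 - int i)):]) 1) \<and>
    Q m = (\<Prod>s=1..lam m. [:1, - (a * q powi (2 * (int s - int m))):])"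
proof -
  obtain \<phi> where \<phi>: "\<phi> \<in> module_hom (Uhat n q) (eval_module n q r a f W) L" "bij_betw \<phi> (carrier W) (carrier L)"
    using assms(12) by (auto simp: module_isomorphic_def eval_module_def pullback_module_def)
  have "evalm n q r a"
    by unfold_locales (use assms in auto)
  then interpret comparison n q r a f W L \<phi>
    by (rule comparison.intro) (use assms \<phi> in \<open>auto simp: comparison_axioms_def is_L_weight_def is_L_Q_def simple_module_def\<close>)
  note main = drinfeld_polynomials [OF assms(10,11,6,9)]
  have S: "{i \<in> {1..n}. lam i \<noteq> 0} = {1..m}" using parts_initial [OF assms(6)] assms(7) by simp
  have m: "m \<in> {1..n}"
  proof -
    have "(\<Sum>i=1..n. lam i) \<noteq> 0" using assms(2,6) by (simp add: dominant_def)
    then have "{i \<in> {1..n}. lam i \<noteq> 0} \<noteq> {}" by auto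
    then have "1 \<le> m" unfolding S by simp
    moreover from this have "m \<in> {i \<in> {1..n}. lam i \<noteq> 0}" unfolding S by simp
    ultimately show ?thesis by simp
  qed
  have "Q i = 1" if "i \<in> {m+1..n}" for i
  proof -
    have "i \<notin> {i \<in> {1..n}. lam i \<noteq> 0}" unfolding S using that by simp
    then have "lam i = 0" using that by simp
    then show ?thesis using main(1) [of i] that by simp
  qed
  then show ?thesis using main m by auto
qed

end
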